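(* Let $(X,\tau,\mathsf d,\mathfrak m)$ be an extended metric measure space with $(X,\mathsf d)$ complete, and let $(\rho_t)_{t\in[0,T]}$ be a curve of probability densities (w.r.t. $\mathfrak m$) with $\sup_{t\in[0,T]}\|\rho_t\|_{L^\infty(X,\mathfrak m)}<\infty$. Then, for $\mu_t=\rho_t\mathfrak m$, one has $$\mu_t\in AC^2([0,T];(\mathcal P(X),W_{\mathsf d}))\quad\Longleftrightarrow\quad\mu_t\in AC^2([0,T];(\mathcal P(X),W_{\mathrm{Ch}}))$$ and the corresponding metric derivatives coincide a.e. in $(0,T)$.
   Context: An extended metric space $(X,\mathsf d)$ is a set with a symmetric $\mathsf d:X\times X\to[0,\infty]$ satisfying the triangle inequality and $\mathsf d(x,y)=0$ iff $x=y$; for a semidistance the last condition is weakened to $\mathsf d(x,x)=0$. For a Hausdorff topology $\tau$ on $X$, $\mathrm{Lip}_b(X,\tau,\mathsf d)$ is the set of bounded, $\mathsf d$-Lipschitz, $\tau$-continuous functions $f:X\to\mathbb R$. $(X,\tau,\mathsf d)$ is an extended metric-topological space if (a) there are $(\tau\times\tau)$-continuous bounded semidistances $\mathsf d_i:X\times X\to[0,\infty)$, $i\in I$, with $\mathsf d=\sup_i\mathsf d_i$; (b) $\tau$ is generated by $\mathrm{Lip}_b(X,\tau,\mathsf d)$. $\mathcal P(X)$ is the set of Radon probability measures on the Borel sets of $\tau$; $(X,\tau,\mathsf d,\mathfrak m)$ is an extended metric measure space if moreover $\mathfrak m\in\mathcal P(X)$. $\mathcal P^a(X)=\{\mu\in\mathcal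 P(X):\mu\ll\mathfrak m\}$. $W_{\mathsf d}^2(\mu,\nu)=\inf\int\mathsf d^2\,d\boldsymbol\pi$ over Radon probability measures $\boldsymbol\pi$ on $X\times X$ with marginals $\mu,\nu$. $AC^2([0,T];(Y,\delta))$ is the set of curves $y:[0,T]\to Y$ for which there is $g\in L^2(0,T)$ with $\delta(y_s,y_t)\le\int_s^tg\,dr$ for $s\le t$; metric derivative $|\dot y_t|=\limsup_{s\to t}\delta(y_s,y_t)/|s-t|$. Cheeger energy: for $f\in\mathrm{Lip}_b(X,\tau,\mathsf d)$, $\mathrm{Lip}_a(f,x)=\lim_{r\downarrow0}\sup\{|f(y)-f(z)|/\mathsf d(y,z):\ \mathsf d(y,x)\vee\mathsf d(z,x)<r,\ \mathsf d(y,z)>0\}$ ($=0$ at $\mathsf d$-isolated points), and $\mathrm{Lip}_a^*(f,\cdot)$ is the $\mathfrak m$-essentially smallest $\mathfrak m$-measurable function which is $\ge\mathrm{Lip}_a(f,\cdot)$ $\mathfrak m$-a.e. For $f\in L^2(X,\mathfrak m)$, $\mathrm{Ch}(f)=\inf\liminf_n\int(\mathrm{Lip}_a^*(f_n,\cdot))^2\,d\mathfrak m$ over sequences $f_n\in\mathrm{Lip}_b(X,\tau,\mathsf d)$ with $f_n\to f$ in $L^2(X,\mathfrak m)$; $D(\mathrm{Ch})=\{\mathrm{Ch}<\infty\}$. A relaxed slope of $f$ is any $G\ge g$ with $g$ a weak $L^2(X,\mathfrak m)$ limit point of $\mathrm{Lip}_a^*(f_n,\cdot)$ for some $f_n\in\mathrm{Lip}_b(X,\tau,\mathsf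 d)$, $f_n\to f$ in $L^2(X,\mathfrak m)$; $|\mathrm Df|_w$ is the relaxed slope of smallest $L^2$ norm. $\mathcal A_{\mathrm{Ch}}=\{f\in D(\mathrm{Ch}):\ f,|\mathrm Df|_w\in L^\infty(X,\mathfrak m)\}$. A family of probability densities $(\rho_t)_{t\in[0,T]}$ belongs to $\mathsf{CE}^2(X,\mathrm{Ch},\mathfrak m)$ if there is $c\in L^2(0,T)$ with $|\int f\rho_t\,d\mathfrak m-\int f\rho_s\,d\mathfrak m|\le\int_s^tc(r)(\int|\mathrm Df|_w^2\rho_r\,d\mathfrak m)^{1/2}dr$ for all $f\in\mathcal A_{\mathrm{Ch}}$, $0\le s\le t\le T$; the least such $c$ is $\|\rho_t'\|$. The extended distance $W_{\mathrm{Ch}}$ on $\mathcal P^a(X)$ is $$W_{\mathrm{Ch}}^2(\rho_0\mathfrak m,\rho_1\mathfrak m)=\inf\Big\{\int_0^1\|\rho_t'\|^2dt:\ (\rho_t)_{t\in[0,1]}\in\mathsf{CE}^2(X,\mathrm{Ch},\mathfrak m)\text{ joining }\rho_0\text{ to }\rho_1\Big\}.$$ *)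

theory Defs
  imports "HOL-Probability.Probability"
begin

text \<open>
  The set \<open>X\<close> is the universe of a type \<open>'a::t2_space\<close>, whose class topology is \<open>\<tau>\<close>. Thus
  \<open>borel :: 'a measure\<close> carries the Borel sets of \<open>\<tau>\<close>, and \<open>borel :: ('a \<times> 'a) measure\<close> those of
  the product topology (in general more than the product \<open>\<sigma>\<close>-algebra).
  Extended distances are \<open>ennreal\<close>-valued. Classes modulo \<open>m\<close>-a.e. equality are represented by
  Borel functions.
\<close>

definition semidistance :: "('a \<Rightarrow> 'a \<Rightarrow> ennreal) \<Rightarrow> bool" where
  "semidistance d \<longleftrightarrow>
     (\<forall>x. d x x = 0) \<and> (\<forall>x y. d x y = d y x) \<and> (\<forall>x y z. d x z \<le> d x y + d y z)"

definition extended_metric :: "('a \<Rightarrow> 'a \<Rightarrow> ennreal) \<Rightarrow> bool" where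
  "extended_metric d \<longleftrightarrow>
     (\<forall>x y. d x y = 0 \<longleftrightarrow> x = y) \<and> (\<forall>x y. d x y = d y x) \<and> (\<forall>x y z. d x z \<le> d x y + d y z)"

definition complete_extended_metric :: "('a \<Rightarrow> 'a \<Rightarrow> ennreal) \<Rightarrow> bool" where
  "complete_extended_metric d \<longleftrightarrow>
     (\<forall>x :: nat \<Rightarrow> 'a. (\<forall>e>0. \<exists>N. \<forall>i\<ge>N. \<forall>j\<ge>N. d (x i) (x j) < e)
        \<longrightarrow> (\<exists>l. (\<lambda>n. d (x n) l) \<longlonglongrightarrow> 0))"

definition Lip_b :: "('a::topological_space \<Rightarrow> 'a \<Rightarrow> ennreal) \<Rightarrow> ('a \<Rightarrow> real) set" where
  "Lip_b d = {f. bounded (range f) \<and> continuous_on UNIV f \<and>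
     (\<exists>L\<ge>0. \<forall>x y. ennreal \<bar>f x - f y\<bar> \<le> ennreal L * d x y)}"

text \<open>
  In the following definition the family \<open>(d\<^sub>i)\<close> is given by its range \<open>D\<close>.
\<close>

definition extended_metric_topological_space ::
    "('a::t2_space \<Rightarrow> 'a \<Rightarrow> ennreal) \<Rightarrow> bool" where
  "extended_metric_topological_space d \<longleftrightarrow> extended_metric d \<and>
     (\<exists>D :: ('a \<Rightarrow> 'a \<Rightarrow> real) set.
        (\<forall>\<delta>\<in>D. (\<forall>x y. 0 \<le> \<delta> x y) \<and> semidistance (\<lambda>x y. ennreal (\<delta> x y)) \<and>
                (\<exists>C. \<forall>x y. \<delta> x y \<le> C) \<and> continuous_on UNIV (\<lambda>(x, y). \<delta> x y)) \<and>
        (\<forall>x y. d x y = (SUP \<delta>\<in>D. ennreal (\<delta> x y)))) \<and>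
     (open :: 'a set \<Rightarrow> bool) = generate_topology {f -` V | f V. f \<in> Lip_b d \<and> open V}"

definition Radon_prob :: "'a::topological_space measure set" where
  "Radon_prob = {\<mu>. sets \<mu> = sets borel \<and> prob_space \<mu> \<and>
     (\<forall>B\<in>sets borel. emeasure \<mu> B = (SUP K\<in>{K. compact K \<and> K \<subseteq> B}. emeasure \<mu> K))}"

definition extended_metric_measure_space ::
    "('a::t2_space \<Rightarrow> 'a \<Rightarrow> ennreal) \<Rightarrow> 'a measure \<Rightarrow> bool" where
  "extended_metric_measure_space d m \<longleftrightarrow>
     extended_metric_topological_space d \<and> m \<in> Radon_prob"

definition esqrt :: "ennreal \<Rightarrow> ennreal" where
  "esqrt a = (if a = \<top> then \<top> else ennreal (sqrt (enn2real a)))"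

definition Wasserstein ::
    "('a::t2_space \<Rightarrow> 'a \<Rightarrow> ennreal) \<Rightarrow> 'a measure \<Rightarrow> 'a measure \<Rightarrow> ennreal" where
  "Wasserstein d \<mu> \<nu> = esqrt
     (INF \<pi>\<in>{\<pi> \<in> Radon_prob. distr \<pi> borel fst = \<mu> \<and> distr \<pi> borel snd = \<nu>}.
        \<integral>\<^sup>+(x, y). (d x y)\<^sup>2 \<partial>\<pi>)"

definition L2 :: "'b measure \<Rightarrow> ('b \<Rightarrow> real) set" where
  "L2 M = {f \<in> borel_measurable M. integrable M (\<lambda>x. (f x)\<^sup>2)}"

definition L2_norm :: "'b measure \<Rightarrow> ('b \<Rightarrow> real) \<Rightarrow> real" where
  "L2_norm M f = sqrt (\<integral>x. (f x)\<^sup>2 \<partial>M)"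

definition L2_tendsto :: "'b measure \<Rightarrow> (nat \<Rightarrow> 'b \<Rightarrow> real) \<Rightarrow> ('b \<Rightarrow> real) \<Rightarrow> bool" where
  "L2_tendsto M F f \<longleftrightarrow> (\<forall>n. F n \<in> L2 M) \<and> f \<in> L2 M \<and>
     (\<lambda>n. L2_norm M (\<lambda>x. F n x - f x)) \<longlonglongrightarrow> 0"

definition L2_weak_tendsto :: "'b measure \<Rightarrow> (nat \<Rightarrow> 'b \<Rightarrow> real) \<Rightarrow> ('b \<Rightarrow> real) \<Rightarrow> bool" where
  "L2_weak_tendsto M F f \<longleftrightarrow> (\<forall>n. F n \<in> L2 M) \<and> f \<in> L2 M \<and>
     (\<forall>h\<in>L2 M. (\<lambda>n. \<integral>x. F n x * h x \<partial>M) \<longlonglongrightarrow> (\<integral>x. f x * h x \<partial>M))"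

definition Linf_norm :: "'b measure \<Rightarrow> ('b \<Rightarrow> real) \<Rightarrow> ennreal" where
  "Linf_norm M f = esssup M (\<lambda>x. ennreal \<bar>f x\<bar>)"

definition Linf :: "'b measure \<Rightarrow> ('b \<Rightarrow> real) set" where
  "Linf M = {f \<in> borel_measurable M. Linf_norm M f < \<top>}"

definition AC2 ::
    "'b set \<Rightarrow> ('b \<Rightarrow> 'b \<Rightarrow> ennreal) \<Rightarrow> real \<Rightarrow> (real \<Rightarrow> 'b) \<Rightarrow> bool" where
  "AC2 Y \<delta> T y \<longleftrightarrow> (\<forall>t\<in>{0..T}. y t \<in> Y) \<and>
     (\<exists>g\<in>L2 (lebesgue_on {0<..<T}). \<forall>s t. 0 \<le> s \<and> s \<le> t \<and> t \<le> T \<longrightarrow>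
        \<delta> (y s) (y t) \<le> ennreal (LINT r:{s..t}|lebesgue. g r))"

definition metric_derivative ::
    "('b \<Rightarrow> 'b \<Rightarrow> ennreal) \<Rightarrow> (real \<Rightarrow> 'b) \<Rightarrow> real \<Rightarrow> ennreal" where
  "metric_derivative \<delta> y t = Limsup (at t) (\<lambda>s. \<delta> (y s) (y t) / ennreal \<bar>s - t\<bar>)"

text \<open>
  At \<open>d\<close>-isolated points the supremum below is eventually over the empty set, hence \<open>0\<close>.
\<close>

definition Lip_a :: "('a \<Rightarrow> 'a \<Rightarrow> ennreal) \<Rightarrow> ('a \<Rightarrow> real) \<Rightarrow> 'a \<Rightarrow> ennreal" where
  "Lip_a d f x = Lim (at_right 0) (\<lambda>r::real.
     SUP (y, z)\<in>{(y, z). max (d y x) (d z x) < ennreal r \<and> 0 < d y z}.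
       ennreal \<bar>f y - f z\<bar> / d y z)"

text \<open>
  \<open>Lip_a_star\<close>, \<open>min_relaxed_slope\<close> and \<open>CE2_speed\<close> choose a representative of an object that
  is unique up to a.e. equality.
\<close>

definition Lip_a_star ::
    "'a measure \<Rightarrow> ('a \<Rightarrow> 'a \<Rightarrow> ennreal) \<Rightarrow> ('a \<Rightarrow> real) \<Rightarrow> 'a \<Rightarrow> ennreal" where
  "Lip_a_star m d f = (SOME G. G \<in> borel_measurable m \<and> (AE x in m. Lip_a d f x \<le> G x) \<and>
     (\<forall>H\<in>borel_measurable m. (AE x in m. Lip_a d f x \<le> H x) \<longrightarrow> (AE x in m. G x \<le> H x)))"

definition Ch ::
    "'a::topological_space measure \<Rightarrow> ('a \<Rightarrow> 'a \<Rightarrow> ennreal) \<Rightarrow> ('a \<Rightarrow> real) \<Rightarrow> ennreal" where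
  "Ch m d f = (INF F\<in>{F. (\<forall>n. F n \<in> Lip_b d) \<and> L2_tendsto m F f}.
     liminf (\<lambda>n. \<integral>\<^sup>+x. (Lip_a_star m d (F n) x)\<^sup>2 \<partial>m))"

definition Ch_domain ::
    "'a::topological_space measure \<Rightarrow> ('a \<Rightarrow> 'a \<Rightarrow> ennreal) \<Rightarrow> ('a \<Rightarrow> real) set" where
  "Ch_domain m d = {f \<in> L2 m. Ch m d f < \<top>}"

text \<open>
  A weak limit point of a sequence is the weak limit of one of its subsequences.
\<close>

definition relaxed_slope ::
    "'a::topological_space measure \<Rightarrow> ('a \<Rightarrow> 'a \<Rightarrow> ennreal) \<Rightarrow> ('a \<Rightarrow> real) \<Rightarrow> ('a \<Rightarrow> real) \<Rightarrow> bool"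
  where
  "relaxed_slope m d f G \<longleftrightarrow> G \<in> L2 m \<and>
     (\<exists>F g k. (\<forall>n. F n \<in> Lip_b d) \<and> L2_tendsto m F f \<and> strict_mono (k :: nat \<Rightarrow> nat) \<and>
        L2_weak_tendsto m (\<lambda>n x. enn2real (Lip_a_star m d (F (k n)) x)) g \<and>
        (AE x in m. g x \<le> G x))"

definition min_relaxed_slope ::
    "'a::topological_space measure \<Rightarrow> ('a \<Rightarrow> 'a \<Rightarrow> ennreal) \<Rightarrow> ('a \<Rightarrow> real) \<Rightarrow> 'a \<Rightarrow> real" where
  "min_relaxed_slope m d f = (SOME G. relaxed_slope m d f G \<and>
     (\<forall>H. relaxed_slope m d f H \<longrightarrow> L2_norm m G \<le> L2_norm m H))"

definition Ch_algebra ::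
    "'a::topological_space measure \<Rightarrow> ('a \<Rightarrow> 'a \<Rightarrow> ennreal) \<Rightarrow> ('a \<Rightarrow> real) set" where
  "Ch_algebra m d = {f \<in> Ch_domain m d. f \<in> Linf m \<and> min_relaxed_slope m d f \<in> Linf m}"

definition prob_density :: "'a measure \<Rightarrow> ('a \<Rightarrow> real) \<Rightarrow> bool" where
  "prob_density m \<rho> \<longleftrightarrow> \<rho> \<in> borel_measurable m \<and> (AE x in m. 0 \<le> \<rho> x) \<and>
     (\<integral>\<^sup>+x. ennreal (\<rho> x) \<partial>m) = 1"

text \<open>
  The bound \<open>c\<close> is taken nonnegative. This matters only at times at which all the energies
  \<open>\<integral>|Df|\<^sub>w\<^sup>2 \<rho>\<^sub>r dm\<close> vanish: there a signed \<open>c\<close> would be unconstrained, and no least one would exist.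
\<close>

definition CE2_bound ::
    "'a::topological_space measure \<Rightarrow> ('a \<Rightarrow> 'a \<Rightarrow> ennreal) \<Rightarrow> real \<Rightarrow> (real \<Rightarrow> 'a \<Rightarrow> real) \<Rightarrow>
     (real \<Rightarrow> real) \<Rightarrow> bool" where
  "CE2_bound m d T \<rho> c \<longleftrightarrow>
     c \<in> L2 (lebesgue_on {0<..<T}) \<and> (AE r in lebesgue_on {0<..<T}. 0 \<le> c r) \<and>
     (\<forall>f\<in>Ch_algebra m d. \<forall>s t. 0 \<le> s \<and> s \<le> t \<and> t \<le> T \<longrightarrow>
        \<bar>(\<integral>x. f x * \<rho> t x \<partial>m) - (\<integral>x. f x * \<rho> s x \<partial>m)\<bar>
          \<le> (LINT r:{s..t}|lebesgue. c r * sqrt (\<integral>x. (min_relaxed_slope m d f x)\<^sup>2 * \<rho> r x \<partial>m)))"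

definition CE2 ::
    "'a::topological_space measure \<Rightarrow> ('a \<Rightarrow> 'a \<Rightarrow> ennreal) \<Rightarrow> real \<Rightarrow> (real \<Rightarrow> 'a \<Rightarrow> real) set" where
  "CE2 m d T = {\<rho>. (\<forall>t\<in>{0..T}. prob_density m (\<rho> t)) \<and> (\<exists>c. CE2_bound m d T \<rho> c)}"

definition CE2_speed ::
    "'a::topological_space measure \<Rightarrow> ('a \<Rightarrow> 'a \<Rightarrow> ennreal) \<Rightarrow> real \<Rightarrow> (real \<Rightarrow> 'a \<Rightarrow> real) \<Rightarrow>
     real \<Rightarrow> real" where
  "CE2_speed m d T \<rho> = (SOME c. CE2_bound m d T \<rho> c \<and>
     (\<forall>c'. CE2_bound m d T \<rho> c' \<longrightarrow> (AE r in lebesgue_on {0<..<T}. c r \<le> c' r)))"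

text \<open>
  The value is \<open>\<infinity>\<close>, as the infimum over the empty set, unless both arguments are absolutely
  continuous with respect to \<open>m\<close>.
\<close>

definition W_Ch ::
    "'a::topological_space measure \<Rightarrow> ('a \<Rightarrow> 'a \<Rightarrow> ennreal) \<Rightarrow> 'a measure \<Rightarrow> 'a measure \<Rightarrow> ennreal" where
  "W_Ch m d \<mu> \<nu> = esqrt
     (INF \<rho>\<in>{\<rho> \<in> CE2 m d 1. density m (\<lambda>x. ennreal (\<rho> 0 x)) = \<mu> \<and>
                          density m (\<lambda>x. ennreal (\<rho> 1 x)) = \<nu>}.
        \<integral>\<^sup>+t. ennreal ((CE2_speed m d 1 \<rho> t)\<^sup>2) \<partial>lebesgue_on {0<..<1})"

end

theory Submission
  imports Defs
begin

text \<open>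
  Kuwada's estimate: if \<open>\<rho>\<close> satisfies the continuity inequality with speed \<open>c\<close>, then along the Hopf-Lax
  semigroup \<open>Q\<^sub>t\<close> of a bounded \<open>\<delta> \<le> d\<close> the function \<open>t \<mapsto> \<integral>Q\<^sub>t f \<rho>\<^sub>t dm\<close> grows at most by \<open>\<integral>c\<^sup>2/2\<close>, since
  the decrease of \<open>Q\<^sub>t f\<close> in \<open>t\<close> compensates its slope. By Kantorovich duality \<open>W\<^sub>d \<le> W\<^sub>C\<^sub>h\<close>, without
  any bound on the densities.

  Conversely, let the densities be bounded and \<open>\<mu>\<close> be Lipschitz for \<open>W\<^sub>d\<close> with constant \<open>G\<close>. An almost optimal
  coupling bounds the increment of \<open>\<integral>f d\<mu>\<^sub>t\<close>, for \<open>f\<close> Lipschitz, by \<open>G\<close> times the \<open>L\<^sup>2(\<mu>\<^sub>t)\<close> norm of the slope of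
  \<open>f\<close> at small scale. As \<open>\<rho>\<^sub>t\<close> is bounded, \<open>L\<^sup>2(m)\<close> convergence of slopes controls these norms uniformly in
  \<open>t\<close>, first for the scale tending to \<open>0\<close> and then for the relaxation, so \<open>G\<close> is an admissible speed.
  Reparametrising by arc length gives \<open>W\<^sub>C\<^sub>h(\<mu>\<^sub>s, \<mu>\<^sub>t) \<le> \<integral>\<^sub>s\<^sup>t g\<close> whenever \<open>g\<close> bounds \<open>W\<^sub>d\<close> in this way.
  The metric derivatives agree because \<open>W\<^sub>d\<close> along \<open>\<mu>\<close> is controlled by the integral of its own metric derivative.
\<close>

subsection \<open>Increments bounded by integrals\<close>

text \<open>The space need not be Polish, and \<open>d\<close> is only a supremum of continuous
  bounded semidistances, so no gluing of plans is used. Duality is built from finite transport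
  problems by compactness, and symmetry and the triangle inequality of \<open>Wasserstein\<close>
  are read off the dual side. A dual pair is tested against one bounded continuous
  \<open>\<delta>\<close> below \<open>d\<close> at a time; this keeps its Hopf-Lax functions
  bounded, continuous and inside \<open>Lip_b d\<close>.

  The second obstacle is measurability. The slope of a Hopf-Lax function is bounded by a difference
  quotient with a fixed positive step, which is continuous, instead of by a derivative; increments
  in time are estimated by one-sided Dini bounds; and least speeds are countable infima.

  The Lipschitz argument yields only a constant speed. This suffices because \<open>W_Ch\<close>
  compares end points over all curves on [0, 1]: every subinterval of the given curve may be run
  through at almost constant speed. The two metric derivatives are then squeezed between an
  integrand h and the \<open>Wasserstein\<close> derivative that bounds h.\<close>

lemma lebesgue_differentiation_right:
  fixes f :: "real \<Rightarrow> real"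
  assumes "\<And>a b. f integrable_on {a..b}"
  obtains N where "negligible N"
    "\<And>x e. x \<notin> N \<Longrightarrow> 0 < e \<Longrightarrow>
       \<exists>d>0. \<forall>h. 0 \<le> h \<and> h < d \<longrightarrow> \<bar>integral {x..x + h} f - f x * h\<bar> \<le> e * h"
proof -
  from integrable_ccontinuous_explicit[of f] assms obtain N where N: "negligible N"
    "\<And>x e. x \<notin> N \<Longrightarrow> 0 < e \<Longrightarrow>
       \<exists>d>0. \<forall>h. 0 < h \<and> h < d \<longrightarrow> norm (integral (cbox x (x + h *\<^sub>R One)) f /\<^sub>R h ^ DIM(real) - f x) < e"
    by auto
  show thesis
  proof (rule that[OF N(1)])
    fix x e :: real assume xe: "x \<notin> N" "0 < e"
    from N(2)[OF this] obtain d where d: "d > 0"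
      "\<And>h. 0 < h \<Longrightarrow> h < d \<Longrightarrow> \<bar>integral {x..x + h} f / h - f x\<bar> < e"
      by (auto simp: divide_inverse mult.commute)
    have "\<bar>integral {x..x + h} f - f x * h\<bar> \<le> e * h" if "0 \<le> h" "h < d" for h
    proof (cases "h = 0")
      case False
      then have h: "h > 0" using that by auto
      have "\<bar>integral {x..x + h} f - f x * h\<bar> = \<bar>integral {x..x + h} f / h - f x\<bar> * h"
        using h by (simp add: abs_mult[symmetric] field_simps flip: abs_of_pos)
      also have "\<dots> \<le> e * h" using d(2)[OF h that(2)] h by (intro mult_right_mono) auto
      finally show ?thesis .
    qed auto
    with d(1) show "\<exists>d>0. \<forall>h. 0 \<le> h \<and> h < d \<longrightarrow> \<bar>integral {x..x + h} f - f x * h\<bar> \<le> e * h"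
      by blast
  qed
qed

text \<open>Left quotients at x are right quotients of the reflected function at -x, and an interval
  that contains x is split at x. Intervals on either side of x are required later, because a metric
  derivative looks at both sides.\<close>

lemma lebesgue_differentiation:
  fixes f :: "real \<Rightarrow> real"
  assumes f: "\<And>a b. f integrable_on {a..b}"
  obtains N where "negligible N"
    "\<And>x e. x \<notin> N \<Longrightarrow> 0 < e \<Longrightarrow>
       \<exists>d>0. \<forall>a b. a \<le> x \<and> x \<le> b \<and> b - a < d \<longrightarrow> \<bar>integral {a..b} f - f x * (b - a)\<bar> \<le> e * (b - a)"
proof -
  obtain N1 where N1: "negligible N1"
    "\<And>x e. x \<notin> N1 \<Longrightarrow> 0 < e \<Longrightarrow>
       \<exists>d>0. \<forall>h. 0 \<le> h \<and> h < d \<longrightarrow> \<bar>integral {x..x + h} f - f x * h\<bar> \<le> e * h"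
    using lebesgue_differentiation_right[OF f] by blast
  have "(\<lambda>x. f (- x)) integrable_on {a..b}" for a b
    using Henstock_Kurzweil_Integration.integrable_reflect_real[of f "-a" "-b"] f by simp
  from lebesgue_differentiation_right[OF this] obtain N2 where N2: "negligible N2"
    "\<And>x e. x \<notin> N2 \<Longrightarrow> 0 < e \<Longrightarrow>
       \<exists>d>0. \<forall>h. 0 \<le> h \<and> h < d \<longrightarrow> \<bar>integral {x..x + h} (\<lambda>x. f (- x)) - f (- x) * h\<bar> \<le> e * h"
    by blast
  have N3: "negligible (uminus ` N2)"
    by (rule negligible_differentiable_image_negligible[OF _ N2(1)])
       (auto simp: differentiable_on_def intro!: differentiable_minus)
  show thesis
  proof (rule that[of "N1 \<union> uminus ` N2"])
    show "negligible (N1 \<union> uminus ` N2)" using N1(1) N3 by simp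
    fix x e :: real assume x: "x \<notin> N1 \<union> uminus ` N2" and e: "0 < e"
    have x2: "- x \<notin> N2" using x by force
    obtain d1 where d1: "d1 > 0" "\<And>h. 0 \<le> h \<Longrightarrow> h < d1 \<Longrightarrow> \<bar>integral {x..x + h} f - f x * h\<bar> \<le> e * h"
      using N1(2)[OF _ e] x by blast
    obtain d2 where d2: "d2 > 0" "\<And>h. 0 \<le> h \<Longrightarrow> h < d2 \<Longrightarrow>
        \<bar>integral {- x..- x + h} (\<lambda>x. f (- x)) - f x * h\<bar> \<le> e * h"
      using N2(2)[OF x2 e] by auto
    have "\<bar>integral {a..b} f - f x * (b - a)\<bar> \<le> e * (b - a)"
      if ab: "a \<le> x" "x \<le> b" "b - a < min d1 d2" for a b
    proof -
      have 1: "\<bar>integral {x..b} f - f x * (b - x)\<bar> \<le> e * (b - x)"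
        using d1(2)[of "b - x"] ab by auto
      have "integral {- x..- a} (\<lambda>x. f (- x)) = integral {a..x} f"
        using Henstock_Kurzweil_Integration.integral_reflect_real[of a x f] by simp
      then have 2: "\<bar>integral {a..x} f - f x * (x - a)\<bar> \<le> e * (x - a)"
        using d2(2)[of "x - a"] ab by auto
      have "integral {a..b} f = integral {a..x} f + integral {x..b} f"
        using Henstock_Kurzweil_Integration.integral_combine[OF ab(1,2) f] by simp
      with 1 2 show ?thesis by (simp add: algebra_simps abs_le_iff)
    qed
    then show "\<exists>d>0. \<forall>a b. a \<le> x \<and> x \<le> b \<and> b - a < d \<longrightarrow>
        \<bar>integral {a..b} f - f x * (b - a)\<bar> \<le> e * (b - a)"
      using d1(1) d2(1) by (intro exI[of _ "min d1 d2"]) auto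
  qed
qed

lemma absolutely_integrable_zero_extension:
  fixes g :: "real \<Rightarrow> real"
  assumes "g absolutely_integrable_on {0..T}" and "S \<in> sets lebesgue"
  shows "(\<lambda>x. if x \<in> {0..T} then g x else 0) absolutely_integrable_on S"
proof -
  have "(\<lambda>x. if x \<in> {0..T} then g x else 0) absolutely_integrable_on UNIV"
    using assms(1) absolutely_integrable_restrict_UNIV[of "{0..T}" g] by simp
  then show ?thesis by (rule set_integrable_subset) (use assms in auto)
qed

lemma lebesgue_differentiation_on:
  fixes f :: "real \<Rightarrow> real"
  assumes f: "f absolutely_integrable_on {0..T}"
  obtains N where "negligible N"
    "\<And>x e. x \<in> {0..T} - N \<Longrightarrow> 0 < e \<Longrightarrow>
       \<exists>d>0. \<forall>a b. 0 \<le> a \<and> a \<le> x \<and> x \<le> b \<and> b \<le> T \<and> b - a < d \<longrightarrow>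
         \<bar>integral {a..b} f - f x * (b - a)\<bar> \<le> e * (b - a)"
proof -
  let ?f = "\<lambda>x. if x \<in> {0..T} then f x else 0"
  have "?f integrable_on {a..b}" for a b
    using absolutely_integrable_zero_extension[OF f, of "{a..b}"]
      set_lebesgue_integral_eq_integral(1) by auto
  from lebesgue_differentiation[OF this] obtain N where N: "negligible N"
    "\<And>x e. x \<notin> N \<Longrightarrow> 0 < e \<Longrightarrow>
       \<exists>d>0. \<forall>a b. a \<le> x \<and> x \<le> b \<and> b - a < d \<longrightarrow> \<bar>integral {a..b} ?f - ?f x * (b - a)\<bar> \<le> e * (b - a)"
    by blast
  show thesis
  proof (rule that[OF N(1)])
    fix x e :: real assume x: "x \<in> {0..T} - N" and e: "0 < e"
    obtain d where d: "d > 0"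
      "\<And>a b. a \<le> x \<Longrightarrow> x \<le> b \<Longrightarrow> b - a < d \<Longrightarrow> \<bar>integral {a..b} ?f - ?f x * (b - a)\<bar> \<le> e * (b - a)"
      using N(2)[OF _ e, of x] x by blast
    show "\<exists>d>0. \<forall>a b. 0 \<le> a \<and> a \<le> x \<and> x \<le> b \<and> b \<le> T \<and> b - a < d \<longrightarrow>
         \<bar>integral {a..b} f - f x * (b - a)\<bar> \<le> e * (b - a)"
    proof (intro exI[of _ d] conjI allI impI)
      fix a b assume ab: "0 \<le> a \<and> a \<le> x \<and> x \<le> b \<and> b \<le> T \<and> b - a < d"
      have "integral {a..b} ?f = integral {a..b} f"
        using ab by (intro Henstock_Kurzweil_Integration.integral_cong) auto
      then show "\<bar>integral {a..b} f - f x * (b - a)\<bar> \<le> e * (b - a)"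
        using d(2)[of a b] ab x by simp
    qed (fact d)
  qed
qed

lemma abs_integrable_subinterval:
  fixes f :: "real \<Rightarrow> real"
  assumes "f absolutely_integrable_on {0..T}" "0 \<le> a" "b \<le> T"
  shows "f absolutely_integrable_on {a..b}" "f integrable_on {a..b}"
proof -
  show "f absolutely_integrable_on {a..b}"
    by (rule set_integrable_subset[OF assms(1)]) (use assms(2,3) in auto)
  then show "f integrable_on {a..b}" by (rule set_lebesgue_integral_eq_integral(1))
qed

lemma integral_combine_abs:
  fixes f :: "real \<Rightarrow> real"
  assumes "f absolutely_integrable_on {0..T}" "0 \<le> a" "a \<le> b" "b \<le> c" "c \<le> T"
  shows "integral {a..c} f = integral {a..b} f + integral {b..c} f"
  using Henstock_Kurzweil_Integration.integral_combine[OF assms(3,4)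
      abs_integrable_subinterval(2)[OF assms(1,2,5)]] by simp

text \<open>The steps 1/(n+1) turn a derivative into the limit of a sequence, which makes Fatou's
  lemma and measurable upper limits available. The last conclusion says that the step eventually
  stays inside the interval, hence r < T.\<close>

lemma integral_quotient_tendsto:
  fixes f :: "real \<Rightarrow> real"
  assumes f: "f absolutely_integrable_on {0..T}"
  obtains N where "negligible N"
    "\<And>r. r \<in> {0..<T} - N \<Longrightarrow> (\<lambda>n. real (Suc n) * integral {r..r + 1 / real (Suc n)} f) \<longlonglongrightarrow> f r"
    "\<And>r. r \<in> {0..<T} \<Longrightarrow> \<forall>\<^sub>F n in sequentially. r + 1 / real (Suc n) \<le> T"
proof -
  have ev: "\<forall>\<^sub>F n in sequentially. 1 / real (Suc n) < d" if "0 < d" for d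
    using order_tendstoD(2)[OF LIMSEQ_inverse_real_of_nat that] by (simp add: inverse_eq_divide)
  have evT: "\<forall>\<^sub>F n in sequentially. r + 1 / real (Suc n) \<le> T" if "r \<in> {0..<T}" for r
    using ev[of "T - r"] that by (auto elim!: eventually_mono)
  obtain N where N: "negligible N" "\<And>x e. x \<in> {0..T} - N \<Longrightarrow> 0 < e \<Longrightarrow>
       \<exists>d>0. \<forall>a b. 0 \<le> a \<and> a \<le> x \<and> x \<le> b \<and> b \<le> T \<and> b - a < d \<longrightarrow>
         \<bar>integral {a..b} f - f x * (b - a)\<bar> \<le> e * (b - a)"
    by (rule lebesgue_differentiation_on[OF f]) (rule that)
  have "(\<lambda>n. real (Suc n) * integral {r..r + 1 / real (Suc n)} f) \<longlonglongrightarrow> f r" if r: "r \<in> {0..<T} - N" for r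
  proof (rule tendstoI)
    fix e :: real assume e: "0 < e"
    obtain d where d: "d > 0" "\<And>a b. 0 \<le> a \<Longrightarrow> a \<le> r \<Longrightarrow> r \<le> b \<Longrightarrow> b \<le> T \<Longrightarrow> b - a < d \<Longrightarrow>
         \<bar>integral {a..b} f - f r * (b - a)\<bar> \<le> e / 2 * (b - a)"
      using N(2)[of r "e / 2"] r e by auto
    have "\<forall>\<^sub>F n in sequentially. r + 1 / real (Suc n) \<le> T" using r by (intro evT) simp
    with ev[OF d(1)] show "\<forall>\<^sub>F n in sequentially. dist (real (Suc n) * integral {r..r + 1 / real (Suc n)} f) (f r) < e"
    proof eventually_elim
      case (elim n)
      let ?d = "1 / real (Suc n)"
      have "real (Suc n) * \<bar>integral {r..r + ?d} f - f r * ?d\<bar> \<le> real (Suc n) * (e / 2 * ?d)"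
        using d(2)[of r "r + ?d"] elim r by (intro mult_left_mono) auto
      moreover have "real (Suc n) * (integral {r..r + ?d} f - f r * ?d) = real (Suc n) * integral {r..r + ?d} f - f r"
        by (simp add: right_diff_distrib del: of_nat_Suc)
      then have "real (Suc n) * \<bar>integral {r..r + ?d} f - f r * ?d\<bar> = \<bar>real (Suc n) * integral {r..r + ?d} f - f r\<bar>"
        by (metis abs_mult abs_of_nat)
      ultimately show ?case using e by (simp add: dist_real_def del: of_nat_Suc)
    qed
  qed
  then show thesis by (rule that[OF N(1) _ evT])
qed

text \<open>The inequality in Lebesgue's theorem on monotone functions: integrals of the forward
  quotients of K telescope to averages near t and s, and Fatou's lemma carries the local lower bound
  w through the limit. K lives on the half line because the shifted argument passes t.\<close>

lemma integral_le_monotone_increment: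
  fixes K w :: "real \<Rightarrow> real"
  assumes st: "s \<le> t" and K: "continuous_on {s..} K" "\<And>a b. s \<le> a \<Longrightarrow> a \<le> b \<Longrightarrow> K a \<le> K b"
    and w: "w absolutely_integrable_on {s..t}" and N: "negligible N"
    and loc: "\<And>r e. r \<in> {s..t} - N \<Longrightarrow> 0 < e \<Longrightarrow>
      \<forall>\<^sub>F n in sequentially. w r - e \<le> real (Suc n) * (K (r + 1 / real (Suc n)) - K r)"
  shows "integral {s..t} w \<le> K t - K s"
proof -
  define u where "u n r = real (Suc n) * (K (r + 1 / real (Suc n)) - K r)" for n r
  have u0: "0 \<le> u n r" if "s \<le> r" for n r using that by (simp add: u_def K(2) del: of_nat_Suc)
  have Kc: "continuous_on {s..t} K" "continuous_on {s..t} (\<lambda>r. K (r + 1 / real (Suc n)))" for n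
    by (auto intro!: continuous_on_subset[OF K(1)] continuous_on_compose2[OF K(1)] continuous_intros intro: add_increasing2)
  have uc: "continuous_on {s..t} (u n)" for n unfolding u_def by (intro continuous_intros Kc)
  \<comment> \<open>After the shift only integrals of K over two end intervals of length 1/(n+1)
    remain; monotonicity bounds them by values of K.\<close>
  have uI: "integral {s..t} (u n) \<le> K (t + 1 / real (Suc n)) - K s" for n
  proof -
    let ?d = "1 / real (Suc n)"
    have i: "K integrable_on {a..b}" if "s \<le> a" for a b
      by (rule integrable_continuous_interval[OF continuous_on_subset[OF K(1)]]) (use that in auto)
    have "integral {s..t} (\<lambda>r. K (r + ?d)) = integral {s + ?d..t + ?d} K"
      using integral_shift_Icc_real[of s t K ?d] by (simp add: o_def add.commute)
    moreover have "integral {s..s + ?d} K + integral {s + ?d..t + ?d} K = integral {s..t} K + integral {t..t + ?d} K"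
      using st i by (simp add: Henstock_Kurzweil_Integration.integral_combine)
    moreover have "integral {t..t + ?d} K \<le> integral {t..t + ?d} (\<lambda>_. K (t + ?d))"
      using st i by (intro integral_le) (auto intro: K(2))
    moreover have "integral {s..s + ?d} (\<lambda>_. K s) \<le> integral {s..s + ?d} K"
      using i by (intro integral_le) (auto intro: K(2))
    ultimately have "integral {s..t} (\<lambda>r. K (r + ?d)) - integral {s..t} K \<le> ?d * (K (t + ?d) - K s)"
      by (simp add: right_diff_distrib)
    moreover have "integral {s..t} (u n) = real (Suc n) * (integral {s..t} (\<lambda>r. K (r + ?d)) - integral {s..t} K)"
      unfolding u_def using Kc(1)[THEN integrable_continuous_interval] Kc(2)[of n, THEN integrable_continuous_interval]
      by (subst Henstock_Kurzweil_Integration.integral_mult_right, subst Henstock_Kurzweil_Integration.integral_diff) auto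
    ultimately show ?thesis by (simp add: field_simps del: of_nat_Suc)
  qed
  \<comment> \<open>Fatou's lemma wants nonnegative functions. The positive part of w obeys the same
    local bound because the quotients are themselves nonnegative.\<close>
  have wp: "(\<lambda>r. max 0 (w r)) absolutely_integrable_on {s..t}"
    using absolutely_integrable_max_1[OF _ w, of "\<lambda>_. 0"] by (simp add: max.commute)
  have "integral {s..t} w \<le> integral {s..t} (\<lambda>r. max 0 (w r))"
    using w wp by (intro integral_le) (auto dest: set_lebesgue_integral_eq_integral(1))
  then have "ennreal (integral {s..t} w) \<le> ennreal (integral {s..t} (\<lambda>r. max 0 (w r)))" by (rule ennreal_leI)
  also have "\<dots> = (\<integral>\<^sup>+r. ennreal (indicator {s..t} r * max 0 (w r)) \<partial>lebesgue)"
    using nn_integral_has_integral_lebesgue[of "{s..t}" "\<lambda>r. max 0 (w r)"] set_lebesgue_integral_eq_integral(1)[OF wp]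
    by (simp add: nn_integral_completion has_integral_integral)
  also have "\<dots> \<le> (\<integral>\<^sup>+r. liminf (\<lambda>n. ennreal (indicator {s..t} r * u n r)) \<partial>lebesgue)"
  proof (rule nn_integral_mono_AE)
    have "AE r in lebesgue. r \<notin> N" using N by (intro AE_not_in) (simp add: negligible_iff_null_sets)
    then show "AE r in lebesgue. ennreal (indicator {s..t} r * max 0 (w r)) \<le> liminf (\<lambda>n. ennreal (indicator {s..t} r * u n r))"
    proof eventually_elim
      case (elim r)
      show ?case
      proof (cases "r \<in> {s..t}")
        case True
        have "ennreal (max 0 (w r)) \<le> liminf (\<lambda>n. ennreal (u n r)) + ennreal e" if e: "0 < e" for e
        proof -
          have "\<forall>\<^sub>F n in sequentially. ennreal (max 0 (w r) - e) \<le> ennreal (u n r)"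
          proof -
            have "\<forall>\<^sub>F n in sequentially. w r - e \<le> u n r"
              unfolding u_def using True elim by (intro loc e) simp
            then show ?thesis
            proof eventually_elim
              case n: (elim n)
              have "0 \<le> u n r" using True by (intro u0) simp
              with n e show ?case by (intro ennreal_leI) (simp add: max_def)
            qed
          qed
          then have "ennreal (max 0 (w r) - e) \<le> liminf (\<lambda>n. ennreal (u n r))" by (rule Liminf_bounded)
          moreover have "ennreal (max 0 (w r)) \<le> ennreal (max 0 (w r) - e) + ennreal e"
            using e by (cases "e \<le> max 0 (w r)") (auto simp: ennreal_plus[symmetric] ennreal_neg intro!: ennreal_leI simp del: ennreal_plus)
          ultimately show ?thesis by (meson add_right_mono order_trans)
        qed
        then show ?thesis using True by (auto intro: ennreal_le_epsilon)
      qed simp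
    qed
  qed
  also have "\<dots> \<le> liminf (\<lambda>n. \<integral>\<^sup>+r. ennreal (indicator {s..t} r * u n r) \<partial>lebesgue)"
    using borel_measurable_continuous_on_indicator[OF _ uc]
    by (intro nn_integral_liminf measurable_compose[OF _ measurable_ennreal] measurable_completion) auto
  also have "\<dots> \<le> liminf (\<lambda>n. ennreal (K (t + 1 / real (Suc n)) - K s))"
  proof (intro Liminf_mono always_eventually allI)
    fix n
    have "(\<integral>\<^sup>+r. ennreal (indicator {s..t} r * u n r) \<partial>lebesgue) = ennreal (integral {s..t} (u n))"
      using nn_integral_has_integral_lebesgue[of "{s..t}" "u n"] u0 integrable_continuous_interval[OF uc]
      by (simp add: nn_integral_completion has_integral_integral)
    with uI[of n] show "(\<integral>\<^sup>+r. ennreal (indicator {s..t} r * u n r) \<partial>lebesgue) \<le> ennreal (K (t + 1 / real (Suc n)) - K s)"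
      by (simp add: ennreal_leI)
  qed
  also have "\<dots> = ennreal (K t - K s)"
  proof (rule lim_imp_Liminf[OF sequentially_bot])
    have "(\<lambda>n. t + 1 / real (Suc n)) \<longlonglongrightarrow> t + 0"
      using LIMSEQ_inverse_real_of_nat by (intro tendsto_intros) (simp add: inverse_eq_divide)
    then have "(\<lambda>n. K (t + 1 / real (Suc n))) \<longlonglongrightarrow> K t"
      using st by (intro continuous_on_tendsto_compose[OF K(1)]) (auto intro!: always_eventually add_increasing2)
    then show "(\<lambda>n. ennreal (K (t + 1 / real (Suc n)) - K s)) \<longlonglongrightarrow> ennreal (K t - K s)"
      by (intro tendsto_ennrealI tendsto_intros)
  qed
  finally show ?thesis using K(2)[of s t] st by (simp add: ennreal_le_iff)
qed

text \<open>\<phi> is not monotone, but G - \<phi> is, where G is a primitive of the crude bound g.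
  An upper bound h on the quotients of \<phi> becomes the lower bound g - h on those of G - \<phi>,
  so the crude bound improves to h.\<close>

lemma increment_le_integral:
  fixes \<phi> g h :: "real \<Rightarrow> real"
  assumes g: "g absolutely_integrable_on {0..T}" and h: "h absolutely_integrable_on {0..T}"
    and bd: "\<And>a b. 0 \<le> a \<Longrightarrow> a \<le> b \<Longrightarrow> b \<le> T \<Longrightarrow> \<bar>\<phi> b - \<phi> a\<bar> \<le> integral {a..b} g"
    and N: "negligible N"
    and loc: "\<And>r e. r \<in> {0..<T} - N \<Longrightarrow> 0 < e \<Longrightarrow>
      \<forall>\<^sub>F n in sequentially. real (Suc n) * (\<phi> (r + 1 / real (Suc n)) - \<phi> r) \<le> h r + e"
    and st: "0 \<le> s" "s \<le> t" "t \<le> T"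
  shows "\<phi> t - \<phi> s \<le> integral {s..t} h"
proof -
  define G where "G x = integral {0..x} g" for x
  define k where "k x = G x - \<phi> x" for x
  have Gc: "continuous_on {0..T} G"
    unfolding G_def by (rule indefinite_integral_continuous_1[OF abs_integrable_subinterval(2)[OF g]]) auto
  have Gd: "G b - G a = integral {a..b} g" if "0 \<le> a" "a \<le> b" "b \<le> T" for a b
    using integral_combine_abs[OF g, of 0 a b] that by (simp add: G_def)
  have \<phi>c: "continuous_on {0..T} \<phi>"
    unfolding continuous_on_iff
  proof (intro ballI allI impI)
    fix x e :: real assume x: "x \<in> {0..T}" and e: "0 < e"
    then obtain d where d: "d > 0" "\<And>y. y \<in> {0..T} \<Longrightarrow> dist y x < d \<Longrightarrow> dist (G y) (G x) < e"
      using Gc unfolding continuous_on_iff by blast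
    have "dist (\<phi> y) (\<phi> x) < e" if y: "y \<in> {0..T}" "dist y x < d" for y
      using d(2)[OF y] bd[of x y] bd[of y x] Gd[of x y] Gd[of y x] x y(1)
      by (cases "x \<le> y") (auto simp: dist_real_def abs_minus_commute)
    with d(1) show "\<exists>d>0. \<forall>y\<in>{0..T}. dist y x < d \<longrightarrow> dist (\<phi> y) (\<phi> x) < e" by blast
  qed
  have kc: "continuous_on {0..T} k" unfolding k_def by (intro continuous_intros Gc \<phi>c)
  have kmono: "k a \<le> k b" if "0 \<le> a" "a \<le> b" "b \<le> T" for a b
    using bd[OF that] Gd[OF that] by (auto simp: k_def)
  obtain N' where N': "negligible N'"
    "\<And>r. r \<in> {0..<T} - N' \<Longrightarrow> (\<lambda>n. real (Suc n) * integral {r..r + 1 / real (Suc n)} g) \<longlonglongrightarrow> g r"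
    "\<And>r. r \<in> {0..<T} \<Longrightarrow> \<forall>\<^sub>F n in sequentially. r + 1 / real (Suc n) \<le> T"
    by (rule integral_quotient_tendsto[OF g]) (rule that)
  note sub = abs_integrable_subinterval[OF _ st(1,3)]
  \<comment> \<open>The minimum with T continues k as a constant, since the monotone lemma evaluates
    it beyond t. The point T joins the exceptional set because no forward step from it stays in the
    interval.\<close>
  have "integral {s..t} (\<lambda>r. g r - h r) \<le> k (min t T) - k (min s T)"
  proof (rule integral_le_monotone_increment[where N = "insert T (N \<union> N')"])
    show "continuous_on {s..} (\<lambda>x. k (min x T))"
      using st by (intro continuous_on_compose2[OF kc] continuous_intros) auto
    show "k (min a T) \<le> k (min b T)" if "s \<le> a" "a \<le> b" for a b using that st by (intro kmono) auto
    show "(\<lambda>r. g r - h r) absolutely_integrable_on {s..t}" using sub(1)[OF g] sub(1)[OF h] by (rule set_integral_diff(1))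
    show "negligible (insert T (N \<union> N'))" using N N'(1) by simp
    fix r e :: real assume r: "r \<in> {s..t} - insert T (N \<union> N')" and e: "0 < e"
    then have rT: "r \<in> {0..<T} - N" "r \<in> {0..<T} - N'" "r \<in> {0..<T}" using st by auto
    have "\<forall>\<^sub>F n in sequentially. g r - e / 2 < real (Suc n) * integral {r..r + 1 / real (Suc n)} g"
      using e by (intro order_tendstoD(1)[OF N'(2)[OF rT(2)]]) simp
    with loc[OF rT(1) half_gt_zero[OF e]] N'(3)[OF rT(3)]
    show "\<forall>\<^sub>F n in sequentially. g r - h r - e \<le> real (Suc n) * (k (min (r + 1 / real (Suc n)) T) - k (min r T))"
    proof eventually_elim
      case (elim n)
      then have "k (min (r + 1 / real (Suc n)) T) - k (min r T)
        = integral {r..r + 1 / real (Suc n)} g - (\<phi> (r + 1 / real (Suc n)) - \<phi> r)"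
        using rT Gd[of r "r + 1 / real (Suc n)"] by (simp add: k_def del: of_nat_Suc)
      then have "real (Suc n) * (k (min (r + 1 / real (Suc n)) T) - k (min r T))
        = real (Suc n) * integral {r..r + 1 / real (Suc n)} g - real (Suc n) * (\<phi> (r + 1 / real (Suc n)) - \<phi> r)"
        by (simp only: right_diff_distrib)
      with elim show ?case by linarith
    qed
  qed (rule st)
  also have "\<dots> = integral {s..t} g - (\<phi> t - \<phi> s)" using st Gd[OF st] by (simp add: k_def)
  finally show ?thesis
    using Henstock_Kurzweil_Integration.integral_diff[OF sub(2)[OF g] sub(2)[OF h]] by simp
qed

text \<open>Off a countable union of null sets every \<open>a k\<close> is the limit of its own
  quotients, so the quotients of \<phi> are eventually below each of them and hence below the
  infimum up to e. This yields the least speed of a curve.\<close>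

lemma increment_le_integral_INF:
  fixes \<phi> :: "real \<Rightarrow> real" and a :: "nat \<Rightarrow> real \<Rightarrow> real"
  assumes a: "\<And>k. a k absolutely_integrable_on {0..T}"
    and an: "\<And>k r. r \<in> {0..T} \<Longrightarrow> 0 \<le> a k r"
    and bd: "\<And>k x y. 0 \<le> x \<Longrightarrow> x \<le> y \<Longrightarrow> y \<le> T \<Longrightarrow> \<bar>\<phi> y - \<phi> x\<bar> \<le> integral {x..y} (a k)"
  shows "(\<lambda>r. INF k. a k r) absolutely_integrable_on {0..T}"
    and "0 \<le> s \<Longrightarrow> s \<le> t \<Longrightarrow> t \<le> T \<Longrightarrow> \<bar>\<phi> t - \<phi> s\<bar> \<le> integral {s..t} (\<lambda>r. INF k. a k r)"
proof -
  let ?h = "\<lambda>r. INF k. a k r"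
  have bdd: "bdd_below (range (\<lambda>k. a k r))" if "r \<in> {0..T}" for r
    using an[OF that] by (intro bdd_belowI[of _ 0]) auto
  have hle: "?h r \<le> a k r" if "r \<in> {0..T}" for r k
    using bdd[OF that] by (rule cINF_lower) auto
  have hn: "0 \<le> ?h r" if "r \<in> {0..T}" for r
    using an[OF that] by (intro cINF_greatest) auto
  have am: "a k \<in> borel_measurable (lebesgue_on {0..T})" for k
    using a[of k] absolutely_integrable_measurable[of "{0..T}" "a k"] by auto
  have "?h \<in> borel_measurable (lebesgue_on {0..T})"
    using am bdd by (intro borel_measurable_cINF) auto
  then show h: "?h absolutely_integrable_on {0..T}"
    using hn hle[of _ 0] abs_integrable_subinterval(2)[OF a[of 0], of 0 T]
    by (intro measurable_bounded_by_integrable_imp_absolutely_integrable[of _ _ "a 0"]) auto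
  have "\<exists>N. negligible N \<and> (\<forall>r\<in>{0..<T} - N. (\<lambda>n. real (Suc n) * integral {r..r + 1 / real (Suc n)} (a k)) \<longlonglongrightarrow> a k r)" for k
    by (rule integral_quotient_tendsto[OF a[of k]]) blast
  then have "\<exists>N. \<forall>k. negligible (N k) \<and>
      (\<forall>r\<in>{0..<T} - N k. (\<lambda>n. real (Suc n) * integral {r..r + 1 / real (Suc n)} (a k)) \<longlonglongrightarrow> a k r)"
    by (intro choice allI)
  then obtain N where N: "\<And>k. negligible (N k)"
    "\<And>k r. r \<in> {0..<T} - N k \<Longrightarrow> (\<lambda>n. real (Suc n) * integral {r..r + 1 / real (Suc n)} (a k)) \<longlonglongrightarrow> a k r"
    by blast
  have evT: "\<forall>\<^sub>F n in sequentially. r + 1 / real (Suc n) \<le> T" if "r \<in> {0..<T}" for r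
    by (rule integral_quotient_tendsto[OF a[of 0]]) (use that in blast)
  assume st: "0 \<le> s" "s \<le> t" "t \<le> T"
  \<comment> \<open>The improvement lemma is one-sided, so it is applied with both signs.\<close>
  have "\<sigma> * \<phi> t - \<sigma> * \<phi> s \<le> integral {s..t} ?h" if \<sigma>: "\<bar>\<sigma>\<bar> = 1" for \<sigma> :: real
  proof (rule increment_le_integral[OF a[of 0] h _ _ _ st])
    have abs: "\<bar>\<sigma> * x - \<sigma> * y\<bar> = \<bar>x - y\<bar>" for x y
      using \<sigma> by (simp add: right_diff_distrib[symmetric] abs_mult)
    show "\<bar>\<sigma> * \<phi> y - \<sigma> * \<phi> x\<bar> \<le> integral {x..y} (a 0)" if "0 \<le> x" "x \<le> y" "y \<le> T" for x y
      unfolding abs by (rule bd[OF that])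
    show "negligible (\<Union>k. N k)" using N(1) by (intro negligible_countable_Union) auto
    fix r e :: real assume r: "r \<in> {0..<T} - (\<Union>k. N k)" and e: "0 < e"
    then have "\<exists>k\<in>UNIV. a k r < ?h r + e / 2"
      by (subst cINF_less_iff[symmetric]) (auto intro!: bdd)
    then obtain k where k: "a k r < ?h r + e / 2" by blast
    have "\<forall>\<^sub>F n in sequentially. real (Suc n) * integral {r..r + 1 / real (Suc n)} (a k) < a k r + e / 2"
      using e r by (intro order_tendstoD(2)[OF N(2)]) auto
    moreover have "\<forall>\<^sub>F n in sequentially. r + 1 / real (Suc n) \<le> T" using r by (intro evT) simp
    ultimately show "\<forall>\<^sub>F n in sequentially. real (Suc n) * (\<sigma> * \<phi> (r + 1 / real (Suc n)) - \<sigma> * \<phi> r) \<le> ?h r + e"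
    proof eventually_elim
      case (elim n)
      have "\<sigma> * \<phi> (r + 1 / real (Suc n)) - \<sigma> * \<phi> r \<le> \<bar>\<phi> (r + 1 / real (Suc n)) - \<phi> r\<bar>"
        by (rule order_trans[OF abs_ge_self eq_refl[OF abs]])
      also have "\<dots> \<le> integral {r..r + 1 / real (Suc n)} (a k)" using elim r by (intro bd) auto
      finally have "real (Suc n) * (\<sigma> * \<phi> (r + 1 / real (Suc n)) - \<sigma> * \<phi> r) \<le> real (Suc n) * integral {r..r + 1 / real (Suc n)} (a k)"
        by (rule mult_left_mono) simp
      with elim k show ?case by linarith
    qed
  qed
  from this[of 1] this[of "-1"] show "\<bar>\<phi> t - \<phi> s\<bar> \<le> integral {s..t} ?h" by (simp add: abs_le_iff)
qed

text \<open>
  The integrand is the upper limit of the forward difference quotients along the steps \<open>1/n\<close>. It is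
  measurable, which is not clear for the metric derivative itself.
\<close>

lemma metric_derivative_integrand:
  fixes \<delta> :: "'b \<Rightarrow> 'b \<Rightarrow> ennreal" and y :: "real \<Rightarrow> 'b"
  assumes sym: "\<And>s t. s \<in> {0..T} \<Longrightarrow> t \<in> {0..T} \<Longrightarrow> \<delta> (y s) (y t) = \<delta> (y t) (y s)"
    and tri: "\<And>r s t. r \<in> {0..T} \<Longrightarrow> s \<in> {0..T} \<Longrightarrow> t \<in> {0..T} \<Longrightarrow>
      \<delta> (y r) (y t) \<le> \<delta> (y r) (y s) + \<delta> (y s) (y t)"
    and g: "g absolutely_integrable_on {0..T}" and gn: "\<And>r. r \<in> {0..T} \<Longrightarrow> 0 \<le> g r"
    and bd: "\<And>s t. 0 \<le> s \<Longrightarrow> s \<le> t \<Longrightarrow> t \<le> T \<Longrightarrow> \<delta> (y s) (y t) \<le> ennreal (integral {s..t} g)"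
  obtains h where "h absolutely_integrable_on {0..T}" "\<And>r. 0 \<le> h r"
    "\<And>r. r \<in> {0<..<T} \<Longrightarrow> ennreal (h r) \<le> metric_derivative \<delta> y r"
    "\<And>s t. 0 \<le> s \<Longrightarrow> s \<le> t \<Longrightarrow> t \<le> T \<Longrightarrow> \<delta> (y s) (y t) \<le> ennreal (integral {s..t} h)"
proof -
  define D where "D a b = enn2real (\<delta> (y a) (y b))" for a b
  have fin: "\<delta> (y a) (y b) < \<top>" if "a \<in> {0..T}" "b \<in> {0..T}" for a b
  proof (cases "a \<le> b")
    case True
    then show ?thesis using bd[of a b] that by (auto intro: le_less_trans)
  next
    case False
    then show ?thesis using bd[of b a] sym[of a b] that by (auto intro: le_less_trans)
  qed
  have De: "\<delta> (y a) (y b) = ennreal (D a b)" if "a \<in> {0..T}" "b \<in> {0..T}" for a b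
    using fin[OF that] by (simp add: D_def)
  have D0: "0 \<le> D a b" for a b by (simp add: D_def)
  have Dsym: "D a b = D b a" if "a \<in> {0..T}" "b \<in> {0..T}" for a b
    using sym[OF that] by (simp add: D_def)
  have Dtri: "D a c \<le> D a b + D b c" if "a \<in> {0..T}" "b \<in> {0..T}" "c \<in> {0..T}" for a b c
    using tri[OF that] that D0 by (simp add: De ennreal_plus[symmetric] del: ennreal_plus)
  define G where "G x = integral {0..x} g" for x
  have Gc: "continuous_on {0..T} G"
    unfolding G_def by (rule indefinite_integral_continuous_1[OF abs_integrable_subinterval(2)[OF g]]) auto
  have Dbd: "D a b \<le> integral {a..b} g" if "0 \<le> a" "a \<le> b" "b \<le> T" for a b
  proof -
    have "0 \<le> integral {a..b} g"
      using gn that abs_integrable_subinterval(2)[OF g] by (intro Henstock_Kurzweil_Integration.integral_nonneg) auto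
    then show ?thesis using bd[OF that] that by (simp add: De)
  qed
  have DG: "D a b \<le> \<bar>G b - G a\<bar>" if "a \<in> {0..T}" "b \<in> {0..T}" for a b
    using Dbd[of a b] Dbd[of b a] integral_combine_abs[OF g, of 0 a b] integral_combine_abs[OF g, of 0 b a] Dsym[OF that] that
    by (cases "a \<le> b") (auto simp: G_def)
  \<comment> \<open>The minimum with T keeps the second argument in {0..T}, so that each q n is
    continuous on the whole interval.\<close>
  define q where "q n r = real (Suc n) * D r (min T (r + 1 / real (Suc n)))" for n r
  have qc: "continuous_on {0..T} (q n)" for n
  proof -
    let ?m = "\<lambda>r. min T (r + 1 / real (Suc n))"
    have m: "?m r \<in> {0..T}" if "r \<in> {0..T}" for r using that by auto
    have Gm: "continuous_on {0..T} (\<lambda>r. G (?m r))" using m by (intro continuous_on_compose2[OF Gc] continuous_intros) auto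
    have "((\<lambda>r. D r (?m r)) \<longlongrightarrow> D x (?m x)) (at x within {0..T})" if x: "x \<in> {0..T}" for x
    proof (rule Lim_null_comparison[where g = "\<lambda>r. \<bar>G r - G x\<bar> + \<bar>G (?m r) - G (?m x)\<bar>", THEN LIM_zero_cancel])
      show "\<forall>\<^sub>F r in at x within {0..T}. norm (D r (?m r) - D x (?m x)) \<le> \<bar>G r - G x\<bar> + \<bar>G (?m r) - G (?m x)\<bar>"
        unfolding eventually_at_filter
      proof (intro always_eventually allI impI)
        fix r assume r: "r \<in> {0..T}"
        note Dtri[OF r x m[OF r]] Dtri[OF x m[OF x] m[OF r]] Dtri[OF x r m[OF x]] Dtri[OF r m[OF r] m[OF x]]
          DG[OF r x] DG[OF x r] DG[OF m[OF r] m[OF x]] DG[OF m[OF x] m[OF r]]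
        then show "norm (D r (?m r) - D x (?m x)) \<le> \<bar>G r - G x\<bar> + \<bar>G (?m r) - G (?m x)\<bar>"
          unfolding real_norm_def by (auto simp: abs_le_iff abs_minus_commute)
      qed
      have "((\<lambda>r. \<bar>G r - G x\<bar> + \<bar>G (?m r) - G (?m x)\<bar>) \<longlongrightarrow> \<bar>G x - G x\<bar> + \<bar>G (?m x) - G (?m x)\<bar>) (at x within {0..T})"
        using Gc Gm x unfolding continuous_on_def by (intro tendsto_intros) auto
      then show "((\<lambda>r. \<bar>G r - G x\<bar> + \<bar>G (?m r) - G (?m x)\<bar>) \<longlongrightarrow> 0) (at x within {0..T})" by simp
    qed
    then have "continuous_on {0..T} (\<lambda>r. D r (?m r))" by (simp add: continuous_on_def)
    then show ?thesis unfolding q_def by (intro continuous_intros)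
  qed
  define H where "H r = limsup (\<lambda>n. ennreal (q n r))" for r
  \<comment> \<open>The quotients are known to be asymptotically below g only at Lebesgue points of
    g. The minimum makes h integrable everywhere and alters nothing at those points.\<close>
  define h where "h r = enn2real (min (H r) (ennreal (g r)))" for r
  have hH: "ennreal (h r) \<le> H r" for r unfolding h_def by (metis ennreal_enn2real_if min.cobounded1 min_less_iff_disj ennreal_less_top top.not_eq_extremum zero_le order_trans)
  have qm: "q n \<in> borel_measurable (lebesgue_on {0..T})" for n
    by (rule continuous_imp_measurable_on_sets_lebesgue[OF qc]) auto
  have Hm: "H \<in> borel_measurable (lebesgue_on {0..T})"
    unfolding H_def by (intro borel_measurable_limsup measurable_compose[OF qm measurable_ennreal])
  have gm: "g \<in> borel_measurable (lebesgue_on {0..T})"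
    using g absolutely_integrable_measurable[of "{0..T}" g] by auto
  have "h \<in> borel_measurable (lebesgue_on {0..T})"
    unfolding h_def using Hm gm by measurable
  moreover have "norm (h r) \<le> g r" if "r \<in> {0..T}" for r
    using gn[OF that] by (auto simp: h_def intro!: enn2real_leI)
  ultimately have h: "h absolutely_integrable_on {0..T}"
    using abs_integrable_subinterval(2)[OF g, of 0 T]
    by (intro measurable_bounded_by_integrable_imp_absolutely_integrable[of _ _ g]) auto
  have h0: "0 \<le> h r" for r by (simp add: h_def)
  obtain N where N: "negligible N"
    "\<And>r. r \<in> {0..<T} - N \<Longrightarrow> (\<lambda>n. real (Suc n) * integral {r..r + 1 / real (Suc n)} g) \<longlonglongrightarrow> g r"
    "\<And>r. r \<in> {0..<T} \<Longrightarrow> \<forall>\<^sub>F n in sequentially. r + 1 / real (Suc n) \<le> T"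
    by (rule integral_quotient_tendsto[OF g]) (rule that)
  have ev: "\<forall>\<^sub>F n in sequentially. q n r \<le> h r + e" if r: "r \<in> {0..<T} - N" and e: "0 < e" for r e
  proof -
    have g0: "0 \<le> g r" using r gn[of r] by auto
    have "\<forall>\<^sub>F n in sequentially. ennreal (q n r) \<le> ennreal (g r) + ennreal e" if e: "0 < e" for e
    proof -
      have "\<forall>\<^sub>F n in sequentially. real (Suc n) * integral {r..r + 1 / real (Suc n)} g < g r + e"
        using e by (intro order_tendstoD(2)[OF N(2)[OF r]]) simp
      moreover have "\<forall>\<^sub>F n in sequentially. r + 1 / real (Suc n) \<le> T" using r by (intro N(3)) simp
      ultimately show ?thesis
      proof eventually_elim
        case (elim n)
        have "q n r \<le> real (Suc n) * integral {r..r + 1 / real (Suc n)} g"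
          unfolding q_def using elim r by (intro mult_left_mono) (auto simp: min_absorb2 intro!: Dbd)
        with elim show ?case using g0 e by (simp add: ennreal_leI flip: ennreal_plus)
      qed
    qed
    then have "H r \<le> ennreal (g r) + ennreal e" if "0 < e" for e unfolding H_def using that by (rule_tac Limsup_bounded)
    then have "H r \<le> ennreal (g r)" by (rule ennreal_le_epsilon)
    then have "H r = ennreal (h r)" by (simp add: h_def min_absorb1 le_less_trans)
    also have "\<dots> < ennreal (h r + e)" using h0 e by (simp add: ennreal_less_iff)
    finally have "\<forall>\<^sub>F n in sequentially. ennreal (q n r) < ennreal (h r + e)" unfolding H_def by (rule Limsup_lessD)
    then show ?thesis
    proof eventually_elim
      case (elim n)
      have "0 \<le> q n r" by (simp add: q_def D0)
      with elim show ?case by (simp add: ennreal_less_iff)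
    qed
  qed
  show thesis
  proof (rule that[OF h h0])
    show "\<delta> (y s) (y t) \<le> ennreal (integral {s..t} h)" if st: "0 \<le> s" "s \<le> t" "t \<le> T" for s t
    proof -
      \<comment> \<open>With s fixed, the real function D s has increments at most D a b by the
        triangle inequality, so the improvement from g to h applies to it.\<close>
      have "D s t - D s s \<le> integral {s..t} h"
      proof (rule increment_le_integral[OF g h _ N(1) _ st])
        show "\<bar>D s b - D s a\<bar> \<le> integral {a..b} g" if "0 \<le> a" "a \<le> b" "b \<le> T" for a b
          using Dtri[of s a b] Dtri[of s b a] Dsym[of a b] Dbd[OF that] that st by (auto simp: abs_le_iff)
        fix r e :: real assume r: "r \<in> {0..<T} - N" and e: "0 < e"
        have "\<forall>\<^sub>F n in sequentially. r + 1 / real (Suc n) \<le> T" using r by (intro N(3)) simp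
        with ev[OF r e] show "\<forall>\<^sub>F n in sequentially. real (Suc n) * (D s (r + 1 / real (Suc n)) - D s r) \<le> h r + e"
        proof eventually_elim
          case (elim n)
          have "real (Suc n) * (D s (r + 1 / real (Suc n)) - D s r) \<le> q n r"
            unfolding q_def using Dtri[of s r "r + 1 / real (Suc n)"] elim r st by (intro mult_left_mono) (auto simp: min_absorb2)
          with elim show ?case by simp
        qed
      qed
      moreover have "D s s = 0" using Dbd[of s s] D0[of s s] st by simp
      ultimately show ?thesis using st by (simp add: De ennreal_leI)
    qed
    fix r assume r: "r \<in> {0<..<T}"
    have lim: "filterlim (\<lambda>n. r + 1 / real (Suc n)) (at r) sequentially"
    proof (rule filterlim_atI)
      have "(\<lambda>n. r + 1 / real (Suc n)) \<longlonglongrightarrow> r + 0"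
        using LIMSEQ_inverse_real_of_nat by (intro tendsto_intros) (simp add: inverse_eq_divide)
      then show "(\<lambda>n. r + 1 / real (Suc n)) \<longlonglongrightarrow> r" by simp
    qed simp
    have "H r \<le> limsup (\<lambda>n. \<delta> (y (r + 1 / real (Suc n))) (y r) / ennreal \<bar>(r + 1 / real (Suc n)) - r\<bar>)"
      unfolding H_def
    proof (rule Limsup_mono)
      have "r \<in> {0..<T}" using r by simp
      from N(3)[OF this] show "\<forall>\<^sub>F n in sequentially. ennreal (q n r) \<le> \<delta> (y (r + 1 / real (Suc n))) (y r) / ennreal \<bar>(r + 1 / real (Suc n)) - r\<bar>"
      proof eventually_elim
        case (elim n)
        then have "\<delta> (y (r + 1 / real (Suc n))) (y r) = ennreal (D r (r + 1 / real (Suc n)))"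
          using r by (simp add: De Dsym del: of_nat_Suc)
        then show ?case using elim D0 by (simp add: q_def min_absorb2 divide_ennreal mult.commute del: of_nat_Suc)
      qed
    qed
    also have "\<dots> \<le> Limsup (filtermap (\<lambda>n. r + 1 / real (Suc n)) sequentially) (\<lambda>s. \<delta> (y s) (y r) / ennreal \<bar>s - r\<bar>)"
      by (rule Limsup_filtermap_ge)
    also have "\<dots> \<le> metric_derivative \<delta> y r"
      unfolding metric_derivative_def Limsup_def
      using lim by (intro INF_superset_mono) (auto simp: filterlim_def le_filter_def)
    finally show "ennreal (h r) \<le> metric_derivative \<delta> y r" using hH[of r] by (rule order_trans[rotated])
  qed
qed

subsection \<open>Duality for finite transport problems\<close>

text \<open>Tychonoff's theorem. The indices are pairs of cells in the finite problems and, later,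
  all subsets of the product space.\<close>

lemma compact_function_box: "compact {f :: 'i \<Rightarrow> real. \<forall>i. f i \<in> {a..b}}"
proof -
  have "compactin (product_topology (\<lambda>i::'i. euclidean) UNIV) (PiE UNIV (\<lambda>i. {a..b::real}))"
    by (simp add: compactin_PiE)
  then have "compact (PiE UNIV (\<lambda>i::'i. {a..b::real}))"
    by (simp add: euclidean_product_topology)
  moreover have "PiE UNIV (\<lambda>i::'i. {a..b::real}) = {f. \<forall>i. f i \<in> {a..b}}"
    by (auto simp: PiE_def Pi_def extensional_def)
  ultimately show ?thesis by simp
qed

text \<open>First-order condition at a minimum: for small t a negative linear term would outweigh
  the quadratic one. It serves the finite transport problem and the projection in Mazur's
  lemma.\<close>

lemma linear_coeff_nonneg:
  fixes A B \<eta> :: real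
  assumes "0 < \<eta>" "\<And>t. 0 < t \<Longrightarrow> t < \<eta> \<Longrightarrow> 0 \<le> t * A + t\<^sup>2 * B"
  shows "0 \<le> A"
proof (rule ccontr)
  assume A: "\<not> 0 \<le> A"
  define t where "t = min (\<eta> / 2) (- A / (2 * (\<bar>B\<bar> + 1)))"
  have t: "0 < t" "t < \<eta>" using assms(1) A by (auto simp: t_def intro!: divide_neg_pos)
  have "t * (\<bar>B\<bar> + 1) \<le> - A / 2"
  proof -
    have "t \<le> - A / (2 * (\<bar>B\<bar> + 1))" by (simp add: t_def)
    then have "t * (\<bar>B\<bar> + 1) \<le> - A / (2 * (\<bar>B\<bar> + 1)) * (\<bar>B\<bar> + 1)" by (intro mult_right_mono) auto
    also have "\<dots> = - A / 2"
      by (simp add: divide_simps)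
    finally show ?thesis .
  qed
  moreover have "t * B \<le> t * (\<bar>B\<bar> + 1)" using t by (intro mult_left_mono) auto
  ultimately have "A + t * B < 0" using A by auto
  then have "t * (A + t * B) < 0" using t by (simp add: mult_pos_neg)
  with assms(2)[OF t] show False by (simp add: algebra_simps power2_eq_square)
qed

lemma max0_power2_le: "(max 0 (u + v))\<^sup>2 \<le> (max 0 u)\<^sup>2 + 2 * v * max 0 u + v\<^sup>2" for u v :: real
proof -
  have "(max 0 (u + v))\<^sup>2 \<le> (max 0 u + v)\<^sup>2"
  proof (cases "0 \<le> u + v")
    case True
    then have "max 0 (u + v) \<le> max 0 u + v" by auto
    with True show ?thesis by (intro power_mono) auto
  qed auto
  also have "\<dots> = (max 0 u)\<^sup>2 + 2 * v * max 0 u + v\<^sup>2"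
    by (simp add: power2_sum)
  finally show ?thesis .
qed

lemma sum_power2_update:
  fixes f :: "'k \<Rightarrow> real"
  assumes "finite K" "k \<in> K"
  shows "(\<Sum>i\<in>K. (f i + (if i = k then t else 0))\<^sup>2) = (\<Sum>i\<in>K. (f i)\<^sup>2) + 2 * t * f k + t\<^sup>2"
proof -
  have "(\<Sum>i\<in>K. (f i + (if i = k then t else 0))\<^sup>2) = (f k + t)\<^sup>2 + (\<Sum>i\<in>K - {k}. (f i + (if i = k then t else 0))\<^sup>2)"
    using assms by (subst sum.remove[of K k]) auto
  also have "(\<Sum>i\<in>K - {k}. (f i + (if i = k then t else 0))\<^sup>2) = (\<Sum>i\<in>K - {k}. (f i)\<^sup>2)"
    by (intro sum.cong) auto
  also have "(\<Sum>i\<in>K. (f i)\<^sup>2) = (f k)\<^sup>2 + (\<Sum>i\<in>K - {k}. (f i)\<^sup>2)"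
    using assms by (subst sum.remove[of K k]) auto
  ultimately show ?thesis by (simp add: power2_sum)
qed

text \<open>Minimise F, the squared violation of the marginals and of the cost bound. The residuals
  \<phi>, \<psi> and lam at a minimiser satisfy
  \<open>\<phi> k + \<psi> l \<le> lam * c k l\<close>, with equality where p charges (k, l). Hence
  the dual value of (\<phi>, \<psi>) is lam * C + F p, and the assumed dual bound forces F p =
  0.\<close>

lemma finite_transport_duality:
  fixes \<mu> \<nu> :: "'k \<Rightarrow> real" and c :: "'k \<Rightarrow> 'k \<Rightarrow> real"
  assumes K: "finite K"
    and \<mu>: "\<And>k. k \<in> K \<Longrightarrow> 0 \<le> \<mu> k" "sum \<mu> K = 1" and \<nu>: "\<And>k. k \<in> K \<Longrightarrow> 0 \<le> \<nu> k" "sum \<nu> K = 1"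
    and c: "\<And>k l. k \<in> K \<Longrightarrow> l \<in> K \<Longrightarrow> 0 \<le> c k l"
    and dual: "\<And>\<phi> \<psi>. (\<And>k l. k \<in> K \<Longrightarrow> l \<in> K \<Longrightarrow> \<phi> k + \<psi> l \<le> c k l) \<Longrightarrow>
       (\<Sum>k\<in>K. \<phi> k * \<mu> k) + (\<Sum>l\<in>K. \<psi> l * \<nu> l) \<le> C"
  obtains p where "\<And>k l. k \<in> K \<Longrightarrow> l \<in> K \<Longrightarrow> 0 \<le> p k l"
    "\<And>k. k \<in> K \<Longrightarrow> (\<Sum>l\<in>K. p k l) = \<mu> k" "\<And>l. l \<in> K \<Longrightarrow> (\<Sum>k\<in>K. p k l) = \<nu> l"
    "(\<Sum>k\<in>K. \<Sum>l\<in>K. p k l * c k l) \<le> C"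
proof -
  have C0: "0 \<le> C" using dual[of "\<lambda>_. 0" "\<lambda>_. 0"] c by simp
  define R where "R p k = (\<Sum>l\<in>K. p (k, l))" for p :: "'k \<times> 'k \<Rightarrow> real" and k
  define S where "S p l = (\<Sum>k\<in>K. p (k, l))" for p :: "'k \<times> 'k \<Rightarrow> real" and l
  define Q where "Q p = (\<Sum>k\<in>K. \<Sum>l\<in>K. p (k, l) * c k l)" for p :: "'k \<times> 'k \<Rightarrow> real"
  define F where "F p = (\<Sum>k\<in>K. (R p k - \<mu> k)\<^sup>2) + (\<Sum>l\<in>K. (S p l - \<nu> l)\<^sup>2) + (max 0 (Q p - C))\<^sup>2"
    for p :: "'k \<times> 'k \<Rightarrow> real"
  \<comment> \<open>With the bound 3 the upper constraint is inactive at a minimiser: the zero plan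
    shows \<open>F p \<le> 2\<close>, while an entry 3 would exceed its row sum by at least 2 and
    give \<open>F p \<ge> 4\<close>. Entries over K can therefore still be increased.\<close>
  let ?B = "{p :: 'k \<times> 'k \<Rightarrow> real. \<forall>i. p i \<in> {0..3}}"
  have "continuous_on UNIV F"
    unfolding F_def R_def S_def Q_def
    by (intro continuous_intros continuous_on_product_coordinates)
  then have "continuous_on ?B F" by (rule continuous_on_subset) auto
  moreover have "?B \<noteq> {}" by (auto intro!: exI[of _ "\<lambda>_. 0"])
  ultimately have "\<exists>p\<in>?B. \<forall>q\<in>?B. F p \<le> F q"
    by (intro continuous_attains_inf compact_function_box)
  then obtain p where p: "p \<in> ?B" and pmin: "\<And>q. q \<in> ?B \<Longrightarrow> F p \<le> F q"
    by blast
  have \<mu>1: "\<mu> k \<le> 1" if "k \<in> K" for k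
    using member_le_sum[of k K \<mu>] \<mu> that K by auto
  have \<nu>1: "\<nu> k \<le> 1" if "k \<in> K" for k
    using member_le_sum[of k K \<nu>] \<nu> that K by auto
  have F2: "F p \<le> 2"
  proof -
    have "F p \<le> F (\<lambda>_. 0)" by (rule pmin) auto
    also have "\<dots> = (\<Sum>k\<in>K. (\<mu> k)\<^sup>2) + (\<Sum>l\<in>K. (\<nu> l)\<^sup>2)"
      using C0 by (simp add: F_def R_def S_def Q_def)
    also have "\<dots> \<le> sum \<mu> K + sum \<nu> K"
      using \<mu>(1) \<nu>(1) \<mu>1 \<nu>1
      by (intro add_mono sum_mono) (auto simp: power2_eq_square intro: mult_left_le)
    finally show ?thesis using \<mu>(2) \<nu>(2) by simp
  qed
  have p3: "p (k, l) < 3" if "k \<in> K" "l \<in> K" for k l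
  proof (rule ccontr)
    assume "\<not> ?thesis"
    moreover have "p (k, l) \<le> R p k"
      unfolding R_def using p K that by (intro member_le_sum[of l K "\<lambda>l. p (k, l)"]) auto
    ultimately have "2 \<le> R p k - \<mu> k" using \<mu>1[OF that(1)] by auto
    then have "2\<^sup>2 \<le> (R p k - \<mu> k)\<^sup>2" by (intro power_mono) auto
    also have "\<dots> \<le> (\<Sum>k\<in>K. (R p k - \<mu> k)\<^sup>2)"
      using K that by (intro member_le_sum[of k K "\<lambda>k. (R p k - \<mu> k)\<^sup>2"]) auto
    also have "\<dots> \<le> F p" unfolding F_def by (simp add: sum_nonneg)
    finally show False using F2 by auto
  qed
  define lam where "lam = max 0 (Q p - C)"
  define \<phi> where "\<phi> k = - (R p k - \<mu> k)" for k
  define \<psi> where "\<psi> l = - (S p l - \<nu> l)" for l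
  have pert: "0 \<le> t * (2 * (lam * c k l - \<phi> k - \<psi> l)) + t\<^sup>2 * (2 + (c k l)\<^sup>2)"
    if kl: "k \<in> K" "l \<in> K" and t: "0 \<le> p (k, l) + t" "p (k, l) + t \<le> 3" for k l t
  proof -
    define q where "q = p((k, l) := p (k, l) + t)"
    have q: "q \<in> ?B" using p t by (auto simp: q_def)
    have qe: "q (i, j) = p (i, j) + (if i = k then if j = l then t else 0 else 0)" for i j
      by (auto simp: q_def)
    have Rq: "R q i = R p i + (if i = k then t else 0)" for i
      using K kl by (simp add: R_def qe sum.distrib sum.delta')
    have Sq: "S q j = S p j + (if j = l then t else 0)" for j
      using K kl by (simp add: S_def qe sum.distrib sum.delta sum.delta')
    have Qq: "Q q = Q p + t * c k l"
    proof -
      have "q (i, j) * c i j = p (i, j) * c i j + (if i = k then if j = l then t * c k l else 0 else 0)" for i j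
        by (auto simp: qe algebra_simps)
      moreover have "(\<Sum>j\<in>K. if i = k then if j = l then a else 0 else 0) = (if i = k then a else 0)" for i and a :: real
        using K kl by (cases "i = k") (simp_all add: sum.delta)
      ultimately show ?thesis using K kl by (simp add: Q_def sum.distrib sum.delta)
    qed
    have "F p \<le> F q" using pmin[OF q] .
    also have "F q = (\<Sum>i\<in>K. ((R p i - \<mu> i) + (if i = k then t else 0))\<^sup>2)
        + (\<Sum>j\<in>K. ((S p j - \<nu> j) + (if j = l then t else 0))\<^sup>2) + (max 0 ((Q p - C) + t * c k l))\<^sup>2"
      by (simp add: F_def Rq Sq Qq algebra_simps)
    also have "\<dots> \<le> ((\<Sum>i\<in>K. (R p i - \<mu> i)\<^sup>2) + 2 * t * (R p k - \<mu> k) + t\<^sup>2)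
        + ((\<Sum>j\<in>K. (S p j - \<nu> j)\<^sup>2) + 2 * t * (S p l - \<nu> l) + t\<^sup>2)
        + ((max 0 (Q p - C))\<^sup>2 + 2 * (t * c k l) * max 0 (Q p - C) + (t * c k l)\<^sup>2)"
      using K kl by (intro add_mono max0_power2_le) (simp_all add: sum_power2_update)
    finally show ?thesis
      by (simp add: F_def \<phi>_def \<psi>_def lam_def algebra_simps power_mult_distrib)
  qed
  have ineq: "\<phi> k + \<psi> l \<le> lam * c k l" if kl: "k \<in> K" "l \<in> K" for k l
  proof -
    have "0 \<le> 2 * (lam * c k l - \<phi> k - \<psi> l)"
    proof (rule linear_coeff_nonneg)
      show "0 < 3 - p (k, l)" using p3[OF kl] by simp
      show "0 \<le> t * (2 * (lam * c k l - \<phi> k - \<psi> l)) + t\<^sup>2 * (2 + (c k l)\<^sup>2)" if "0 < t" "t < 3 - p (k, l)" for t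
        using pert[OF kl, of t] that p by (auto simp: add_nonneg_nonneg)
    qed
    then show ?thesis by simp
  qed
  \<comment> \<open>Complementary slackness: a positive entry may also be decreased, which gives the
    opposite inequality.\<close>
  have slack: "p (k, l) * (\<phi> k + \<psi> l - lam * c k l) = 0" if kl: "k \<in> K" "l \<in> K" for k l
  proof (cases "p (k, l) = 0")
    case False
    then have p0: "p (k, l) > 0" using p by (auto simp: less_le)
    have "0 \<le> - (2 * (lam * c k l - \<phi> k - \<psi> l))"
    proof (rule linear_coeff_nonneg)
      show "0 < p (k, l)" by fact
      show "0 \<le> t * - (2 * (lam * c k l - \<phi> k - \<psi> l)) + t\<^sup>2 * (2 + (c k l)\<^sup>2)" if "0 < t" "t < p (k, l)" for t
      proof -
        have "0 \<le> (- t) * (2 * (lam * c k l - \<phi> k - \<psi> l)) + (- t)\<^sup>2 * (2 + (c k l)\<^sup>2)"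
          using that p3[OF kl] by (intro pert kl) auto
        then show ?thesis by (simp only: mult_minus_left mult_minus_right power2_minus)
      qed
    qed
    with ineq[OF kl] show ?thesis by simp
  qed simp
  have Feq: "F p = (\<Sum>k\<in>K. (\<phi> k)\<^sup>2) + (\<Sum>l\<in>K. (\<psi> l)\<^sup>2) + lam\<^sup>2"
    by (simp add: F_def \<phi>_def \<psi>_def lam_def power2_commute)
  have lC: "lam * C = lam * Q p - lam\<^sup>2"
    by (auto simp: lam_def max_def algebra_simps power2_eq_square)
  have "(\<Sum>k\<in>K. \<phi> k * R p k) + (\<Sum>l\<in>K. \<psi> l * S p l) - lam * Q p
      = (\<Sum>k\<in>K. \<Sum>l\<in>K. p (k, l) * (\<phi> k + \<psi> l - lam * c k l))"
  proof -
    have "(\<Sum>l\<in>K. \<psi> l * S p l) = (\<Sum>k\<in>K. \<Sum>l\<in>K. \<psi> l * p (k, l))"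
      unfolding S_def sum_distrib_left by (rule sum.swap)
    then show ?thesis
      by (simp add: R_def Q_def sum_distrib_left sum.distrib sum_subtractf algebra_simps)
  qed
  also have "\<dots> = 0" by (intro sum.neutral ballI slack)
  finally have 1: "(\<Sum>k\<in>K. \<phi> k * R p k) + (\<Sum>l\<in>K. \<psi> l * S p l) = lam * Q p" by simp
  have "(\<Sum>k\<in>K. \<phi> k * \<mu> k) = (\<Sum>k\<in>K. \<phi> k * R p k) + (\<Sum>k\<in>K. (\<phi> k)\<^sup>2)"
    unfolding sum.distrib[symmetric] by (intro sum.cong) (auto simp: \<phi>_def algebra_simps power2_eq_square)
  moreover have "(\<Sum>l\<in>K. \<psi> l * \<nu> l) = (\<Sum>l\<in>K. \<psi> l * S p l) + (\<Sum>l\<in>K. (\<psi> l)\<^sup>2)"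
    unfolding sum.distrib[symmetric] by (intro sum.cong) (auto simp: \<psi>_def algebra_simps power2_eq_square)
  ultimately have 2: "(\<Sum>k\<in>K. \<phi> k * \<mu> k) + (\<Sum>l\<in>K. \<psi> l * \<nu> l) = lam * C + F p"
    using 1 lC Feq by simp
  have l0: "lam \<ge> 0" by (simp add: lam_def)
  have F0: "F p \<le> 0"
  proof (cases "lam = 0")
    case False
    then have lp: "lam > 0" using l0 by simp
    have "(\<Sum>k\<in>K. \<phi> k / lam * \<mu> k) + (\<Sum>l\<in>K. \<psi> l / lam * \<nu> l) \<le> C"
      using lp ineq by (intro dual) (auto simp: field_simps)
    then have "((\<Sum>k\<in>K. \<phi> k * \<mu> k) + (\<Sum>l\<in>K. \<psi> l * \<nu> l)) / lam \<le> C"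
      by (simp add: add_divide_distrib sum_divide_distrib)
    with lp 2 show ?thesis by (simp add: field_simps)
  next
    \<comment> \<open>If lam vanishes then \<open>\<phi> k + \<psi> l \<le> 0\<close>, so every
      positive multiple of the pair is dual admissible and its value, a multiple of F p, would
      exceed C.\<close>
    case True
    show ?thesis
    proof (rule ccontr)
      assume "\<not> ?thesis"
      then have Fp: "F p > 0" by simp
      obtain n :: nat where n: "C < real n * F p" using reals_Archimedean3[OF Fp] by blast
      have "(\<Sum>k\<in>K. (real n * \<phi> k) * \<mu> k) + (\<Sum>l\<in>K. (real n * \<psi> l) * \<nu> l) \<le> C"
      proof (rule dual)
        fix k l assume kl: "k \<in> K" "l \<in> K"
        have "real n * (\<phi> k + \<psi> l) \<le> 0"
          using ineq[OF kl] True by (intro mult_nonneg_nonpos) auto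
        then show "real n * \<phi> k + real n * \<psi> l \<le> c k l"
          using c[OF kl] by (simp add: distrib_left)
      qed
      then have "real n * ((\<Sum>k\<in>K. \<phi> k * \<mu> k) + (\<Sum>l\<in>K. \<psi> l * \<nu> l)) \<le> C"
        by (simp add: sum_distrib_left distrib_left mult.assoc)
      then show False using 2 True n by simp
    qed
  qed
  have nn: "0 \<le> (\<Sum>k\<in>K. (\<phi> k)\<^sup>2)" "0 \<le> (\<Sum>l\<in>K. (\<psi> l)\<^sup>2)" "0 \<le> lam\<^sup>2" by (auto intro: sum_nonneg)
  with F0 Feq have "(\<Sum>k\<in>K. (\<phi> k)\<^sup>2) = 0" "(\<Sum>l\<in>K. (\<psi> l)\<^sup>2) = 0" "lam\<^sup>2 = 0"
    by linarith+
  then have z: "(\<Sum>k\<in>K. (\<phi> k)\<^sup>2) = 0" "(\<Sum>l\<in>K. (\<psi> l)\<^sup>2) = 0" "lam = 0"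
    by simp_all
  show thesis
  proof (rule that[of "\<lambda>k l. p (k, l)"])
    show "0 \<le> p (k, l)" for k l using p by auto
    show "(\<Sum>l\<in>K. p (k, l)) = \<mu> k" if "k \<in> K" for k
      using z(1) that K by (auto simp: sum_nonneg_eq_0_iff \<phi>_def R_def)
    show "(\<Sum>k\<in>K. p (k, l)) = \<nu> l" if "l \<in> K" for l
      using z(2) that K by (auto simp: sum_nonneg_eq_0_iff \<psi>_def S_def)
    show "(\<Sum>k\<in>K. \<Sum>l\<in>K. p (k, l) * c k l) \<le> C"
      using z(3) by (simp add: lam_def Q_def max_def split: if_splits)
  qed
qed

subsection \<open>Radon measures from finitely additive ones\<close>

lemma Hausdorff_space_euclidean_t2: "Hausdorff_space (euclidean :: 'b::t2_space topology)"
  unfolding Hausdorff_space_def disjnt_def by simp (metis hausdorff)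

text \<open>K - U and K - V are disjoint compact sets; disjoint open sets around them are cut out of
  K. This gives the finite subadditivity of \<open>inner\<close> on open sets.\<close>

lemma compact_split_open_cover:
  fixes K :: "'b::t2_space set"
  assumes K: "compact K" and O: "open U" "open V" "K \<subseteq> U \<union> V"
  obtains L M where "compact L" "compact M" "L \<subseteq> U" "M \<subseteq> V" "K = L \<union> M"
proof -
  have "compact (K - U)" "compact (K - V)"
    using K O by (auto intro: compact_diff)
  moreover have "(K - U) \<inter> (K - V) = {}" using O(3) by auto
  ultimately obtain A B where AB: "open A" "open B" "K - U \<subseteq> A" "K - V \<subseteq> B" "A \<inter> B = {}"
    using Hausdorff_space_compact_separation[OF Hausdorff_space_euclidean_t2, of "K - U" "K - V"]
    by (auto simp: disjnt_def)
  show thesis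
  proof (rule that[of "K - A" "K - B"])
    show "compact (K - A)" "compact (K - B)" using K AB by (auto intro: compact_diff)
    show "K - A \<subseteq> U" "K - B \<subseteq> V" "K = K - A \<union> (K - B)" using AB by auto
  qed
qed

text \<open>
  Finite subcovers of compact sets make the outer measure induced by such a \<open>p\<close> countably subadditive.
\<close>

locale tight_charge =
  fixes p :: "'b::t2_space set \<Rightarrow> real"
  assumes nonneg: "0 \<le> p S"
    and additive: "S \<inter> S' = {} \<Longrightarrow> p (S \<union> S') = p S + p S'"
    and total: "p UNIV = 1"
    and tight: "0 < e \<Longrightarrow> \<exists>K. compact K \<and> p (- K) \<le> e"
begin

lemma mono: "S \<subseteq> S' \<Longrightarrow> p S \<le> p S'"
  using additive[of S "S' - S"] nonneg[of "S' - S"] by (simp add: Un_absorb1)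

lemma empty [simp]: "p {} = 0"
  using additive[of "{}" "{}"] by simp

lemma subadditive: "p (S \<union> S') \<le> p S + p S'"
  using additive[of S "S' - S"] mono[of "S' - S" S'] by simp

text \<open>Mass that p places outside all compact subsets of U is discarded, so
  \<open>inner U\<close> may be smaller than p U. Tightness ensures that nothing is lost for the
  whole space.\<close>

definition inner :: "'b set \<Rightarrow> ennreal" where
  "inner U = (SUP K\<in>{K. compact K \<and> K \<subseteq> U}. ennreal (p K))"

definition outer :: "'b set \<Rightarrow> ennreal" where
  "outer A = (INF U\<in>{U. open U \<and> A \<subseteq> U}. inner U)"

lemma inner_upper: "compact K \<Longrightarrow> K \<subseteq> U \<Longrightarrow> ennreal (p K) \<le> inner U"
  unfolding inner_def by (rule SUP_upper) auto

lemma inner_le: "inner U \<le> ennreal (p U)"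
  unfolding inner_def by (rule SUP_least) (auto intro: ennreal_leI mono)

lemma inner_mono: "U \<subseteq> V \<Longrightarrow> inner U \<le> inner V"
  unfolding inner_def by (rule SUP_subset_mono) auto

lemma outer_open: "open U \<Longrightarrow> outer U = inner U"
  unfolding outer_def by (intro antisym INF_lower2[of U] INF_greatest) (auto intro: inner_mono)

lemma outer_mono: "A \<subseteq> B \<Longrightarrow> outer A \<le> outer B"
  unfolding outer_def by (rule INF_superset_mono) auto

lemma outer_le_1: "outer A \<le> 1"
proof -
  have "outer A \<le> inner UNIV" unfolding outer_def by (rule INF_lower) auto
  also have "\<dots> \<le> 1" using inner_le[of UNIV] total by simp
  finally show ?thesis .
qed

lemma outer_fin: "outer A < \<top>"
  using outer_le_1[of A] by (rule le_less_trans) simp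

lemma outer_approx: "0 < e \<Longrightarrow> \<exists>U. open U \<and> A \<subseteq> U \<and> inner U < outer A + e" for e :: ennreal
proof -
  assume "0 < e"
  then have "outer A < outer A + e"
    using outer_fin[of A] ennreal_add_left_cancel_less[of "outer A" 0 e] by (simp add: less_top)
  then show ?thesis unfolding outer_def by (subst (asm) INF_less_iff) auto
qed

lemma compact_le_sum_inner:
  assumes "finite I" "\<And>i. i \<in> I \<Longrightarrow> open (U i)" "compact K" "K \<subseteq> (\<Union>i\<in>I. U i)"
  shows "ennreal (p K) \<le> (\<Sum>i\<in>I. inner (U i))"
  using assms
proof (induction I arbitrary: K rule: finite_induct)
  case (insert i I)
  have "K \<subseteq> U i \<union> (\<Union>i\<in>I. U i)" using insert.prems by auto
  then obtain L M where LM: "compact L" "compact M" "L \<subseteq> U i" "M \<subseteq> (\<Union>i\<in>I. U i)" "K = L \<union> M"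
    using compact_split_open_cover[of K "U i" "\<Union>i\<in>I. U i"] insert.prems by (metis open_UN insertCI)
  have "ennreal (p K) \<le> ennreal (p L) + ennreal (p M)"
    using subadditive[of L M] LM nonneg by (simp add: ennreal_leI flip: ennreal_plus)
  also have "\<dots> \<le> inner (U i) + (\<Sum>i\<in>I. inner (U i))"
    using LM insert by (intro add_mono inner_upper insert.IH) auto
  finally show ?case using insert by simp
qed auto

lemma inner_UN_le:
  assumes "\<And>n::nat. open (U n)"
  shows "inner (\<Union>n. U n) \<le> (\<Sum>n. inner (U n))"
  unfolding inner_def[of "\<Union>n. U n"]
proof (rule SUP_least)
  fix K assume "K \<in> {K. compact K \<and> K \<subseteq> (\<Union>n. U n)}"
  then obtain I where I: "finite I" "K \<subseteq> (\<Union>n\<in>I. U n)" "compact K"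
    using compactE_image[of K UNIV U] assms by auto
  have "ennreal (p K) \<le> (\<Sum>n\<in>I. inner (U n))"
    using I assms by (intro compact_le_sum_inner)
  also have "\<dots> \<le> (\<Sum>n. inner (U n))"
    using I by (intro sum_le_suminf) auto
  finally show "ennreal (p K) \<le> (\<Sum>n. inner (U n))" .
qed

lemma outer_UN_le: "outer (\<Union>n::nat. A n) \<le> (\<Sum>n. outer (A n))"
proof (rule ennreal_le_epsilon)
  fix e :: real assume e: "0 < e"
  have "\<exists>U. open U \<and> A n \<subseteq> U \<and> inner U < outer (A n) + ennreal (e * (1 / 2) ^ Suc n)" for n
    using e by (intro outer_approx) simp
  then obtain U where U: "\<And>n. open (U n)" "\<And>n. A n \<subseteq> U n"
      "\<And>n. inner (U n) < outer (A n) + ennreal (e * (1 / 2) ^ Suc n)"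
    by metis
  have "outer (\<Union>n. A n) \<le> inner (\<Union>n. U n)"
    unfolding outer_def using U by (intro INF_lower) auto
  also have "\<dots> \<le> (\<Sum>n. inner (U n))" by (rule inner_UN_le) fact
  also have "\<dots> \<le> (\<Sum>n. outer (A n) + ennreal (e * (1 / 2) ^ Suc n))"
    using U(3) by (intro suminf_le) (auto intro: less_imp_le)
  also have "\<dots> = (\<Sum>n. outer (A n)) + (\<Sum>n. ennreal (e * (1 / 2) ^ Suc n))"
    by (intro suminf_add[symmetric]) auto
  also have "(\<Sum>n. ennreal (e * (1 / 2) ^ Suc n)) = ennreal e"
  proof -
    have "(\<lambda>n. e * (1 / 2) ^ Suc n) sums (e * 1)"
      using sums_mult[OF power_half_series, of e] by simp
    then show ?thesis using e by (intro suminf_ennreal_eq) auto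
  qed
  finally show "outer (\<Union>n. A n) \<le> (\<Sum>n. outer (A n)) + ennreal e" .
qed

lemma outer_empty [simp]: "outer {} = 0"
  using outer_open[of "{}"] inner_le[of "{}"] by simp

lemma outer_measure: "outer_measure_space (Pow UNIV) outer"
  unfolding outer_measure_space_def positive_def increasing_def countably_subadditive_def
  by (auto intro: outer_mono outer_UN_le)

lemma outer_Un_le: "outer (A \<union> B) \<le> outer A + outer B"
proof -
  have "outer (\<Union>n::nat. if n = 0 then A else if n = 1 then B else {}) \<le>
      (\<Sum>n::nat. outer (if n = 0 then A else if n = 1 then B else {}))"
    by (rule outer_UN_le)
  also have "\<dots> = (\<Sum>n\<in>{0, 1}. outer (if n = 0 then A else if n = (1::nat) then B else {}))"
    by (intro suminf_finite) auto
  also have "(\<Union>n::nat. if n = 0 then A else if n = 1 then B else {}) = A \<union> B"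
    by (auto split: if_splits)
  finally show ?thesis by simp
qed

lemma inner_disjoint_add:
  assumes "compact K" "K \<subseteq> U"
  shows "ennreal (p K) + inner (U - K) \<le> inner U"
proof -
  have "ennreal (p K) + inner (U - K) = (SUP L\<in>{L. compact L \<and> L \<subseteq> U - K}. ennreal (p K) + ennreal (p L))"
    unfolding inner_def[of "U - K"] by (intro ennreal_SUP_add_right) auto
  also have "\<dots> \<le> inner U"
  proof (rule SUP_least)
    fix L assume L: "L \<in> {L. compact L \<and> L \<subseteq> U - K}"
    then have "K \<inter> L = {}" by auto
    then have "ennreal (p K) + ennreal (p L) = ennreal (p (K \<union> L))"
      using additive[of K L] nonneg by (simp add: ennreal_plus)
    also have "\<dots> \<le> inner U" using L assms by (intro inner_upper) (auto intro: compact_Un)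
    finally show "ennreal (p K) + ennreal (p L) \<le> inner U" .
  qed
  finally show ?thesis .
qed

text \<open>The substantial half of Caratheodory's condition for V, tested on open U: removing a
  compact K inside \<open>U \<inter> V\<close> leaves the open set U - K, which contains U - V, and
  p is additive on disjoint compact sets.\<close>

lemma inner_split:
  assumes "open U" "open V"
  shows "inner (U \<inter> V) + outer (U - V) \<le> inner U"
proof -
  have "inner (U \<inter> V) + outer (U - V) = (SUP K\<in>{K. compact K \<and> K \<subseteq> U \<inter> V}. ennreal (p K) + outer (U - V))"
    unfolding inner_def using outer_fin[of "U - V"] by (intro ennreal_SUP_add_left[symmetric]) auto
  also have "\<dots> \<le> inner U"
  proof (rule SUP_least)
    fix K assume K: "K \<in> {K. compact K \<and> K \<subseteq> U \<inter> V}"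
    then have "open (U - K)" using assms by (auto intro: open_Diff compact_imp_closed)
    then have "outer (U - V) \<le> inner (U - K)"
      unfolding outer_def using K by (intro INF_lower) auto
    then have "ennreal (p K) + outer (U - V) \<le> ennreal (p K) + inner (U - K)" by (rule add_left_mono)
    also have "\<dots> \<le> inner U" using K by (intro inner_disjoint_add) auto
    finally show "ennreal (p K) + outer (U - V) \<le> inner U" .
  qed
  finally show ?thesis .
qed

lemma outer_split:
  assumes "open V"
  shows "outer (V \<inter> A) + outer ((UNIV - V) \<inter> A) = outer A"
proof (rule antisym)
  have "outer A \<le> outer (V \<inter> A \<union> (UNIV - V) \<inter> A)" by (rule outer_mono) auto
  then show "outer A \<le> outer (V \<inter> A) + outer ((UNIV - V) \<inter> A)"
    using outer_Un_le order_trans by blast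
  show "outer (V \<inter> A) + outer ((UNIV - V) \<inter> A) \<le> outer A"
    unfolding outer_def[of A]
  proof (rule INF_greatest)
    fix U assume U: "U \<in> {U. open U \<and> A \<subseteq> U}"
    have "outer (V \<inter> A) + outer ((UNIV - V) \<inter> A) \<le> outer (U \<inter> V) + outer (U - V)"
      using U by (intro add_mono outer_mono) auto
    also have "\<dots> \<le> inner U" using U assms inner_split[of U V] by (simp add: outer_open open_Int)
    finally show "outer (V \<inter> A) + outer ((UNIV - V) \<inter> A) \<le> inner U" .
  qed
qed

definition radon :: "'b measure" where
  "radon = measure_of UNIV (sets borel) outer"

lemma sets_radon [simp]: "sets radon = sets borel" and space_radon [simp]: "space radon = UNIV"
  using sets.sets_measure_of_eq[of "borel :: 'b measure"] by (auto simp: radon_def space_measure_of_conv)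

lemma emeasure_radon:
  assumes "A \<in> sets borel"
  shows "emeasure radon A = outer A"
proof -
  let ?L = "lambda_system UNIV (Pow UNIV) outer"
  have ms: "measure_space UNIV ?L outer"
    by (rule sigma_algebra.caratheodory_lemma[OF sigma_algebra_Pow outer_measure])
  then interpret L: sigma_algebra UNIV ?L by (simp add: measure_space_def)
  have "open V \<Longrightarrow> V \<in> ?L" for V unfolding lambda_system_def by (auto simp: outer_split)
  then have "sets (borel :: 'b measure) \<subseteq> ?L"
  proof -
    have "sigma_sets UNIV {S :: 'b set. open S} \<subseteq> ?L"
      by (rule L.sigma_sets_subset) (use \<open>\<And>V. open V \<Longrightarrow> V \<in> ?L\<close> in blast)
    then show ?thesis by (simp add: borel_def sets_measure_of)
  qed
  then have "countably_additive (sets (borel :: 'b measure)) outer"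
    using ms unfolding measure_space_def countably_additive_def by blast
  moreover have "positive (sets (borel :: 'b measure)) outer" by (simp add: positive_def)
  ultimately show ?thesis
    unfolding radon_def using assms sets.sigma_algebra_axioms[of "borel :: 'b measure"]
    by (intro emeasure_measure_of_sigma) auto
qed

text \<open>The one relation to p that survives, and the one used later: the marginals are
  identified by comparison on open sets, and the superlevel sets of the cost are open.\<close>

lemma emeasure_radon_open: "open U \<Longrightarrow> emeasure radon U \<le> ennreal (p U)"
  by (simp add: emeasure_radon outer_open inner_le)

lemma prob_space_radon: "prob_space radon"
proof (rule prob_spaceI)
  have "1 \<le> inner UNIV"
  proof (rule ennreal_le_epsilon)
    fix e :: real assume "0 < e"
    then obtain K where K: "compact K" "p (- K) \<le> e" using tight by blast
    have "p UNIV = p K + p (- K)" using additive[of K "- K"] by simp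
    then have "1 \<le> p K + e" using K total by simp
    then have "1 \<le> ennreal (p K + e)" by (metis ennreal_1 ennreal_leI)
    also have "\<dots> = ennreal (p K) + ennreal e" using nonneg \<open>0 < e\<close> by (intro ennreal_plus) auto
    also have "\<dots> \<le> inner UNIV + ennreal e" using K by (intro add_right_mono inner_upper) auto
    finally show "1 \<le> inner UNIV + ennreal e" .
  qed
  then show "emeasure radon (space radon) = 1"
    using outer_le_1[of UNIV] by (simp add: emeasure_radon outer_open antisym)
qed

text \<open>Cover the complement of B by an open U with little excess and take K compact with p (-
  K) small; then K - U is a compact subset of B that misses little of it.\<close>

lemma radon_Radon: "radon \<in> Radon_prob"
proof -
  interpret prob_space radon by (rule prob_space_radon)
  have "emeasure radon B = (SUP K\<in>{K. compact K \<and> K \<subseteq> B}. emeasure radon K)" (is "_ = ?S")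
    if B: "B \<in> sets borel" for B
  proof (rule antisym)
    show "?S \<le> emeasure radon B" using B by (intro SUP_least emeasure_mono) auto
    show "emeasure radon B \<le> ?S"
    proof (rule ennreal_le_epsilon)
      fix e :: real assume e: "0 < e"
      then have e2: "0 < e / 2" by simp
      obtain K where K: "compact K" "p (- K) \<le> e / 2" using tight[OF e2] by blast
      obtain U where U: "open U" "- B \<subseteq> U" "inner U < outer (- B) + ennreal (e / 2)"
        using outer_approx[of "ennreal (e / 2)" "- B"] e by auto
      have cK: "compact (K - U)" using K U by (auto intro: compact_diff)
      have sB: "- B \<in> sets borel" using B by (metis borel_comp)
      have sK: "K \<in> sets borel" "K - U \<in> sets borel" using K cK by (auto intro: borel_compact)
      have sU: "U \<in> sets borel" using U by auto
      have "emeasure radon (- K) \<le> ennreal (p (- K))"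
        using K by (intro emeasure_radon_open) (auto intro: compact_imp_closed)
      also have "\<dots> \<le> ennreal (e / 2)" using K(2) by (rule ennreal_leI)
      finally have 1: "measure radon (- K) \<le> e / 2"
        using e by (simp add: emeasure_eq_measure)
      have "emeasure radon U \<le> emeasure radon (- B) + ennreal (e / 2)"
        using U sB sU by (simp add: emeasure_radon outer_open)
      then have 2: "measure radon U \<le> measure radon (- B) + e / 2"
        using e by (simp add: emeasure_eq_measure flip: ennreal_plus)
      have "measure radon U = measure radon (- B) + measure radon (U \<inter> B)"
      proof -
        have "U = - B \<union> U \<inter> B" using U by auto
        then show ?thesis using finite_measure_Union[of "- B" "U \<inter> B"] sB sU B by auto
      qed
      with 2 have 3: "measure radon (U \<inter> B) \<le> e / 2" by simp
      have "measure radon B \<le> measure radon ((K - U) \<union> (- K \<union> U \<inter> B))"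
        using sK sU B by (intro finite_measure_mono) auto
      also have "\<dots> \<le> measure radon (K - U) + (measure radon (- K) + measure radon (U \<inter> B))"
        using sK sU B by (intro order_trans[OF measure_Un_le] add_left_mono measure_Un_le) auto
      also have "\<dots> \<le> measure radon (K - U) + e" using 1 3 by simp
      finally have "ennreal (measure radon B) \<le> ennreal (measure radon (K - U)) + ennreal e"
        using e by (simp add: ennreal_leI flip: ennreal_plus)
      also have "\<dots> \<le> ?S + ennreal e"
        using cK U(2) unfolding emeasure_eq_measure[symmetric] by (intro add_right_mono SUP_upper) auto
      finally show "emeasure radon B \<le> ?S + ennreal e" by (simp add: emeasure_eq_measure)
    qed
  qed
  then show ?thesis by (simp add: Radon_prob_def prob_space_radon)
qed

end

subsection \<open>Kantorovich duality for the quadratic cost\<close>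

text \<open>The set of all such semidistances, rather than one generating family, is closed under
  maxima. Its elements therefore approximate \<open>d\<close> in a directed way.\<close>

definition admissible :: "('a::topological_space \<Rightarrow> 'a \<Rightarrow> ennreal) \<Rightarrow> ('a \<Rightarrow> 'a \<Rightarrow> real) set" where
  "admissible d = {\<delta>. (\<forall>x y. 0 \<le> \<delta> x y) \<and> semidistance (\<lambda>x y. ennreal (\<delta> x y)) \<and>
     (\<exists>C. \<forall>x y. \<delta> x y \<le> C) \<and> continuous_on UNIV (\<lambda>(x, y). \<delta> x y) \<and>
     (\<forall>x y. ennreal (\<delta> x y) \<le> d x y)}"

lemma admissibleD:
  assumes "\<delta> \<in> admissible d"
  shows "0 \<le> \<delta> x y" "\<delta> x x = 0" "\<delta> x y = \<delta> y x" "\<delta> x z \<le> \<delta> x y + \<delta> y z"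
    "ennreal (\<delta> x y) \<le> d x y" "continuous_on UNIV (\<lambda>(x, y). \<delta> x y)"
proof -
  have n: "0 \<le> \<delta> x y" for x y using assms by (auto simp: admissible_def)
  show "0 \<le> \<delta> x y" by (rule n)
  have "ennreal (\<delta> x x) = 0" "ennreal (\<delta> x y) = ennreal (\<delta> y x)"
    "ennreal (\<delta> x z) \<le> ennreal (\<delta> x y) + ennreal (\<delta> y z)"
    using assms by (auto simp: admissible_def semidistance_def)
  then show "\<delta> x x = 0" "\<delta> x y = \<delta> y x" "\<delta> x z \<le> \<delta> x y + \<delta> y z"
    using n by (auto simp: ennreal_eq_0_iff antisym ennreal_inj simp flip: ennreal_plus)
  show "ennreal (\<delta> x y) \<le> d x y" "continuous_on UNIV (\<lambda>(x, y). \<delta> x y)"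
    using assms by (auto simp: admissible_def)
qed

lemma admissible_bound:
  assumes "\<delta> \<in> admissible d"
  obtains M where "0 < M" "\<And>x y. \<delta> x y \<le> M"
proof -
  obtain C where "\<And>x y. \<delta> x y \<le> C" using assms by (auto simp: admissible_def)
  then show thesis by (intro that[of "max 1 C"]) (auto simp: le_max_iff_disj)
qed

lemma semidistance_ennreal:
  assumes "\<And>x y. 0 \<le> m x y" "\<And>x. m x x = 0" "\<And>x y. m x y = m y x" "\<And>x y z. m x z \<le> m x y + m y z"
  shows "semidistance (\<lambda>x y. ennreal (m x y))"
  unfolding semidistance_def
proof (intro conjI allI)
  show "ennreal (m x y) = ennreal (m y x)" for x y using assms(3)[of x y] by simp
  show "ennreal (m x z) \<le> ennreal (m x y) + ennreal (m y z)" for x y z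
    using assms(1,4) by (simp add: ennreal_leI flip: ennreal_plus)
qed (simp add: assms(2))

lemma admissible_zero: "(\<lambda>_ _. 0) \<in> admissible d"
  by (auto simp: admissible_def semidistance_def)

lemma admissible_max:
  assumes "\<delta> \<in> admissible d" "\<delta>' \<in> admissible d"
  shows "(\<lambda>x y. max (\<delta> x y) (\<delta>' x y)) \<in> admissible d"
proof -
  note D = admissibleD[OF assms(1)] and D' = admissibleD[OF assms(2)]
  obtain M M' where M: "\<And>x y. \<delta> x y \<le> M" "\<And>x y. \<delta>' x y \<le> M'"
    using admissible_bound[OF assms(1)] admissible_bound[OF assms(2)] by metis
  have "max (\<delta> x y) (\<delta>' x y) \<le> max M M'" for x y
    using M[of x y] by (auto simp: le_max_iff_disj)
  moreover have "continuous_on UNIV (\<lambda>(x, y). max (\<delta> x y) (\<delta>' x y))"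
    using continuous_on_max[OF D(6) D'(6)] by (simp add: case_prod_unfold)
  moreover have "semidistance (\<lambda>x y. ennreal (max (\<delta> x y) (\<delta>' x y)))"
  proof -
    have "max (\<delta> x z) (\<delta>' x z) \<le> max (\<delta> x y) (\<delta>' x y) + max (\<delta> y z) (\<delta>' y z)" for x y z
      using D(4)[of x z y] D'(4)[of x z y] by (auto simp: max_def)
    moreover have "max (\<delta> x y) (\<delta>' x y) = max (\<delta> y x) (\<delta>' y x)" for x y
      using D(3)[of x y] D'(3)[of x y] by simp
    moreover have "0 \<le> max (\<delta> x y) (\<delta>' x y)" "max (\<delta> x x) (\<delta>' x x) = 0" for x y
      using D(1)[of x y] D(2) D'(2) by auto
    ultimately show ?thesis by (intro semidistance_ennreal)
  qed
  moreover have "ennreal (max (\<delta> x y) (\<delta>' x y)) \<le> d x y" for x y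
    using D(5) D'(5) by (simp add: max_def)
  moreover have "0 \<le> max (\<delta> x y) (\<delta>' x y)" for x y using D(1)[of x y] by simp
  ultimately show ?thesis unfolding admissible_def by blast
qed

lemma admissible_finite_upper:
  assumes "finite F" "F \<subseteq> admissible d"
  obtains \<delta> where "\<delta> \<in> admissible d" "\<And>\<delta>' x y. \<delta>' \<in> F \<Longrightarrow> \<delta>' x y \<le> \<delta> x y"
proof -
  have "\<exists>\<delta>\<in>admissible d. \<forall>\<delta>'\<in>F. \<forall>x y. \<delta>' x y \<le> \<delta> x y"
    using assms
  proof (induction F rule: finite_induct)
    case empty
    then show ?case using admissible_zero by auto
  next
    case (insert \<delta>0 F)
    then obtain \<delta> where "\<delta> \<in> admissible d" "\<forall>\<delta>'\<in>F. \<forall>x y. \<delta>' x y \<le> \<delta> x y" by auto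
    then show ?case using insert.prems
      by (intro bexI[of _ "\<lambda>x y. max (\<delta> x y) (\<delta>0 x y)"] admissible_max) (auto simp: le_max_iff_disj)
  qed
  with that show thesis by blast
qed

lemma SUP_admissible:
  assumes "extended_metric_topological_space d"
  shows "d x y = (SUP \<delta>\<in>admissible d. ennreal (\<delta> x y))"
proof (rule antisym)
  obtain D where D: "\<forall>\<delta>\<in>D. (\<forall>x y. 0 \<le> \<delta> x y) \<and> semidistance (\<lambda>x y. ennreal (\<delta> x y)) \<and>
                (\<exists>C. \<forall>x y. \<delta> x y \<le> C) \<and> continuous_on UNIV (\<lambda>(x, y). \<delta> x y)"
    "\<And>x y. d x y = (SUP \<delta>\<in>D. ennreal (\<delta> x y))"
    using assms unfolding extended_metric_topological_space_def by blast
  have "\<delta> \<in> admissible d" if "\<delta> \<in> D" for \<delta>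
    using D that unfolding admissible_def by (auto intro!: SUP_upper)
  then have "D \<subseteq> admissible d" by auto
  then show "d x y \<le> (SUP \<delta>\<in>admissible d. ennreal (\<delta> x y))"
    by (subst D(2)) (rule SUP_subset_mono, auto)
  show "(SUP \<delta>\<in>admissible d. ennreal (\<delta> x y)) \<le> d x y"
    by (rule SUP_least) (rule admissibleD(5))
qed

section \<open>Functions that are Lipschitz for one semidistance, and their c-transforms\<close>

definition blip :: "('a \<Rightarrow> 'a \<Rightarrow> real) \<Rightarrow> ('a \<Rightarrow> real) set" where
  "blip \<delta> = {f. (\<exists>B. \<forall>x. \<bar>f x\<bar> \<le> B) \<and> (\<exists>L\<ge>0. \<forall>x y. \<bar>f x - f y\<bar> \<le> L * \<delta> x y)}"

lemma blipI:
  assumes "\<And>x. \<bar>f x\<bar> \<le> B" "0 \<le> L" "\<And>x y. \<bar>f x - f y\<bar> \<le> L * \<delta> x y"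
  shows "f \<in> blip \<delta>"
  using assms by (auto simp: blip_def)

lemma blip_scale: "f \<in> blip \<delta> \<Longrightarrow> (\<lambda>x. c * f x) \<in> blip \<delta>"
proof -
  assume "f \<in> blip \<delta>"
  then obtain B L where f: "\<And>x. \<bar>f x\<bar> \<le> B" "L \<ge> 0" "\<And>x y. \<bar>f x - f y\<bar> \<le> L * \<delta> x y"
    by (auto simp: blip_def)
  show ?thesis
  proof (rule blipI[of _ "\<bar>c\<bar> * B" "\<bar>c\<bar> * L"])
    show "\<bar>c * f x\<bar> \<le> \<bar>c\<bar> * B" for x using f(1) by (simp add: abs_mult mult_left_mono)
    show "\<bar>c * f x - c * f y\<bar> \<le> \<bar>c\<bar> * L * \<delta> x y" for x y
      using mult_left_mono[OF f(3)[of x y], of "\<bar>c\<bar>"]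
      by (simp add: abs_mult[symmetric] right_diff_distrib mult.assoc)
  qed (use f in auto)
qed

lemma blip_continuous:
  fixes d :: "'a::t2_space \<Rightarrow> 'a \<Rightarrow> ennreal"
  assumes \<delta>: "\<delta> \<in> admissible d" and f: "f \<in> blip \<delta>"
  shows "continuous_on UNIV f"
proof -
  obtain L where L: "L \<ge> 0" "\<And>x y. \<bar>f x - f y\<bar> \<le> L * \<delta> x y" using f by (auto simp: blip_def)
  have "isCont f x" for x
  proof -
    have c: "continuous_on UNIV (\<lambda>y. \<delta> y x)"
      using continuous_on_compose2[OF admissibleD(6)[OF \<delta>], of UNIV "\<lambda>y. (y, x)"]
      by (simp add: continuous_on_Pair)
    then have "isCont (\<lambda>y. \<delta> y x) x" by (simp add: continuous_on_eq_continuous_at)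
    then have "(\<lambda>y. \<delta> y x) \<midarrow>x\<rightarrow> 0"
      unfolding isCont_def using admissibleD(2)[OF \<delta>, of x] by simp
    then have "(\<lambda>y. L * \<delta> y x) \<midarrow>x\<rightarrow> 0" by (rule tendsto_mult_right_zero)
    then have "(\<lambda>y. f y - f x) \<midarrow>x\<rightarrow> 0"
      by (rule Lim_null_comparison[rotated]) (auto intro!: always_eventually L(2))
    then show ?thesis by (simp add: isCont_def LIM_zero_iff)
  qed
  then show ?thesis by (simp add: continuous_on_eq_continuous_at)
qed

lemma blip_Lip_b:
  fixes d :: "'a::t2_space \<Rightarrow> 'a \<Rightarrow> ennreal"
  assumes \<delta>: "\<delta> \<in> admissible d" and f: "f \<in> blip \<delta>"
  shows "f \<in> Lip_b d"
proof -
  obtain B L where L: "\<And>x. \<bar>f x\<bar> \<le> B" "L \<ge> 0" "\<And>x y. \<bar>f x - f y\<bar> \<le> L * \<delta> x y"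
    using f by (auto simp: blip_def)
  have "ennreal \<bar>f x - f y\<bar> \<le> ennreal L * d x y" for x y
  proof -
    have "ennreal \<bar>f x - f y\<bar> \<le> ennreal (L * \<delta> x y)" using L(3) by (rule ennreal_leI)
    also have "\<dots> = ennreal L * ennreal (\<delta> x y)" using L(2) admissibleD(1)[OF \<delta>] by (rule ennreal_mult)
    also have "\<dots> \<le> ennreal L * d x y" using admissibleD(5)[OF \<delta>] by (rule mult_left_mono) auto
    finally show ?thesis .
  qed
  moreover have "bounded (range f)" using L(1) by (auto simp: bounded_iff)
  ultimately show ?thesis using blip_continuous[OF \<delta> f] L(2) by (auto simp: Lip_b_def)
qed

lemma continuous_real_borel:
  "continuous_on UNIV (f :: 'a::topological_space \<Rightarrow> real) \<Longrightarrow> f \<in> borel_measurable borel"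
  by (rule borel_measurable_continuous_onI)

lemma blip_integrable:
  fixes d :: "'a::t2_space \<Rightarrow> 'a \<Rightarrow> ennreal"
  assumes \<delta>: "\<delta> \<in> admissible d" and f: "f \<in> blip \<delta>" and M: "M \<in> Radon_prob"
  shows "integrable M f"
proof -
  interpret prob_space M using M by (simp add: Radon_prob_def)
  obtain B where B: "\<And>x. \<bar>f x\<bar> \<le> B" using f by (auto simp: blip_def)
  have "f \<in> borel_measurable M"
    using continuous_real_borel[OF blip_continuous[OF \<delta> f]] M
    by (simp add: Radon_prob_def cong: measurable_cong_sets)
  then show ?thesis by (rule integrable_const_bound[of _ B, rotated]) (use B in auto)
qed

text \<open>
  For \<open>s = 1 / (2 t)\<close> this is the Hopf-Lax semigroup at time \<open>t\<close> applied to \<open>- g\<close>.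
\<close>

definition ctrans :: "('a \<Rightarrow> 'a \<Rightarrow> real) \<Rightarrow> real \<Rightarrow> ('a \<Rightarrow> real) \<Rightarrow> 'a \<Rightarrow> real" where
  "ctrans \<delta> s g y = (INF x. s * (\<delta> x y)\<^sup>2 - g x)"

text \<open>The transform is the largest partner of g in the inequality with cost
  \<open>s * (\<delta> x y)\<^sup>2\<close>. It inherits a Lipschitz constant from the cost: a
  difference of two squares is a difference, at most \<delta> y z, times a sum, at most 2 M.\<close>

lemma ctrans:
  assumes \<delta>: "\<delta> \<in> admissible d" and s: "0 \<le> s" and g: "\<And>x. \<bar>g x\<bar> \<le> B"
  shows ctrans_le: "g x + ctrans \<delta> s g y \<le> s * (\<delta> x y)\<^sup>2"
    and ctrans_ge: "(\<And>x. g x + c \<le> s * (\<delta> x y)\<^sup>2) \<Longrightarrow> c \<le> ctrans \<delta> s g y"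
    and ctrans_blip: "ctrans \<delta> s g \<in> blip \<delta>"
proof -
  note D = admissibleD[OF \<delta>]
  obtain M where M: "0 < M" "\<And>x y. \<delta> x y \<le> M" using admissible_bound[OF \<delta>] by metis
  have lb: "- B \<le> s * (\<delta> x y)\<^sup>2 - g x" for x y
  proof -
    have "0 \<le> s * (\<delta> x y)\<^sup>2" using s by simp
    then show ?thesis using g[of x] by linarith
  qed
  have bdd: "bdd_below (range (\<lambda>x. s * (\<delta> x y)\<^sup>2 - g x))" for y
    using lb by (intro bdd_belowI[of _ "-B"]) auto
  have le: "g x + ctrans \<delta> s g y \<le> s * (\<delta> x y)\<^sup>2" for x y
    using cINF_lower[OF bdd, of x y] by (simp add: ctrans_def)
  show "g x + ctrans \<delta> s g y \<le> s * (\<delta> x y)\<^sup>2" by (rule le)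
  have ge: "c \<le> ctrans \<delta> s g y" if "\<And>x. g x + c \<le> s * (\<delta> x y)\<^sup>2" for c y
    unfolding ctrans_def using that by (intro cINF_greatest) (auto simp: algebra_simps)
  then show "(\<And>x. g x + c \<le> s * (\<delta> x y)\<^sup>2) \<Longrightarrow> c \<le> ctrans \<delta> s g y" by blast
  have 1: "\<bar>ctrans \<delta> s g y\<bar> \<le> B + s * M\<^sup>2" for y
  proof -
    have "- B \<le> ctrans \<delta> s g y" using lb[of _ y] by (intro ge) (simp add: algebra_simps)
    moreover have "ctrans \<delta> s g y \<le> - g y" using le[of y y] D(2)[of y] by simp
    moreover have "0 \<le> s * M\<^sup>2" using s by simp
    ultimately show ?thesis using g[of y] by linarith
  qed
  have 2: "ctrans \<delta> s g y - ctrans \<delta> s g z \<le> 2 * s * M * \<delta> y z" for y z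
  proof -
    have "ctrans \<delta> s g y - 2 * s * M * \<delta> y z \<le> ctrans \<delta> s g z"
    proof (rule ge)
      fix x
      have "(\<delta> x y)\<^sup>2 - (\<delta> x z)\<^sup>2 = (\<delta> x y - \<delta> x z) * (\<delta> x y + \<delta> x z)"
        by (simp add: power2_eq_square algebra_simps)
      also have "\<dots> \<le> \<delta> y z * (\<delta> x y + \<delta> x z)"
        using D(4)[of x y z] D(3)[of y z] D(1) by (intro mult_right_mono) (auto intro: add_nonneg_nonneg)
      also have "\<dots> \<le> \<delta> y z * (2 * M)"
        using M(2)[of x y] M(2)[of x z] D(1) by (intro mult_left_mono) auto
      finally have "s * ((\<delta> x y)\<^sup>2 - (\<delta> x z)\<^sup>2) \<le> s * (\<delta> y z * (2 * M))" using s by (rule mult_left_mono)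
      then show "g x + (ctrans \<delta> s g y - 2 * s * M * \<delta> y z) \<le> s * (\<delta> x z)\<^sup>2"
        using le[of x y] by (simp add: algebra_simps)
    qed
    then show ?thesis by simp
  qed
  show "ctrans \<delta> s g \<in> blip \<delta>"
  proof (rule blipI[OF 1])
    show "0 \<le> 2 * s * M" using s M by simp
    show "\<bar>ctrans \<delta> s g x - ctrans \<delta> s g y\<bar> \<le> 2 * s * M * \<delta> x y" for x y
      using 2[of x y] 2[of y x] D(3)[of x y] by (simp add: abs_le_iff)
  qed
qed

section \<open>Couplings for finitely many marginal constraints\<close>

lemma fiber_sum_integral:
  assumes \<mu>: "prob_space \<mu>" "sets \<mu> = sets borel" and K: "finite (range \<tau>)"
    and m: "\<And>k. \<tau> -` {k} \<in> sets borel"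
  shows "(\<Sum>k\<in>range \<tau>. f k * measure \<mu> (\<tau> -` {k})) = (\<integral>x. (f (\<tau> x) :: real) \<partial>\<mu>)"
    and "integrable \<mu> (\<lambda>x. f (\<tau> x) :: real)"
proof -
  interpret prob_space \<mu> by fact
  have eq: "f (\<tau> x) = (\<Sum>k\<in>range \<tau>. f k * indicator (\<tau> -` {k}) x)" for x
    using K by (subst sum.remove[of _ "\<tau> x"]) (auto intro!: sum.neutral simp: indicator_def)
  have i: "integrable \<mu> (\<lambda>x. f k * indicator (\<tau> -` {k}) x)" for k
    using m[of k] \<mu>(2) by (intro integrable_mult_right) (auto simp: emeasure_eq_measure integrable_indicator_iff)
  show "integrable \<mu> (\<lambda>x. f (\<tau> x))" unfolding eq using i by simp
  have sp: "\<tau> -` {k} \<inter> space \<mu> = \<tau> -` {k}" for k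
    using sets_eq_imp_space_eq[OF \<mu>(2)] by simp
  show "(\<Sum>k\<in>range \<tau>. f k * measure \<mu> (\<tau> -` {k})) = (\<integral>x. f (\<tau> x) \<partial>\<mu>)"
    unfolding eq using i by (simp add: Bochner_Integration.integral_sum sp)
qed

text \<open>Lower Riemann sums with mesh h of the layer-cake formula. Together with the next lemma
  they determine a up to h and up to truncation at N h. The induction proves the bound by N h as
  well, which is what it needs when another layer is counted.\<close>

lemma layer_sum_le:
  fixes a h :: real
  assumes "0 < h" "0 \<le> a"
  shows "(\<Sum>i = 1..N. h * of_bool (real i * h < a)) \<le> a"
proof -
  define q where "q = (\<lambda>i. h * of_bool (real i * h < a))"
  have q: "q i = h * of_bool (real i * h < a)" for i by (simp add: q_def)
  have "sum q {1..N} \<le> min a (real N * h)"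
  proof (induction N)
    case (Suc N)
    then show ?case using assms by (auto simp: q[of "Suc N"] min_def algebra_simps split: if_splits)
  qed (use assms in simp)
  then show ?thesis unfolding q_def by (rule order_trans) simp
qed

lemma layer_sum_ge:
  fixes a h :: real
  assumes "0 < h"
  shows "min a (real N * h) \<le> h + (\<Sum>i = 1..N. h * of_bool (real i * h < a))"
proof -
  define q where "q = (\<lambda>i. h * of_bool (real i * h < a))"
  have q: "q i = h * of_bool (real i * h < a)" for i by (simp add: q_def)
  have "min a (real N * h + h) \<le> h + sum q {1..N}"
  proof (induction N)
    case (Suc N)
    then show ?case using assms by (auto simp: q[of "Suc N"] min_def algebra_simps split: if_splits)
  qed (use assms in simp)
  moreover have "min a (real N * h) \<le> min a (real N * h + h)" using assms by simp
  ultimately show ?thesis unfolding q_def by (rule order_trans[rotated])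
qed

text \<open>The finite family cuts the space into cells, the cost between two cells is the infimum
  over representatives, and the finite duality applies. Its dual hypothesis is inherited from
  \<open>dual\<close> after functions of cells are replaced by Lipschitz functions. The resulting
  matrix is realised by point masses at nearly optimal pairs.\<close>

lemma discrete_coupling:
  fixes d :: "'a::t2_space \<Rightarrow> 'a \<Rightarrow> ennreal"
  assumes \<mu>: "\<mu> \<in> Radon_prob" and \<nu>: "\<nu> \<in> Radon_prob" and \<delta>: "\<delta> \<in> admissible d"
    and dual: "\<And>\<phi> \<psi>. \<phi> \<in> blip \<delta> \<Longrightarrow> \<psi> \<in> blip \<delta> \<Longrightarrow> (\<And>x y. \<phi> x + \<psi> y \<le> (\<delta> x y)\<^sup>2) \<Longrightarrow>
      (\<integral>x. \<phi> x \<partial>\<mu>) + (\<integral>x. \<psi> x \<partial>\<nu>) \<le> C"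
    and \<A>: "finite \<A>" "\<A> \<subseteq> sets borel" and e: "0 < e"
  obtains p :: "('a \<times> 'a) set \<Rightarrow> real" where
    "\<And>S. 0 \<le> p S" "\<And>S S'. S \<inter> S' = {} \<Longrightarrow> p (S \<union> S') = p S + p S'" "p UNIV = 1"
    "\<And>A. A \<in> \<A> \<Longrightarrow> p (A \<times> UNIV) = measure \<mu> A" "\<And>A. A \<in> \<A> \<Longrightarrow> p (UNIV \<times> A) = measure \<nu> A"
    "\<And>h N. 0 < h \<Longrightarrow> (\<Sum>i = 1..N. h * p {(x, y). real i * h < (\<delta> x y)\<^sup>2}) \<le> C + e"
proof -
  \<comment> \<open>The fibres of \<tau> are the atoms of the finite algebra generated by the
    family.\<close>
  define \<tau> where "\<tau> x = {A \<in> \<A>. x \<in> A}" for x :: 'a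
  have \<tau>A: "A \<in> \<tau> x \<longleftrightarrow> x \<in> A" if "A \<in> \<A>" for A x using that by (simp add: \<tau>_def)
  define K where "K = range \<tau>"
  have K: "finite K" using \<A>(1) by (auto simp: K_def \<tau>_def intro: finite_subset[of _ "Pow \<A>"])
  have \<tau>m: "\<tau> -` {k} \<in> sets borel" for k
  proof (cases "k \<subseteq> \<A>")
    case True
    have "\<tau> x = k \<longleftrightarrow> (\<forall>A\<in>\<A>. x \<in> (if A \<in> k then A else - A))" for x
    proof -
      have "\<tau> x = k \<longleftrightarrow> (\<forall>A\<in>\<A>. A \<in> k \<longleftrightarrow> x \<in> A)"
        using True unfolding \<tau>_def by blast
      then show ?thesis by auto
    qed
    then have "\<tau> -` {k} = (\<Inter>A\<in>\<A>. if A \<in> k then A else - A)"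
      by (intro set_eqI) (simp only: vimage_singleton_eq INT_iff)
    also have "\<dots> \<in> sets borel"
    proof (cases "\<A> = {}")
      case False
      then show ?thesis using \<A> by (intro sets.finite_INT) auto
    qed simp
    finally show ?thesis .
  next
    case False
    then have "\<tau> -` {k} = {}" by (auto simp: \<tau>_def)
    then show ?thesis by simp
  qed
  have pm: "prob_space \<mu>" "sets \<mu> = sets borel" and pn: "prob_space \<nu>" "sets \<nu> = sets borel"
    using \<mu> \<nu> by (auto simp: Radon_prob_def)
  note sm = fiber_sum_integral[OF pm K[unfolded K_def] \<tau>m, folded K_def]
  note sn = fiber_sum_integral[OF pn K[unfolded K_def] \<tau>m, folded K_def]
  interpret \<mu>: prob_space \<mu> by fact
  interpret \<nu>: prob_space \<nu> by fact
  note D = admissibleD[OF \<delta>]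
  define c where "c k l = (INF (x, y)\<in>{(x, y). \<tau> x = k \<and> \<tau> y = l}. (\<delta> x y)\<^sup>2)" for k l
  have bdd: "bdd_below ((\<lambda>(x, y). (\<delta> x y)\<^sup>2) ` {(x, y). \<tau> x = k \<and> \<tau> y = l})" for k l
    by (intro bdd_belowI[of _ 0]) auto
  have ne: "{(x, y). \<tau> x = k \<and> \<tau> y = l} \<noteq> {}" if "k \<in> K" "l \<in> K" for k l
    using that by (auto simp: K_def)
  have cle: "c (\<tau> x) (\<tau> y) \<le> (\<delta> x y)\<^sup>2" for x y
    unfolding c_def by (rule cINF_lower2[OF bdd, of "(x, y)"]) auto
  have c0: "0 \<le> c k l" if "k \<in> K" "l \<in> K" for k l
    unfolding c_def by (rule cINF_greatest[OF ne[OF that]]) auto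
  obtain P where P: "\<And>k l. k \<in> K \<Longrightarrow> l \<in> K \<Longrightarrow> 0 \<le> P k l"
    "\<And>k. k \<in> K \<Longrightarrow> (\<Sum>l\<in>K. P k l) = measure \<mu> (\<tau> -` {k})"
    "\<And>l. l \<in> K \<Longrightarrow> (\<Sum>k\<in>K. P k l) = measure \<nu> (\<tau> -` {l})"
    "(\<Sum>k\<in>K. \<Sum>l\<in>K. P k l * c k l) \<le> C"
  proof (rule finite_transport_duality[of K "\<lambda>k. measure \<mu> (\<tau> -` {k})" "\<lambda>k. measure \<nu> (\<tau> -` {k})" c C])
    show "(\<Sum>k\<in>K. measure \<mu> (\<tau> -` {k})) = 1" using sm(1)[of "\<lambda>_. 1"] by (simp add: \<mu>.prob_space)
    show "(\<Sum>k\<in>K. measure \<nu> (\<tau> -` {k})) = 1" using sn(1)[of "\<lambda>_. 1"] by (simp add: \<nu>.prob_space)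
    fix \<phi> \<psi> assume le: "\<And>k l. k \<in> K \<Longrightarrow> l \<in> K \<Longrightarrow> \<phi> k + \<psi> l \<le> c k l"
    obtain B where B: "\<And>k. k \<in> K \<Longrightarrow> \<bar>\<phi> k\<bar> \<le> B"
      using bdd_above_finite[of "(\<lambda>k. \<bar>\<phi> k\<bar>) ` K"] K unfolding bdd_above_def by auto
    \<comment> \<open>A function of the cell is bounded but not continuous. Two c-transforms replace
      (\<phi>, \<psi>) by a pair in \<open>blip \<delta>\<close> that is pointwise larger and still
      satisfies the cost constraint, so the bound C applies to it.\<close>
    define \<psi>1 where "\<psi>1 = ctrans \<delta> 1 (\<lambda>x. \<phi> (\<tau> x))"
    have B': "\<bar>\<phi> (\<tau> x)\<bar> \<le> B" for x using B[of "\<tau> x"] by (auto simp: K_def)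
    note t1 = ctrans[where g = "\<lambda>x. \<phi> (\<tau> x)", OF \<delta> zero_le_one B', folded \<psi>1_def]
    obtain B1 where B1: "\<And>x. \<bar>\<psi>1 x\<bar> \<le> B1" using t1(3) by (auto simp: blip_def)
    define \<phi>1 where "\<phi>1 = ctrans \<delta> 1 \<psi>1"
    note t2 = ctrans[where g = \<psi>1, OF \<delta> zero_le_one B1, folded \<phi>1_def]
    have \<psi>1: "\<psi> (\<tau> y) \<le> \<psi>1 y" for y
    proof (rule t1(2))
      show "\<phi> (\<tau> x) + \<psi> (\<tau> y) \<le> 1 * (\<delta> x y)\<^sup>2" for x
        using le[of "\<tau> x" "\<tau> y"] cle[of x y] by (auto simp: K_def)
    qed
    have \<phi>1: "\<phi> (\<tau> x) \<le> \<phi>1 x" for x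
    proof (rule t2(2))
      show "\<psi>1 y + \<phi> (\<tau> x) \<le> 1 * (\<delta> y x)\<^sup>2" for y
        using t1(1)[of x y] D(3)[of x y] by simp
    qed
    have "(\<Sum>k\<in>K. \<phi> k * measure \<mu> (\<tau> -` {k})) + (\<Sum>l\<in>K. \<psi> l * measure \<nu> (\<tau> -` {l}))
        = (\<integral>x. \<phi> (\<tau> x) \<partial>\<mu>) + (\<integral>x. \<psi> (\<tau> x) \<partial>\<nu>)"
      using sm(1)[of \<phi>] sn(1)[of \<psi>] by simp
    also have "\<dots> \<le> (\<integral>x. \<phi>1 x \<partial>\<mu>) + (\<integral>x. \<psi>1 x \<partial>\<nu>)"
      using \<phi>1 \<psi>1 by (intro add_mono integral_mono sm(2) sn(2) blip_integrable[OF \<delta>] t1(3) t2(3) \<mu> \<nu>)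
    also have "\<dots> \<le> C"
    proof (rule dual[OF t2(3) t1(3)])
      show "\<phi>1 x + \<psi>1 y \<le> (\<delta> x y)\<^sup>2" for x y
        using t2(1)[of y x] D(3)[of x y] by simp
    qed
    finally show "(\<Sum>k\<in>K. \<phi> k * measure \<mu> (\<tau> -` {k})) + (\<Sum>l\<in>K. \<psi> l * measure \<nu> (\<tau> -` {l})) \<le> C" .
  qed (use K c0 in auto)
  have "\<exists>x y. \<tau> x = k \<and> \<tau> y = l \<and> (\<delta> x y)\<^sup>2 < c k l + e" if "k \<in> K" "l \<in> K" for k l
  proof -
    have "\<exists>z\<in>{(x, y). \<tau> x = k \<and> \<tau> y = l}. (\<lambda>(x, y). (\<delta> x y)\<^sup>2) z < c k l + e"
      using e by (subst cINF_less_iff[OF ne[OF that] bdd, symmetric]) (simp add: c_def)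
    then show ?thesis by auto
  qed
  then obtain X Y where XY: "\<And>k l. k \<in> K \<Longrightarrow> l \<in> K \<Longrightarrow> \<tau> (X k l) = k"
     "\<And>k l. k \<in> K \<Longrightarrow> l \<in> K \<Longrightarrow> \<tau> (Y k l) = l"
     "\<And>k l. k \<in> K \<Longrightarrow> l \<in> K \<Longrightarrow> (\<delta> (X k l) (Y k l))\<^sup>2 < c k l + e"
    by metis
  \<comment> \<open>A finite sum of point masses has a value on every subset of the product, as the
    compactness argument over all set functions requires.\<close>
  define p where "p S = (\<Sum>k\<in>K. \<Sum>l\<in>K. P k l * of_bool ((X k l, Y k l) \<in> S))" for S
  have tot: "(\<Sum>k\<in>K. \<Sum>l\<in>K. P k l) = 1"
    using P(2) sm(1)[of "\<lambda>_. 1"] by (simp add: \<mu>.prob_space)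
  show thesis
  proof (rule that[of p])
    show "0 \<le> p S" for S unfolding p_def using P(1) by (intro sum_nonneg) auto
    show "p (S \<union> S') = p S + p S'" if "S \<inter> S' = {}" for S S'
      unfolding p_def sum.distrib[symmetric] using that by (intro sum.cong refl) auto
    show "p UNIV = 1" using tot by (simp add: p_def)
    show "p (A \<times> UNIV) = measure \<mu> A" if A: "A \<in> \<A>" for A
    proof -
      have "p (A \<times> UNIV) = (\<Sum>k\<in>K. \<Sum>l\<in>K. of_bool (A \<in> k) * P k l)"
        unfolding p_def using \<tau>A[OF A] XY(1) by (intro sum.cong refl) (auto simp: \<tau>_def)
      also have "\<dots> = (\<Sum>k\<in>K. of_bool (A \<in> k) * measure \<mu> (\<tau> -` {k}))"
        using P(2) by (simp add: sum_distrib_left[symmetric])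
      also have "\<dots> = (\<integral>x. of_bool (A \<in> \<tau> x) \<partial>\<mu>)" by (rule sm(1))
      also have "\<dots> = (\<integral>x. indicator A x \<partial>\<mu>)"
        using \<tau>A[OF A] by (intro Bochner_Integration.integral_cong) (auto simp: indicator_def)
      also have "\<dots> = measure \<mu> A" using A \<A>(2) pm(2) sets_eq_imp_space_eq[OF pm(2)] by auto
      finally show ?thesis .
    qed
    show "p (UNIV \<times> A) = measure \<nu> A" if A: "A \<in> \<A>" for A
    proof -
      have "p (UNIV \<times> A) = (\<Sum>k\<in>K. \<Sum>l\<in>K. of_bool (A \<in> l) * P k l)"
        unfolding p_def using \<tau>A[OF A] XY(2) by (intro sum.cong refl) (auto simp: \<tau>_def)
      also have "\<dots> = (\<Sum>l\<in>K. \<Sum>k\<in>K. of_bool (A \<in> l) * P k l)" by (rule sum.swap)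
      also have "\<dots> = (\<Sum>k\<in>K. of_bool (A \<in> k) * measure \<nu> (\<tau> -` {k}))"
        using P(3) by (simp add: sum_distrib_left[symmetric])
      also have "\<dots> = (\<integral>x. of_bool (A \<in> \<tau> x) \<partial>\<nu>)" by (rule sn(1))
      also have "\<dots> = (\<integral>x. indicator A x \<partial>\<nu>)"
        using \<tau>A[OF A] by (intro Bochner_Integration.integral_cong) (auto simp: indicator_def)
      also have "\<dots> = measure \<nu> A" using A \<A>(2) pn(2) sets_eq_imp_space_eq[OF pn(2)] by auto
      finally show ?thesis .
    qed
    fix h :: real and N :: nat assume h: "0 < h"
    let ?a = "\<lambda>k l. (\<delta> (X k l) (Y k l))\<^sup>2"
    have "(\<Sum>i = 1..N. h * p {(x, y). real i * h < (\<delta> x y)\<^sup>2})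
        = (\<Sum>i = 1..N. \<Sum>k\<in>K. \<Sum>l\<in>K. P k l * (h * of_bool (real i * h < ?a k l)))"
      by (simp add: p_def sum_distrib_left algebra_simps)
    also have "\<dots> = (\<Sum>k\<in>K. \<Sum>i = 1..N. \<Sum>l\<in>K. P k l * (h * of_bool (real i * h < ?a k l)))"
      by (rule sum.swap)
    also have "\<dots> = (\<Sum>k\<in>K. \<Sum>l\<in>K. \<Sum>i = 1..N. P k l * (h * of_bool (real i * h < ?a k l)))"
      by (intro sum.cong refl sum.swap)
    also have "\<dots> = (\<Sum>k\<in>K. \<Sum>l\<in>K. P k l * (\<Sum>i = 1..N. h * of_bool (real i * h < ?a k l)))"
      by (simp only: sum_distrib_left)
    also have "\<dots> \<le> (\<Sum>k\<in>K. \<Sum>l\<in>K. P k l * (c k l + e))"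
      using P(1) XY(3) by (intro sum_mono mult_left_mono order_trans[OF layer_sum_le[OF h] less_imp_le]) auto
    also have "\<dots> = (\<Sum>k\<in>K. \<Sum>l\<in>K. P k l * c k l) + e * (\<Sum>k\<in>K. \<Sum>l\<in>K. P k l)"
      by (simp add: distrib_left sum.distrib sum_distrib_left mult.commute)
    also have "\<dots> \<le> C + e" using P(4) tot by simp
    finally show "(\<Sum>i = 1..N. h * p {(x, y). real i * h < (\<delta> x y)\<^sup>2}) \<le> C + e" .
  qed
qed

section \<open>Regularity of Radon probabilities\<close>

lemma Radon_compact_approx:
  fixes \<mu> :: "'a::t2_space measure"
  assumes \<mu>: "\<mu> \<in> Radon_prob" and B: "B \<in> sets borel" and e: "0 < e"
  obtains K where "compact K" "K \<subseteq> B" "measure \<mu> B \<le> measure \<mu> K + e"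
proof -
  interpret prob_space \<mu> using \<mu> by (simp add: Radon_prob_def)
  have "emeasure \<mu> B = (SUP K\<in>{K. compact K \<and> K \<subseteq> B}. emeasure \<mu> K)"
    using \<mu> B by (auto simp: Radon_prob_def)
  moreover have "emeasure \<mu> B < emeasure \<mu> B + ennreal e"
    using e ennreal_add_left_cancel_less[of "emeasure \<mu> B" 0 "ennreal e"] by simp
  moreover have ne: "{K. compact K \<and> K \<subseteq> B} \<noteq> {}" by (auto intro!: exI[of _ "{}"])
  ultimately have "(SUP K\<in>{K. compact K \<and> K \<subseteq> B}. emeasure \<mu> K + ennreal e) > emeasure \<mu> B"
    by (simp add: ennreal_SUP_add_left)
  then obtain K where K: "compact K" "K \<subseteq> B" "emeasure \<mu> B < emeasure \<mu> K + ennreal e"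
    unfolding less_SUP_iff by auto
  then have "measure \<mu> B < measure \<mu> K + e"
    using e by (simp add: emeasure_eq_measure ennreal_less_iff flip: ennreal_plus)
  with K that show thesis by auto
qed

lemma Radon_outer_regular:
  fixes \<mu> :: "'a::t2_space measure"
  assumes \<mu>: "\<mu> \<in> Radon_prob" and B: "B \<in> sets borel" and e: "0 < e"
  obtains U where "open U" "B \<subseteq> U" "measure \<mu> U \<le> measure \<mu> B + e"
proof -
  interpret prob_space \<mu> using \<mu> by (simp add: Radon_prob_def)
  have s: "sets \<mu> = sets borel" and sp: "space \<mu> = UNIV"
    using \<mu> sets_eq_imp_space_eq[of \<mu> borel] by (auto simp: Radon_prob_def)
  have "- B \<in> sets borel" using B by (metis borel_comp)
  then obtain K where K: "compact K" "K \<subseteq> - B" "measure \<mu> (- B) \<le> measure \<mu> K + e"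
    by (rule Radon_compact_approx[OF \<mu> _ e]) (rule that)
  have "measure \<mu> (- B) = 1 - measure \<mu> B" "measure \<mu> (- K) = 1 - measure \<mu> K"
    using prob_compl[of B] prob_compl[of K] B borel_compact[OF K(1)] by (auto simp: s sp Compl_eq_Diff_UNIV)
  then show thesis
    using K by (intro that[of "- K"]) (auto intro: compact_imp_closed)
qed

lemma Radon_sigma_compact:
  fixes \<mu> :: "'a::t2_space measure"
  assumes \<mu>: "\<mu> \<in> Radon_prob" and B: "B \<in> sets borel"
  obtains K where "\<And>n::nat. compact (K n)" "incseq K" "\<And>n. K n \<subseteq> B" "AE x in \<mu>. x \<in> B \<longrightarrow> x \<in> (\<Union>n. K n)"
proof -
  interpret prob_space \<mu> using \<mu> by (simp add: Radon_prob_def)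
  have s: "sets \<mu> = sets borel" using \<mu> by (simp add: Radon_prob_def)
  have "\<exists>K. compact K \<and> K \<subseteq> B \<and> measure \<mu> B \<le> measure \<mu> K + 1 / real (Suc n)" for n
    by (rule Radon_compact_approx[OF \<mu> B, of "1 / real (Suc n)"]) auto
  then obtain K where K: "\<And>n. compact (K n)" "\<And>n. K n \<subseteq> B" "\<And>n. measure \<mu> B \<le> measure \<mu> (K n) + 1 / real (Suc n)"
    by metis
  have Ks: "K n \<in> sets borel" for n by (rule borel_compact[OF K(1)])
  let ?N = "B - (\<Union>n. \<Union>i\<le>n. K i)"
  have N: "?N \<in> sets \<mu>" using B Ks s by auto
  have "measure \<mu> ?N \<le> 1 / real (Suc n)" for n
  proof -
    have "measure \<mu> ?N \<le> measure \<mu> (B - K n)" using B Ks s by (intro finite_measure_mono) auto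
    also have "\<dots> = measure \<mu> B - measure \<mu> (K n)" using B Ks K(2) s by (intro finite_measure_Diff) auto
    finally show ?thesis using K(3)[of n] by simp
  qed
  then have "measure \<mu> ?N \<le> 0"
    by (intro LIMSEQ_le_const[OF LIMSEQ_inverse_real_of_nat]) (auto simp: inverse_eq_divide)
  then have "?N \<in> null_sets \<mu>" using N by (intro null_setsI) (auto simp: emeasure_eq_measure measure_le_0_iff)
  then have "AE x in \<mu>. x \<in> B \<longrightarrow> x \<in> (\<Union>n. \<Union>i\<le>n. K i)" using AE_not_in by fastforce
  moreover have "incseq (\<lambda>n. \<Union>i\<le>n. K i)" unfolding incseq_def by fastforce
  ultimately show thesis using K(1,2) by (intro that[of "\<lambda>n. \<Union>i\<le>n. K i"]) (auto intro!: compact_UN)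
qed

text \<open>Outer regularity of \<mu> carries the inequality from open to Borel sets; on complements
  it reverses, since both measures have mass 1.\<close>

lemma Radon_eqI_open_le:
  fixes \<mu> \<kappa> :: "'a::t2_space measure"
  assumes \<mu>: "\<mu> \<in> Radon_prob" and l: "prob_space \<kappa>" "sets \<kappa> = sets borel"
    and le: "\<And>U. open U \<Longrightarrow> measure \<kappa> U \<le> measure \<mu> U"
  shows "\<kappa> = \<mu>"
proof -
  interpret \<mu>: prob_space \<mu> using \<mu> by (simp add: Radon_prob_def)
  interpret l: prob_space \<kappa> by fact
  have s: "sets \<mu> = sets borel" and sp: "space \<mu> = UNIV" "space \<kappa> = UNIV"
    using \<mu> sets_eq_imp_space_eq[of \<mu> borel] sets_eq_imp_space_eq[OF l(2)] by (auto simp: Radon_prob_def)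
  have *: "measure \<kappa> B \<le> measure \<mu> B" if B: "B \<in> sets borel" for B
  proof (rule field_le_epsilon)
    fix e :: real assume "0 < e"
    then obtain U where U: "open U" "B \<subseteq> U" "measure \<mu> U \<le> measure \<mu> B + e"
      using Radon_outer_regular[OF \<mu> B] by blast
    have "measure \<kappa> B \<le> measure \<kappa> U" using U B l(2) by (intro l.finite_measure_mono) auto
    with le[OF U(1)] U(3) show "measure \<kappa> B \<le> measure \<mu> B + e" by simp
  qed
  show ?thesis
  proof (rule measure_eqI)
    show "sets \<kappa> = sets \<mu>" using l(2) s by simp
    fix B assume "B \<in> sets \<kappa>"
    then have B: "B \<in> sets borel" "- B \<in> sets borel" using l(2) borel_comp[of B] by auto
    have "measure \<kappa> (- B) = 1 - measure \<kappa> B" "measure \<mu> (- B) = 1 - measure \<mu> B"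
      using \<mu>.prob_compl[of B] l.prob_compl[of B] B by (auto simp: s sp l(2) Compl_eq_Diff_UNIV)
    then have "measure \<kappa> B = measure \<mu> B" using *[OF B(1)] *[OF B(2)] by simp
    then show "emeasure \<kappa> B = emeasure \<mu> B" by (simp add: l.emeasure_eq_measure \<mu>.emeasure_eq_measure)
  qed
qed

section \<open>Passage from finite couplings to a Radon coupling\<close>

lemma superlevel_mono:
  assumes "\<delta>' \<in> admissible d" "\<And>x y. \<delta>' x y \<le> \<delta> x y"
  shows "{(x, y). t < (\<delta>' x y)\<^sup>2} \<subseteq> {(x, y). t < (\<delta> x y)\<^sup>2}"
  using power_mono[OF assms(2) admissibleD(1)[OF assms(1)]] by (auto intro: less_le_trans)

text \<open>
  The constraints on \<open>p\<close> are closed in the compact space of \<open>[0, 1]\<close>-valued set functions, and finitely many of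
  them are met by a discrete coupling. The cost \<open>\<integral>\<delta>\<^sup>2 dp\<close>, not available for a finitely additive \<open>p\<close>, is
  replaced by its layer-cake sums.
\<close>

lemma coupling_charge:
  fixes d :: "'a::t2_space \<Rightarrow> 'a \<Rightarrow> ennreal"
  assumes \<mu>: "\<mu> \<in> Radon_prob" and \<nu>: "\<nu> \<in> Radon_prob"
    and dual: "\<And>\<delta> \<phi> \<psi>. \<delta> \<in> admissible d \<Longrightarrow> \<phi> \<in> blip \<delta> \<Longrightarrow> \<psi> \<in> blip \<delta> \<Longrightarrow>
      (\<And>x y. \<phi> x + \<psi> y \<le> (\<delta> x y)\<^sup>2) \<Longrightarrow> (\<integral>x. \<phi> x \<partial>\<mu>) + (\<integral>x. \<psi> x \<partial>\<nu>) \<le> C"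
  obtains p :: "('a \<times> 'a) set \<Rightarrow> real" where
    "\<And>S. 0 \<le> p S" "\<And>S S'. S \<inter> S' = {} \<Longrightarrow> p (S \<union> S') = p S + p S'" "p UNIV = 1"
    "\<And>A. A \<in> sets borel \<Longrightarrow> p (A \<times> UNIV) = measure \<mu> A"
    "\<And>A. A \<in> sets borel \<Longrightarrow> p (UNIV \<times> A) = measure \<nu> A"
    "\<And>\<delta> h N. \<delta> \<in> admissible d \<Longrightarrow> 0 < h \<Longrightarrow> (\<Sum>i = 1..N. h * p {(x, y). real i * h < (\<delta> x y)\<^sup>2}) \<le> C"
proof -
  define G where "G = (\<lambda>(\<A>, F, e). {p :: ('a \<times> 'a) set \<Rightarrow> real.
     (\<forall>S S'. S \<inter> S' = {} \<longrightarrow> p (S \<union> S') = p S + p S') \<and> p UNIV = 1 \<and>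
     (\<forall>A\<in>\<A>. p (A \<times> UNIV) = measure \<mu> A \<and> p (UNIV \<times> A) = measure \<nu> A) \<and>
     (\<forall>\<delta>\<in>F. \<forall>h>0. \<forall>N. (\<Sum>i = 1..N. h * p {(x, y). real i * h < (\<delta> x y)\<^sup>2}) \<le> C + e)})"
  define I where "I = {(\<A> :: 'a set set, F, e :: real). finite \<A> \<and> \<A> \<subseteq> sets borel \<and> finite F \<and> F \<subseteq> admissible d \<and> 0 < e}"
  let ?B = "{p :: ('a \<times> 'a) set \<Rightarrow> real. \<forall>S. p S \<in> {0..1}}"
  have Gne: "?B \<inter> G i \<noteq> {}" if i: "i \<in> I" for i
  proof -
    obtain \<A> F e where ie: "i = (\<A>, F, e)" by (cases i)
    with i have \<A>: "finite \<A>" "\<A> \<subseteq> sets borel" "finite F" "F \<subseteq> admissible d" "0 < e" by (auto simp: I_def)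
    obtain \<delta> where \<delta>: "\<delta> \<in> admissible d" "\<And>\<delta>' x y. \<delta>' \<in> F \<Longrightarrow> \<delta>' x y \<le> \<delta> x y"
      using admissible_finite_upper[OF \<A>(3,4)] by blast
    obtain p :: "('a \<times> 'a) set \<Rightarrow> real" where p:
      "\<And>S. 0 \<le> p S" "\<And>S S'. S \<inter> S' = {} \<Longrightarrow> p (S \<union> S') = p S + p S'" "p UNIV = 1"
      "\<And>A. A \<in> \<A> \<Longrightarrow> p (A \<times> UNIV) = measure \<mu> A" "\<And>A. A \<in> \<A> \<Longrightarrow> p (UNIV \<times> A) = measure \<nu> A"
      "\<And>h N. 0 < h \<Longrightarrow> (\<Sum>i = 1..N. h * p {(x, y). real i * h < (\<delta> x y)\<^sup>2}) \<le> C + e"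
      using discrete_coupling[OF \<mu> \<nu> \<delta>(1) dual[OF \<delta>(1)] \<A>(1,2,5)] by blast
    have mono: "p S \<le> p S'" if "S \<subseteq> S'" for S S'
      using p(2)[of S "S' - S"] p(1)[of "S' - S"] that by (simp add: Un_absorb1)
    have "(\<Sum>i = 1..N. h * p {(x, y). real i * h < (\<delta>' x y)\<^sup>2}) \<le> C + e" if \<delta>': "\<delta>' \<in> F" and h: "h > 0" for \<delta>' h N
    proof (rule order_trans[OF sum_mono p(6)[OF h, of N]])
      fix i assume "i \<in> {1..N}"
      have "{(x, y). real i * h < (\<delta>' x y)\<^sup>2} \<subseteq> {(x, y). real i * h < (\<delta> x y)\<^sup>2}"
        using \<delta>' \<A>(4) by (intro superlevel_mono[of _ d] \<delta>(2)) auto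
      from mono[OF this] show "h * p {(x, y). real i * h < (\<delta>' x y)\<^sup>2} \<le> h * p {(x, y). real i * h < (\<delta> x y)\<^sup>2}"
        using h by (intro mult_left_mono) auto
    qed
    then have "p \<in> G i" using p by (simp add: G_def ie)
    moreover have "p \<in> ?B" using p(1) mono[of _ UNIV] p(3) by auto
    ultimately show ?thesis by blast
  qed
  \<comment> \<open>Every single condition involves only finitely many values of p and is thus
    closed in the product topology. Countable additivity is not of this kind, which is why the limit
    is only finitely additive.\<close>
  have cl: "closed (G i)" for i
  proof -
    have cc: "continuous_on UNIV (\<lambda>p :: ('a \<times> 'a) set \<Rightarrow> real. p S)" for S
      by (rule continuous_on_product_coordinates)
    obtain \<A> F e where "i = (\<A>, F, e)" by (cases i)
    then show ?thesis unfolding G_def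
      by (auto intro!: closed_Collect_conj closed_Collect_all closed_Collect_imp closed_Collect_eq closed_Collect_le
          continuous_intros cc simp: Ball_def)
  qed
  have "?B \<inter> \<Inter> (G ` I) \<noteq> {}"
  proof (rule compact_imp_fip[OF compact_function_box])
    show "closed T" if "T \<in> G ` I" for T using that cl by auto
    fix F' assume "finite F'" "F' \<subseteq> G ` I"
    then obtain J where J: "finite J" "J \<subseteq> I" "F' = G ` J" by (metis finite_subset_image)
    show "?B \<inter> \<Inter> F' \<noteq> {}"
    proof (cases "J = {}")
      case True
      then show ?thesis using J by (auto intro!: exI[of _ "\<lambda>_. 0"])
    next
      case False
      \<comment> \<open>The conditions become stronger as the two families grow and e decreases, so
        finitely many of them follow from the single index built here.\<close>
      define i where "i = ((\<Union>j\<in>J. fst j), (\<Union>j\<in>J. fst (snd j)), Min ((\<lambda>j. snd (snd j)) ` J))"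
      have Jp: "finite (fst j) \<and> fst j \<subseteq> sets borel \<and> finite (fst (snd j)) \<and> fst (snd j) \<subseteq> admissible d \<and> 0 < snd (snd j)"
        if "j \<in> J" for j using J(2) that by (force simp: I_def)
      have "i \<in> I"
      proof -
        have "(\<Union>j\<in>J. fst j) \<subseteq> sets borel" "(\<Union>j\<in>J. fst (snd j)) \<subseteq> admissible d"
          "finite (\<Union>j\<in>J. fst j)" "finite (\<Union>j\<in>J. fst (snd j))"
          using Jp J(1) by (blast, blast, blast, blast)
        moreover have "0 < Min ((\<lambda>j. snd (snd j)) ` J)" using J(1) Jp False by simp
        ultimately show ?thesis unfolding I_def i_def by simp
      qed
      moreover have "G i \<subseteq> G j" if j: "j \<in> J" for j
      proof -
        have "Min ((\<lambda>j. snd (snd j)) ` J) \<le> snd (snd j)" using J(1) j by (intro Min_le) auto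
        then show ?thesis unfolding G_def i_def using j
          by (auto simp: case_prod_unfold) (meson add_left_mono order_trans)
      qed
      ultimately show ?thesis using Gne[of i] J(3) by blast
    qed
  qed
  then obtain p where p: "p \<in> ?B" "\<And>i. i \<in> I \<Longrightarrow> p \<in> G i" by blast
  show thesis
  proof (rule that[of p])
    show "0 \<le> p S" for S using p(1) by auto
    have "p \<in> G ({}, {}, 1)" by (rule p(2)) (auto simp: I_def)
    then show "\<And>S S'. S \<inter> S' = {} \<Longrightarrow> p (S \<union> S') = p S + p S'" "p UNIV = 1" by (auto simp: G_def)
    fix A :: "'a set" assume A: "A \<in> sets borel"
    have "p \<in> G ({A}, {}, 1)" by (rule p(2)) (use A in \<open>auto simp: I_def\<close>)
    then show "p (A \<times> UNIV) = measure \<mu> A" "p (UNIV \<times> A) = measure \<nu> A" by (auto simp: G_def)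
  next
    fix \<delta> and h :: real and N assume \<delta>: "\<delta> \<in> admissible d" and h: "0 < h"
    show "(\<Sum>i = 1..N. h * p {(x, y). real i * h < (\<delta> x y)\<^sup>2}) \<le> C"
    proof (rule field_le_epsilon)
      fix e :: real assume e: "0 < e"
      have "p \<in> G ({}, {\<delta>}, e)" by (rule p(2)) (use \<delta> e in \<open>auto simp: I_def\<close>)
      then show "(\<Sum>i = 1..N. h * p {(x, y). real i * h < (\<delta> x y)\<^sup>2}) \<le> C + e" using h by (auto simp: G_def)
    qed
  qed
qed

lemma borel_fst_snd:
  "fst \<in> borel_measurable (borel :: ('a::topological_space \<times> 'b::topological_space) measure)"
  "snd \<in> borel_measurable (borel :: ('a::topological_space \<times> 'b::topological_space) measure)"
  by (auto intro!: borel_measurable_continuous_onI continuous_intros)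

text \<open>Tightness of the charge p comes from its marginals, so it induces a Radon measure below
  p on open sets; this fixes the marginals. For the cost, a superlevel set of \<open>d\<close>
  squared is a union of open superlevel sets of admissible \<delta>. By inner regularity finitely
  many of these carry nearly all its mass, and one \<delta> above all of them reduces the layer sums
  to those of p.\<close>

lemma coupling_of_dual_bound:
  assumes d: "extended_metric_topological_space d" and \<mu>: "\<mu> \<in> Radon_prob" and \<nu>: "\<nu> \<in> Radon_prob"
    and dual: "\<And>\<delta> \<phi> \<psi>. \<delta> \<in> admissible d \<Longrightarrow> \<phi> \<in> blip \<delta> \<Longrightarrow> \<psi> \<in> blip \<delta> \<Longrightarrow>
      (\<And>x y. \<phi> x + \<psi> y \<le> (\<delta> x y)\<^sup>2) \<Longrightarrow> (\<integral>x. \<phi> x \<partial>\<mu>) + (\<integral>x. \<psi> x \<partial>\<nu>) \<le> C"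
  obtains \<pi> where "\<pi> \<in> Radon_prob" "distr \<pi> borel fst = \<mu>" "distr \<pi> borel snd = \<nu>"
    "(\<integral>\<^sup>+(x, y). (d x y)\<^sup>2 \<partial>\<pi>) \<le> ennreal C"
proof -
  obtain p :: "('a \<times> 'a) set \<Rightarrow> real" where p:
    "\<And>S. 0 \<le> p S" "\<And>S S'. S \<inter> S' = {} \<Longrightarrow> p (S \<union> S') = p S + p S'" "p UNIV = 1"
    "\<And>A. A \<in> sets borel \<Longrightarrow> p (A \<times> UNIV) = measure \<mu> A"
    "\<And>A. A \<in> sets borel \<Longrightarrow> p (UNIV \<times> A) = measure \<nu> A"
    "\<And>\<delta> h N. \<delta> \<in> admissible d \<Longrightarrow> 0 < h \<Longrightarrow> (\<Sum>i = 1..N. h * p {(x, y). real i * h < (\<delta> x y)\<^sup>2}) \<le> C"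
    by (rule coupling_charge[OF \<mu> \<nu>]) (rule dual, assumption+, rule that, assumption+)
  interpret \<mu>: prob_space \<mu> using \<mu> by (simp add: Radon_prob_def)
  interpret \<nu>: prob_space \<nu> using \<nu> by (simp add: Radon_prob_def)
  have s: "sets \<mu> = sets borel" "sets \<nu> = sets borel" and sp: "space \<mu> = UNIV" "space \<nu> = UNIV"
    using \<mu> \<nu> sets_eq_imp_space_eq[of \<mu> borel] sets_eq_imp_space_eq[of \<nu> borel] by (auto simp: Radon_prob_def)
  interpret T: tight_charge p
  proof
    fix e :: real assume e: "0 < e"
    then have e2: "0 < e / 2" by simp
    obtain K L where K: "compact K" "measure \<mu> UNIV \<le> measure \<mu> K + e / 2"
      and L: "compact L" "measure \<nu> UNIV \<le> measure \<nu> L + e / 2"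
      using Radon_compact_approx[OF \<mu> _ e2, of UNIV] Radon_compact_approx[OF \<nu> _ e2, of UNIV]
      by (metis sets.top space_borel)
    have mono: "p S \<le> p S'" if "S \<subseteq> S'" for S S'
      using p(2)[of S "S' - S"] p(1)[of "S' - S"] that by (simp add: Un_absorb1)
    have KL: "- K \<in> sets borel" "- L \<in> sets borel" "K \<in> sets borel" "L \<in> sets borel"
      using borel_compact[OF K(1)] borel_compact[OF L(1)] borel_comp by blast+
    \<comment> \<open>Splitting the complement of a product of compact sets in this way lets the two
      marginals control its charge.\<close>
    have "- (K \<times> L) = (- K) \<times> UNIV \<union> K \<times> (- L)" by auto
    then have "p (- (K \<times> L)) = p ((- K) \<times> UNIV) + p (K \<times> (- L))"
      using p(2)[of "(- K) \<times> UNIV" "K \<times> (- L)"] by (metis ComplD disjoint_iff mem_Times_iff)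
    also have "p (K \<times> (- L)) \<le> p (UNIV \<times> (- L))" by (rule mono) auto
    also have "p ((- K) \<times> UNIV) + p (UNIV \<times> (- L)) = measure \<mu> (- K) + measure \<nu> (- L)"
      using p(4,5) KL by simp
    also have "\<dots> = (1 - measure \<mu> K) + (1 - measure \<nu> L)"
      using \<mu>.prob_compl[of K] \<nu>.prob_compl[of L] KL by (simp add: s sp Compl_eq_Diff_UNIV)
    also have "\<dots> \<le> e" using K(2) L(2) \<mu>.prob_space \<nu>.prob_space sp by simp
    finally show "\<exists>K. compact K \<and> p (- K) \<le> e"
      using compact_Times[OF K(1) L(1)] by (intro exI[of _ "K \<times> L"]) auto
  qed (use p in auto)
  let ?\<pi> = "T.radon"
  interpret \<pi>: prob_space ?\<pi> by (rule T.prob_space_radon)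
  have R: "?\<pi> \<in> Radon_prob" by (rule T.radon_Radon)
  have op: "measure ?\<pi> U \<le> p U" if "open U" for U
    using T.emeasure_radon_open[OF that] p(1) by (simp add: \<pi>.emeasure_eq_measure)
  have mb: "f \<in> measurable ?\<pi> N" if "f \<in> measurable borel N" for f and N :: "'c measure"
    using that T.sets_radon by (simp cong: measurable_cong_sets)
  have m1: "distr ?\<pi> borel fst = \<mu>"
  proof (rule Radon_eqI_open_le[OF \<mu>])
    show "prob_space (distr ?\<pi> borel fst)" by (rule \<pi>.prob_space_distr) (rule mb[OF borel_fst_snd(1)])
    fix U :: "'a set" assume U: "open U"
    have "measure (distr ?\<pi> borel fst) U = measure ?\<pi> (U \<times> UNIV)"
      using U mb[OF borel_fst_snd(1)] by (subst measure_distr) (auto intro!: arg_cong[of _ _ "measure ?\<pi>"])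
    also have "\<dots> \<le> p (U \<times> UNIV)" using U by (intro op open_Times) auto
    also have "\<dots> = measure \<mu> U" using U by (intro p(4)) auto
    finally show "measure (distr ?\<pi> borel fst) U \<le> measure \<mu> U" .
  qed simp
  have m2: "distr ?\<pi> borel snd = \<nu>"
  proof (rule Radon_eqI_open_le[OF \<nu>])
    show "prob_space (distr ?\<pi> borel snd)" by (rule \<pi>.prob_space_distr) (rule mb[OF borel_fst_snd(2)])
    fix U :: "'a set" assume U: "open U"
    have "measure (distr ?\<pi> borel snd) U = measure ?\<pi> (UNIV \<times> U)"
      using U mb[OF borel_fst_snd(2)] by (subst measure_distr) (auto intro!: arg_cong[of _ _ "measure ?\<pi>"])
    also have "\<dots> \<le> p (UNIV \<times> U)" using U by (intro op open_Times) auto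
    also have "\<dots> = measure \<nu> U" using U by (intro p(5)) auto
    finally show "measure (distr ?\<pi> borel snd) U \<le> measure \<nu> U" .
  qed simp
  define A where "A \<delta> t = {(x, y). t < (\<delta> x y)\<^sup>2}" for \<delta> :: "'a \<Rightarrow> 'a \<Rightarrow> real" and t :: real
  \<comment> \<open>For nonnegative t this is the set where \<open>d\<close> squared exceeds
    t.\<close>
  define H where "H t = (\<Union>\<delta>\<in>admissible d. A \<delta> t)" for t
  have Ao: "open (A \<delta> t)" if "\<delta> \<in> admissible d" for \<delta> t
  proof -
    have "continuous_on UNIV (\<lambda>z. ((\<lambda>(x, y). \<delta> x y) z)\<^sup>2)"
      using admissibleD(6)[OF that] by (intro continuous_intros)
    then have "open {z. t < ((\<lambda>(x, y). \<delta> x y) z)\<^sup>2}" by (intro open_Collect_less continuous_on_const)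
    then show ?thesis by (simp add: A_def case_prod_unfold)
  qed
  have Ho: "open (H t)" for t unfolding H_def using Ao by auto
  have layer: "(\<Sum>i = 1..N. h * measure ?\<pi> (H (real i * h))) \<le> C" if h: "0 < h" for h N
  proof (rule field_le_epsilon)
    fix e :: real assume e: "0 < e"
    \<comment> \<open>N layers of height h lose e' each, together at most e; the summand 1 keeps the
      denominator positive.\<close>
    define e' where "e' = e / (real N * h + 1)"
    have Nh: "0 \<le> real N * h" using h by simp
    then have e': "0 < e'" "real N * h * e' \<le> e" using e by (auto simp: e'_def field_simps)
    have "\<exists>F. finite F \<and> F \<subseteq> admissible d \<and>
        measure ?\<pi> (H (real i * h)) \<le> measure ?\<pi> (\<Union>\<delta>\<in>F. A \<delta> (real i * h)) + e'" for i
    proof -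
      obtain K where K: "compact K" "K \<subseteq> H (real i * h)" "measure ?\<pi> (H (real i * h)) \<le> measure ?\<pi> K + e'"
        using Radon_compact_approx[OF R _ e'(1), of "H (real i * h)"] Ho by auto
      obtain F where F: "F \<subseteq> admissible d" "finite F" "K \<subseteq> (\<Union>\<delta>\<in>F. A \<delta> (real i * h))"
        using compactE_image[OF K(1), of "admissible d" "\<lambda>\<delta>. A \<delta> (real i * h)"] Ao K(2) unfolding H_def by metis
      have "open (\<Union>\<delta>\<in>F. A \<delta> (real i * h))" using Ao F(1) by auto
      then have "measure ?\<pi> K \<le> measure ?\<pi> (\<Union>\<delta>\<in>F. A \<delta> (real i * h))"
        using F(3) by (intro \<pi>.finite_measure_mono) auto
      with K(3) F show ?thesis by (intro exI[of _ F]) auto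
    qed
    then obtain F where F: "\<And>i. finite (F i)" "\<And>i. F i \<subseteq> admissible d"
      "\<And>i. measure ?\<pi> (H (real i * h)) \<le> measure ?\<pi> (\<Union>\<delta>\<in>F i. A \<delta> (real i * h)) + e'"
      by metis
    obtain \<delta> where \<delta>: "\<delta> \<in> admissible d" "\<And>\<delta>' x y. \<delta>' \<in> (\<Union>i\<in>{1..N}. F i) \<Longrightarrow> \<delta>' x y \<le> \<delta> x y"
    proof (rule admissible_finite_upper)
      show "finite (\<Union>i\<in>{1..N}. F i)" "(\<Union>i\<in>{1..N}. F i) \<subseteq> admissible d" using F(1,2) by auto
    qed (rule that)
    have "(\<Sum>i = 1..N. h * measure ?\<pi> (H (real i * h))) \<le> (\<Sum>i = 1..N. h * p (A \<delta> (real i * h)) + h * e')"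
    proof (rule sum_mono)
      fix i assume i: "i \<in> {1..N}"
      have "A \<delta>' (real i * h) \<subseteq> A \<delta> (real i * h)" if "\<delta>' \<in> F i" for \<delta>'
        unfolding A_def using that i F(2) by (intro superlevel_mono[of _ d] \<delta>(2)) auto
      then have "measure ?\<pi> (\<Union>\<delta>\<in>F i. A \<delta> (real i * h)) \<le> measure ?\<pi> (A \<delta> (real i * h))"
        using Ao[OF \<delta>(1)] by (intro \<pi>.finite_measure_mono) auto
      also have "\<dots> \<le> p (A \<delta> (real i * h))" using op Ao[OF \<delta>(1)] by blast
      finally have "measure ?\<pi> (H (real i * h)) \<le> p (A \<delta> (real i * h)) + e'" using F(3)[of i] by simp
      then have "h * measure ?\<pi> (H (real i * h)) \<le> h * (p (A \<delta> (real i * h)) + e')"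
        using h by (intro mult_left_mono) auto
      then show "h * measure ?\<pi> (H (real i * h)) \<le> h * p (A \<delta> (real i * h)) + h * e'"
        by (simp add: distrib_left)
    qed
    also have "\<dots> = (\<Sum>i = 1..N. h * p (A \<delta> (real i * h))) + real N * h * e'"
      by (simp add: sum.distrib)
    also have "\<dots> \<le> C + e" using p(6)[OF \<delta>(1) h, of N] e'(2) by (intro add_mono) (simp_all add: A_def)
    finally show "(\<Sum>i = 1..N. h * measure ?\<pi> (H (real i * h))) \<le> C + e" .
  qed
  \<comment> \<open>With mesh 1/(n+1) and (n+1)^2 layers the sums reach up to height n+1, so mesh
    and truncation disappear together.\<close>
  define h where "h n = 1 / real (Suc n)" for n
  define N where "N n = (Suc n)\<^sup>2" for n
  have h0: "0 < h n" for n by (simp add: h_def)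
  have Nh: "real (N n) * h n = real (Suc n)" for n
  proof -
    have "real (N n) = real (Suc n) * real (Suc n)" by (simp only: N_def power2_eq_square of_nat_mult)
    then show ?thesis by (simp add: h_def del: of_nat_Suc)
  qed
  define f where "f n z = ennreal (\<Sum>i = 1..N n. h n * indicator (H (real i * h n)) z)" for n z
  have fm: "f n \<in> borel_measurable ?\<pi>" for n
    unfolding f_def using Ho by (intro borel_measurable_sum measurable_compose[OF _ measurable_ennreal]
      borel_measurable_times borel_measurable_const borel_measurable_indicator) auto
  have fint: "(\<integral>\<^sup>+z. f n z \<partial>?\<pi>) \<le> ennreal C" for n
  proof -
    have "(\<integral>\<^sup>+z. f n z \<partial>?\<pi>) = ennreal (\<integral>z. (\<Sum>i = 1..N n. h n * indicator (H (real i * h n)) z) \<partial>?\<pi>)"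
      unfolding f_def using Ho h0[of n]
      by (intro nn_integral_eq_integral AE_I2 sum_nonneg Bochner_Integration.integrable_sum integrable_mult_right)
         (auto simp: integrable_indicator_iff \<pi>.emeasure_eq_measure intro: less_imp_le)
    also have "(\<integral>z. (\<Sum>i = 1..N n. h n * indicator (H (real i * h n)) z) \<partial>?\<pi>)
        = (\<Sum>i = 1..N n. h n * measure ?\<pi> (H (real i * h n)))"
      using Ho by (subst Bochner_Integration.integral_sum)
         (auto simp: integrable_indicator_iff \<pi>.emeasure_eq_measure)
    also have "ennreal \<dots> \<le> ennreal C" by (intro ennreal_leI layer h0)
    finally show ?thesis .
  qed
  have lim: "(d x y)\<^sup>2 \<le> liminf (\<lambda>n. f n (x, y))" for x y
  proof (rule dense_le)
    fix a assume a: "a < (d x y)\<^sup>2"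
    then obtain t where t: "a = ennreal t" "0 \<le> t" by (cases a) auto
    have "\<exists>\<delta>\<in>admissible d. t < (\<delta> x y)\<^sup>2"
    proof (rule ccontr)
      assume "\<not> ?thesis"
      then have "\<delta> x y \<le> sqrt t" if "\<delta> \<in> admissible d" for \<delta>
        using that admissibleD(1)[OF that, of x y] by (auto simp: not_less intro: real_le_rsqrt)
      then have "d x y \<le> ennreal (sqrt t)"
        by (subst SUP_admissible[OF d]) (auto intro!: SUP_least ennreal_leI)
      then have "(d x y)\<^sup>2 \<le> (ennreal (sqrt t))\<^sup>2" by (intro power_mono) auto
      also have "\<dots> = a" using t by (simp add: ennreal_power)
      finally show False using a by simp
    qed
    then obtain \<delta> where \<delta>: "\<delta> \<in> admissible d" "t < (\<delta> x y)\<^sup>2" by blast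
    obtain n0 where n0: "1 / real (Suc n0) < (\<delta> x y)\<^sup>2 - t" using \<delta>(2) nat_approx_posE[of "(\<delta> x y)\<^sup>2 - t"] by auto
    obtain n1 :: nat where n1: "(\<delta> x y)\<^sup>2 \<le> real n1" using real_arch_simple by blast
    have "a \<le> f n (x, y)" if n: "max n0 n1 \<le> n" for n
    proof -
      have "h n \<le> 1 / real (Suc n0)" using n by (simp add: h_def frac_le)
      then have "t \<le> (\<delta> x y)\<^sup>2 - h n" using n0 by simp
      also have "(\<delta> x y)\<^sup>2 = min ((\<delta> x y)\<^sup>2) (real (N n) * h n)" using n n1 by (simp add: Nh)
      also have "\<dots> - h n \<le> (\<Sum>i = 1..N n. h n * of_bool (real i * h n < (\<delta> x y)\<^sup>2))"
        using layer_sum_ge[OF h0, of "(\<delta> x y)\<^sup>2" "N n" n] by simp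
      also have "\<dots> \<le> (\<Sum>i = 1..N n. h n * indicator (H (real i * h n)) (x, y))"
        using \<delta>(1) h0[of n] by (intro sum_mono mult_left_mono) (auto simp: H_def A_def indicator_def)
      finally show ?thesis unfolding f_def t(1) by (rule ennreal_leI)
    qed
    then show "a \<le> liminf (\<lambda>n. f n (x, y))"
      by (intro Liminf_bounded) (auto simp: eventually_sequentially intro!: exI[of _ "max n0 n1"])
  qed
  have "(\<integral>\<^sup>+(x, y). (d x y)\<^sup>2 \<partial>?\<pi>) \<le> (\<integral>\<^sup>+z. liminf (\<lambda>n. f n z) \<partial>?\<pi>)"
    using lim by (intro nn_integral_mono) (auto simp: case_prod_unfold)
  also have "\<dots> \<le> liminf (\<lambda>n. \<integral>\<^sup>+z. f n z \<partial>?\<pi>)" by (rule nn_integral_liminf) (rule fm)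
  also have "\<dots> \<le> liminf (\<lambda>n. ennreal C)" by (intro Liminf_mono always_eventually allI fint)
  also have "\<dots> = ennreal C" by (simp add: Liminf_const)
  finally show thesis by (rule that[OF R m1 m2])
qed

section \<open>Duality and the metric properties of the Wasserstein distance\<close>

lemma Radon_integral_distr_fst_snd:
  fixes f g :: "'a::t2_space \<Rightarrow> real"
  assumes \<pi>: "\<pi> \<in> Radon_prob" and m: "distr \<pi> borel fst = \<mu>" "distr \<pi> borel snd = \<nu>"
    and f: "f \<in> borel_measurable borel" "integrable \<mu> f" and g: "g \<in> borel_measurable borel" "integrable \<nu> g"
  shows "integrable \<pi> (\<lambda>z. f (fst z))" "(\<integral>z. f (fst z) \<partial>\<pi>) = (\<integral>x. f x \<partial>\<mu>)"
    "integrable \<pi> (\<lambda>z. g (snd z))" "(\<integral>z. g (snd z) \<partial>\<pi>) = (\<integral>x. g x \<partial>\<nu>)"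
proof -
  have s: "sets \<pi> = sets borel" using \<pi> by (simp add: Radon_prob_def)
  have fs: "fst \<in> measurable \<pi> borel" "snd \<in> measurable \<pi> borel"
    using borel_fst_snd s by (simp_all cong: measurable_cong_sets)
  show "integrable \<pi> (\<lambda>z. f (fst z))" using f m(1) integrable_distr_eq[OF fs(1) f(1)] by simp
  show "integrable \<pi> (\<lambda>z. g (snd z))" using g m(2) integrable_distr_eq[OF fs(2) g(1)] by simp
  show "(\<integral>z. f (fst z) \<partial>\<pi>) = (\<integral>x. f x \<partial>\<mu>)" using integral_distr[OF fs(1) f(1)] m(1) by simp
  show "(\<integral>z. g (snd z) \<partial>\<pi>) = (\<integral>x. g x \<partial>\<nu>)" using integral_distr[OF fs(2) g(1)] m(2) by simp
qed

lemma dual_le_cost: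
  fixes d :: "'a::t2_space \<Rightarrow> 'a \<Rightarrow> ennreal"
  assumes \<pi>: "\<pi> \<in> Radon_prob" and m: "distr \<pi> borel fst = \<mu>" "distr \<pi> borel snd = \<nu>"
    and \<mu>: "\<mu> \<in> Radon_prob" and \<nu>: "\<nu> \<in> Radon_prob"
    and \<delta>: "\<delta> \<in> admissible d" and f: "\<phi> \<in> blip \<delta>" "\<psi> \<in> blip \<delta>" "\<And>x y. \<phi> x + \<psi> y \<le> (\<delta> x y)\<^sup>2"
  shows "ennreal ((\<integral>x. \<phi> x \<partial>\<mu>) + (\<integral>x. \<psi> x \<partial>\<nu>)) \<le> (\<integral>\<^sup>+(x, y). (d x y)\<^sup>2 \<partial>\<pi>)"
proof -
  note I = Radon_integral_distr_fst_snd[OF \<pi> m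
      continuous_real_borel[OF blip_continuous[OF \<delta> f(1)]] blip_integrable[OF \<delta> f(1) \<mu>]
      continuous_real_borel[OF blip_continuous[OF \<delta> f(2)]] blip_integrable[OF \<delta> f(2) \<nu>]]
  have "ennreal ((\<integral>x. \<phi> x \<partial>\<mu>) + (\<integral>x. \<psi> x \<partial>\<nu>)) = ennreal (\<integral>z. \<phi> (fst z) + \<psi> (snd z) \<partial>\<pi>)"
    using I by simp
  \<comment> \<open>The dual integrand may be negative; its positive part can be compared with the
    cost, which is integrated in \<open>ennreal\<close>.\<close>
  also have "\<dots> \<le> ennreal (\<integral>z. max 0 (\<phi> (fst z) + \<psi> (snd z)) \<partial>\<pi>)"
    using I by (intro ennreal_leI integral_mono) auto
  also have "\<dots> = (\<integral>\<^sup>+z. ennreal (max 0 (\<phi> (fst z) + \<psi> (snd z))) \<partial>\<pi>)"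
    using I by (intro nn_integral_eq_integral[symmetric]) auto
  also have "\<dots> \<le> (\<integral>\<^sup>+(x, y). (d x y)\<^sup>2 \<partial>\<pi>)"
  proof (intro nn_integral_mono)
    fix z
    have "max 0 (\<phi> (fst z) + \<psi> (snd z)) \<le> (\<delta> (fst z) (snd z))\<^sup>2" using f(3) by simp
    then have "ennreal (max 0 (\<phi> (fst z) + \<psi> (snd z))) \<le> ennreal ((\<delta> (fst z) (snd z))\<^sup>2)" by (rule ennreal_leI)
    also have "\<dots> = (ennreal (\<delta> (fst z) (snd z)))\<^sup>2" using admissibleD(1)[OF \<delta>] by (simp add: ennreal_power)
    also have "\<dots> \<le> (d (fst z) (snd z))\<^sup>2" using admissibleD(5)[OF \<delta>] by (intro power_mono) auto
    finally show "ennreal (max 0 (\<phi> (fst z) + \<psi> (snd z))) \<le> (case z of (x, y) \<Rightarrow> (d x y)\<^sup>2)"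
      by (simp add: case_prod_unfold)
  qed
  finally show ?thesis .
qed

lemma esqrt_le_iff: "0 \<le> C \<Longrightarrow> esqrt a \<le> ennreal C \<longleftrightarrow> a \<le> ennreal (C\<^sup>2)"
proof (cases a)
  case (real r)
  assume C: "0 \<le> C"
  have "sqrt r \<le> C \<longleftrightarrow> r \<le> C\<^sup>2" using C real by (simp add: real_sqrt_le_iff' sqrt_le_D)
  then show ?thesis using C real by (simp add: esqrt_def)
qed (simp add: esqrt_def top_unique)

text \<open>Kantorovich duality with a bound C in place of a supremum. Statements about
  \<open>Wasserstein\<close> become statements about real integrals of pairs of functions.\<close>

lemma Wasserstein_le_iff_dual:
  assumes d: "extended_metric_topological_space d" and \<mu>: "\<mu> \<in> Radon_prob" and \<nu>: "\<nu> \<in> Radon_prob"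
    and C: "0 \<le> C"
  shows "Wasserstein d \<mu> \<nu> \<le> ennreal C \<longleftrightarrow>
    (\<forall>\<delta> \<phi> \<psi>. \<delta> \<in> admissible d \<and> \<phi> \<in> blip \<delta> \<and> \<psi> \<in> blip \<delta> \<and> (\<forall>x y. \<phi> x + \<psi> y \<le> (\<delta> x y)\<^sup>2) \<longrightarrow>
      (\<integral>x. \<phi> x \<partial>\<mu>) + (\<integral>x. \<psi> x \<partial>\<nu>) \<le> C\<^sup>2)" (is "?W \<longleftrightarrow> ?D")
proof
  assume ?W
  then have le: "(INF \<pi>\<in>{\<pi> \<in> Radon_prob. distr \<pi> borel fst = \<mu> \<and> distr \<pi> borel snd = \<nu>}.
      \<integral>\<^sup>+(x, y). (d x y)\<^sup>2 \<partial>\<pi>) \<le> ennreal (C\<^sup>2)"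
    using C by (simp add: Wasserstein_def esqrt_le_iff)
  show ?D
  proof (intro allI impI)
    fix \<delta> \<phi> \<psi>
    assume *: "\<delta> \<in> admissible d \<and> \<phi> \<in> blip \<delta> \<and> \<psi> \<in> blip \<delta> \<and> (\<forall>x y. \<phi> x + \<psi> y \<le> (\<delta> x y)\<^sup>2)"
    have "ennreal ((\<integral>x. \<phi> x \<partial>\<mu>) + (\<integral>x. \<psi> x \<partial>\<nu>)) \<le>
      (INF \<pi>\<in>{\<pi> \<in> Radon_prob. distr \<pi> borel fst = \<mu> \<and> distr \<pi> borel snd = \<nu>}. \<integral>\<^sup>+(x, y). (d x y)\<^sup>2 \<partial>\<pi>)"
      using * by (intro INF_greatest dual_le_cost[OF _ _ _ \<mu> \<nu>, where \<delta> = \<delta>]) auto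
    also note le
    finally show "(\<integral>x. \<phi> x \<partial>\<mu>) + (\<integral>x. \<psi> x \<partial>\<nu>) \<le> C\<^sup>2" by simp
  qed
next
  assume D: ?D
  obtain \<pi> where \<pi>: "\<pi> \<in> Radon_prob" "distr \<pi> borel fst = \<mu>" "distr \<pi> borel snd = \<nu>"
    "(\<integral>\<^sup>+(x, y). (d x y)\<^sup>2 \<partial>\<pi>) \<le> ennreal (C\<^sup>2)"
  proof (rule coupling_of_dual_bound[OF d \<mu> \<nu>])
    show "(\<integral>x. \<phi> x \<partial>\<mu>) + (\<integral>x. \<psi> x \<partial>\<nu>) \<le> C\<^sup>2"
      if "\<delta> \<in> admissible d" "\<phi> \<in> blip \<delta>" "\<psi> \<in> blip \<delta>" "\<And>x y. \<phi> x + \<psi> y \<le> (\<delta> x y)\<^sup>2" for \<delta> \<phi> \<psi>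
      using D that by blast
  qed
  have "(INF \<pi>\<in>{\<pi> \<in> Radon_prob. distr \<pi> borel fst = \<mu> \<and> distr \<pi> borel snd = \<nu>}.
      \<integral>\<^sup>+(x, y). (d x y)\<^sup>2 \<partial>\<pi>) \<le> ennreal (C\<^sup>2)"
    using \<pi> by (intro INF_lower2[of \<pi>]) auto
  then show ?W using C by (simp add: Wasserstein_def esqrt_le_iff)
qed

lemma Wasserstein_sym:
  assumes d: "extended_metric_topological_space d" and \<mu>: "\<mu> \<in> Radon_prob" and \<nu>: "\<nu> \<in> Radon_prob"
  shows "Wasserstein d \<mu> \<nu> = Wasserstein d \<nu> \<mu>"
proof -
  have *: "Wasserstein d \<nu> \<mu> \<le> Wasserstein d \<mu> \<nu>" if \<mu>: "\<mu> \<in> Radon_prob" and \<nu>: "\<nu> \<in> Radon_prob" for \<mu> \<nu>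
  proof (cases "Wasserstein d \<mu> \<nu>")
    case (real C)
    then have D: "(\<integral>x. \<phi> x \<partial>\<mu>) + (\<integral>x. \<psi> x \<partial>\<nu>) \<le> C\<^sup>2"
      if "\<delta> \<in> admissible d" "\<phi> \<in> blip \<delta>" "\<psi> \<in> blip \<delta>" "\<forall>x y. \<phi> x + \<psi> y \<le> (\<delta> x y)\<^sup>2" for \<delta> \<phi> \<psi>
      using Wasserstein_le_iff_dual[OF d \<mu> \<nu>, of C] that by simp
    have "Wasserstein d \<nu> \<mu> \<le> ennreal C"
      unfolding Wasserstein_le_iff_dual[OF d \<nu> \<mu> real(1)]
    proof (intro allI impI, elim conjE)
      fix \<delta> \<phi> \<psi> assume *: "\<delta> \<in> admissible d" "\<phi> \<in> blip \<delta>" "\<psi> \<in> blip \<delta>" "\<forall>x y. \<phi> x + \<psi> y \<le> (\<delta> x y)\<^sup>2"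
      have "\<psi> x + \<phi> y \<le> (\<delta> x y)\<^sup>2" for x y
        using *(4) admissibleD(3)[OF *(1), of x y] by (simp add: add.commute)
      then show "(\<integral>x. \<phi> x \<partial>\<nu>) + (\<integral>x. \<psi> x \<partial>\<mu>) \<le> C\<^sup>2"
        using D[OF *(1,3,2)] by (simp add: add.commute)
    qed
    with real show ?thesis by simp
  qed simp
  show ?thesis using *[OF \<mu> \<nu>] *[OF \<nu> \<mu>] by simp
qed

text \<open>Convexity of the square at u + v = a (u/a) + b (v/b).\<close>

lemma power2_sum_le_weighted:
  fixes u v a b :: real
  assumes "0 < a" "0 < b" "a + b = 1"
  shows "(u + v)\<^sup>2 \<le> u\<^sup>2 / a + v\<^sup>2 / b"
proof -
  have "0 \<le> (b * u - a * v)\<^sup>2 / (a * b)" using assms by simp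
  also have "\<dots> = u\<^sup>2 * (b / a) + v\<^sup>2 * (a / b) - 2 * u * v"
    using assms by (simp add: power2_eq_square field_simps)
  finally have "0 \<le> u\<^sup>2 * (b / a) + v\<^sup>2 * (a / b) - 2 * u * v" .
  moreover have "b / a = 1 / a - 1" "a / b = 1 / b - 1" using assms by (simp_all add: field_simps)
  ultimately show ?thesis by (simp add: power2_eq_square algebra_simps)
qed

text \<open>The dual replacement for gluing: the transform g0 of \<phi> with cost
  \<open>\<delta>\<^sup>2 / a\<close> is inserted as an intermediate potential. Then (\<phi>, g0) is
  a pair for the cost \<open>\<delta>\<^sup>2 / a\<close>, and (-g0, \<psi>) one for
  \<open>\<delta>\<^sup>2 / b\<close>. The weights a = C1/(C1+C2) and b = C2/(C1+C2) turn the sum of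
  the two bounds into the square of C1 + C2.\<close>

lemma Wasserstein_triangle_real:
  assumes d: "extended_metric_topological_space d" and \<mu>: "\<mu> \<in> Radon_prob" and \<sigma>: "\<sigma> \<in> Radon_prob"
    and \<nu>: "\<nu> \<in> Radon_prob" and C: "0 < C1" "0 < C2"
    and W: "Wasserstein d \<mu> \<sigma> \<le> ennreal C1" "Wasserstein d \<sigma> \<nu> \<le> ennreal C2"
  shows "Wasserstein d \<mu> \<nu> \<le> ennreal (C1 + C2)"
proof -
  have C12: "0 \<le> C1 + C2" using C by simp
  have D1: "(\<integral>x. \<phi> x \<partial>\<mu>) + (\<integral>x. \<psi> x \<partial>\<sigma>) \<le> C1\<^sup>2"
    if "\<delta> \<in> admissible d" "\<phi> \<in> blip \<delta>" "\<psi> \<in> blip \<delta>" "\<And>x y. \<phi> x + \<psi> y \<le> (\<delta> x y)\<^sup>2" for \<delta> \<phi> \<psi>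
    using Wasserstein_le_iff_dual[OF d \<mu> \<sigma> less_imp_le[OF C(1)]] that W(1) by blast
  have D2: "(\<integral>x. \<phi> x \<partial>\<sigma>) + (\<integral>x. \<psi> x \<partial>\<nu>) \<le> C2\<^sup>2"
    if "\<delta> \<in> admissible d" "\<phi> \<in> blip \<delta>" "\<psi> \<in> blip \<delta>" "\<And>x y. \<phi> x + \<psi> y \<le> (\<delta> x y)\<^sup>2" for \<delta> \<phi> \<psi>
    using Wasserstein_le_iff_dual[OF d \<sigma> \<nu> less_imp_le[OF C(2)]] that W(2) by blast
  show ?thesis
    unfolding Wasserstein_le_iff_dual[OF d \<mu> \<nu> C12]
  proof (intro allI impI, elim conjE)
    fix \<delta> \<phi> \<psi> assume *: "\<delta> \<in> admissible d" "\<phi> \<in> blip \<delta>" "\<psi> \<in> blip \<delta>" "\<forall>x y. \<phi> x + \<psi> y \<le> (\<delta> x y)\<^sup>2"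
    note D = admissibleD[OF *(1)]
    obtain B where B: "\<And>x. \<bar>\<phi> x\<bar> \<le> B" using *(2) by (auto simp: blip_def)
    define a where "a = C1 / (C1 + C2)"
    define b where "b = C2 / (C1 + C2)"
    have ab: "0 < a" "0 < b" "a + b = 1" using C by (auto simp: a_def b_def add_divide_distrib[symmetric])
    have a0: "0 \<le> 1 / a" using ab by simp
    define g0 where "g0 = ctrans \<delta> (1 / a) \<phi>"
    note t = ctrans[where g = \<phi>, OF *(1) a0 B, folded g0_def]
    have "(\<integral>x. a * \<phi> x \<partial>\<mu>) + (\<integral>x. a * g0 x \<partial>\<sigma>) \<le> C1\<^sup>2"
    proof (rule D1[OF *(1)])
      show "a * \<phi> x + a * g0 y \<le> (\<delta> x y)\<^sup>2" for x y
        using mult_left_mono[OF t(1)[of x y], of a] ab by (simp add: distrib_left)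
    qed (intro blip_scale t(3) *)+
    then have 1: "(\<integral>x. \<phi> x \<partial>\<mu>) + (\<integral>x. g0 x \<partial>\<sigma>) \<le> C1\<^sup>2 / a"
      using ab by (simp add: field_simps)
    have "(\<integral>x. (- b) * g0 x \<partial>\<sigma>) + (\<integral>x. b * \<psi> x \<partial>\<nu>) \<le> C2\<^sup>2"
    proof (rule D2[OF *(1)])
      show "(- b) * g0 y + b * \<psi> z \<le> (\<delta> y z)\<^sup>2" for y z
      proof -
        have "\<psi> z - (\<delta> y z)\<^sup>2 / b \<le> g0 y"
        proof (rule t(2))
          fix x
          have "\<phi> x + \<psi> z \<le> (\<delta> x z)\<^sup>2" using *(4) by simp
          also have "\<dots> \<le> (\<delta> x y + \<delta> y z)\<^sup>2" using D(1,4) by (intro power_mono) auto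
          also have "\<dots> \<le> (\<delta> x y)\<^sup>2 / a + (\<delta> y z)\<^sup>2 / b" by (rule power2_sum_le_weighted[OF ab])
          finally show "\<phi> x + (\<psi> z - (\<delta> y z)\<^sup>2 / b) \<le> 1 / a * (\<delta> x y)\<^sup>2" by simp
        qed
        then have "b * (\<psi> z - (\<delta> y z)\<^sup>2 / b) \<le> b * g0 y" using ab by (intro mult_left_mono) auto
        then show ?thesis using ab by (simp add: right_diff_distrib)
      qed
    qed (intro blip_scale t(3) *)+
    then have 2: "- (\<integral>x. g0 x \<partial>\<sigma>) + (\<integral>x. \<psi> x \<partial>\<nu>) \<le> C2\<^sup>2 / b"
      using ab by (simp add: field_simps)
    have "C1\<^sup>2 / a + C2\<^sup>2 / b = (C1 + C2)\<^sup>2"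
      using C by (simp add: a_def b_def power2_eq_square field_simps)
    with 1 2 show "(\<integral>x. \<phi> x \<partial>\<mu>) + (\<integral>x. \<psi> x \<partial>\<nu>) \<le> (C1 + C2)\<^sup>2" by simp
  qed
qed

lemma Wasserstein_triangle:
  assumes d: "extended_metric_topological_space d" and \<mu>: "\<mu> \<in> Radon_prob" and \<sigma>: "\<sigma> \<in> Radon_prob"
    and \<nu>: "\<nu> \<in> Radon_prob"
  shows "Wasserstein d \<mu> \<nu> \<le> Wasserstein d \<mu> \<sigma> + Wasserstein d \<sigma> \<nu>"
proof (cases "Wasserstein d \<mu> \<sigma> = \<top> \<or> Wasserstein d \<sigma> \<nu> = \<top>")
  case False
  then obtain C1 C2 where C: "Wasserstein d \<mu> \<sigma> = ennreal C1" "0 \<le> C1" "Wasserstein d \<sigma> \<nu> = ennreal C2" "0 \<le> C2"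
    by (cases "Wasserstein d \<mu> \<sigma>"; cases "Wasserstein d \<sigma> \<nu>") auto
  show ?thesis
  proof (rule ennreal_le_epsilon)
    fix e :: real assume e: "0 < e"
    \<comment> \<open>Adding e/2 to each cost makes both weights of the real version
      positive.\<close>
    have "Wasserstein d \<mu> \<nu> \<le> ennreal ((C1 + e / 2) + (C2 + e / 2))"
      using C e by (intro Wasserstein_triangle_real[OF d \<mu> \<sigma> \<nu>]) (auto intro!: ennreal_leI)
    also have "\<dots> = Wasserstein d \<mu> \<sigma> + Wasserstein d \<sigma> \<nu> + ennreal e"
      using C e by (simp flip: ennreal_plus)
    finally show "Wasserstein d \<mu> \<nu> \<le> Wasserstein d \<mu> \<sigma> + Wasserstein d \<sigma> \<nu> + ennreal e" .
  qed
qed auto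

subsection \<open>Bounded Lipschitz functions\<close>

lemma Lip_bE:
  assumes "f \<in> Lip_b d"
  obtains B L where "0 \<le> B" "0 \<le> L" "\<And>x. \<bar>f x\<bar> \<le> B" "\<And>x y. ennreal \<bar>f x - f y\<bar> \<le> ennreal L * d x y"
    "continuous_on UNIV f"
proof -
  have "bounded (range f)" using assms by (simp add: Lip_b_def)
  then obtain B where B: "\<And>x. \<bar>f x\<bar> \<le> B" by (auto simp: bounded_iff)
  obtain L where "0 \<le> L" "\<And>x y. ennreal \<bar>f x - f y\<bar> \<le> ennreal L * d x y" "continuous_on UNIV f"
    using assms by (auto simp: Lip_b_def)
  with that[of B L] B order_trans[OF abs_ge_zero B] show thesis by blast
qed

lemma Lip_bI:
  assumes "\<And>x. \<bar>f x\<bar> \<le> B" "0 \<le> L" "\<And>x y. ennreal \<bar>f x - f y\<bar> \<le> ennreal L * d x y" "continuous_on UNIV f"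
  shows "f \<in> Lip_b d"
  using assms by (auto simp: Lip_b_def bounded_iff)

lemma ennreal_Lipschitz_real:
  assumes "0 \<le> L" "ennreal \<bar>a\<bar> \<le> ennreal L * e" "e = ennreal D" "0 \<le> D"
  shows "\<bar>a\<bar> \<le> L * D"
  using assms by (simp add: ennreal_mult[symmetric])

text \<open>Bounded functions keep h on a square, where a Lipschitz constant of h suffices; thus
  products are covered along with sums and maxima.\<close>

lemma Lip_b_compose2:
  assumes f: "f \<in> Lip_b d" and g: "g \<in> Lip_b d"
    and h: "\<And>B. \<exists>C\<ge>0. \<forall>a b a' b'. \<bar>a\<bar> \<le> B \<and> \<bar>b\<bar> \<le> B \<and> \<bar>a'\<bar> \<le> B \<and> \<bar>b'\<bar> \<le> B \<longrightarrow>
       \<bar>h a b - h a' b'\<bar> \<le> C * (\<bar>a - a'\<bar> + \<bar>b - b'\<bar>)"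
    and c: "continuous_on UNIV (\<lambda>x. h (f x) (g x))"
  shows "(\<lambda>x. h (f x) (g x)) \<in> Lip_b d"
proof -
  obtain B L where f: "0 \<le> B" "0 \<le> L" "\<And>x. \<bar>f x\<bar> \<le> B" "\<And>x y. ennreal \<bar>f x - f y\<bar> \<le> ennreal L * d x y"
    by (rule Lip_bE[OF f]) (rule that)
  obtain B' L' where g: "0 \<le> B'" "0 \<le> L'" "\<And>x. \<bar>g x\<bar> \<le> B'" "\<And>x y. ennreal \<bar>g x - g y\<bar> \<le> ennreal L' * d x y"
    by (rule Lip_bE[OF g]) (rule that)
  have b: "\<bar>f x\<bar> \<le> max B B'" "\<bar>g x\<bar> \<le> max B B'" for x using f(3)[of x] g(3)[of x] by auto
  obtain C where C: "C \<ge> 0" "\<And>a b a' b'. \<bar>a\<bar> \<le> max B B' \<Longrightarrow> \<bar>b\<bar> \<le> max B B' \<Longrightarrow> \<bar>a'\<bar> \<le> max B B' \<Longrightarrow> \<bar>b'\<bar> \<le> max B B' \<Longrightarrow>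
       \<bar>h a b - h a' b'\<bar> \<le> C * (\<bar>a - a'\<bar> + \<bar>b - b'\<bar>)"
    using h[of "max B B'"] by blast
  show ?thesis
  proof (rule Lip_bI[OF _ _ _ c, of "\<bar>h 0 0\<bar> + C * (B + B')" "C * (L + L')"])
    show "\<bar>h (f x) (g x)\<bar> \<le> \<bar>h 0 0\<bar> + C * (B + B')" for x
    proof -
      have "\<bar>h (f x) (g x) - h 0 0\<bar> \<le> C * (\<bar>f x\<bar> + \<bar>g x\<bar>)" using C(2)[OF b(1)[of x] b(2)[of x], of 0 0] f(1) by simp
      also have "\<dots> \<le> C * (B + B')" by (intro mult_left_mono add_mono f g C)
      finally show ?thesis by linarith
    qed
    show "0 \<le> C * (L + L')" using C f g by simp
    show "ennreal \<bar>h (f x) (g x) - h (f y) (g y)\<bar> \<le> ennreal (C * (L + L')) * d x y" for x y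
    proof -
      have "ennreal \<bar>h (f x) (g x) - h (f y) (g y)\<bar> \<le> ennreal (C * (\<bar>f x - f y\<bar> + \<bar>g x - g y\<bar>))"
        by (intro ennreal_leI C(2) b)
      also have "\<dots> = ennreal C * (ennreal \<bar>f x - f y\<bar> + ennreal \<bar>g x - g y\<bar>)"
        using C(1) by (simp add: ennreal_mult)
      also have "\<dots> \<le> ennreal C * (ennreal L * d x y + ennreal L' * d x y)"
        by (intro mult_left_mono add_mono f g) auto
      also have "\<dots> = ennreal (C * (L + L')) * d x y"
        using C(1) f(2) g(2) by (simp add: ennreal_mult distrib_left distrib_right mult.assoc)
      finally show ?thesis .
    qed
  qed
qed

lemma Lip_b_const: "(\<lambda>_. c) \<in> Lip_b d"
  by (rule Lip_bI[of _ "\<bar>c\<bar>" 0]) auto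

lemma Lip_b_continuous: "f \<in> Lip_b d \<Longrightarrow> continuous_on UNIV f"
  by (simp add: Lip_b_def)

lemma Lip_b_max: "f \<in> Lip_b d \<Longrightarrow> g \<in> Lip_b d \<Longrightarrow> (\<lambda>x. max (f x) (g x)) \<in> Lip_b d"
proof (rule Lip_b_compose2[where d = d and h = max])
  show "\<exists>C\<ge>0. \<forall>a b a' b'. \<bar>a\<bar> \<le> B \<and> \<bar>b\<bar> \<le> B \<and> \<bar>a'\<bar> \<le> B \<and> \<bar>b'\<bar> \<le> B \<longrightarrow>
       \<bar>max a b - max a' b'\<bar> \<le> C * (\<bar>a - a'\<bar> + \<bar>b - b'\<bar>)" for B :: real
    by (intro exI[of _ 1]) (auto simp: max_def)
qed (auto intro!: continuous_intros intro: Lip_b_continuous[where d = d])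

lemma Lip_b_add: "f \<in> Lip_b d \<Longrightarrow> g \<in> Lip_b d \<Longrightarrow> (\<lambda>x. f x + g x) \<in> Lip_b d"
  by (rule Lip_b_compose2[where d = d and h = "(+)"])
     (auto intro!: exI[of _ 1] continuous_intros intro: Lip_b_continuous[where d = d])

lemma Lip_b_mult: "f \<in> Lip_b d \<Longrightarrow> g \<in> Lip_b d \<Longrightarrow> (\<lambda>x. f x * g x) \<in> Lip_b d"
proof (rule Lip_b_compose2[where d = d and h = "\<lambda>x y. x * y"])
  fix B :: real
  show "\<exists>C\<ge>0. \<forall>a b a' b'. \<bar>a\<bar> \<le> B \<and> \<bar>b\<bar> \<le> B \<and> \<bar>a'\<bar> \<le> B \<and> \<bar>b'\<bar> \<le> B \<longrightarrow>
       \<bar>a * b - a' * b'\<bar> \<le> C * (\<bar>a - a'\<bar> + \<bar>b - b'\<bar>)"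
  proof (intro exI[of _ "\<bar>B\<bar>"] conjI allI impI)
    fix a b a' b' assume *: "\<bar>a\<bar> \<le> B \<and> \<bar>b\<bar> \<le> B \<and> \<bar>a'\<bar> \<le> B \<and> \<bar>b'\<bar> \<le> B"
    have "\<bar>a * b - a' * b'\<bar> = \<bar>(a - a') * b + a' * (b - b')\<bar>" by (simp add: algebra_simps)
    also have "\<dots> \<le> \<bar>a - a'\<bar> * \<bar>b\<bar> + \<bar>a'\<bar> * \<bar>b - b'\<bar>" by (simp add: abs_mult[symmetric])
    also have "\<dots> \<le> \<bar>a - a'\<bar> * \<bar>B\<bar> + \<bar>B\<bar> * \<bar>b - b'\<bar>" using * by (intro add_mono mult_left_mono mult_right_mono) auto
    finally show "\<bar>a * b - a' * b'\<bar> \<le> \<bar>B\<bar> * (\<bar>a - a'\<bar> + \<bar>b - b'\<bar>)" by (simp add: algebra_simps)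
  qed auto
qed (auto intro!: continuous_intros intro: Lip_b_continuous[where d = d])

lemma Lip_b_scale: "f \<in> Lip_b d \<Longrightarrow> (\<lambda>x. c * f x) \<in> Lip_b d"
  by (rule Lip_b_mult[OF Lip_b_const])

lemma Lip_b_diff: "f \<in> Lip_b d \<Longrightarrow> g \<in> Lip_b d \<Longrightarrow> (\<lambda>x. f x - g x) \<in> Lip_b d"
  using Lip_b_add[OF _ Lip_b_scale[of g d "-1"], of f] by simp

lemma Lip_b_min: "f \<in> Lip_b d \<Longrightarrow> g \<in> Lip_b d \<Longrightarrow> (\<lambda>x. min (f x) (g x)) \<in> Lip_b d"
proof -
  assume "f \<in> Lip_b d" "g \<in> Lip_b d"
  then have "(\<lambda>x. - 1 * max (-1 * f x) (-1 * g x)) \<in> Lip_b d"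
    by (intro Lip_b_scale Lip_b_max)
  moreover have "(\<lambda>x. - 1 * max (-1 * f x) (-1 * g x)) = (\<lambda>x. min (f x) (g x))"
    by (auto simp: min_def max_def)
  ultimately show ?thesis by simp
qed

lemma Lip_b_abs: "f \<in> Lip_b d \<Longrightarrow> (\<lambda>x. \<bar>f x\<bar>) \<in> Lip_b d"
proof -
  assume "f \<in> Lip_b d"
  then have "(\<lambda>x. max (f x) (-1 * f x)) \<in> Lip_b d" by (intro Lip_b_max Lip_b_scale)
  moreover have "(\<lambda>x. max (f x) (-1 * f x)) = (\<lambda>x. \<bar>f x\<bar>)" by (auto simp: max_def)
  ultimately show ?thesis by simp
qed

section \<open>Bumps, Urysohn functions and density of \<open>Lip_b\<close>\<close>

lemma Lip_b_bump:
  assumes d: "extended_metric_topological_space d" and U: "open U" "x \<in> U"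
  obtains f where "f \<in> Lip_b d" "\<And>y. 0 \<le> f y \<and> f y \<le> 1" "f x = 1" "\<And>y. y \<notin> U \<Longrightarrow> f y = 0"
proof -
  \<comment> \<open>Induction over the generation of the topology: a subbasic preimage carries a
    tent function, an intersection the minimum of two bumps, a union the bump of one of its
    members.\<close>
  have "generate_topology {f -` V | f V. f \<in> Lip_b d \<and> open V} U"
    using d U(1) unfolding extended_metric_topological_space_def by simp
  then have "x \<in> U \<longrightarrow> (\<exists>f\<in>Lip_b d. (\<forall>y. 0 \<le> f y \<and> f y \<le> 1) \<and> f x = 1 \<and> (\<forall>y. y \<notin> U \<longrightarrow> f y = 0))"
  proof (induction rule: generate_topology.induct)
    case UNIV
    show ?case by (auto intro!: bexI[of _ "\<lambda>_. 1"] Lip_b_const)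
  next
    case (Int a b)
    show ?case
    proof
      assume "x \<in> a \<inter> b"
      then obtain f g where "f \<in> Lip_b d" "\<forall>y. 0 \<le> f y \<and> f y \<le> 1" "f x = 1" "\<forall>y. y \<notin> a \<longrightarrow> f y = 0"
         "g \<in> Lip_b d" "\<forall>y. 0 \<le> g y \<and> g y \<le> 1" "g x = 1" "\<forall>y. y \<notin> b \<longrightarrow> g y = 0" using Int by auto
      then show "\<exists>f\<in>Lip_b d. (\<forall>y. 0 \<le> f y \<and> f y \<le> 1) \<and> f x = 1 \<and> (\<forall>y. y \<notin> a \<inter> b \<longrightarrow> f y = 0)"
        by (intro bexI[of _ "\<lambda>y. min (f y) (g y)"] Lip_b_min conjI allI impI) (auto, (metis min_def order_antisym)+)
    qed
  next
    case (UN \<K>)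
    show ?case
    proof
      assume "x \<in> \<Union> \<K>"
      then obtain k where k: "k \<in> \<K>" "x \<in> k" by blast
      with UN[OF k(1)] show "\<exists>f\<in>Lip_b d. (\<forall>y. 0 \<le> f y \<and> f y \<le> 1) \<and> f x = 1 \<and> (\<forall>y. y \<notin> \<Union> \<K> \<longrightarrow> f y = 0)"
        by (metis UnionI)
    qed
  next
    case (Basis s)
    then obtain f V where fV: "s = f -` V" "f \<in> Lip_b d" "open V" by auto
    show ?case
    proof
      assume "x \<in> s"
      then obtain r where r: "r > 0" "ball (f x) r \<subseteq> V" using fV openE by blast
      define g where "g y = max 0 (1 - 1 / r * \<bar>f y - f x\<bar>)" for y
      have "g \<in> Lip_b d" unfolding g_def
        by (intro Lip_b_max Lip_b_const Lip_b_diff Lip_b_scale Lip_b_abs fV)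
      moreover have "g y = 0" if "y \<notin> s" for y
      proof -
        have "f y \<notin> ball (f x) r" using that r fV by auto
        then have "r \<le> \<bar>f y - f x\<bar>" by (simp add: dist_real_def abs_minus_commute)
        then show ?thesis using r by (simp add: g_def field_simps)
      qed
      ultimately show "\<exists>f\<in>Lip_b d. (\<forall>y. 0 \<le> f y \<and> f y \<le> 1) \<and> f x = 1 \<and> (\<forall>y. y \<notin> s \<longrightarrow> f y = 0)"
        using r(1) by (intro bexI[of _ g]) (auto simp: g_def)
    qed
  qed
  with U(2) that show thesis by blast
qed

lemma Lip_b_Urysohn:
  assumes d: "extended_metric_topological_space d" and K: "compact K" and U: "open U" "K \<subseteq> U"
  obtains f where "f \<in> Lip_b d" "\<And>y. 0 \<le> f y \<and> f y \<le> 1" "\<And>y. y \<in> K \<Longrightarrow> f y = 1" "\<And>y. y \<notin> U \<Longrightarrow> f y = 0"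
proof -
  have "\<exists>f. f \<in> Lip_b d \<and> (\<forall>y. 0 \<le> f y \<and> f y \<le> 1) \<and> f x = 1 \<and> (\<forall>y. y \<notin> U \<longrightarrow> f y = 0)" if "x \<in> K" for x
    using Lip_b_bump[OF d U(1), of x] U(2) that by (metis subsetD)
  then obtain F where F: "\<And>x. x \<in> K \<Longrightarrow> F x \<in> Lip_b d" "\<And>x y. x \<in> K \<Longrightarrow> 0 \<le> F x y \<and> F x y \<le> 1"
    "\<And>x. x \<in> K \<Longrightarrow> F x x = 1" "\<And>x y. x \<in> K \<Longrightarrow> y \<notin> U \<Longrightarrow> F x y = 0"
    by metis
  have op: "open {y. 1 / 2 < F x y}" if "x \<in> K" for x
    using Lip_b_continuous[OF F(1)[OF that]] by (intro open_Collect_less continuous_on_const)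
  obtain J where J: "J \<subseteq> K" "finite J" "K \<subseteq> (\<Union>x\<in>J. {y. 1 / 2 < F x y})"
  proof (rule compactE_image[OF K, of K "\<lambda>x. {y. 1 / 2 < F x y}"])
    show "K \<subseteq> (\<Union>x\<in>K. {y. 1 / 2 < F x y})" using F(3) by force
  qed (use op in auto)
  have "\<exists>g\<in>Lip_b d. (\<forall>y. 0 \<le> g y \<and> g y \<le> 1) \<and> (\<forall>y. y \<notin> U \<longrightarrow> g y = 0) \<and> (\<forall>x\<in>J. \<forall>y. F x y \<le> g y)"
    using J(2,1)
  proof (induction J rule: finite_induct)
    case empty
    show ?case by (auto intro!: bexI[of _ "\<lambda>_. 0"] Lip_b_const)
  next
    case (insert x J)
    then obtain g where "g \<in> Lip_b d" "\<forall>y. 0 \<le> g y \<and> g y \<le> 1" "\<forall>y. y \<notin> U \<longrightarrow> g y = 0" "\<forall>x\<in>J. \<forall>y. F x y \<le> g y" by auto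
    then show ?case using F[of x] insert.prems
      by (intro bexI[of _ "\<lambda>y. max (g y) (F x y)"] Lip_b_max) (auto simp: le_max_iff_disj)
  qed
  then obtain g where g: "g \<in> Lip_b d" "\<And>y. 0 \<le> g y \<and> g y \<le> 1" "\<And>y. y \<notin> U \<Longrightarrow> g y = 0" "\<And>x y. x \<in> J \<Longrightarrow> F x y \<le> g y"
    by blast
  show thesis
  \<comment> \<open>Finitely many sets where some bump exceeds 1/2 cover K, so g exceeds 1/2 there;
    doubling and truncating gives the value 1.\<close>
  proof (rule that[of "\<lambda>y. min 1 (2 * g y)"])
    show "(\<lambda>y. min 1 (2 * g y)) \<in> Lip_b d" by (intro Lip_b_min Lip_b_const Lip_b_scale g)
    show "min 1 (2 * g y) = 1" if "y \<in> K" for y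
    proof -
      obtain x where "x \<in> J" "1 / 2 < F x y" using J(3) \<open>y \<in> K\<close> by auto
      with g(4)[of x y] show ?thesis by simp
    qed
  qed (use g in auto)
qed

lemma Lip_b_integrable:
  fixes d :: "'a::t2_space \<Rightarrow> 'a \<Rightarrow> ennreal"
  assumes f: "f \<in> Lip_b d" and m: "m \<in> Radon_prob"
  shows "f \<in> borel_measurable m" "integrable m f"
proof -
  interpret prob_space m using m by (simp add: Radon_prob_def)
  obtain B where B: "\<And>x. \<bar>f x\<bar> \<le> B" by (rule Lip_bE[OF f]) (rule that)
  show bm: "f \<in> borel_measurable m"
    using continuous_real_borel[OF Lip_b_continuous[OF f]] m
    by (simp add: Radon_prob_def cong: measurable_cong_sets)
  show "integrable m f" by (rule integrable_const_bound[of _ B, OF _ bm]) (use B in auto)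
qed

lemma Lip_b_L1_dense_indicator:
  assumes d: "extended_metric_topological_space d" and m: "m \<in> Radon_prob" and B: "B \<in> sets borel" and e: "0 < e"
  obtains f where "f \<in> Lip_b d" "(\<integral>x. \<bar>f x - indicator B x\<bar> \<partial>m) \<le> e"
proof -
  interpret prob_space m using m by (simp add: Radon_prob_def)
  have s: "sets m = sets borel" using m by (simp add: Radon_prob_def)
  have e2: "0 < e / 2" using e by simp
  obtain K where K: "compact K" "K \<subseteq> B" "measure m B \<le> measure m K + e / 2"
    by (rule Radon_compact_approx[OF m B e2])
  obtain U where U: "open U" "B \<subseteq> U" "measure m U \<le> measure m B + e / 2"
    by (rule Radon_outer_regular[OF m B e2])
  obtain f where f: "f \<in> Lip_b d" "\<And>y. 0 \<le> f y \<and> f y \<le> 1" "\<And>y. y \<in> K \<Longrightarrow> f y = 1" "\<And>y. y \<notin> U \<Longrightarrow> f y = 0"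
    using Lip_b_Urysohn[OF d K(1) U(1)] K U by (metis order_trans)
  have sU: "U \<in> sets m" "K \<in> sets m" "B \<in> sets m" using U(1) borel_compact[OF K(1)] B s by auto
  have "(\<integral>x. \<bar>f x - indicator B x\<bar> \<partial>m) \<le> (\<integral>x. indicator (U - K) x \<partial>m)"
  proof (rule integral_mono)
    show "integrable m (\<lambda>x. \<bar>f x - indicator B x\<bar>)"
      using Lip_b_integrable[OF f(1) m] sU by (intro integrable_abs Bochner_Integration.integrable_diff)
        (auto simp: integrable_indicator_iff emeasure_eq_measure)
    show "integrable m (indicator (U - K) :: 'a \<Rightarrow> real)"
      using sU by (auto simp: integrable_indicator_iff emeasure_eq_measure)
    show "\<bar>f x - indicator B x\<bar> \<le> indicator (U - K) x" for x
      using f(2)[of x] f(3)[of x] f(4)[of x] K(2) U(2) by (auto simp: indicator_def abs_le_iff)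
  qed
  also have "\<dots> = measure m U - measure m K"
    using sU K(2) U(2) finite_measure_Diff[of U K] by (auto simp: sets.Int_space_eq2)
  also have "\<dots> \<le> e" using K U by simp
  finally show thesis using that f(1) by blast
qed

lemma Lip_b_L1_dense:
  assumes d: "extended_metric_topological_space d" and m: "m \<in> Radon_prob" and h: "integrable m (h :: _ \<Rightarrow> real)" and e: "0 < e"
  obtains f where "f \<in> Lip_b d" "(\<integral>x. \<bar>f x - h x\<bar> \<partial>m) \<le> e"
proof -
  interpret prob_space m using m by (simp add: Radon_prob_def)
  have s: "sets m = sets borel" using m by (simp add: Radon_prob_def)
  have "\<forall>e>0. \<exists>f\<in>Lip_b d. (\<integral>x. \<bar>f x - h x\<bar> \<partial>m) \<le> e"
    using h
  proof (induction rule: integrable_induct)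
    case (base A c)
    show ?case
    proof (intro allI impI)
      fix e :: real assume e: "0 < e"
      then have "0 < e / (\<bar>c\<bar> + 1)" by simp
      then obtain f where f: "f \<in> Lip_b d" "(\<integral>x. \<bar>f x - indicator A x\<bar> \<partial>m) \<le> e / (\<bar>c\<bar> + 1)"
        using Lip_b_L1_dense_indicator[OF d m, of A] base(1) s by blast
      have "(\<integral>x. \<bar>c * f x - indicator A x *\<^sub>R c\<bar> \<partial>m) = (\<integral>x. \<bar>c\<bar> * \<bar>f x - indicator A x\<bar> \<partial>m)"
        by (intro Bochner_Integration.integral_cong) (auto simp: abs_mult[symmetric] algebra_simps)
      also have "\<dots> = \<bar>c\<bar> * (\<integral>x. \<bar>f x - indicator A x\<bar> \<partial>m)" by simp
      also have "\<dots> \<le> \<bar>c\<bar> * (e / (\<bar>c\<bar> + 1))" using f(2) by (intro mult_left_mono) auto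
      also have "\<dots> \<le> e" using e by (simp add: field_simps)
      finally show "\<exists>f\<in>Lip_b d. (\<integral>x. \<bar>f x - indicator A x *\<^sub>R c\<bar> \<partial>m) \<le> e"
        by (rule bexI[OF _ Lip_b_scale[OF f(1)]])
    qed
  next
    case (add u v)
    show ?case
    proof (intro allI impI)
      fix e :: real assume e: "0 < e"
      then have e2: "0 < e / 2" by simp
      obtain f g where fg: "f \<in> Lip_b d" "(\<integral>x. \<bar>f x - u x\<bar> \<partial>m) \<le> e / 2"
        "g \<in> Lip_b d" "(\<integral>x. \<bar>g x - v x\<bar> \<partial>m) \<le> e / 2"
        using add(3) add(4) e2 by meson
      note i = add(1,2) Lip_b_integrable(2)[OF fg(1) m] Lip_b_integrable(2)[OF fg(3) m]
      have "(\<integral>x. \<bar>(f x + g x) - (u x + v x)\<bar> \<partial>m) \<le> (\<integral>x. \<bar>f x - u x\<bar> + \<bar>g x - v x\<bar> \<partial>m)"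
        using i by (intro integral_mono) auto
      also have "\<dots> = (\<integral>x. \<bar>f x - u x\<bar> \<partial>m) + (\<integral>x. \<bar>g x - v x\<bar> \<partial>m)"
        using i by (intro Bochner_Integration.integral_add) auto
      also have "\<dots> \<le> e" using fg by simp
      finally show "\<exists>f\<in>Lip_b d. (\<integral>x. \<bar>f x - (u x + v x)\<bar> \<partial>m) \<le> e"
        by (rule bexI[OF _ Lip_b_add[OF fg(1,3)]])
    qed
  next
    case (lim u v)
    show ?case
    proof (intro allI impI)
      fix e :: real assume e: "0 < e"
      then have e2: "0 < e / 2" by simp
      have "(\<lambda>n. \<integral>x. norm (v n x - u x) \<partial>m) \<longlonglongrightarrow> (\<integral>x. norm (0 :: real) \<partial>m)"
      proof (rule integral_dominated_convergence[where w = "\<lambda>x. 3 * norm (u x)"])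
        show "AE x in m. (\<lambda>n. norm (v n x - u x)) \<longlonglongrightarrow> norm (0 :: real)"
        proof (rule AE_I2)
          fix x assume "x \<in> space m"
          then have "(\<lambda>n. v n x) \<longlonglongrightarrow> u x" using lim(2) by blast
          then have "(\<lambda>n. v n x - u x) \<longlonglongrightarrow> 0" by (simp add: LIM_zero_iff)
          then show "(\<lambda>n. norm (v n x - u x)) \<longlonglongrightarrow> norm (0 :: real)" by (rule tendsto_norm)
        qed
        show "AE x in m. norm (norm (v n x - u x)) \<le> 3 * norm (u x)" for n
        proof (rule AE_I2)
          fix x assume "x \<in> space m"
          then have "norm (v n x) \<le> 2 * norm (u x)" by (rule lim(3))
          then show "norm (norm (v n x - u x)) \<le> 3 * norm (u x)"
            using norm_triangle_ineq4[of "v n x" "u x"] by simp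
        qed
      qed (use lim in \<open>auto intro: borel_measurable_integrable\<close>)
      then have "(\<lambda>n. \<integral>x. \<bar>v n x - u x\<bar> \<partial>m) \<longlonglongrightarrow> 0" by simp
      from order_tendstoD(2)[OF this e2] obtain n where n: "(\<integral>x. \<bar>v n x - u x\<bar> \<partial>m) < e / 2"
        by (auto simp: eventually_sequentially)
      obtain f where f: "f \<in> Lip_b d" "(\<integral>x. \<bar>f x - v n x\<bar> \<partial>m) \<le> e / 2" using lim(5) e2 by blast
      note i = lim(1)[of n] lim(4) Lip_b_integrable(2)[OF f(1) m]
      have "(\<integral>x. \<bar>f x - u x\<bar> \<partial>m) \<le> (\<integral>x. \<bar>f x - v n x\<bar> + \<bar>v n x - u x\<bar> \<partial>m)"
        using i by (intro integral_mono) auto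
      also have "\<dots> = (\<integral>x. \<bar>f x - v n x\<bar> \<partial>m) + (\<integral>x. \<bar>v n x - u x\<bar> \<partial>m)"
        using i by (intro Bochner_Integration.integral_add) auto
      also have "\<dots> \<le> e" using n f by simp
      finally show "\<exists>f\<in>Lip_b d. (\<integral>x. \<bar>f x - u x\<bar> \<partial>m) \<le> e" using f by blast
    qed
  qed
  with e that show thesis by blast
qed

text \<open>Convergence of first moments gives an a.e. convergent subsequence, and truncation
  between a and b keeps the limit. The uniform bounds later permit dominated convergence.\<close>

lemma Lip_b_AE_dense:
  assumes d: "extended_metric_topological_space d" and m: "m \<in> Radon_prob"
    and h: "h \<in> borel_measurable m" "\<And>x. a \<le> h x \<and> h x \<le> (b :: real)"
  obtains F where "\<And>n::nat. F n \<in> Lip_b d" "\<And>n x. a \<le> F n x \<and> F n x \<le> b" "AE x in m. (\<lambda>n. F n x) \<longlonglongrightarrow> h x"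
proof -
  interpret prob_space m using m by (simp add: Radon_prob_def)
  have hi: "integrable m h"
    by (rule integrable_const_bound[of _ "max \<bar>a\<bar> \<bar>b\<bar>", OF _ h(1)]) (use h(2) in \<open>auto simp: abs_le_iff le_max_iff_disj intro!: AE_I2; smt (verit)\<close>)
  have "\<exists>f\<in>Lip_b d. (\<integral>x. \<bar>f x - h x\<bar> \<partial>m) \<le> 1 / real (Suc n)" for n
    using Lip_b_L1_dense[OF d m hi, of "1 / real (Suc n)"] by (metis of_nat_0_less_iff zero_less_Suc zero_less_divide_1_iff)
  then obtain G where G: "\<And>n. G n \<in> Lip_b d" "\<And>n. (\<integral>x. \<bar>G n x - h x\<bar> \<partial>m) \<le> 1 / real (Suc n)" by metis
  have i: "integrable m (\<lambda>x. G n x - h x)" for n using Lip_b_integrable(2)[OF G(1) m] hi by auto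
  have "(\<lambda>n. \<integral>x. norm (G n x - h x) \<partial>m) \<longlonglongrightarrow> 0"
    by (rule Lim_null_comparison[OF _ LIMSEQ_inverse_real_of_nat])
       (use G(2) in \<open>auto simp: inverse_eq_divide intro!: always_eventually\<close>)
  from tendsto_L1_AE_subseq[OF i this] obtain r where r: "AE x in m. (\<lambda>n. G (r n) x - h x) \<longlonglongrightarrow> 0" by blast
  define F where "F n x = max a (min b (G (r n) x))" for n x
  show thesis
  proof (rule that[of F])
    show "F n \<in> Lip_b d" for n unfolding F_def by (intro Lip_b_max Lip_b_min Lip_b_const G)
    show "a \<le> F n x \<and> F n x \<le> b" for n x using h(2)[of x] by (auto simp: F_def)
    show "AE x in m. (\<lambda>n. F n x) \<longlonglongrightarrow> h x"
      using r
    proof eventually_elim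
      case (elim x)
      then have "(\<lambda>n. G (r n) x) \<longlonglongrightarrow> h x" by (simp add: LIM_zero_iff)
      then have "(\<lambda>n. F n x) \<longlonglongrightarrow> max a (min b (h x))" unfolding F_def by (intro tendsto_intros)
      then show ?case using h(2)[of x] by (simp add: max_def min_def split: if_splits)
    qed
  qed
qed

subsection \<open>Asymptotic slopes\<close>

definition slope_ball :: "('a \<Rightarrow> 'a \<Rightarrow> ennreal) \<Rightarrow> ('a \<Rightarrow> real) \<Rightarrow> 'a \<Rightarrow> real \<Rightarrow> ennreal" where
  "slope_ball d f x r = (SUP (y, z)\<in>{(y, z). max (d y x) (d z x) < ennreal r \<and> 0 < d y z}.
     ennreal \<bar>f y - f z\<bar> / d y z)"

lemma slope_ball_mono: "r \<le> s \<Longrightarrow> slope_ball d f x r \<le> slope_ball d f x s"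
  unfolding slope_ball_def
  by (intro SUP_subset_mono) (auto intro: less_le_trans ennreal_leI)

lemma Lip_a_INF: "Lip_a d f x = (INF r\<in>{0<..}. slope_ball d f x r)"
proof -
  have "((\<lambda>r. slope_ball d f x r) \<longlongrightarrow> (INF r\<in>{0<..}. slope_ball d f x r)) (at_right 0)"
  proof (rule order_tendstoI)
    fix a assume a: "a < (INF r\<in>{0<..}. slope_ball d f x r)"
    show "\<forall>\<^sub>F r in at_right 0. a < slope_ball d f x r"
      using eventually_at_right_less[of "0::real"]
    proof eventually_elim
      case (elim r)
      then have "(INF r\<in>{0<..}. slope_ball d f x r) \<le> slope_ball d f x r" by (intro INF_lower) auto
      with a show ?case by (rule less_le_trans)
    qed
  next
    fix a assume "(INF r\<in>{0<..}. slope_ball d f x r) < a"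
    then obtain r0 where r0: "r0 > 0" "slope_ball d f x r0 < a" by (auto simp: INF_less_iff)
    have "\<forall>\<^sub>F r in at_right 0. r < r0" using r0(1) eventually_at_right by blast
    then show "\<forall>\<^sub>F r in at_right 0. slope_ball d f x r < a"
    proof eventually_elim
      case (elim r)
      then show ?case using slope_ball_mono[of r r0 d f x] r0(2) by (auto intro: le_less_trans)
    qed
  qed
  then show ?thesis unfolding Lip_a_def slope_ball_def[symmetric] by (intro tendsto_Lim) auto
qed

lemma Lip_a_leI:
  assumes c: "0 \<le> c"
    and "\<And>e. 0 < e \<Longrightarrow> \<exists>r>0. \<forall>y z. d y x < ennreal r \<and> d z x < ennreal r \<longrightarrow> ennreal \<bar>f y - f z\<bar> \<le> ennreal (c + e) * d y z"
  shows "Lip_a d f x \<le> ennreal c"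
proof (rule ennreal_le_epsilon)
  fix e :: real assume e: "0 < e"
  then obtain r where r: "r > 0" "\<And>y z. d y x < ennreal r \<Longrightarrow> d z x < ennreal r \<Longrightarrow> ennreal \<bar>f y - f z\<bar> \<le> ennreal (c + e) * d y z"
    using assms(2) by meson
  have "Lip_a d f x \<le> slope_ball d f x r" unfolding Lip_a_INF using r(1) by (intro INF_lower) auto
  also have "\<dots> \<le> ennreal (c + e)"
    unfolding slope_ball_def
  proof (rule SUP_least, clarify)
    fix y z assume "max (d y x) (d z x) < ennreal r" "0 < d y z"
    then show "ennreal \<bar>f y - f z\<bar> / d y z \<le> ennreal (c + e)"
      using r(2)[of y z] by (intro divide_le_posI_ennreal) (auto simp: mult.commute)
  qed
  finally show "Lip_a d f x \<le> ennreal c + ennreal e" using c e by (simp flip: ennreal_plus)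
qed

lemma Lip_a_le_Lipschitz:
  assumes "0 \<le> L" "\<And>x y. ennreal \<bar>f x - f y\<bar> \<le> ennreal L * d x y"
  shows "Lip_a d f x \<le> ennreal L"
proof (rule Lip_a_leI[OF assms(1)])
  fix e :: real assume "0 < e"
  then have "ennreal L * d y z \<le> ennreal (L + e) * d y z" for y z
    by (intro mult_right_mono ennreal_leI) auto
  then show "\<exists>r>0. \<forall>y z. d y x < ennreal r \<and> d z x < ennreal r \<longrightarrow> ennreal \<bar>f y - f z\<bar> \<le> ennreal (L + e) * d y z"
    using order_trans[OF assms(2)] by (intro exI[of _ 1]) simp
qed

text \<open>Faithful where \<open>Lip_a\<close> is finite, in particular on
  \<open>Lip_b\<close>.\<close>

definition lipa :: "('a \<Rightarrow> 'a \<Rightarrow> ennreal) \<Rightarrow> ('a \<Rightarrow> real) \<Rightarrow> 'a \<Rightarrow> real" where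
  "lipa d f x = enn2real (Lip_a d f x)"

lemma lipa_nonneg: "0 \<le> lipa d f x"
  by (simp add: lipa_def)

lemma Lip_a_eq_lipa: "f \<in> Lip_b d \<Longrightarrow> Lip_a d f x = ennreal (lipa d f x)"
proof -
  assume f: "f \<in> Lip_b d"
  obtain L where "0 \<le> L" "\<And>x y. ennreal \<bar>f x - f y\<bar> \<le> ennreal L * d x y" by (rule Lip_bE[OF f]) (rule that)
  from Lip_a_le_Lipschitz[of L f d x, OF this] show ?thesis
    unfolding lipa_def by (metis ennreal_enn2real ennreal_less_top le_less_trans)
qed

lemma lipaD:
  assumes d: "extended_metric d" and f: "f \<in> Lip_b d" and e: "0 < e"
  obtains r where "0 < r" "\<And>y z D. d y x < ennreal r \<Longrightarrow> d z x < ennreal r \<Longrightarrow> d y z = ennreal D \<Longrightarrow> 0 \<le> D \<Longrightarrow>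
    \<bar>f y - f z\<bar> \<le> (lipa d f x + e) * D"
proof -
  have c: "0 < lipa d f x + e" using lipa_nonneg[of d f x] e by simp
  have "Lip_a d f x < ennreal (lipa d f x + e)"
    unfolding Lip_a_eq_lipa[OF f] using e lipa_nonneg[of d f x] by (simp add: ennreal_less_iff)
  then obtain r where r: "0 < r" "slope_ball d f x r < ennreal (lipa d f x + e)" unfolding Lip_a_INF by (auto simp: INF_less_iff)
  have "\<bar>f y - f z\<bar> \<le> (lipa d f x + e) * D" if yz: "d y x < ennreal r" "d z x < ennreal r" "d y z = ennreal D" "0 \<le> D" for y z D
  proof (cases "D = 0")
    case True
    then have "y = z" using d yz(3) by (simp add: extended_metric_def)
    with True show ?thesis by simp
  next
    case False
    then have D: "0 < D" "0 < d y z" using yz(3,4) by auto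
    have "ennreal \<bar>f y - f z\<bar> / d y z \<le> slope_ball d f x r"
      unfolding slope_ball_def by (rule SUP_upper2[of "(y, z)"]) (use yz D in auto)
    also have "\<dots> \<le> ennreal (lipa d f x + e)" using r(2) by simp
    finally have "\<bar>f y - f z\<bar> / D \<le> lipa d f x + e" using D(1) c yz(3) by (simp add: divide_ennreal del: ennreal_plus)
    then show ?thesis using D(1) by (simp add: field_simps)
  qed
  with r(1) that show thesis by blast
qed

lemma lipa_leI:
  assumes f: "f \<in> Lip_b d" and d: "extended_metric d" and c: "0 \<le> c"
    and *: "\<And>e. 0 < e \<Longrightarrow> \<exists>r>0. \<forall>y z D. d y x < ennreal r \<and> d z x < ennreal r \<and> d y z = ennreal D \<and> 0 \<le> D \<longrightarrow>
      \<bar>f y - f z\<bar> \<le> (c + e) * D"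
  shows "lipa d f x \<le> c"
proof -
  have "Lip_a d f x \<le> ennreal c"
  proof (rule Lip_a_leI[OF c])
    fix e :: real assume e: "0 < e"
    then obtain r where r: "r > 0" "\<And>y z D. d y x < ennreal r \<Longrightarrow> d z x < ennreal r \<Longrightarrow> d y z = ennreal D \<Longrightarrow> 0 \<le> D \<Longrightarrow>
      \<bar>f y - f z\<bar> \<le> (c + e) * D" using * by meson
    have "ennreal \<bar>f y - f z\<bar> \<le> ennreal (c + e) * d y z" if "d y x < ennreal r" "d z x < ennreal r" for y z
    proof (cases "d y z")
      case (real D)
      then show ?thesis using r(2)[OF that real(2,1)] e c
        by (simp add: ennreal_mult[symmetric] ennreal_leI del: ennreal_plus)
    next
      case top
      then show ?thesis using e c by (simp add: ennreal_mult_top)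
    qed
    with r(1) show "\<exists>r>0. \<forall>y z. d y x < ennreal r \<and> d z x < ennreal r \<longrightarrow> ennreal \<bar>f y - f z\<bar> \<le> ennreal (c + e) * d y z"
      by blast
  qed
  then show ?thesis unfolding Lip_a_eq_lipa[OF f] using c by simp
qed

text \<open>The increment of the mixture splits into k y (f y - f z), (1 - k y) (g y - g z) and (k y
  - k z) (f z - g z). Constant k gives convexity of the slope. Variable k gives a cut-and-paste rule
  whose error \<open>K * \<bar>f x - g x\<bar>\<close> disappears when f approaches g.\<close>

lemma lipa_convex_Leibniz:
  assumes d: "extended_metric d" and f: "f \<in> Lip_b d" and g: "g \<in> Lip_b d" and \<chi>: "k \<in> Lip_b d"
    and k01: "\<And>x. 0 \<le> k x \<and> k x \<le> 1" and K: "0 \<le> K" "\<And>x y. ennreal \<bar>k x - k y\<bar> \<le> ennreal K * d x y"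
  shows "lipa d (\<lambda>x. k x * f x + (1 - k x) * g x) x
    \<le> k x * lipa d f x + (1 - k x) * lipa d g x + K * \<bar>f x - g x\<bar>" (is "lipa d ?h x \<le> ?c")
proof (rule lipa_leI[OF _ d])
  show "?h \<in> Lip_b d" by (intro Lip_b_add Lip_b_mult Lip_b_diff Lip_b_const f g \<chi>)
  show "0 \<le> ?c" using k01[of x] K lipa_nonneg[of d f x] lipa_nonneg[of d g x] by (intro add_nonneg_nonneg mult_nonneg_nonneg) auto
  fix e :: real assume e: "0 < e"
  obtain Lf where Lf: "0 \<le> Lf" "\<And>x y. ennreal \<bar>f x - f y\<bar> \<le> ennreal Lf * d x y" by (rule Lip_bE[OF f]) (rule that)
  obtain Lg where Lg: "0 \<le> Lg" "\<And>x y. ennreal \<bar>g x - g y\<bar> \<le> ennreal Lg * d x y" by (rule Lip_bE[OF g]) (rule that)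
  have e2: "0 < e / 2" using e by simp
  obtain r1 where r1: "0 < r1" "\<And>y z D. d y x < ennreal r1 \<Longrightarrow> d z x < ennreal r1 \<Longrightarrow> d y z = ennreal D \<Longrightarrow> 0 \<le> D \<Longrightarrow>
    \<bar>f y - f z\<bar> \<le> (lipa d f x + e / 2) * D" by (rule lipaD[OF d f e2]) (rule that)
  obtain r2 where r2: "0 < r2" "\<And>y z D. d y x < ennreal r2 \<Longrightarrow> d z x < ennreal r2 \<Longrightarrow> d y z = ennreal D \<Longrightarrow> 0 \<le> D \<Longrightarrow>
    \<bar>g y - g z\<bar> \<le> (lipa d g x + e / 2) * D" by (rule lipaD[OF d g e2]) (rule that)
  \<comment> \<open>C gathers the errors, linear in r, of evaluating k and f - g at x instead of at
    the nearby points; r is then chosen so that C r is at most e/2.\<close>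
  define C where "C = K * \<bar>lipa d f x - lipa d g x\<bar> + K * (Lf + Lg)"
  have C: "0 \<le> C" using K Lf Lg by (auto simp: C_def)
  define r where "r = min (min r1 r2) (e / (2 * (C + 1)))"
  have r: "0 < r" "r \<le> r1" "r \<le> r2" using r1(1) r2(1) e C by (auto simp: r_def)
  have Cr: "C * r \<le> e / 2"
  proof -
    have "C * r \<le> C * (e / (2 * (C + 1)))" using C by (intro mult_left_mono) (auto simp: r_def)
    also have "\<dots> \<le> e / 2" using C e by (simp add: field_simps)
    finally show ?thesis .
  qed
  have "\<bar>?h y - ?h z\<bar> \<le> (?c + e) * D"
    if yz: "d y x < ennreal r" "d z x < ennreal r" "d y z = ennreal D" "0 \<le> D" for y z D
  proof -
    have lt: "d y x < ennreal r1" "d z x < ennreal r1" "d y x < ennreal r2" "d z x < ennreal r2"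
      using yz(1,2) r(2,3) by (auto intro: less_le_trans ennreal_leI)
    obtain Dy where Dy: "d y x = ennreal Dy" "0 \<le> Dy" "Dy < r"
      using yz(1) r(1) by (cases "d y x") (auto simp: ennreal_less_iff)
    obtain Dz where Dz: "d z x = ennreal Dz" "0 \<le> Dz" "Dz < r"
      using yz(2) r(1) by (cases "d z x") (auto simp: ennreal_less_iff)
    have 1: "\<bar>f y - f z\<bar> \<le> (lipa d f x + e / 2) * D" by (rule r1(2)[OF lt(1,2) yz(3,4)])
    have 2: "\<bar>g y - g z\<bar> \<le> (lipa d g x + e / 2) * D" by (rule r2(2)[OF lt(3,4) yz(3,4)])
    have 3: "\<bar>k y - k z\<bar> \<le> K * D" by (rule ennreal_Lipschitz_real[OF K(1) K(2) yz(3,4)])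
    have "\<bar>k y - k x\<bar> \<le> K * Dy" by (rule ennreal_Lipschitz_real[OF K(1) K(2) Dy(1,2)])
    then have 4: "\<bar>k y - k x\<bar> \<le> K * r" using Dy(3) K(1) by (meson less_imp_le mult_left_mono order_trans)
    have "\<bar>f z - f x\<bar> \<le> Lf * Dz" by (rule ennreal_Lipschitz_real[OF Lf(1) Lf(2) Dz(1,2)])
    then have 5: "\<bar>f z - f x\<bar> \<le> Lf * r" using Dz(3) Lf(1) by (meson less_imp_le mult_left_mono order_trans)
    have "\<bar>g z - g x\<bar> \<le> Lg * Dz" by (rule ennreal_Lipschitz_real[OF Lg(1) Lg(2) Dz(1,2)])
    then have 6: "\<bar>g z - g x\<bar> \<le> Lg * r" using Dz(3) Lg(1) by (meson less_imp_le mult_left_mono order_trans)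
    have "?h y - ?h z = k y * (f y - f z) + (1 - k y) * (g y - g z) + (k y - k z) * (f z - g z)"
      by (simp add: algebra_simps)
    then have "\<bar>?h y - ?h z\<bar> \<le> \<bar>k y * (f y - f z)\<bar> + \<bar>(1 - k y) * (g y - g z)\<bar> + \<bar>(k y - k z) * (f z - g z)\<bar>"
      by linarith
    also have "\<dots> = k y * \<bar>f y - f z\<bar> + (1 - k y) * \<bar>g y - g z\<bar> + \<bar>k y - k z\<bar> * \<bar>f z - g z\<bar>"
      using k01[of y] by (simp add: abs_mult)
    also have "\<dots> \<le> k y * ((lipa d f x + e / 2) * D) + (1 - k y) * ((lipa d g x + e / 2) * D)
        + (K * D) * (\<bar>f x - g x\<bar> + (Lf + Lg) * r)"
    proof -
      have "\<bar>f z - g z\<bar> \<le> \<bar>f x - g x\<bar> + (Lf + Lg) * r" using 5 6 by (simp add: distrib_right)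
      then have "\<bar>k y - k z\<bar> * \<bar>f z - g z\<bar> \<le> (K * D) * (\<bar>f x - g x\<bar> + (Lf + Lg) * r)"
        using K yz(4) by (intro mult_mono[OF 3]) simp_all
      moreover have "k y * \<bar>f y - f z\<bar> \<le> k y * ((lipa d f x + e / 2) * D)"
        using k01[of y] by (intro mult_left_mono[OF 1]) simp
      moreover have "(1 - k y) * \<bar>g y - g z\<bar> \<le> (1 - k y) * ((lipa d g x + e / 2) * D)"
        using k01[of y] by (intro mult_left_mono[OF 2]) simp
      ultimately show ?thesis by (intro add_mono)
    qed
    also have "\<dots> = (k y * lipa d f x + (1 - k y) * lipa d g x + e / 2 + K * \<bar>f x - g x\<bar> + K * (Lf + Lg) * r) * D"
    proof -
      have "s * ((A + c) * D) + (1 - s) * ((B + c) * D) + K * D * (F + M * r)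
          = (s * A + (1 - s) * B + c + K * F + K * M * r) * D" for s A B c F M :: real
        by (simp add: algebra_simps)
      then show ?thesis .
    qed
    also have "\<dots> \<le> (?c + e) * D"
    proof (rule mult_right_mono[OF _ yz(4)])
      have "k y * lipa d f x + (1 - k y) * lipa d g x
          = k x * lipa d f x + (1 - k x) * lipa d g x + (k y - k x) * (lipa d f x - lipa d g x)"
        by (simp add: algebra_simps)
      also have "(k y - k x) * (lipa d f x - lipa d g x) \<le> K * r * \<bar>lipa d f x - lipa d g x\<bar>"
      proof -
        have "(k y - k x) * (lipa d f x - lipa d g x) \<le> \<bar>k y - k x\<bar> * \<bar>lipa d f x - lipa d g x\<bar>"
          unfolding abs_mult[symmetric] by simp
        also have "\<dots> \<le> K * r * \<bar>lipa d f x - lipa d g x\<bar>" using 4 by (intro mult_right_mono) auto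
        finally show ?thesis .
      qed
      finally have "k y * lipa d f x + (1 - k y) * lipa d g x + K * (Lf + Lg) * r
          \<le> k x * lipa d f x + (1 - k x) * lipa d g x + C * r" by (simp add: C_def algebra_simps)
      then show "k y * lipa d f x + (1 - k y) * lipa d g x + e / 2 + K * \<bar>f x - g x\<bar> + K * (Lf + Lg) * r \<le> ?c + e"
        using Cr by simp
    qed
    finally show ?thesis .
  qed
  with r(1) show "\<exists>r>0. \<forall>y z D. d y x < ennreal r \<and> d z x < ennreal r \<and> d y z = ennreal D \<and> 0 \<le> D \<longrightarrow>
      \<bar>?h y - ?h z\<bar> \<le> (?c + e) * D" by blast
qed

text \<open>Take the infimum of a sequence of measurable majorants whose integrals approach the
  least possible value. Its minimum with another majorant is again a majorant and cannot have a
  smaller integral, hence agrees with it a.e. The bound L makes these integrals finite. This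
  justifies the choice in \<open>Lip_a_star\<close>.\<close>

lemma measurable_envelope_exists:
  fixes u :: "'b \<Rightarrow> ennreal"
  assumes M: "finite_measure M" and u: "\<And>x. u x \<le> ennreal L"
  shows "\<exists>G. G \<in> borel_measurable M \<and> (AE x in M. u x \<le> G x) \<and>
     (\<forall>H\<in>borel_measurable M. (AE x in M. u x \<le> H x) \<longrightarrow> (AE x in M. G x \<le> H x))"
proof -
  interpret finite_measure M by fact
  define \<H> where "\<H> = {H \<in> borel_measurable M. AE x in M. u x \<le> H x}"
  define I where "I = (INF H\<in>\<H>. \<integral>\<^sup>+x. H x \<partial>M)"
  have LH: "(\<lambda>_. ennreal L) \<in> \<H>" using u by (simp add: \<H>_def)
  then have ne: "\<H> \<noteq> {}" by auto
  have "I \<le> (\<integral>\<^sup>+x. ennreal L \<partial>M)" unfolding I_def using LH by (intro INF_lower)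
  also have "\<dots> < \<top>" by (simp add: emeasure_eq_measure ennreal_mult_less_top)
  finally have If: "I < \<top>" .
  obtain F where F: "\<And>n::nat. F n \<in> (\<lambda>H. \<integral>\<^sup>+x. H x \<partial>M) ` \<H>" "F \<longlonglongrightarrow> I"
  proof -
    obtain F where "range F \<subseteq> (\<lambda>H. \<integral>\<^sup>+x. H x \<partial>M) ` \<H>" "F \<longlonglongrightarrow> Inf ((\<lambda>H. \<integral>\<^sup>+x. H x \<partial>M) ` \<H>)"
      using Inf_as_limit[of "(\<lambda>H. \<integral>\<^sup>+x. H x \<partial>M) ` \<H>"] ne by auto
    then show thesis by (intro that[of F]) (auto simp: I_def image_subset_iff)
  qed
  then obtain H where H: "\<And>n. H n \<in> \<H>" "\<And>n. F n = (\<integral>\<^sup>+x. H n x \<partial>M)" by (simp add: image_iff) metis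
  define G where "G x = (INF n. H n x)" for x
  have Gm: "G \<in> borel_measurable M" unfolding G_def using H(1) by (intro borel_measurable_INF) (auto simp: \<H>_def)
  have "AE x in M. \<forall>n. u x \<le> H n x" using H(1) by (auto simp: AE_all_countable \<H>_def)
  then have uG: "AE x in M. u x \<le> G x" unfolding G_def by eventually_elim (auto intro: INF_greatest)
  then have G: "G \<in> \<H>" using Gm by (simp add: \<H>_def)
  have "(\<integral>\<^sup>+x. G x \<partial>M) \<le> F n" for n
    unfolding H(2) G_def by (intro nn_integral_mono INF_lower) auto
  then have "(\<integral>\<^sup>+x. G x \<partial>M) \<le> I" using F(2) by (intro LIMSEQ_le_const[OF F(2)]) auto
  then have GI: "(\<integral>\<^sup>+x. G x \<partial>M) = I" using G unfolding I_def by (intro antisym INF_lower)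
  have "AE x in M. G x \<le> K x" if K: "K \<in> borel_measurable M" "AE x in M. u x \<le> K x" for K
  proof -
    let ?m = "\<lambda>x. min (G x) (K x)"
    have mm: "?m \<in> borel_measurable M" using Gm K(1) by (intro borel_measurable_min)
    have "AE x in M. u x \<le> ?m x" using uG K(2) by eventually_elim simp
    then have "?m \<in> \<H>" using mm by (simp add: \<H>_def)
    then have Im: "I \<le> (\<integral>\<^sup>+x. ?m x \<partial>M)" unfolding I_def by (rule INF_lower)
    have mfin: "(\<integral>\<^sup>+x. ?m x \<partial>M) \<noteq> \<top>"
      using nn_integral_mono[of M ?m G] GI If by (auto simp: top_unique)
    have "(\<integral>\<^sup>+x. G x - ?m x \<partial>M) = (\<integral>\<^sup>+x. G x \<partial>M) - (\<integral>\<^sup>+x. ?m x \<partial>M)"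
      using mfin by (intro nn_integral_diff Gm mm) auto
    also have "\<dots> = 0" using Im GI by (simp add: diff_eq_0_iff_ennreal If)
    finally have "AE x in M. G x - ?m x = 0"
      using Gm mm by (subst (asm) nn_integral_0_iff_AE) auto
    moreover have "AE x in M. G x \<noteq> \<infinity>" using GI If Gm by (intro nn_integral_PInf_AE) auto
    ultimately show ?thesis
      by eventually_elim (auto simp: min_def diff_eq_0_iff_ennreal less_top split: if_splits)
  qed
  then show ?thesis using Gm uG by blast
qed

definition lips :: "'a measure \<Rightarrow> ('a \<Rightarrow> 'a \<Rightarrow> ennreal) \<Rightarrow> ('a \<Rightarrow> real) \<Rightarrow> 'a \<Rightarrow> real" where
  "lips m d f x = enn2real (Lip_a_star m d f x)"

lemma lips_nonneg: "0 \<le> lips m d f x"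
  by (simp add: lips_def)

lemma lips:
  fixes d :: "'a::t2_space \<Rightarrow> 'a \<Rightarrow> ennreal"
  assumes m: "m \<in> Radon_prob" and f: "f \<in> Lip_b d"
  shows lips_measurable: "lips m d f \<in> borel_measurable m"
    and lips_star: "AE x in m. Lip_a_star m d f x = ennreal (lips m d f x)"
    and lips_ge: "AE x in m. lipa d f x \<le> lips m d f x"
    and lips_least: "H \<in> borel_measurable m \<Longrightarrow> AE x in m. lipa d f x \<le> H x \<Longrightarrow> AE x in m. lips m d f x \<le> H x"
proof -
  interpret prob_space m using m by (simp add: Radon_prob_def)
  obtain L where L: "0 \<le> L" "\<And>x y. ennreal \<bar>f x - f y\<bar> \<le> ennreal L * d x y" by (rule Lip_bE[OF f]) (rule that)
  have le: "Lip_a d f x \<le> ennreal L" for x by (rule Lip_a_le_Lipschitz[OF L])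
  let ?P = "\<lambda>G. G \<in> borel_measurable m \<and> (AE x in m. Lip_a d f x \<le> G x) \<and>
     (\<forall>H\<in>borel_measurable m. (AE x in m. Lip_a d f x \<le> H x) \<longrightarrow> (AE x in m. G x \<le> H x))"
  have "?P (Lip_a_star m d f)"
    unfolding Lip_a_star_def using measurable_envelope_exists[OF finite_measure_axioms le] by (rule someI_ex)
  then have S: "Lip_a_star m d f \<in> borel_measurable m" "AE x in m. Lip_a d f x \<le> Lip_a_star m d f x"
    "\<And>H. H \<in> borel_measurable m \<Longrightarrow> AE x in m. Lip_a d f x \<le> H x \<Longrightarrow> AE x in m. Lip_a_star m d f x \<le> H x" by auto
  have "AE x in m. Lip_a_star m d f x \<le> ennreal L" using le by (intro S(3)) auto
  then show eq: "AE x in m. Lip_a_star m d f x = ennreal (lips m d f x)"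
    unfolding lips_def by eventually_elim (metis ennreal_enn2real ennreal_less_top le_less_trans)
  show "lips m d f \<in> borel_measurable m" unfolding lips_def using S(1) by simp
  show "AE x in m. lipa d f x \<le> lips m d f x"
    using S(2) eq by eventually_elim (simp add: Lip_a_eq_lipa[OF f] lips_nonneg)
  show "AE x in m. lips m d f x \<le> H x" if "H \<in> borel_measurable m" "AE x in m. lipa d f x \<le> H x"
  proof -
    have "AE x in m. Lip_a_star m d f x \<le> ennreal (H x)"
      using that(2) by (intro S(3)) (use that(1) in \<open>auto simp: Lip_a_eq_lipa[OF f] intro: ennreal_leI elim!: eventually_mono\<close>)
    then show ?thesis using eq that(2)
      by eventually_elim (metis ennreal_le_iff lipa_nonneg order_trans)
  qed
qed

lemma lips_le_Lipschitz:
  fixes d :: "'a::t2_space \<Rightarrow> 'a \<Rightarrow> ennreal"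
  assumes m: "m \<in> Radon_prob" and f: "f \<in> Lip_b d" and L: "0 \<le> L" "\<And>x y. ennreal \<bar>f x - f y\<bar> \<le> ennreal L * d x y"
  shows "AE x in m. lips m d f x \<le> L"
proof (rule lips_least[OF m f])
  show "AE x in m. lipa d f x \<le> L"
  proof (rule AE_I2)
    show "lipa d f x \<le> L" for x
      using Lip_a_le_Lipschitz[of L f d x, OF L] L(1) by (simp add: Lip_a_eq_lipa[OF f])
  qed
qed simp

subsection \<open>Relaxed slopes\<close>

context prob_space
begin

lemma L2_measurable: "f \<in> L2 M \<Longrightarrow> f \<in> borel_measurable M"
  and L2_integrable_power2: "f \<in> L2 M \<Longrightarrow> integrable M (\<lambda>x. (f x)\<^sup>2)"
  by (auto simp: L2_def)

lemma L2_integrable_mult: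
  assumes "f \<in> L2 M" "g \<in> L2 M"
  shows "integrable M (\<lambda>x. f x * g x)"
proof (rule Bochner_Integration.integrable_bound)
  show "integrable M (\<lambda>x. (f x)\<^sup>2 + (g x)\<^sup>2)" using assms by (auto simp: L2_def)
  show "AE x in M. norm (f x * g x) \<le> norm ((f x)\<^sup>2 + (g x)\<^sup>2)"
  proof (rule AE_I2)
    fix x
    have "2 * (\<bar>f x\<bar> * \<bar>g x\<bar>) \<le> (f x)\<^sup>2 + (g x)\<^sup>2"
      using sum_squares_bound[of "\<bar>f x\<bar>" "\<bar>g x\<bar>"] by simp
    moreover have "0 \<le> \<bar>f x\<bar> * \<bar>g x\<bar>" by simp
    ultimately show "norm (f x * g x) \<le> norm ((f x)\<^sup>2 + (g x)\<^sup>2)"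
      unfolding real_norm_def abs_mult by linarith
  qed
qed (use assms in \<open>auto simp: L2_def\<close>)

lemma L2_bounded: "f \<in> borel_measurable M \<Longrightarrow> AE x in M. \<bar>f x\<bar> \<le> B \<Longrightarrow> f \<in> L2 M"
proof -
  assume f: "f \<in> borel_measurable M" and b: "AE x in M. \<bar>f x\<bar> \<le> B"
  have "AE x in M. norm ((f x)\<^sup>2) \<le> B\<^sup>2"
    using b by eventually_elim (simp add: abs_le_square_iff[symmetric])
  then have "integrable M (\<lambda>x. (f x)\<^sup>2)" using f by (intro integrable_const_bound[of _ "B\<^sup>2"]) auto
  with f show ?thesis by (simp add: L2_def)
qed

lemma L2_const: "(\<lambda>_. c) \<in> L2 M"
  by (simp add: L2_def)

lemma L2_integrable: "f \<in> L2 M \<Longrightarrow> integrable M f"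
  using L2_integrable_mult[OF _ L2_const[of 1], of f] by simp

lemma L2_add:
  assumes f: "f \<in> L2 M" and g: "g \<in> L2 M"
  shows "(\<lambda>x. f x + g x) \<in> L2 M"
proof -
  have "(\<lambda>x. (f x + g x)\<^sup>2) = (\<lambda>x. (f x)\<^sup>2 + (g x)\<^sup>2 + 2 * (f x * g x))" by (simp add: power2_sum fun_eq_iff)
  then have "integrable M (\<lambda>x. (f x + g x)\<^sup>2)"
    using f g L2_integrable_mult[OF f g] by (auto simp: L2_def)
  with f g show ?thesis by (auto simp: L2_def)
qed

lemma L2_scale: "f \<in> L2 M \<Longrightarrow> (\<lambda>x. c * f x) \<in> L2 M"
  by (auto simp: L2_def power_mult_distrib)

lemma L2_diff: "f \<in> L2 M \<Longrightarrow> g \<in> L2 M \<Longrightarrow> (\<lambda>x. f x - g x) \<in> L2 M"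
  using L2_add[OF _ L2_scale[of g "-1"], of f] by simp

lemma L2_abs: "f \<in> L2 M \<Longrightarrow> (\<lambda>x. \<bar>f x\<bar>) \<in> L2 M"
  by (auto simp: L2_def)

lemma L2_dominated: "g \<in> borel_measurable M \<Longrightarrow> f \<in> L2 M \<Longrightarrow> AE x in M. \<bar>g x\<bar> \<le> \<bar>f x\<bar> \<Longrightarrow> g \<in> L2 M"
proof -
  assume g: "g \<in> borel_measurable M" and f: "f \<in> L2 M" and le: "AE x in M. \<bar>g x\<bar> \<le> \<bar>f x\<bar>"
  have "integrable M (\<lambda>x. (g x)\<^sup>2)"
    by (rule Bochner_Integration.integrable_bound[OF L2_integrable_power2[OF f]])
       (use g le in \<open>auto elim!: eventually_mono simp: abs_le_square_iff\<close>)
  with g show ?thesis by (simp add: L2_def)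
qed

lemma L2_norm_nonneg: "0 \<le> L2_norm M f"
  by (simp add: L2_norm_def)

lemma L2_norm_power2: "(L2_norm M f)\<^sup>2 = (\<integral>x. (f x)\<^sup>2 \<partial>M)"
  by (simp add: L2_norm_def)

lemma L2_norm_scale: "L2_norm M (\<lambda>x. c * f x) = \<bar>c\<bar> * L2_norm M f"
  by (simp add: L2_norm_def power_mult_distrib real_sqrt_mult)

lemma L2_norm_minus: "L2_norm M (\<lambda>x. f x - g x) = L2_norm M (\<lambda>x. g x - f x)"
  by (simp add: L2_norm_def power2_commute)

lemma L2_norm_mono:
  assumes "f \<in> borel_measurable M" "g \<in> L2 M" "AE x in M. \<bar>f x\<bar> \<le> \<bar>g x\<bar>"
  shows "L2_norm M f \<le> L2_norm M g"
  unfolding L2_norm_def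
proof (rule real_sqrt_le_mono, rule integral_mono_AE)
  have "f \<in> L2 M" using L2_dominated assms by blast
  then show "integrable M (\<lambda>x. (f x)\<^sup>2)" by (rule L2_integrable_power2)
  show "AE x in M. (f x)\<^sup>2 \<le> (g x)\<^sup>2" using assms(3) by eventually_elim (simp add: abs_le_square_iff)
qed (use assms in \<open>auto simp: L2_def\<close>)

lemma L2_norm_add_power2:
  assumes "f \<in> L2 M" "g \<in> L2 M"
  shows "(L2_norm M (\<lambda>x. f x + t * g x))\<^sup>2 = (L2_norm M f)\<^sup>2 + t * (2 * (\<integral>x. f x * g x \<partial>M)) + t\<^sup>2 * (L2_norm M g)\<^sup>2"
proof -
  have "(\<integral>x. (f x + t * g x)\<^sup>2 \<partial>M) = (\<integral>x. (f x)\<^sup>2 + (2 * t) * (f x * g x) + t\<^sup>2 * (g x)\<^sup>2 \<partial>M)"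
    by (intro Bochner_Integration.integral_cong) (auto simp: power2_eq_square algebra_simps)
  also have "\<dots> = (\<integral>x. (f x)\<^sup>2 \<partial>M) + (2 * t) * (\<integral>x. f x * g x \<partial>M) + t\<^sup>2 * (\<integral>x. (g x)\<^sup>2 \<partial>M)"
    using L2_integrable_power2[OF assms(1)] L2_integrable_power2[OF assms(2)] L2_integrable_mult[OF assms]
    by (subst Bochner_Integration.integral_add; (subst Bochner_Integration.integral_add)?) auto
  finally show ?thesis by (simp add: L2_norm_power2)
qed

lemma L2_Cauchy_Schwarz:
  assumes "f \<in> L2 M" "g \<in> L2 M"
  shows "\<bar>\<integral>x. f x * g x \<partial>M\<bar> \<le> L2_norm M f * L2_norm M g"
proof -
  let ?b = "\<integral>x. f x * g x \<partial>M" and ?F = "L2_norm M f" and ?G = "L2_norm M g"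
  have q: "0 \<le> ?F\<^sup>2 + t * (2 * ?b) + t\<^sup>2 * ?G\<^sup>2" for t
    using L2_norm_add_power2[OF assms, of t] by (metis zero_le_power2)
  have "?b\<^sup>2 \<le> (?F * ?G)\<^sup>2"
  proof (cases "?G = 0")
    \<comment> \<open>The quadratic in t degenerates to an affine function, so its slope must
      vanish; the t chosen below would give it the value -1.\<close>
    case True
    have "?b = 0"
    proof (rule ccontr)
      assume b: "?b \<noteq> 0"
      have "0 \<le> ?F\<^sup>2 + (- (?F\<^sup>2 + 1) / (2 * ?b)) * (2 * ?b)" using q[of "- (?F\<^sup>2 + 1) / (2 * ?b)"] True by simp
      then show False using b by (simp add: field_simps)
    qed
    then show ?thesis by simp
  next
    case False
    then have G: "?G\<^sup>2 > 0" by simp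
    have "0 \<le> ?F\<^sup>2 + (- ?b / ?G\<^sup>2) * (2 * ?b) + (- ?b / ?G\<^sup>2)\<^sup>2 * ?G\<^sup>2" by (rule q)
    also have "\<dots> = ?F\<^sup>2 - ?b\<^sup>2 / ?G\<^sup>2" using G by (simp add: power2_eq_square field_simps)
    finally show ?thesis using G by (simp add: field_simps power_mult_distrib)
  qed
  then show ?thesis using L2_norm_nonneg by (simp add: abs_le_square_iff[symmetric] abs_mult)
qed

lemma L2_norm_triangle:
  assumes "f \<in> L2 M" "g \<in> L2 M"
  shows "L2_norm M (\<lambda>x. f x + g x) \<le> L2_norm M f + L2_norm M g"
proof -
  have "(L2_norm M (\<lambda>x. f x + g x))\<^sup>2 = (L2_norm M f)\<^sup>2 + 2 * (\<integral>x. f x * g x \<partial>M) + (L2_norm M g)\<^sup>2"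
    using L2_norm_add_power2[OF assms, of 1] by simp
  also have "\<dots> \<le> (L2_norm M f + L2_norm M g)\<^sup>2"
    using L2_Cauchy_Schwarz[OF assms] by (simp add: power2_sum abs_le_iff)
  finally show ?thesis using L2_norm_nonneg by (auto intro: power2_le_imp_le add_nonneg_nonneg)
qed

lemma L2_norm_lincomb:
  assumes "f \<in> L2 M" "g \<in> L2 M"
  shows "L2_norm M (\<lambda>x. s * f x + t * g x) \<le> \<bar>s\<bar> * L2_norm M f + \<bar>t\<bar> * L2_norm M g"
  using L2_norm_triangle[OF L2_scale[OF assms(1), of s] L2_scale[OF assms(2), of t]] by (simp only: L2_norm_scale)

lemma L2_norm_le_add_diff:
  assumes "f \<in> L2 M" "g \<in> L2 M"
  shows "L2_norm M f \<le> L2_norm M g + L2_norm M (\<lambda>x. f x - g x)"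
  using L2_norm_triangle[OF assms(2) L2_diff[OF assms]] by simp

lemma L2_parallelogram:
  assumes "f \<in> L2 M" "g \<in> L2 M"
  shows "(L2_norm M (\<lambda>x. f x - g x))\<^sup>2 = 2 * (L2_norm M f)\<^sup>2 + 2 * (L2_norm M g)\<^sup>2 - (L2_norm M (\<lambda>x. f x + g x))\<^sup>2"
  using L2_norm_add_power2[OF assms, of 1] L2_norm_add_power2[OF assms, of "-1"] by simp

lemma L2_norm_eq_0_AE: "f \<in> L2 M \<Longrightarrow> L2_norm M f = 0 \<Longrightarrow> AE x in M. f x = 0"
  using integral_nonneg_eq_0_iff_AE[of M "\<lambda>x. (f x)\<^sup>2"] by (auto simp: L2_norm_def L2_def)

lemma L1_le_L2_norm: "f \<in> L2 M \<Longrightarrow> (\<integral>x. \<bar>f x\<bar> \<partial>M) \<le> L2_norm M f"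
  using L2_Cauchy_Schwarz[OF L2_abs L2_const[of 1], of f] by (simp add: L2_norm_def prob_space)

text \<open>On a probability space the L1 norm is below the L2 norm, so a subsequence converges
  a.e.; Fatou's lemma turns the Cauchy estimate into convergence of the whole sequence to that
  limit.\<close>

lemma L2_complete:
  fixes H :: "nat \<Rightarrow> 'a \<Rightarrow> real"
  assumes H: "\<And>n. H n \<in> L2 M" and C: "\<And>e. 0 < e \<Longrightarrow> \<exists>N. \<forall>i\<ge>N. \<forall>j\<ge>N. L2_norm M (\<lambda>x. H i x - H j x) < e"
  obtains G where "G \<in> L2 M" "(\<lambda>n. L2_norm M (\<lambda>x. H n x - G x)) \<longlonglongrightarrow> 0"
proof -
  have "\<exists>N. \<forall>i\<ge>N. \<forall>j\<ge>N. LINT x|M. norm (H i x - H j x) < e" if e: "0 < e" for e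
  proof -
    obtain N where N: "\<And>i j. i \<ge> N \<Longrightarrow> j \<ge> N \<Longrightarrow> L2_norm M (\<lambda>x. H i x - H j x) < e" using C[OF e] by blast
    have "LINT x|M. norm (H i x - H j x) < e" if "i \<ge> N" "j \<ge> N" for i j
      using L1_le_L2_norm[OF L2_diff[OF H[of i] H[of j]]] N[OF that] by simp
    then show ?thesis by blast
  qed
  from cauchy_L1_AE_cauchy_subseq[of M H, OF L2_integrable[OF H] this]
  obtain r where r: "strict_mono r" "AE x in M. Cauchy (\<lambda>i. H (r i) x)" by blast
  define G where "G x = lim (\<lambda>i. H (r i) x)" for x
  have Gm: "G \<in> borel_measurable M"
    unfolding G_def using H by (intro borel_measurable_lim_metric) (auto simp: L2_def)
  have conv: "AE x in M. (\<lambda>i. H (r i) x) \<longlonglongrightarrow> G x"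
    using r(2) unfolding G_def by eventually_elim (simp add: Cauchy_convergent_iff convergent_LIMSEQ_iff)
  have bd: "(\<integral>\<^sup>+x. ennreal ((H n x - G x)\<^sup>2) \<partial>M) \<le> ennreal (e\<^sup>2)"
    if e: "0 < e" and n: "\<And>j. j \<ge> n \<Longrightarrow> L2_norm M (\<lambda>x. H n x - H j x) < e" for n e
  proof -
    have "(\<integral>\<^sup>+x. ennreal ((H n x - G x)\<^sup>2) \<partial>M) \<le> (\<integral>\<^sup>+x. liminf (\<lambda>i. ennreal ((H n x - H (r i) x)\<^sup>2)) \<partial>M)"
    proof (rule nn_integral_mono_AE)
      show "AE x in M. ennreal ((H n x - G x)\<^sup>2) \<le> liminf (\<lambda>i. ennreal ((H n x - H (r i) x)\<^sup>2))"
        using conv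
      proof eventually_elim
        case (elim x)
        then have "(\<lambda>i. ennreal ((H n x - H (r i) x)\<^sup>2)) \<longlonglongrightarrow> ennreal ((H n x - G x)\<^sup>2)"
          by (intro tendsto_ennrealI tendsto_intros)
        from lim_imp_Liminf[OF sequentially_bot this] show ?case by simp
      qed
    qed
    also have "\<dots> \<le> liminf (\<lambda>i. \<integral>\<^sup>+x. ennreal ((H n x - H (r i) x)\<^sup>2) \<partial>M)"
      using L2_measurable[OF H]
      by (intro nn_integral_liminf measurable_compose[OF _ measurable_ennreal] borel_measurable_power
          borel_measurable_diff)
    also have "\<dots> \<le> ennreal (e\<^sup>2)"
    proof (rule Liminf_le)
      have "\<forall>\<^sub>F i in sequentially. r i \<ge> n"
        using filterlim_subseq[OF r(1)] by (auto simp: filterlim_at_top)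
      then show "\<forall>\<^sub>F i in sequentially. (\<integral>\<^sup>+x. ennreal ((H n x - H (r i) x)\<^sup>2) \<partial>M) \<le> ennreal (e\<^sup>2)"
      proof eventually_elim
        case (elim i)
        have "(\<integral>\<^sup>+x. ennreal ((H n x - H (r i) x)\<^sup>2) \<partial>M) = ennreal ((L2_norm M (\<lambda>x. H n x - H (r i) x))\<^sup>2)"
          unfolding L2_norm_power2 using L2_integrable_power2[OF L2_diff[OF H H]]
          by (intro nn_integral_eq_integral) auto
        also have "\<dots> \<le> ennreal (e\<^sup>2)" using n[OF elim] L2_norm_nonneg by (intro ennreal_leI power_mono) auto
        finally show ?case .
      qed
    qed simp
    finally show ?thesis .
  qed
  have L2d: "(\<lambda>x. H n x - G x) \<in> L2 M \<and> L2_norm M (\<lambda>x. H n x - G x) \<le> e"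
    if e: "0 < e" and n: "\<And>j. j \<ge> n \<Longrightarrow> L2_norm M (\<lambda>x. H n x - H j x) < e" for n e
  proof -
    have m: "(\<lambda>x. H n x - G x) \<in> borel_measurable M" using H[of n] Gm by (auto simp: L2_def)
    have "integrable M (\<lambda>x. (H n x - G x)\<^sup>2)"
      using m bd[OF e n] by (intro integrableI_bounded) (auto simp: le_less_trans)
    moreover from this have "ennreal ((L2_norm M (\<lambda>x. H n x - G x))\<^sup>2) \<le> ennreal (e\<^sup>2)"
      using bd[OF e n] nn_integral_eq_integral[of M "\<lambda>x. (H n x - G x)\<^sup>2"] unfolding L2_norm_power2 by simp
    ultimately show ?thesis using m e by (auto simp: L2_def intro: power2_le_imp_le)
  qed
  show thesis
  proof (rule that[of G])
    obtain N where N: "\<And>i j. i \<ge> N \<Longrightarrow> j \<ge> N \<Longrightarrow> L2_norm M (\<lambda>x. H i x - H j x) < 1" using C[of 1] by auto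
    have "(\<lambda>x. H N x - G x) \<in> L2 M" using L2d[of 1 N] N by auto
    from L2_diff[OF H[of N] this] show "G \<in> L2 M" by simp
    show "(\<lambda>n. L2_norm M (\<lambda>x. H n x - G x)) \<longlonglongrightarrow> 0"
    proof (rule LIMSEQ_I)
      fix e :: real assume e: "0 < e"
      then obtain N where N: "\<And>i j. i \<ge> N \<Longrightarrow> j \<ge> N \<Longrightarrow> L2_norm M (\<lambda>x. H i x - H j x) < e / 2"
        using C[of "e / 2"] by auto
      have "norm (L2_norm M (\<lambda>x. H n x - G x) - 0) < e" if "n \<ge> N" for n
        using L2d[of "e / 2" n] N that e L2_norm_nonneg[of "\<lambda>x. H n x - G x"] by fastforce
      then show "\<exists>N. \<forall>n\<ge>N. norm (L2_norm M (\<lambda>x. H n x - G x) - 0) < e" by blast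
    qed
  qed
qed

lemma L2_norm_tendsto:
  assumes "\<And>n. H n \<in> L2 M" "G \<in> L2 M" "(\<lambda>n. L2_norm M (\<lambda>x. H n x - G x)) \<longlonglongrightarrow> 0"
  shows "(\<lambda>n. L2_norm M (H n)) \<longlonglongrightarrow> L2_norm M G"
proof -
  have "\<bar>L2_norm M (H n) - L2_norm M G\<bar> \<le> L2_norm M (\<lambda>x. H n x - G x)" for n
    using L2_norm_le_add_diff[OF assms(1)[of n] assms(2)] L2_norm_le_add_diff[OF assms(2) assms(1)[of n]]
      L2_norm_minus[of "H n" G] by simp
  then have "(\<lambda>n. L2_norm M (H n) - L2_norm M G) \<longlonglongrightarrow> 0"
    by (intro Lim_null_comparison[OF _ assms(3)]) auto
  then show ?thesis by (simp add: LIM_zero_iff)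
qed

lemma L2_limit_nonneg:
  assumes "\<And>n. H n \<in> L2 M" "G \<in> L2 M" "(\<lambda>n. L2_norm M (\<lambda>x. H n x - G x)) \<longlonglongrightarrow> 0" "\<And>n. AE x in M. 0 \<le> H n x"
  shows "AE x in M. 0 \<le> G x"
proof -
  have m: "(\<lambda>x. max 0 (- G x)) \<in> borel_measurable M" using assms(2) by (auto simp: L2_def)
  have l2: "(\<lambda>x. max 0 (- G x)) \<in> L2 M" by (rule L2_dominated[OF m assms(2)]) auto
  have "L2_norm M (\<lambda>x. max 0 (- G x)) \<le> L2_norm M (\<lambda>x. H n x - G x)" for n
    using assms(4)[of n] by (intro L2_norm_mono m L2_diff assms) (auto elim!: eventually_mono)
  then have "L2_norm M (\<lambda>x. max 0 (- G x)) \<le> 0" by (intro LIMSEQ_le_const[OF assms(3)]) auto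
  then have "AE x in M. max 0 (- G x) = 0"
    using L2_norm_nonneg[of "\<lambda>x. max 0 (- G x)"] by (intro L2_norm_eq_0_AE l2) auto
  then show ?thesis by eventually_elim (auto simp: max_def split: if_splits)
qed

end

section \<open>Minimal relaxed slopes through strong limits\<close>

locale emms =
  fixes d :: "'a::t2_space \<Rightarrow> 'a \<Rightarrow> ennreal" and m :: "'a measure"
  assumes d: "extended_metric_topological_space d" and m: "m \<in> Radon_prob"
begin

lemma ext: "extended_metric d"
  using d by (simp add: extended_metric_topological_space_def)

lemma prob: "prob_space m"
  using m by (simp add: Radon_prob_def)

sublocale prob_space m by (rule prob)

lemma sets_m [measurable_cong]: "sets m = sets borel"
  using m by (simp add: Radon_prob_def)

lemma space_m [simp]: "space m = UNIV"
  using sets_eq_imp_space_eq[OF sets_m] by simp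

abbreviation "lp \<equiv> lips m d"
abbreviation "nrm \<equiv> L2_norm m"

lemma Lip_b_L2: "f \<in> Lip_b d \<Longrightarrow> f \<in> L2 m"
proof -
  assume f: "f \<in> Lip_b d"
  obtain B where "\<And>x. \<bar>f x\<bar> \<le> B" by (rule Lip_bE[OF f]) (rule that)
  then show ?thesis using Lip_b_integrable(1)[OF f m] by (intro L2_bounded[of _ B]) auto
qed

lemma lp_bounded:
  assumes f: "f \<in> Lip_b d"
  obtains L where "0 \<le> L" "AE x in m. lp f x \<le> L"
proof -
  obtain L where "0 \<le> L" "\<And>x y. ennreal \<bar>f x - f y\<bar> \<le> ennreal L * d x y" by (rule Lip_bE[OF f]) (rule that)
  with lips_le_Lipschitz[OF m f] that show thesis by blast
qed

lemma lp_L2: "f \<in> Lip_b d \<Longrightarrow> lp f \<in> L2 m"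
proof -
  assume f: "f \<in> Lip_b d"
  obtain L where L: "0 \<le> L" "AE x in m. lp f x \<le> L" by (rule lp_bounded[OF f]) (rule that)
  then show ?thesis using lips_measurable[OF m f]
    by (intro L2_bounded[of _ L]) (auto simp: lips_nonneg)
qed

lemma lp_Leibniz:
  assumes "f \<in> Lip_b d" "g \<in> Lip_b d" "k \<in> Lip_b d" "\<And>x. 0 \<le> k x \<and> k x \<le> 1"
    "0 \<le> K" "\<And>x y. ennreal \<bar>k x - k y\<bar> \<le> ennreal K * d x y"
  shows "AE x in m. lp (\<lambda>x. k x * f x + (1 - k x) * g x) x \<le> k x * lp f x + (1 - k x) * lp g x + K * \<bar>f x - g x\<bar>"
proof (rule lips_least[OF m])
  show "(\<lambda>x. k x * f x + (1 - k x) * g x) \<in> Lip_b d"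
    by (intro Lip_b_add Lip_b_mult Lip_b_diff Lip_b_const assms)
  show "(\<lambda>x. k x * lp f x + (1 - k x) * lp g x + K * \<bar>f x - g x\<bar>) \<in> borel_measurable m"
    using assms(1,2,3) Lip_b_integrable(1)[OF _ m] lips_measurable[OF m] by measurable
  show "AE x in m. lipa d (\<lambda>x. k x * f x + (1 - k x) * g x) x \<le> k x * lp f x + (1 - k x) * lp g x + K * \<bar>f x - g x\<bar>"
    using lips_ge[OF m assms(1)] lips_ge[OF m assms(2)]
  proof eventually_elim
    case (elim x)
    have "k x * lipa d f x + (1 - k x) * lipa d g x \<le> k x * lp f x + (1 - k x) * lp g x"
      using elim assms(4)[of x] by (intro add_mono mult_left_mono) auto
    then show ?case using lipa_convex_Leibniz[OF ext assms, of x] by linarith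
  qed
qed

lemma lp_convex:
  assumes "f \<in> Lip_b d" "g \<in> Lip_b d" "0 \<le> t" "t \<le> 1"
  shows "AE x in m. lp (\<lambda>x. t * f x + (1 - t) * g x) x \<le> t * lp f x + (1 - t) * lp g x"
  using lp_Leibniz[OF assms(1,2) Lip_b_const[of t], of 0] assms(3,4) by simp

text \<open>
  Relaxed slopes are defined by weak limits. Strong limits of majorants of the slopes suffice, by
  Mazur's lemma below, and are stable under limits.
\<close>

definition upper_slope :: "('a \<Rightarrow> real) \<Rightarrow> ('a \<Rightarrow> real) \<Rightarrow> bool" where
  "upper_slope f G \<longleftrightarrow> G \<in> L2 m \<and> (\<exists>F H. (\<forall>n::nat. F n \<in> Lip_b d \<and> H n \<in> L2 m \<and> (AE x in m. lp (F n) x \<le> H n x)) \<and>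
     (\<lambda>n. nrm (\<lambda>x. F n x - f x)) \<longlonglongrightarrow> 0 \<and> (\<lambda>n. nrm (\<lambda>x. H n x - G x)) \<longlonglongrightarrow> 0)"

lemma upper_slope_nonneg: "upper_slope f G \<Longrightarrow> AE x in m. 0 \<le> G x"
proof -
  assume "upper_slope f G"
  then obtain F H where *: "G \<in> L2 m" "\<And>n::nat. F n \<in> Lip_b d \<and> H n \<in> L2 m \<and> (AE x in m. lp (F n) x \<le> H n x)"
    "(\<lambda>n. nrm (\<lambda>x. H n x - G x)) \<longlonglongrightarrow> 0" unfolding upper_slope_def by blast
  show ?thesis
  proof (rule L2_limit_nonneg[OF _ *(1) *(3)])
    show "H n \<in> L2 m" for n using *(2) by blast
    show "AE x in m. 0 \<le> H n x" for n
    proof -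
      have "AE x in m. lp (F n) x \<le> H n x" using *(2) by blast
      then show ?thesis by eventually_elim (rule order_trans[OF lips_nonneg])
    qed
  qed
qed

text \<open>Along a sequence with finite lower limit of the energies, the energy is frequently below
  a and the distance to f eventually below e, so some member has both properties.\<close>

lemma Ch_finite_approx:
  assumes "Ch m d f < \<top>"
  obtains A where "0 \<le> A" "\<And>e. 0 < e \<Longrightarrow> \<exists>F\<in>Lip_b d. nrm (\<lambda>x. F x - f x) < e \<and> nrm (lp F) \<le> A"
proof -
  obtain F where F: "\<And>n. F n \<in> Lip_b d" "L2_tendsto m F f"
    "liminf (\<lambda>n. \<integral>\<^sup>+x. (Lip_a_star m d (F n) x)\<^sup>2 \<partial>m) < \<top>"
    using assms unfolding Ch_def INF_less_iff by auto
  then obtain a where a: "liminf (\<lambda>n. \<integral>\<^sup>+x. (Lip_a_star m d (F n) x)\<^sup>2 \<partial>m) < ennreal a" "0 < a"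
  proof -
    obtain b where b: "liminf (\<lambda>n. \<integral>\<^sup>+x. (Lip_a_star m d (F n) x)\<^sup>2 \<partial>m) = ennreal b" "0 \<le> b"
      using F(3) by (cases "liminf (\<lambda>n. \<integral>\<^sup>+x. (Lip_a_star m d (F n) x)\<^sup>2 \<partial>m)") auto
    then have "liminf (\<lambda>n. \<integral>\<^sup>+x. (Lip_a_star m d (F n) x)\<^sup>2 \<partial>m) < ennreal (b + 1)"
      by (simp add: ennreal_less_iff del: ennreal_plus)
    with b(2) show thesis by (intro that[of "b + 1"]) auto
  qed
  have eq: "(\<integral>\<^sup>+x. (Lip_a_star m d (F n) x)\<^sup>2 \<partial>m) = ennreal ((nrm (lp (F n)))\<^sup>2)" for n
  proof -
    have "(\<integral>\<^sup>+x. (Lip_a_star m d (F n) x)\<^sup>2 \<partial>m) = (\<integral>\<^sup>+x. ennreal ((lp (F n) x)\<^sup>2) \<partial>m)"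
      using lips_star[OF m F(1)[of n]] by (intro nn_integral_cong_AE) (auto elim!: eventually_mono simp: ennreal_power lips_nonneg)
    also have "\<dots> = ennreal ((nrm (lp (F n)))\<^sup>2)"
      unfolding L2_norm_power2 using L2_integrable_power2[OF lp_L2[OF F(1)[of n]]]
      by (intro nn_integral_eq_integral) auto
    finally show ?thesis .
  qed
  show thesis
  proof (rule that[of "sqrt a"])
    fix e :: real assume e: "0 < e"
    have fr: "\<exists>\<^sub>F n in sequentially. (\<integral>\<^sup>+x. (Lip_a_star m d (F n) x)\<^sup>2 \<partial>m) < ennreal a"
    proof (rule ccontr)
      assume "\<not> ?thesis"
      then have "\<forall>\<^sub>F n in sequentially. ennreal a \<le> (\<integral>\<^sup>+x. (Lip_a_star m d (F n) x)\<^sup>2 \<partial>m)"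
        by (simp add: not_frequently not_less)
      then have "ennreal a \<le> liminf (\<lambda>n. \<integral>\<^sup>+x. (Lip_a_star m d (F n) x)\<^sup>2 \<partial>m)" by (rule Liminf_bounded)
      with a show False by simp
    qed
    have ev: "\<forall>\<^sub>F n in sequentially. nrm (\<lambda>x. F n x - f x) < e"
      using F(2) e unfolding L2_tendsto_def by (intro order_tendstoD(2)) auto
    have "\<exists>\<^sub>F n in sequentially. nrm (\<lambda>x. F n x - f x) < e \<and> (\<integral>\<^sup>+x. (Lip_a_star m d (F n) x)\<^sup>2 \<partial>m) < ennreal a"
      by (rule frequently_rev_mp[OF fr]) (use ev in \<open>auto elim: eventually_mono\<close>)
    then obtain n where n: "nrm (\<lambda>x. F n x - f x) < e" "(\<integral>\<^sup>+x. (Lip_a_star m d (F n) x)\<^sup>2 \<partial>m) < ennreal a"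
      using frequently_ex by blast
    then have "(nrm (lp (F n)))\<^sup>2 < a" using a(2) unfolding eq by (simp add: ennreal_less_iff)
    then have "nrm (lp (F n)) \<le> sqrt a" using real_less_rsqrt less_imp_le by blast
    with n F(1) show "\<exists>F\<in>Lip_b d. nrm (\<lambda>x. F x - f x) < e \<and> nrm (lp F) \<le> sqrt a" by blast
  qed (use a in auto)
qed

text \<open>
  The energies of near-minimisers in shrinking \<open>L\<^sup>2\<close> balls around \<open>f\<close> converge to their supremum, so
  by convexity and the parallelogram identity their slopes form a Cauchy sequence.
\<close>

lemma minimal_upper_slope_exists:
  assumes f: "f \<in> Ch_domain m d"
  obtains G F where "G \<in> L2 m" "\<And>n::nat. F n \<in> Lip_b d" "(\<lambda>n. nrm (\<lambda>x. F n x - f x)) \<longlonglongrightarrow> 0"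
    "(\<lambda>n. nrm (\<lambda>x. lp (F n) x - G x)) \<longlonglongrightarrow> 0" "\<And>H. upper_slope f H \<Longrightarrow> nrm G \<le> nrm H"
proof -
  have fL: "f \<in> L2 m" and Chf: "Ch m d f < \<top>" using f by (auto simp: Ch_domain_def)
  obtain A where A: "0 \<le> A" "\<And>e. 0 < e \<Longrightarrow> \<exists>F\<in>Lip_b d. nrm (\<lambda>x. F x - f x) < e \<and> nrm (lp F) \<le> A"
    by (rule Ch_finite_approx[OF Chf]) (rule that)
  define e where "e n = 1 / real (Suc n)" for n
  have e: "0 < e n" "n \<le> k \<Longrightarrow> e k \<le> e n" for n k by (auto simp: e_def frac_le)
  have e0: "e \<longlonglongrightarrow> 0" unfolding e_def using LIMSEQ_inverse_real_of_nat by (simp add: inverse_eq_divide)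
  define E where "E n = {F \<in> Lip_b d. nrm (\<lambda>x. F x - f x) < e n}" for n
  define c where "c n = (INF F\<in>E n. nrm (lp F))" for n
  have bdd: "bdd_below ((\<lambda>F. nrm (lp F)) ` E n)" for n by (intro bdd_belowI[of _ 0]) (auto simp: L2_norm_nonneg)
  have ne: "E n \<noteq> {}" for n using A(2)[OF e(1)[of n]] by (auto simp: E_def)
  have c0: "0 \<le> c n" for n unfolding c_def by (rule cINF_greatest[OF ne]) (rule L2_norm_nonneg)
  have cle: "c n \<le> nrm (lp F)" if "F \<in> E n" for F n unfolding c_def by (rule cINF_lower[OF bdd that])
  have cA: "c n \<le> A" for n
  proof -
    obtain F where "F \<in> E n" "nrm (lp F) \<le> A" using A(2)[OF e(1)[of n]] by (auto simp: E_def)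
    with cle[of F n] show ?thesis by simp
  qed
  have Esub: "E k \<subseteq> E n" if "n \<le> k" for n k using e(2)[OF that] by (auto simp: E_def)
  have "incseq c" unfolding incseq_def c_def using Esub by (auto intro!: cINF_superset_mono ne bdd)
  then obtain c' where c': "c \<longlonglongrightarrow> c'" "\<And>n. c n \<le> c'" using incseq_convergent[of c A] cA by blast
  have "\<exists>F\<in>E n. nrm (lp F) < c n + e n" for n
    using e(1)[of n] by (subst cINF_less_iff[OF ne bdd, symmetric]) (simp add: c_def)
  then obtain F where F: "\<And>n. F n \<in> E n" "\<And>n. nrm (lp (F n)) < c n + e n" by metis
  have FL: "F n \<in> Lip_b d" for n using F(1) by (auto simp: E_def)
  \<comment> \<open>What the parallelogram identity leaves: both slopes have norm at most c' + e n,
    while their sum has norm at least 2 c n because the midpoint of F n and F k still lies in E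
    n.\<close>
  define q where "q n = 4 * ((c' + e n)\<^sup>2 - (c n)\<^sup>2)" for n
  have q0: "q \<longlonglongrightarrow> 0"
  proof -
    have "q \<longlonglongrightarrow> 4 * ((c' + 0)\<^sup>2 - c'\<^sup>2)" unfolding q_def by (intro tendsto_intros e0 c'(1))
    then show ?thesis by simp
  qed
  have key: "(nrm (\<lambda>x. lp (F n) x - lp (F k) x))\<^sup>2 \<le> q n" if nk: "n \<le> k" for n k
  proof -
    define h where "h x = 1 / 2 * F n x + (1 - 1 / 2) * F k x" for x
    have hL: "h \<in> Lip_b d" unfolding h_def by (intro Lip_b_add Lip_b_scale FL)
    have "nrm (\<lambda>x. h x - f x) < e n"
    proof -
      have "(\<lambda>x. h x - f x) = (\<lambda>x. 1 / 2 * (F n x - f x) + 1 / 2 * (F k x - f x))"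
        by (simp add: h_def fun_eq_iff field_simps)
      then have "nrm (\<lambda>x. h x - f x) \<le> \<bar>1 / 2\<bar> * nrm (\<lambda>x. F n x - f x) + \<bar>1 / 2\<bar> * nrm (\<lambda>x. F k x - f x)"
        by (simp only:) (intro L2_norm_lincomb L2_diff Lip_b_L2[OF FL] fL)
      also have "\<dots> < e n" using F(1)[of n] F(1)[of k] Esub[OF nk] by (auto simp: E_def)
      finally show ?thesis .
    qed
    then have "c n \<le> nrm (lp h)" using hL by (intro cle) (simp add: E_def)
    also have "nrm (lp h) \<le> nrm (\<lambda>x. 1 / 2 * (lp (F n) x + lp (F k) x))"
    proof (rule L2_norm_mono[OF lips_measurable[OF m hL]])
      show "(\<lambda>x. 1 / 2 * (lp (F n) x + lp (F k) x)) \<in> L2 m" by (intro L2_scale L2_add lp_L2 FL)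
      show "AE x in m. \<bar>lp h x\<bar> \<le> \<bar>1 / 2 * (lp (F n) x + lp (F k) x)\<bar>"
        using lp_convex[OF FL[of n] FL[of k], of "1 / 2"] lips_nonneg[of m d] unfolding h_def[symmetric]
        by (auto elim!: eventually_mono simp: field_simps)
    qed
    also have "\<dots> = 1 / 2 * nrm (\<lambda>x. lp (F n) x + lp (F k) x)" by (simp only: L2_norm_scale)
    finally have "2 * c n \<le> nrm (\<lambda>x. lp (F n) x + lp (F k) x)" by simp
    then have "(2 * c n)\<^sup>2 \<le> (nrm (\<lambda>x. lp (F n) x + lp (F k) x))\<^sup>2" using c0 by (intro power_mono) auto
    moreover have "(nrm (lp (F n)))\<^sup>2 \<le> (c' + e n)\<^sup>2"
      using F(2)[of n] c'(2)[of n] L2_norm_nonneg by (intro power_mono) auto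
    moreover have "(nrm (lp (F k)))\<^sup>2 \<le> (c' + e n)\<^sup>2"
      using F(2)[of k] c'(2)[of k] e(2)[OF nk] L2_norm_nonneg by (intro power_mono) auto
    ultimately show ?thesis
      using L2_parallelogram[OF lp_L2[OF FL[of n]] lp_L2[OF FL[of k]]] by (simp add: q_def power_mult_distrib)
  qed
  have "\<exists>N. \<forall>i\<ge>N. \<forall>j\<ge>N. nrm (\<lambda>x. lp (F i) x - lp (F j) x) < r" if r: "0 < r" for r
  proof -
    have "\<forall>\<^sub>F n in sequentially. q n < r\<^sup>2" using q0 r by (intro order_tendstoD(2)) auto
    then obtain N where N: "\<And>n. n \<ge> N \<Longrightarrow> q n < r\<^sup>2" by (auto simp: eventually_sequentially)
    have *: "nrm (\<lambda>x. lp (F i) x - lp (F j) x) < r" if "N \<le> i" "i \<le> j" for i j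
      using key[OF that(2)] N[OF that(1)] r by (intro power2_less_imp_less[of _ r]) auto
    have "nrm (\<lambda>x. lp (F i) x - lp (F j) x) < r" if "N \<le> i" "N \<le> j" for i j
      using *[of i j] *[of j i] that L2_norm_minus[of "lp (F i)" "lp (F j)"] by (cases "i \<le> j") auto
    then show ?thesis by blast
  qed
  from L2_complete[OF lp_L2[OF FL] this] obtain G where G: "G \<in> L2 m" "(\<lambda>n. nrm (\<lambda>x. lp (F n) x - G x)) \<longlonglongrightarrow> 0"
    by blast
  show thesis
  proof (rule that[OF G(1) FL _ G(2)])
    show "(\<lambda>n. nrm (\<lambda>x. F n x - f x)) \<longlonglongrightarrow> 0"
      using F(1) L2_norm_nonneg by (intro Lim_null_comparison[OF _ e0]) (auto simp: E_def intro!: always_eventually less_imp_le)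
    fix H assume "upper_slope f H"
    then obtain F' H' where *: "H \<in> L2 m" "\<And>n::nat. F' n \<in> Lip_b d" "\<And>n. H' n \<in> L2 m" "\<And>n. AE x in m. lp (F' n) x \<le> H' n x"
      "(\<lambda>n. nrm (\<lambda>x. F' n x - f x)) \<longlonglongrightarrow> 0" "(\<lambda>n. nrm (\<lambda>x. H' n x - H x)) \<longlonglongrightarrow> 0"
      unfolding upper_slope_def by blast
    \<comment> \<open>The functions approximating a competitor eventually enter the ball E
      n.\<close>
    have "c n \<le> nrm H" for n
    proof (rule LIMSEQ_le_const[OF L2_norm_tendsto[OF *(3,1,6)]])
      have "\<forall>\<^sub>F k in sequentially. nrm (\<lambda>x. F' k x - f x) < e n" using *(5) e(1) by (rule order_tendstoD(2))
      then obtain N where N: "\<And>k. k \<ge> N \<Longrightarrow> nrm (\<lambda>x. F' k x - f x) < e n" by (auto simp: eventually_sequentially)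
      have "c n \<le> nrm (H' k)" if "k \<ge> N" for k
      proof -
        have "c n \<le> nrm (lp (F' k))" using N[OF that] *(2) by (intro cle) (simp add: E_def)
        also have "\<dots> \<le> nrm (H' k)"
          using *(4)[of k] lips_nonneg[of m d "F' k"]
          by (intro L2_norm_mono[OF lips_measurable[OF m *(2)] *(3)]) (auto elim!: eventually_mono intro: order_trans)
        finally show ?thesis .
      qed
      then show "\<exists>N. \<forall>k\<ge>N. c n \<le> nrm (H' k)" by blast
    qed
    then have cH: "c' \<le> nrm H" using c'(1) by (intro LIMSEQ_le_const2) auto
    have "nrm G \<le> c' + 0"
    proof (rule LIMSEQ_le[OF L2_norm_tendsto[OF lp_L2[OF FL] G]])
      show "(\<lambda>n. c n + e n) \<longlonglongrightarrow> c' + 0" by (intro tendsto_intros c' e0)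
      show "\<exists>N. \<forall>n\<ge>N. nrm (lp (F n)) \<le> c n + e n" using F(2) by (auto intro: less_imp_le)
    qed
    with cH show "nrm G \<le> nrm H" by simp
  qed
qed

text \<open>Convex hull of a tail of the sequence of pairs. Functions and slope majorants are
  combined together so that both receive the same weights.\<close>

inductive_set conv_tail :: "(nat \<Rightarrow> 'a \<Rightarrow> real) \<Rightarrow> (nat \<Rightarrow> 'a \<Rightarrow> real) \<Rightarrow> nat \<Rightarrow> (('a \<Rightarrow> real) \<times> ('a \<Rightarrow> real)) set"
  for F H :: "nat \<Rightarrow> 'a \<Rightarrow> real" and n :: nat where
  base: "n \<le> k \<Longrightarrow> (F k, H k) \<in> conv_tail F H n"
| comb: "(u, v) \<in> conv_tail F H n \<Longrightarrow> (u', v') \<in> conv_tail F H n \<Longrightarrow> 0 \<le> t \<Longrightarrow> t \<le> 1 \<Longrightarrow>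
    ((\<lambda>x. t * u x + (1 - t) * u' x), (\<lambda>x. t * v x + (1 - t) * v' x)) \<in> conv_tail F H n"

lemma conv_tail_props:
  assumes F: "\<And>k. n \<le> k \<Longrightarrow> F k \<in> Lip_b d" and H: "\<And>k. H k = lp (F k)"
    and f: "f \<in> L2 m" and e: "\<And>k. n \<le> k \<Longrightarrow> nrm (\<lambda>x. F k x - f x) \<le> e"
    and uv: "(u, v) \<in> conv_tail F H n"
  shows "u \<in> Lip_b d \<and> v \<in> L2 m \<and> (AE x in m. lp u x \<le> v x) \<and> nrm (\<lambda>x. u x - f x) \<le> e"
  using uv
proof (induction rule: conv_tail.induct)
  case (base k)
  then show ?case using F e by (auto simp: H lp_L2)
next
  case (comb u v u' v' t)
  then have *: "u \<in> Lip_b d" "v \<in> L2 m" "AE x in m. lp u x \<le> v x" "nrm (\<lambda>x. u x - f x) \<le> e"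
    "u' \<in> Lip_b d" "v' \<in> L2 m" "AE x in m. lp u' x \<le> v' x" "nrm (\<lambda>x. u' x - f x) \<le> e" "0 \<le> t" "t \<le> 1" by auto
  have "AE x in m. lp (\<lambda>x. t * u x + (1 - t) * u' x) x \<le> t * v x + (1 - t) * v' x"
    using lp_convex[OF *(1,5,9,10)] *(3,7)
  proof eventually_elim
    case (elim x)
    have "t * lp u x + (1 - t) * lp u' x \<le> t * v x + (1 - t) * v' x"
      using elim *(9,10) by (intro add_mono mult_left_mono) auto
    with elim(1) show ?case by linarith
  qed
  moreover have "nrm (\<lambda>x. (t * u x + (1 - t) * u' x) - f x) \<le> e"
  proof -
    have "(\<lambda>x. (t * u x + (1 - t) * u' x) - f x) = (\<lambda>x. t * (u x - f x) + (1 - t) * (u' x - f x))"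
      by (simp add: fun_eq_iff algebra_simps)
    then have "nrm (\<lambda>x. (t * u x + (1 - t) * u' x) - f x) \<le> \<bar>t\<bar> * nrm (\<lambda>x. u x - f x) + \<bar>1 - t\<bar> * nrm (\<lambda>x. u' x - f x)"
      by (simp only:) (intro L2_norm_lincomb L2_diff Lip_b_L2 * f)
    also have "\<dots> = t * nrm (\<lambda>x. u x - f x) + (1 - t) * nrm (\<lambda>x. u' x - f x)"
      using *(9,10) by simp
    also have "\<dots> \<le> t * e + (1 - t) * e" using * by (intro add_mono mult_left_mono) auto
    finally show ?thesis by (simp add: algebra_simps)
  qed
  ultimately show ?case using * by (auto intro!: Lip_b_add Lip_b_scale L2_add L2_scale)
qed

text \<open>
  Mazur's lemma for the slopes: the projection \<open>Z\<close> of the weak limit onto the convex hull of a tail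
  satisfies the variational inequality against every member of the tail, and passing to the weak
  limit there forces \<open>Z\<close> to be that limit.
\<close>

lemma conv_tail_approx:
  assumes F: "\<And>k. F k \<in> Lip_b d" and H: "\<And>k. H k = lp (F k)" and f: "f \<in> L2 m"
    and e: "\<And>k. n \<le> k \<Longrightarrow> nrm (\<lambda>x. F k x - f x) \<le> e"
    and weak: "L2_weak_tendsto m H g" and r: "0 < r"
  shows "\<exists>(u, v)\<in>conv_tail F H n. nrm (\<lambda>x. v x - g x) < r"
proof -
  have g: "g \<in> L2 m" and wl: "\<And>h. h \<in> L2 m \<Longrightarrow> (\<lambda>n. \<integral>x. H n x * h x \<partial>m) \<longlonglongrightarrow> (\<integral>x. g x * h x \<partial>m)"
    using weak by (auto simp: L2_weak_tendsto_def)
  let ?T = "conv_tail F H n"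
  define V where "V = snd ` ?T"
  have VL: "v \<in> L2 m" if "v \<in> V" for v
    using that conv_tail_props[OF F H f e] by (auto simp: V_def)
  have Vc: "(\<lambda>x. t * v x + (1 - t) * v' x) \<in> V" if V: "v \<in> V" "v' \<in> V" and t: "0 \<le> t" "t \<le> 1" for v v' t
  proof -
    obtain z z' where z: "z \<in> ?T" "v = snd z" "z' \<in> ?T" "v' = snd z'"
      using V unfolding V_def by blast
    define u u' where "u = fst z" and "u' = fst z'"
    have u: "(u, v) \<in> ?T" "(u', v') \<in> ?T" using z by (simp_all add: u_def u'_def)
    have "snd ((\<lambda>x. t * u x + (1 - t) * u' x), (\<lambda>x. t * v x + (1 - t) * v' x)) \<in> V"
      unfolding V_def using conv_tail.comb[OF u t] by (rule imageI)
    then show ?thesis by simp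
  qed
  have VH: "H k \<in> V" if "n \<le> k" for k
    unfolding V_def using conv_tail.base[OF that, of F H] by force
  have Vne: "V \<noteq> {}" using VH[of n] by auto
  define D where "D v = nrm (\<lambda>x. v x - g x)" for v
  define c where "c = (INF v\<in>V. D v)"
  have bdd: "bdd_below (D ` V)" by (intro bdd_belowI[of _ 0]) (auto simp: D_def L2_norm_nonneg)
  have cle: "c \<le> D v" if "v \<in> V" for v unfolding c_def by (rule cINF_lower[OF bdd that])
  have c0: "0 \<le> c" unfolding c_def by (rule cINF_greatest[OF Vne]) (simp add: D_def L2_norm_nonneg)
  define s where "s n = 1 / real (Suc n)" for n
  have s: "0 < s n" "n \<le> k \<Longrightarrow> s k \<le> s n" for n k by (auto simp: s_def frac_le)
  have s0: "s \<longlonglongrightarrow> 0" unfolding s_def using LIMSEQ_inverse_real_of_nat by (simp add: inverse_eq_divide)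
  have "\<exists>v\<in>V. D v < c + s i" for i
    using s(1)[of i] by (subst cINF_less_iff[OF Vne bdd, symmetric]) (simp add: c_def)
  then obtain v where v: "\<And>i. v i \<in> V" "\<And>i. D (v i) < c + s i" by metis
  define q where "q n = 4 * ((c + s n)\<^sup>2 - c\<^sup>2)" for n
  have q0: "q \<longlonglongrightarrow> 0"
  proof -
    have "q \<longlonglongrightarrow> 4 * ((c + 0)\<^sup>2 - c\<^sup>2)" unfolding q_def by (intro tendsto_intros s0)
    then show ?thesis by simp
  qed
  have key: "(nrm (\<lambda>x. v i x - v j x))\<^sup>2 \<le> q i" if ij: "i \<le> j" for i j
  proof -
    have "c \<le> D (\<lambda>x. 1 / 2 * v i x + (1 - 1 / 2) * v j x)" by (intro cle Vc v) auto
    also have "\<dots> = nrm (\<lambda>x. 1 / 2 * ((v i x - g x) + (v j x - g x)))"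
      unfolding D_def by (intro arg_cong[of _ _ nrm] ext) (simp add: field_simps)
    also have "\<dots> = 1 / 2 * nrm (\<lambda>x. (v i x - g x) + (v j x - g x))" by (simp only: L2_norm_scale)
    finally have "2 * c \<le> nrm (\<lambda>x. (v i x - g x) + (v j x - g x))" by simp
    then have "(2 * c)\<^sup>2 \<le> (nrm (\<lambda>x. (v i x - g x) + (v j x - g x)))\<^sup>2" using c0 by (intro power_mono) auto
    moreover have "(D (v i))\<^sup>2 \<le> (c + s i)\<^sup>2"
      using v(2)[of i] L2_norm_nonneg by (intro power_mono) (auto simp: D_def)
    moreover have "(D (v j))\<^sup>2 \<le> (c + s i)\<^sup>2"
      using v(2)[of j] s(2)[OF ij] L2_norm_nonneg by (intro power_mono) (auto simp: D_def)
    moreover have "(nrm (\<lambda>x. v i x - v j x))\<^sup>2 = 2 * (D (v i))\<^sup>2 + 2 * (D (v j))\<^sup>2 - (nrm (\<lambda>x. (v i x - g x) + (v j x - g x)))\<^sup>2"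
      using L2_parallelogram[OF L2_diff[OF VL[OF v(1)[of i]] g] L2_diff[OF VL[OF v(1)[of j]] g]]
      by (simp add: D_def)
    ultimately show ?thesis by (simp add: q_def power_mult_distrib)
  qed
  have "\<exists>N. \<forall>i\<ge>N. \<forall>j\<ge>N. nrm (\<lambda>x. v i x - v j x) < r" if r: "0 < r" for r
  proof -
    have "\<forall>\<^sub>F n in sequentially. q n < r\<^sup>2" using q0 r by (intro order_tendstoD(2)) auto
    then obtain N where N: "\<And>n. n \<ge> N \<Longrightarrow> q n < r\<^sup>2" by (auto simp: eventually_sequentially)
    have *: "nrm (\<lambda>x. v i x - v j x) < r" if "N \<le> i" "i \<le> j" for i j
      using key[OF that(2)] N[OF that(1)] r by (intro power2_less_imp_less[of _ r]) auto
    have "nrm (\<lambda>x. v i x - v j x) < r" if "N \<le> i" "N \<le> j" for i j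
      using *[of i j] *[of j i] that L2_norm_minus[of "v i" "v j"] by (cases "i \<le> j") auto
    then show ?thesis by blast
  qed
  from L2_complete[OF VL[OF v(1)] this] obtain Z where Z: "Z \<in> L2 m" "(\<lambda>n. nrm (\<lambda>x. v n x - Z x)) \<longlonglongrightarrow> 0"
    by blast
  define w where "w x = Z x - g x" for x
  have w: "w \<in> L2 m" unfolding w_def by (intro L2_diff Z g)
  have "nrm w \<le> c + 0"
  proof (rule LIMSEQ_le)
    show "(\<lambda>i. D (v i)) \<longlonglongrightarrow> nrm w"
      unfolding D_def using L2_norm_tendsto[OF L2_diff[OF VL[OF v(1)] g] w] Z(2) by (simp add: w_def)
    show "(\<lambda>i. c + s i) \<longlonglongrightarrow> c + 0" by (intro tendsto_intros s0)
    show "\<exists>N. \<forall>n\<ge>N. D (v n) \<le> c + s n" using v(2) by (auto intro: less_imp_le)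
  qed
  then have wc: "nrm w \<le> c" by simp
  have var: "0 \<le> 2 * (\<integral>x. w x * (H k x - Z x) \<partial>m)" if k: "n \<le> k" for k
  proof (rule linear_coeff_nonneg)
    fix t :: real assume t: "0 < t" "t < 1"
    define h where "h x = H k x - Z x" for x
    have HL: "H k \<in> L2 m" by (rule VL[OF VH[OF k]])
    have h: "h \<in> L2 m" unfolding h_def by (intro L2_diff HL Z)
    \<comment> \<open>Z itself need not belong to V; the combination of H k and Z is therefore
      approached by combinations of H k and v i, which do belong to V.\<close>
    have "c \<le> nrm (\<lambda>x. w x + t * h x)"
    proof (rule LIMSEQ_le_const)
      have wh: "(\<lambda>x. w x + t * h x) \<in> L2 m" by (intro L2_add L2_scale w h)
      have "(\<lambda>i. \<bar>1 - t\<bar> * nrm (\<lambda>x. v i x - Z x)) \<longlonglongrightarrow> 0" using tendsto_mult_right_zero[OF Z(2)] .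
      then have "(\<lambda>i. nrm (\<lambda>x. (1 - t) * (v i x - Z x))) \<longlonglongrightarrow> 0" by (simp only: L2_norm_scale)
      moreover have "(\<lambda>x. (1 - t) * (v i x - Z x)) = (\<lambda>x. ((t * H k x + (1 - t) * v i x) - g x) - (w x + t * h x))" for i
        by (simp add: w_def h_def fun_eq_iff algebra_simps)
      ultimately have lim: "(\<lambda>i. nrm (\<lambda>x. ((t * H k x + (1 - t) * v i x) - g x) - (w x + t * h x))) \<longlonglongrightarrow> 0" by simp
      show "(\<lambda>i. D (\<lambda>x. t * H k x + (1 - t) * v i x)) \<longlonglongrightarrow> nrm (\<lambda>x. w x + t * h x)"
        unfolding D_def
        by (rule L2_norm_tendsto[OF _ wh lim]) (intro L2_diff L2_add L2_scale HL VL[OF v(1)] g)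
      show "\<exists>N. \<forall>i\<ge>N. c \<le> D (\<lambda>x. t * H k x + (1 - t) * v i x)"
        using t by (auto intro!: cle Vc VH v k)
    qed
    then have "c\<^sup>2 \<le> (nrm (\<lambda>x. w x + t * h x))\<^sup>2" using c0 by (intro power_mono)
    also have "\<dots> = (nrm w)\<^sup>2 + t * (2 * (\<integral>x. w x * h x \<partial>m)) + t\<^sup>2 * (nrm h)\<^sup>2"
      by (rule L2_norm_add_power2[OF w h])
    also have "(nrm w)\<^sup>2 \<le> c\<^sup>2" using wc L2_norm_nonneg by (intro power_mono)
    finally show "0 \<le> t * (2 * (\<integral>x. w x * (H k x - Z x) \<partial>m)) + t\<^sup>2 * (nrm h)\<^sup>2" by (simp add: h_def)
  qed auto
  have lim: "(\<lambda>k. \<integral>x. w x * (H k x - Z x) \<partial>m) \<longlonglongrightarrow> - (nrm w)\<^sup>2"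
  proof -
    have HL: "H k \<in> L2 m" for k using lp_L2[OF F] by (simp add: H)
    have "(\<integral>x. w x * (H k x - Z x) \<partial>m) = (\<integral>x. H k x * w x \<partial>m) - (\<integral>x. Z x * w x \<partial>m)" for k
      using L2_integrable_mult[OF HL[of k] w] L2_integrable_mult[OF Z(1) w]
      by (subst Bochner_Integration.integral_diff[symmetric]) (auto simp: algebra_simps)
    moreover have "(\<lambda>k. (\<integral>x. H k x * w x \<partial>m) - (\<integral>x. Z x * w x \<partial>m)) \<longlonglongrightarrow> (\<integral>x. g x * w x \<partial>m) - (\<integral>x. Z x * w x \<partial>m)"
      by (intro tendsto_intros wl w)
    moreover have "(\<integral>x. g x * w x \<partial>m) - (\<integral>x. Z x * w x \<partial>m) = - (nrm w)\<^sup>2"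
    proof -
      have "(\<integral>x. g x * w x \<partial>m) - (\<integral>x. Z x * w x \<partial>m) = (\<integral>x. - (w x)\<^sup>2 \<partial>m)"
        using L2_integrable_mult[OF g w] L2_integrable_mult[OF Z(1) w]
        by (subst Bochner_Integration.integral_diff[symmetric]) (auto simp: w_def power2_eq_square algebra_simps)
      then show ?thesis by (simp add: L2_norm_power2)
    qed
    ultimately show ?thesis by simp
  qed
  have "0 \<le> - (nrm w)\<^sup>2"
  proof (rule LIMSEQ_le_const[OF lim])
    show "\<exists>N. \<forall>k\<ge>N. 0 \<le> (\<integral>x. w x * (H k x - Z x) \<partial>m)" using var by auto
  qed
  then have "nrm w = 0" by simp
  then have w0: "AE x in m. w x = 0" by (rule L2_norm_eq_0_AE[OF w])
  have "(\<lambda>i. D (v i)) \<longlonglongrightarrow> nrm w"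
    unfolding D_def using L2_norm_tendsto[OF L2_diff[OF VL[OF v(1)] g] w] Z(2) by (simp add: w_def)
  then have "(\<lambda>i. D (v i)) \<longlonglongrightarrow> 0" using \<open>nrm w = 0\<close> by simp
  from order_tendstoD(2)[OF this r] obtain i where "D (v i) < r" by (auto simp: eventually_sequentially)
  with v(1)[of i] show ?thesis unfolding V_def D_def by force
qed

text \<open>The n-th pair is a convex combination from a tail on which the functions are already
  within s n of f. The combination then stays that close to f, while its majorant is within s n of
  the weak limit.\<close>

lemma relaxed_slope_upper_slope:
  assumes "relaxed_slope m d f G"
  obtains g where "upper_slope f g" "AE x in m. g x \<le> G x"
proof -
  obtain F g k where *: "\<And>n. F n \<in> Lip_b d" "L2_tendsto m F f" "strict_mono (k :: nat \<Rightarrow> nat)"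
    "L2_weak_tendsto m (\<lambda>n x. enn2real (Lip_a_star m d (F (k n)) x)) g" "AE x in m. g x \<le> G x"
    using assms unfolding relaxed_slope_def by blast
  have weak: "L2_weak_tendsto m (\<lambda>n. lp (F (k n))) g" using *(4) by (simp add: lips_def[abs_def])
  have f: "f \<in> L2 m" "(\<lambda>n. nrm (\<lambda>x. F n x - f x)) \<longlonglongrightarrow> 0" using *(2) by (auto simp: L2_tendsto_def)
  have lim: "(\<lambda>n. nrm (\<lambda>x. F (k n) x - f x)) \<longlonglongrightarrow> 0"
    using LIMSEQ_subseq_LIMSEQ[OF f(2) *(3)] by (simp add: o_def)
  define s where "s n = 1 / real (Suc n)" for n
  have s: "0 < s n" for n by (simp add: s_def)
  have s0: "s \<longlonglongrightarrow> 0" unfolding s_def using LIMSEQ_inverse_real_of_nat by (simp add: inverse_eq_divide)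
  define P where "P n z \<longleftrightarrow> fst z \<in> Lip_b d \<and> snd z \<in> L2 m \<and> (AE x in m. lp (fst z) x \<le> snd z x) \<and>
      nrm (\<lambda>x. fst z x - f x) \<le> s n \<and> nrm (\<lambda>x. snd z x - g x) \<le> s n" for n z
  have "\<exists>z. P n z" for n
  proof -
    have "\<forall>\<^sub>F i in sequentially. nrm (\<lambda>x. F (k i) x - f x) < s n" using lim s by (rule order_tendstoD(2))
    then obtain N where N: "\<And>i. N \<le> i \<Longrightarrow> nrm (\<lambda>x. F (k i) x - f x) \<le> s n"
      by (auto simp: eventually_sequentially intro: less_imp_le)
    obtain u v where uv: "(u, v) \<in> conv_tail (\<lambda>i. F (k i)) (\<lambda>i. lp (F (k i))) N" "nrm (\<lambda>x. v x - g x) < s n"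
      using conv_tail_approx[of "\<lambda>i. F (k i)" "\<lambda>i. lp (F (k i))" f N "s n" g "s n", OF *(1) refl f(1) N weak s] by blast
    from conv_tail_props[of N "\<lambda>i. F (k i)" "\<lambda>i. lp (F (k i))" f "s n", OF *(1) refl f(1) N uv(1)] uv(2)
    show ?thesis unfolding P_def by (intro exI[of _ "(u, v)"]) auto
  qed
  then obtain z where z: "\<And>n. P n (z n)" by metis
  define u where "u n = fst (z n)" for n
  define v where "v n = snd (z n)" for n
  have uv: "\<And>n. u n \<in> Lip_b d" "\<And>n. v n \<in> L2 m" "\<And>n. AE x in m. lp (u n) x \<le> v n x"
     "\<And>n. nrm (\<lambda>x. u n x - f x) \<le> s n" "\<And>n. nrm (\<lambda>x. v n x - g x) \<le> s n"
    using z unfolding P_def u_def v_def by blast+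
  have "(\<lambda>n. nrm (\<lambda>x. u n x - f x)) \<longlonglongrightarrow> 0"
    using uv(4) L2_norm_nonneg by (intro Lim_null_comparison[OF _ s0]) auto
  moreover have "(\<lambda>n. nrm (\<lambda>x. v n x - g x)) \<longlonglongrightarrow> 0"
    using uv(5) L2_norm_nonneg by (intro Lim_null_comparison[OF _ s0]) auto
  moreover have "g \<in> L2 m" using weak by (simp add: L2_weak_tendsto_def)
  ultimately have "upper_slope f g" unfolding upper_slope_def using uv(1-3) by blast
  with *(5) that show thesis by blast
qed

text \<open>The minimal upper slope G is a relaxed slope, as strong convergence is weak convergence
  along the identity subsequence, and every relaxed slope dominates an upper slope. The chosen slope
  S thus lies above some upper slope g, and \<open>nrm S \<le> nrm G \<le> nrm g\<close> forces S =
  g a.e.\<close>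

lemma min_relaxed_slope:
  assumes f: "f \<in> Ch_domain m d"
  shows "upper_slope f (min_relaxed_slope m d f)"
    and "\<And>K. upper_slope f K \<Longrightarrow> nrm (min_relaxed_slope m d f) \<le> nrm K"
proof -
  have fL: "f \<in> L2 m" using f by (simp add: Ch_domain_def)
  obtain G F where G: "G \<in> L2 m" "\<And>n::nat. F n \<in> Lip_b d" "(\<lambda>n. nrm (\<lambda>x. F n x - f x)) \<longlonglongrightarrow> 0"
    "(\<lambda>n. nrm (\<lambda>x. lp (F n) x - G x)) \<longlonglongrightarrow> 0" "\<And>H. upper_slope f H \<Longrightarrow> nrm G \<le> nrm H"
    by (rule minimal_upper_slope_exists[OF f]) (rule that)
  have "L2_weak_tendsto m (\<lambda>n. lp (F n)) G"
    unfolding L2_weak_tendsto_def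
  proof (intro conjI allI ballI G(1) lp_L2 G(2))
    fix h assume h: "h \<in> L2 m"
    have bnd: "\<bar>(\<integral>x. lp (F n) x * h x \<partial>m) - (\<integral>x. G x * h x \<partial>m)\<bar> \<le> nrm (\<lambda>x. lp (F n) x - G x) * nrm h" for n
    proof -
      have "(\<integral>x. lp (F n) x * h x \<partial>m) - (\<integral>x. G x * h x \<partial>m) = (\<integral>x. (lp (F n) x - G x) * h x \<partial>m)"
        using L2_integrable_mult[OF lp_L2[OF G(2)[of n]] h] L2_integrable_mult[OF G(1) h]
        by (subst Bochner_Integration.integral_diff[symmetric]) (auto simp: algebra_simps)
      then show ?thesis using L2_Cauchy_Schwarz[OF L2_diff[OF lp_L2[OF G(2)[of n]] G(1)] h] by simp
    qed
    have "(\<lambda>n. nrm (\<lambda>x. lp (F n) x - G x) * nrm h) \<longlonglongrightarrow> 0" by (rule tendsto_mult_left_zero[OF G(4)])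
    then have "(\<lambda>n. (\<integral>x. lp (F n) x * h x \<partial>m) - (\<integral>x. G x * h x \<partial>m)) \<longlonglongrightarrow> 0"
    proof (rule Lim_null_comparison[rotated])
      show "\<forall>\<^sub>F n in sequentially. norm ((\<integral>x. lp (F n) x * h x \<partial>m) - (\<integral>x. G x * h x \<partial>m))
          \<le> nrm (\<lambda>x. lp (F n) x - G x) * nrm h"
        unfolding real_norm_def by (rule always_eventually) (rule allI, rule bnd)
    qed
    then show "(\<lambda>n. \<integral>x. lp (F n) x * h x \<partial>m) \<longlonglongrightarrow> (\<integral>x. G x * h x \<partial>m)" by (simp add: LIM_zero_iff)
  qed
  moreover have "L2_tendsto m F f" unfolding L2_tendsto_def using G fL Lip_b_L2 by auto
  ultimately have "L2_tendsto m F f \<and> strict_mono (id :: nat \<Rightarrow> nat) \<and>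
      L2_weak_tendsto m (\<lambda>n x. enn2real (Lip_a_star m d (F (id n)) x)) G \<and> (AE x in m. G x \<le> G x)"
    by (simp add: lips_def[abs_def] strict_mono_id)
  then have rG: "relaxed_slope m d f G"
    unfolding relaxed_slope_def
    by (intro conjI[OF G(1)] exI[of _ F] exI[of _ G] exI[of _ id]) (simp add: G(2))
  have low: "nrm G \<le> nrm H" if rH: "relaxed_slope m d f H" for H
  proof -
    obtain g where g: "upper_slope f g" "AE x in m. g x \<le> H x" by (rule relaxed_slope_upper_slope[OF rH]) (rule that)
    have HL: "H \<in> L2 m" using rH by (simp add: relaxed_slope_def)
    have "nrm G \<le> nrm g" by (rule G(5)[OF g(1)])
    also have "\<dots> \<le> nrm H"
    proof (rule L2_norm_mono[OF _ HL])
      show "g \<in> borel_measurable m" using g(1) by (simp add: upper_slope_def L2_def)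
      show "AE x in m. \<bar>g x\<bar> \<le> \<bar>H x\<bar>" using g(2) upper_slope_nonneg[OF g(1)] by eventually_elim auto
    qed
    finally show ?thesis .
  qed
  let ?S = "min_relaxed_slope m d f"
  have S: "relaxed_slope m d f ?S \<and> (\<forall>H. relaxed_slope m d f H \<longrightarrow> nrm ?S \<le> nrm H)"
    unfolding min_relaxed_slope_def by (rule someI[of _ G]) (use rG low in blast)
  obtain g where g: "upper_slope f g" "AE x in m. g x \<le> ?S x"
    by (rule relaxed_slope_upper_slope[OF S[THEN conjunct1]]) (rule that)
  have SL: "?S \<in> L2 m" using S by (simp add: relaxed_slope_def)
  have gL: "g \<in> L2 m" using g(1) by (simp add: upper_slope_def)
  have g0: "AE x in m. 0 \<le> g x" by (rule upper_slope_nonneg[OF g(1)])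
  have SG: "nrm ?S \<le> nrm G" using S rG by blast
  have Gg: "nrm G \<le> nrm g" by (rule G(5)[OF g(1)])
  have "(\<integral>x. (?S x)\<^sup>2 - (g x)\<^sup>2 \<partial>m) \<le> 0"
  proof -
    have "(nrm ?S)\<^sup>2 \<le> (nrm g)\<^sup>2" using SG Gg L2_norm_nonneg by (intro power_mono) auto
    then show ?thesis using L2_integrable_power2[OF SL] L2_integrable_power2[OF gL]
      by (simp add: L2_norm_power2)
  qed
  moreover have n: "AE x in m. 0 \<le> (?S x)\<^sup>2 - (g x)\<^sup>2" using g(2) g0 by eventually_elim (simp add: power_mono)
  moreover have i: "integrable m (\<lambda>x. (?S x)\<^sup>2 - (g x)\<^sup>2)"
    using L2_integrable_power2[OF SL] L2_integrable_power2[OF gL] by simp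
  ultimately have "(\<integral>x. (?S x)\<^sup>2 - (g x)\<^sup>2 \<partial>m) = 0" using integral_nonneg_AE[OF n] by linarith
  then have "AE x in m. (?S x)\<^sup>2 - (g x)\<^sup>2 = 0" using integral_nonneg_eq_0_iff_AE[OF i n] by simp
  then have eq: "AE x in m. ?S x = g x"
    using g0 g(2) by eventually_elim (auto simp: power2_eq_iff)
  have nS: "nrm (\<lambda>x. H x - g x) = nrm (\<lambda>x. H x - ?S x)" if H: "H \<in> L2 m" for H
  proof -
    have "(\<integral>x. (H x - g x)\<^sup>2 \<partial>m) = (\<integral>x. (H x - ?S x)\<^sup>2 \<partial>m)"
    proof (rule Bochner_Integration.integral_cong_AE)
      show "AE x in m. (H x - g x)\<^sup>2 = (H x - ?S x)\<^sup>2" using eq by eventually_elim simp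
    qed (use L2_measurable[OF H] L2_measurable[OF SL] L2_measurable[OF gL] in measurable)
    then show ?thesis by (simp add: L2_norm_def)
  qed
  obtain F H where FH: "\<forall>n::nat. F n \<in> Lip_b d \<and> H n \<in> L2 m \<and> (AE x in m. lp (F n) x \<le> H n x)"
     "(\<lambda>n. nrm (\<lambda>x. F n x - f x)) \<longlonglongrightarrow> 0" "(\<lambda>n. nrm (\<lambda>x. H n x - g x)) \<longlonglongrightarrow> 0"
    using g(1) unfolding upper_slope_def by blast
  have "(\<lambda>n. nrm (\<lambda>x. H n x - ?S x)) \<longlonglongrightarrow> 0" using FH(3) nS FH(1) by simp
  then show "upper_slope f ?S" unfolding upper_slope_def using FH(1,2) SL by blast
  show "nrm ?S \<le> nrm K" if "upper_slope f K" for K using SG G(5)[OF that] by simp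
qed

end

section \<open>Comparison of the minimal relaxed slope with the asymptotic slope\<close>

context emms
begin

lemma Lip_b_Ch_domain: "f \<in> Lip_b d \<Longrightarrow> f \<in> Ch_domain m d"
proof -
  assume f: "f \<in> Lip_b d"
  have "Ch m d f \<le> liminf (\<lambda>n::nat. \<integral>\<^sup>+x. (Lip_a_star m d f x)\<^sup>2 \<partial>m)"
    unfolding Ch_def
    by (rule INF_lower2[of "\<lambda>_. f"]) (use f Lip_b_L2[OF f] in \<open>auto simp: L2_tendsto_def L2_norm_def\<close>)
  also have "\<dots> = (\<integral>\<^sup>+x. (Lip_a_star m d f x)\<^sup>2 \<partial>m)" by (simp add: Liminf_const)
  also have "\<dots> = (\<integral>\<^sup>+x. ennreal ((lp f x)\<^sup>2) \<partial>m)"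
    using lips_star[OF m f] by (intro nn_integral_cong_AE) (auto elim!: eventually_mono simp: ennreal_power lips_nonneg)
  also have "\<dots> = ennreal (\<integral>x. (lp f x)\<^sup>2 \<partial>m)"
    using L2_integrable_power2[OF lp_L2[OF f]] by (intro nn_integral_eq_integral) auto
  finally have "Ch m d f < \<top>" by (rule le_less_trans) simp
  then show ?thesis using Lip_b_L2[OF f] by (simp add: Ch_domain_def)
qed

lemma min_relaxed_slope_nonneg: "f \<in> Ch_domain m d \<Longrightarrow> AE x in m. 0 \<le> min_relaxed_slope m d f x"
  by (rule upper_slope_nonneg[OF min_relaxed_slope(1)])

lemma min_relaxed_slope_L2: "f \<in> Ch_domain m d \<Longrightarrow> min_relaxed_slope m d f \<in> L2 m"
  using min_relaxed_slope(1) by (simp add: upper_slope_def)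

text \<open>Paste the approximants F n of f into f by means of k. The Leibniz error
  \<open>K * \<bar>F n x - f x\<bar>\<close> tends to 0 in L2.\<close>

lemma upper_slope_interpolate:
  assumes f: "f \<in> Lip_b d" and G: "upper_slope f G" and k: "k \<in> Lip_b d" "\<And>x. 0 \<le> k x \<and> k x \<le> 1"
  shows "upper_slope f (\<lambda>x. k x * G x + (1 - k x) * lp f x)"
proof -
  obtain F H where FH: "\<And>n::nat. F n \<in> Lip_b d" "\<And>n. H n \<in> L2 m" "\<And>n. AE x in m. lp (F n) x \<le> H n x"
     "(\<lambda>n. nrm (\<lambda>x. F n x - f x)) \<longlonglongrightarrow> 0" "(\<lambda>n. nrm (\<lambda>x. H n x - G x)) \<longlonglongrightarrow> 0" and GL: "G \<in> L2 m"
    using G unfolding upper_slope_def by blast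
  obtain K where K: "0 \<le> K" "\<And>x y. ennreal \<bar>k x - k y\<bar> \<le> ennreal K * d x y" by (rule Lip_bE[OF k(1)]) (rule that)
  have km: "k \<in> borel_measurable m" by (rule Lip_b_integrable(1)[OF k(1) m])
  have kL: "(\<lambda>x. k x * u x) \<in> L2 m" "nrm (\<lambda>x. k x * u x) \<le> nrm u" if u: "u \<in> L2 m" for u
  proof -
    have mm: "(\<lambda>x. k x * u x) \<in> borel_measurable m" using km L2_measurable[OF u] by measurable
    have le: "AE x in m. \<bar>k x * u x\<bar> \<le> \<bar>u x\<bar>" using k(2) by (auto simp: abs_mult intro!: mult_left_le_one_le)
    show "(\<lambda>x. k x * u x) \<in> L2 m" by (rule L2_dominated[OF mm u le])
    show "nrm (\<lambda>x. k x * u x) \<le> nrm u" by (rule L2_norm_mono[OF mm u le])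
  qed
  have kL': "(\<lambda>x. (1 - k x) * u x) \<in> L2 m" if u: "u \<in> L2 m" for u
    using L2_diff[OF u kL(1)[OF u]] by (simp add: left_diff_distrib)
  define F' where "F' n x = k x * F n x + (1 - k x) * f x" for n x
  define H' where "H' n x = k x * H n x + (1 - k x) * lp f x + K * \<bar>F n x - f x\<bar>" for n x
  note fL = Lip_b_L2[OF f] and FL = Lip_b_L2[OF FH(1)]
  have dL: "(\<lambda>x. \<bar>F n x - f x\<bar>) \<in> L2 m" for n by (rule L2_abs[OF L2_diff[OF FL fL]])
  have F'L: "F' n \<in> Lip_b d" for n
    unfolding F'_def by (intro Lip_b_add Lip_b_mult Lip_b_diff Lip_b_const f FH k)
  have H'L: "H' n \<in> L2 m" for n
    unfolding H'_def by (intro L2_add kL kL' L2_scale dL FH lp_L2 f)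
  have le: "AE x in m. lp (F' n) x \<le> H' n x" for n
    using lp_Leibniz[OF FH(1)[of n] f k K] FH(3)[of n]
  proof eventually_elim
    case (elim x)
    have "k x * lp (F n) x \<le> k x * H n x" using elim(2) k(2)[of x] by (intro mult_left_mono) auto
    then show ?case using elim(1) unfolding F'_def H'_def by linarith
  qed
  have "(\<lambda>n. nrm (\<lambda>x. F' n x - f x)) \<longlonglongrightarrow> 0"
  proof (rule Lim_null_comparison[OF _ FH(4)], rule always_eventually, rule allI)
    fix n
    have "nrm (\<lambda>x. F' n x - f x) = nrm (\<lambda>x. k x * (F n x - f x))"
      by (intro arg_cong[of _ _ nrm] HOL.ext) (simp add: F'_def algebra_simps)
    also have "\<dots> \<le> nrm (\<lambda>x. F n x - f x)" by (rule kL(2)[OF L2_diff[OF FL fL]])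
    finally show "norm (nrm (\<lambda>x. F' n x - f x)) \<le> nrm (\<lambda>x. F n x - f x)" by (simp add: L2_norm_nonneg)
  qed
  moreover have "(\<lambda>n. nrm (\<lambda>x. H' n x - (k x * G x + (1 - k x) * lp f x))) \<longlonglongrightarrow> 0"
  proof (rule Lim_null_comparison[where g = "\<lambda>n. nrm (\<lambda>x. H n x - G x) + K * nrm (\<lambda>x. F n x - f x)"])
    show "\<forall>\<^sub>F n in sequentially. norm (nrm (\<lambda>x. H' n x - (k x * G x + (1 - k x) * lp f x)))
        \<le> nrm (\<lambda>x. H n x - G x) + K * nrm (\<lambda>x. F n x - f x)"
    proof (rule always_eventually, rule allI)
      fix n
      have "nrm (\<lambda>x. H' n x - (k x * G x + (1 - k x) * lp f x)) = nrm (\<lambda>x. k x * (H n x - G x) + K * \<bar>F n x - f x\<bar>)"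
        by (intro arg_cong[of _ _ nrm] HOL.ext) (simp add: H'_def algebra_simps)
      also have "\<dots> \<le> nrm (\<lambda>x. k x * (H n x - G x)) + nrm (\<lambda>x. K * \<bar>F n x - f x\<bar>)"
        by (intro L2_norm_triangle kL L2_diff FH GL L2_scale dL)
      also have "\<dots> \<le> nrm (\<lambda>x. H n x - G x) + K * nrm (\<lambda>x. F n x - f x)"
      proof (rule add_mono)
        show "nrm (\<lambda>x. k x * (H n x - G x)) \<le> nrm (\<lambda>x. H n x - G x)" by (intro kL L2_diff FH GL)
        have "nrm (\<lambda>x. \<bar>F n x - f x\<bar>) = nrm (\<lambda>x. F n x - f x)" by (simp add: L2_norm_def)
        then show "nrm (\<lambda>x. K * \<bar>F n x - f x\<bar>) \<le> K * nrm (\<lambda>x. F n x - f x)"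
          using K(1) by (simp add: L2_norm_scale)
      qed
      finally show "norm (nrm (\<lambda>x. H' n x - (k x * G x + (1 - k x) * lp f x)))
        \<le> nrm (\<lambda>x. H n x - G x) + K * nrm (\<lambda>x. F n x - f x)" by (simp add: L2_norm_nonneg)
    qed
    show "(\<lambda>n. nrm (\<lambda>x. H n x - G x) + K * nrm (\<lambda>x. F n x - f x)) \<longlonglongrightarrow> 0"
      using tendsto_add[OF FH(5) tendsto_mult_right_zero[OF FH(4), of K]] by simp
  qed
  moreover have "(\<lambda>x. k x * G x + (1 - k x) * lp f x) \<in> L2 m"
    by (intro L2_add kL kL' GL lp_L2 f)
  ultimately show ?thesis unfolding upper_slope_def using F'L H'L le by blast
qed

text \<open>Minimality of the norm becomes a pointwise comparison by locality: interpolate with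
  Lipschitz k that tend to the indicator of the set where \<open>G \<le> lp f\<close>. The
  interpolated slopes tend to the minimum of G and \<open>lp f\<close>, whose norm is then no less
  than that of G.\<close>

lemma min_relaxed_slope_le_lp:
  assumes f: "f \<in> Lip_b d"
  shows "AE x in m. min_relaxed_slope m d f x \<le> lp f x"
proof -
  define G where "G = min_relaxed_slope m d f"
  note fD = Lip_b_Ch_domain[OF f]
  have uG: "upper_slope f G" unfolding G_def by (rule min_relaxed_slope(1)[OF fD])
  have GL: "G \<in> L2 m" and lL: "lp f \<in> L2 m" using uG lp_L2[OF f] by (auto simp: upper_slope_def)
  have G0: "AE x in m. 0 \<le> G x" by (rule upper_slope_nonneg[OF uG])
  note Gm = L2_measurable[OF GL] and lm = L2_measurable[OF lL]
  define A where "A x = (if G x \<le> lp f x then 1 else 0 :: real)" for x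
  have Am: "A \<in> borel_measurable m" unfolding A_def using Gm lm by measurable
  obtain k where k: "\<And>n::nat. k n \<in> Lip_b d" "\<And>n x. 0 \<le> k n x \<and> k n x \<le> 1" "AE x in m. (\<lambda>n. k n x) \<longlonglongrightarrow> A x"
    by (rule Lip_b_AE_dense[OF d m Am, of 0 1]) (auto simp: A_def intro: that)
  have km: "k n \<in> borel_measurable m" for n by (rule Lip_b_integrable(1)[OF k(1) m])
  let ?u = "\<lambda>n x. k n x * G x + (1 - k n x) * lp f x"
  have lim: "(\<lambda>n. \<integral>x. (?u n x)\<^sup>2 \<partial>m) \<longlonglongrightarrow> (\<integral>x. (min (G x) (lp f x))\<^sup>2 \<partial>m)"
  proof (rule integral_dominated_convergence[where w = "\<lambda>x. (G x)\<^sup>2 + (lp f x)\<^sup>2"])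
    show "integrable m (\<lambda>x. (G x)\<^sup>2 + (lp f x)\<^sup>2)"
      using L2_integrable_power2[OF GL] L2_integrable_power2[OF lL] by simp
    show "AE x in m. (\<lambda>n. (?u n x)\<^sup>2) \<longlonglongrightarrow> (min (G x) (lp f x))\<^sup>2"
      using k(3)
    proof eventually_elim
      case (elim x)
      have "(\<lambda>n. (?u n x)\<^sup>2) \<longlonglongrightarrow> (A x * G x + (1 - A x) * lp f x)\<^sup>2" by (intro tendsto_intros elim)
      moreover have "A x * G x + (1 - A x) * lp f x = min (G x) (lp f x)" by (auto simp: A_def)
      ultimately show ?case by simp
    qed
    show "AE x in m. norm ((?u n x)\<^sup>2) \<le> (G x)\<^sup>2 + (lp f x)\<^sup>2" for n
      using G0
    proof eventually_elim
      case (elim x)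
      have "?u n x \<le> max (G x) (lp f x)" "0 \<le> ?u n x"
        using k(2)[of n x] elim lips_nonneg[of m d f x]
        by (auto intro!: convex_bound_le add_nonneg_nonneg mult_nonneg_nonneg)
      then have "(?u n x)\<^sup>2 \<le> (max (G x) (lp f x))\<^sup>2" by (intro power_mono)
      also have "\<dots> \<le> (G x)\<^sup>2 + (lp f x)\<^sup>2" by (auto simp: max_def)
      finally show ?case by simp
    qed
  qed (use Gm lm km in measurable)
  have "(nrm G)\<^sup>2 \<le> (\<integral>x. (?u n x)\<^sup>2 \<partial>m)" for n
  proof -
    have "nrm G \<le> nrm (?u n)"
      unfolding G_def by (rule min_relaxed_slope(2)[OF fD upper_slope_interpolate[OF f min_relaxed_slope(1)[OF fD] k(1,2)]])
    then have "(nrm G)\<^sup>2 \<le> (nrm (?u n))\<^sup>2" using L2_norm_nonneg by (intro power_mono)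
    then show ?thesis by (simp only: L2_norm_power2)
  qed
  then have le: "(nrm G)\<^sup>2 \<le> (\<integral>x. (min (G x) (lp f x))\<^sup>2 \<partial>m)" by (intro LIMSEQ_le_const[OF lim]) auto
  have "(\<lambda>x. min (G x) (lp f x)) \<in> L2 m"
    using G0 by (intro L2_dominated[OF _ GL]) (use Gm lm in \<open>auto elim!: eventually_mono simp: lips_nonneg min_def\<close>)
  then have i: "integrable m (\<lambda>x. (G x)\<^sup>2 - (min (G x) (lp f x))\<^sup>2)"
    using L2_integrable_power2[OF GL] L2_integrable_power2 by auto
  have n: "AE x in m. 0 \<le> (G x)\<^sup>2 - (min (G x) (lp f x))\<^sup>2"
    using G0 by eventually_elim (auto simp: lips_nonneg intro!: power_mono)
  have "(\<integral>x. (G x)\<^sup>2 - (min (G x) (lp f x))\<^sup>2 \<partial>m) \<le> 0"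
    using le L2_integrable_power2[OF GL] L2_integrable_power2[OF \<open>(\<lambda>x. min (G x) (lp f x)) \<in> L2 m\<close>]
    by (simp add: L2_norm_power2)
  then have "(\<integral>x. (G x)\<^sup>2 - (min (G x) (lp f x))\<^sup>2 \<partial>m) = 0" using integral_nonneg_AE[OF n] by linarith
  then have "AE x in m. (G x)\<^sup>2 - (min (G x) (lp f x))\<^sup>2 = 0" using integral_nonneg_eq_0_iff_AE[OF i n] by simp
  then show ?thesis
    using G0 unfolding G_def[symmetric]
  proof eventually_elim
    case (elim x)
    then have "G x = min (G x) (lp f x)" using lips_nonneg[of m d f x] by (auto simp: power2_eq_iff_nonneg)
    then show ?case by linarith
  qed
qed

lemma Linf_bound:
  assumes "f \<in> Linf m"
  obtains B where "0 \<le> B" "AE x in m. \<bar>f x\<bar> \<le> B"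
proof -
  have f: "f \<in> borel_measurable m" "esssup m (\<lambda>x. ennreal \<bar>f x\<bar>) < \<top>"
    using assms by (auto simp: Linf_def Linf_norm_def)
  then obtain B where B: "esssup m (\<lambda>x. ennreal \<bar>f x\<bar>) = ennreal B" "0 \<le> B"
    by (cases "esssup m (\<lambda>x. ennreal \<bar>f x\<bar>)") auto
  have "AE x in m. ennreal \<bar>f x\<bar> \<le> esssup m (\<lambda>x. ennreal \<bar>f x\<bar>)" by (rule esssup_AE)
  then have "AE x in m. \<bar>f x\<bar> \<le> B" using B by (auto elim!: eventually_mono)
  with B(2) that show thesis by blast
qed

lemma Linf_I:
  assumes "f \<in> borel_measurable m" "AE x in m. \<bar>f x\<bar> \<le> B"
  shows "f \<in> Linf m"
proof -
  have "esssup m (\<lambda>x. ennreal \<bar>f x\<bar>) \<le> ennreal B"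
    using assms by (intro esssup_I) (auto elim!: eventually_mono intro: ennreal_leI)
  then show ?thesis using assms(1) by (auto simp: Linf_def Linf_norm_def le_less_trans)
qed

lemma Lip_b_Ch_algebra:
  assumes f: "f \<in> Lip_b d"
  shows "f \<in> Ch_algebra m d"
proof -
  obtain B where "\<And>x. \<bar>f x\<bar> \<le> B" by (rule Lip_bE[OF f]) (rule that)
  then have "f \<in> Linf m" using Lip_b_integrable(1)[OF f m] by (intro Linf_I[of _ B]) auto
  moreover obtain L where L: "0 \<le> L" "AE x in m. lp f x \<le> L" by (rule lp_bounded[OF f]) (rule that)
  have "min_relaxed_slope m d f \<in> Linf m"
  proof (rule Linf_I)
    show "min_relaxed_slope m d f \<in> borel_measurable m"
      by (rule L2_measurable[OF min_relaxed_slope_L2[OF Lip_b_Ch_domain[OF f]]])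
    show "AE x in m. \<bar>min_relaxed_slope m d f x\<bar> \<le> L"
      using L(2) min_relaxed_slope_le_lp[OF f] min_relaxed_slope_nonneg[OF Lip_b_Ch_domain[OF f]]
      by eventually_elim simp
  qed
  ultimately show ?thesis using Lip_b_Ch_domain[OF f] by (simp add: Ch_algebra_def)
qed

end

subsection \<open>The continuity inequality and the Wasserstein distance\<close>

text \<open>Continuous induction: the bound holds on a closed set containing a, and from its largest
  point below b one could move further to the right.\<close>

lemma Dini_upper_bound:
  fixes Z :: "real \<Rightarrow> real"
  assumes ab: "a \<le> b" and Z: "continuous_on {a..b} Z"
    and D: "\<And>t. a \<le> t \<Longrightarrow> t < b \<Longrightarrow> \<exists>\<eta>>0. \<forall>h. 0 < h \<and> h < \<eta> \<and> t + h \<le> b \<longrightarrow> Z (t + h) - Z t \<le> e * h"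
  shows "Z b - Z a \<le> e * (b - a)"
proof -
  define S where "S = {t \<in> {a..b}. Z t - Z a - e * (t - a) \<le> 0}"
  have "closed ({a..b} \<inter> (\<lambda>t. Z t - Z a - e * (t - a)) -` {..0})"
    by (intro continuous_closed_preimage continuous_intros Z)
  then have "closed S" by (simp add: S_def Int_def vimage_def)
  have aS: "a \<in> S" using ab by (simp add: S_def)
  have bd: "bdd_above S" by (intro bdd_aboveI[of _ b]) (auto simp: S_def)
  have sS: "Sup S \<in> S" using aS bd \<open>closed S\<close> by (intro closed_contains_Sup) auto
  have "Sup S = b"
  proof (rule ccontr)
    assume "Sup S \<noteq> b"
    then have t: "a \<le> Sup S" "Sup S < b" using sS by (auto simp: S_def)
    then obtain \<eta> where \<eta>: "\<eta> > 0" "\<And>h. 0 < h \<Longrightarrow> h < \<eta> \<Longrightarrow> Sup S + h \<le> b \<Longrightarrow> Z (Sup S + h) - Z (Sup S) \<le> e * h"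
      using D by meson
    define h where "h = min (\<eta> / 2) (b - Sup S)"
    have h: "0 < h" "h < \<eta>" "Sup S + h \<le> b" using \<eta>(1) t by (auto simp: h_def min_def)
    have "Sup S + h \<in> S" using \<eta>(2)[OF h] sS t h by (auto simp: S_def algebra_simps)
    then have "Sup S + h \<le> Sup S" using bd by (rule cSup_upper)
    with h show False by simp
  qed
  with sS show ?thesis by (simp add: S_def)
qed

lemma lebesgue_on_integrable_absolutely:
  fixes h :: "real \<Rightarrow> real"
  assumes "integrable (lebesgue_on {0<..<T}) h"
  shows "h absolutely_integrable_on {0..T}"
proof -
  have "h absolutely_integrable_on {0<..<T}"
    using assms by (simp add: integrable_restrict_space set_integrable_def)
  then show ?thesis using absolutely_integrable_on_open_interval[where f = h and a = 0 and b = T] by simp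
qed

text \<open>If f is not integrable its integral is 0 by convention, and the nonnegative g still
  dominates. The energy term in \<open>CE2_bound\<close> can thus be estimated before its
  measurability in time is known.\<close>

lemma set_lebesgue_integral_le_bound:
  fixes f g :: "real \<Rightarrow> real"
  assumes g: "g absolutely_integrable_on {s..t}" and g0: "\<And>r. r \<in> {s..t} \<Longrightarrow> 0 \<le> g r"
    and le: "\<And>r. r \<in> {s..t} \<Longrightarrow> f r \<le> g r"
  shows "(LINT r:{s..t}|lebesgue. f r) \<le> integral {s..t} g"
proof -
  have "(LINT r:{s..t}|lebesgue. f r) \<le> (LINT r:{s..t}|lebesgue. g r)"
  proof (cases "set_integrable lebesgue {s..t} f")
    case True
    then show ?thesis using g le by (intro set_integral_mono)
  next
    case False
    then have "(LINT r:{s..t}|lebesgue. f r) = 0"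
      by (simp add: set_lebesgue_integral_def set_integrable_def not_integrable_integral_eq)
    also have "0 \<le> (LINT r:{s..t}|lebesgue. g r)"
      unfolding set_lebesgue_integral_def using g0 by (intro integral_nonneg_AE AE_I2) (auto simp: indicator_def)
    finally show ?thesis .
  qed
  then show ?thesis using set_lebesgue_integral_eq_integral(2)[OF g] by simp
qed

section \<open>Probability densities and the continuity inequality tested on
  \<open>Lip_b\<close>\<close>

context emms
begin

lemma prob_density_integrable:
  assumes \<rho>: "prob_density m \<rho>"
  shows "integrable m \<rho>" "(\<integral>x. \<rho> x \<partial>m) = 1" "\<rho> \<in> borel_measurable m" "AE x in m. 0 \<le> \<rho> x"
proof -
  show r: "\<rho> \<in> borel_measurable m" "AE x in m. 0 \<le> \<rho> x" using \<rho> by (auto simp: prob_density_def)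
  have e: "(\<integral>\<^sup>+x. ennreal (\<rho> x) \<partial>m) = 1" using \<rho> by (auto simp: prob_density_def)
  have "has_bochner_integral m \<rho> 1"
    by (rule has_bochner_integral_nn_integral) (use r e in auto)
  then show "integrable m \<rho>" "(\<integral>x. \<rho> x \<partial>m) = 1" by (auto simp: has_bochner_integral_iff)
qed

lemma prob_density_mult_integrable:
  assumes \<rho>: "prob_density m \<rho>" and f: "f \<in> borel_measurable m" "AE x in m. \<bar>f x\<bar> \<le> B"
  shows "integrable m (\<lambda>x. f x * \<rho> x)"
proof (rule Bochner_Integration.integrable_bound[of _ "\<lambda>x. B * \<rho> x"])
  show "integrable m (\<lambda>x. B * \<rho> x)" using prob_density_integrable(1)[OF \<rho>] by simp
  show "AE x in m. norm (f x * \<rho> x) \<le> norm (B * \<rho> x)"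
    using f(2)
  proof eventually_elim
    case (elim x)
    have "\<bar>f x\<bar> * \<bar>\<rho> x\<bar> \<le> \<bar>B\<bar> * \<bar>\<rho> x\<bar>" using elim by (intro mult_right_mono) auto
    then show ?case by (simp add: abs_mult)
  qed
qed (use f(1) prob_density_integrable(3)[OF \<rho>] in measurable)

lemma prob_density_integral_mono:
  assumes \<rho>: "prob_density m \<rho>" and f: "f \<in> borel_measurable m" "AE x in m. \<bar>f x\<bar> \<le> B"
    and g: "g \<in> borel_measurable m" "AE x in m. \<bar>g x\<bar> \<le> B'" and le: "AE x in m. f x \<le> g x"
  shows "(\<integral>x. f x * \<rho> x \<partial>m) \<le> (\<integral>x. g x * \<rho> x \<partial>m)"
proof (rule integral_mono_AE[OF prob_density_mult_integrable[OF \<rho> f] prob_density_mult_integrable[OF \<rho> g]])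
  show "AE x in m. f x * \<rho> x \<le> g x * \<rho> x"
    using le prob_density_integrable(4)[OF \<rho>] by eventually_elim (rule mult_right_mono)
qed

lemma prob_density_integral_le_const:
  assumes \<rho>: "prob_density m \<rho>" and f: "f \<in> borel_measurable m" "AE x in m. \<bar>f x\<bar> \<le> B" and le: "AE x in m. f x \<le> c"
  shows "(\<integral>x. f x * \<rho> x \<partial>m) \<le> c"
  using prob_density_integral_mono[OF \<rho> f, of "\<lambda>_. c" "\<bar>c\<bar>"] le prob_density_integrable(2)[OF \<rho>] by simp

lemma prob_density_integral_ge_const:
  assumes \<rho>: "prob_density m \<rho>" and f: "f \<in> borel_measurable m" "AE x in m. \<bar>f x\<bar> \<le> B" and le: "AE x in m. c \<le> f x"
  shows "c \<le> (\<integral>x. f x * \<rho> x \<partial>m)"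
  using prob_density_integral_mono[OF \<rho> _ _ f, of "\<lambda>_. c" "\<bar>c\<bar>"] le prob_density_integrable(2)[OF \<rho>] by simp

abbreviation "mu \<rho> \<equiv> density m (\<lambda>x. ennreal (\<rho> x))"

lemma integral_mu:
  assumes \<rho>: "prob_density m \<rho>" and f: "f \<in> borel_measurable m"
  shows "(\<integral>x. f x \<partial>mu \<rho>) = (\<integral>x. f x * \<rho> x \<partial>m)"
  using integral_density[OF f prob_density_integrable(3,4)[OF \<rho>]] by (simp add: mult.commute)

text \<open>A countable union of compact subsets exhausts B up to an m-null set, which is null for
  the density measure too; continuity from below does the rest.\<close>

lemma mu_Radon:
  assumes \<rho>: "prob_density m \<rho>"
  shows "mu \<rho> \<in> Radon_prob"
proof -
  have rm: "\<rho> \<in> borel_measurable m" by (rule prob_density_integrable(3)[OF \<rho>])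
  have sets: "sets (mu \<rho>) = sets borel" by (simp add: sets_m)
  have ps: "prob_space (mu \<rho>)"
    by (rule prob_spaceI) (use rm \<rho> in \<open>simp add: emeasure_density prob_density_def\<close>)
  interpret \<mu>: prob_space "mu \<rho>" by fact
  have "emeasure (mu \<rho>) B = (SUP K\<in>{K. compact K \<and> K \<subseteq> B}. emeasure (mu \<rho>) K)" (is "_ = ?S") if B: "B \<in> sets borel" for B
  proof (rule antisym)
    show "?S \<le> emeasure (mu \<rho>) B" using B sets by (intro SUP_least emeasure_mono) auto
    obtain K where K: "\<And>n::nat. compact (K n)" "incseq K" "\<And>n. K n \<subseteq> B" "AE x in m. x \<in> B \<longrightarrow> x \<in> (\<Union>n. K n)"
      by (rule Radon_sigma_compact[OF m B]) (rule that)
    have Ks: "K n \<in> sets (mu \<rho>)" for n using borel_compact[OF K(1)] sets by simp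
    have "AE x in mu \<rho>. x \<in> B \<longrightarrow> x \<in> (\<Union>n. K n)" using K(4) rm by (subst AE_density) (auto elim!: eventually_mono)
    then have "emeasure (mu \<rho>) B \<le> emeasure (mu \<rho>) (\<Union>n. K n)" using Ks by (intro emeasure_mono_AE) auto
    also have "\<dots> = (SUP n. emeasure (mu \<rho>) (K n))" using Ks K(2) by (intro SUP_emeasure_incseq[symmetric]) auto
    also have "\<dots> \<le> ?S" using K by (intro SUP_least SUP_upper) auto
    finally show "emeasure (mu \<rho>) B \<le> ?S" .
  qed
  then show ?thesis using sets ps by (simp add: Radon_prob_def)
qed

text \<open>Young's inequality separates the speed from the energy, and the minimal relaxed slope is
  below \<open>lp f\<close>. The function a stands for a majorant of the squared slope whose
  integral is controlled uniformly on {s..t}.\<close>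

lemma CE2_bound_Lip_b:
  assumes c: "CE2_bound m d T \<rho> c" and \<rho>: "\<And>t. t \<in> {0..T} \<Longrightarrow> prob_density m (\<rho> t)"
    and f: "f \<in> Lip_b d" and a: "a \<in> borel_measurable m" "AE x in m. \<bar>a x\<bar> \<le> A" "AE x in m. (lp f x)\<^sup>2 \<le> a x"
    and st: "0 \<le> s" "s \<le> t" "t \<le> T" and B: "\<And>r. r \<in> {s..t} \<Longrightarrow> (\<integral>x. a x * \<rho> r x \<partial>m) \<le> B"
  shows "\<bar>(\<integral>x. f x * \<rho> t x \<partial>m) - (\<integral>x. f x * \<rho> s x \<partial>m)\<bar> \<le> integral {s..t} (\<lambda>r. (c r)\<^sup>2) / 2 + B / 2 * (t - s)"
proof -
  let ?G = "min_relaxed_slope m d f"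
  note fD = Lip_b_Ch_domain[OF f]
  have cI: "(\<lambda>r. (c r)\<^sup>2) absolutely_integrable_on {0..T}"
    using c by (intro lebesgue_on_integrable_absolutely) (simp add: CE2_bound_def L2_def)
  obtain L where L: "0 \<le> L" "AE x in m. lp f x \<le> L" by (rule lp_bounded[OF f]) (rule that)
  have Gm: "?G \<in> borel_measurable m" by (rule L2_measurable[OF min_relaxed_slope_L2[OF fD]])
  have G2: "AE x in m. (?G x)\<^sup>2 \<le> (lp f x)\<^sup>2"
    using min_relaxed_slope_le_lp[OF f] min_relaxed_slope_nonneg[OF fD] by eventually_elim (rule power_mono)
  have GL: "AE x in m. \<bar>(?G x)\<^sup>2\<bar> \<le> L\<^sup>2"
    using G2 L(2)
  proof eventually_elim
    case (elim x)
    have "(lp f x)\<^sup>2 \<le> L\<^sup>2" using elim(2) lips_nonneg by (rule power_mono)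
    with elim(1) show ?case by simp
  qed
  have E: "(\<integral>x. (?G x)\<^sup>2 * \<rho> r x \<partial>m) \<le> B" "0 \<le> (\<integral>x. (?G x)\<^sup>2 * \<rho> r x \<partial>m)" if r: "r \<in> {s..t}" for r
  proof -
    have \<rho>r: "prob_density m (\<rho> r)" using r st by (intro \<rho>) auto
    have "(\<integral>x. (?G x)\<^sup>2 * \<rho> r x \<partial>m) \<le> (\<integral>x. a x * \<rho> r x \<partial>m)"
      using G2 a(3) by (intro prob_density_integral_mono[OF \<rho>r _ GL a(1,2)]) (use Gm in \<open>auto elim!: eventually_elim2\<close>)
    with B[OF r] show "(\<integral>x. (?G x)\<^sup>2 * \<rho> r x \<partial>m) \<le> B" by simp
    show "0 \<le> (\<integral>x. (?G x)\<^sup>2 * \<rho> r x \<partial>m)"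
      by (rule prob_density_integral_ge_const[OF \<rho>r _ GL]) (use Gm in auto)
  qed
  have "\<bar>(\<integral>x. f x * \<rho> t x \<partial>m) - (\<integral>x. f x * \<rho> s x \<partial>m)\<bar>
      \<le> (LINT r:{s..t}|lebesgue. c r * sqrt (\<integral>x. (?G x)\<^sup>2 * \<rho> r x \<partial>m))"
    using c Lip_b_Ch_algebra[OF f] st by (simp add: CE2_bound_def)
  also have "\<dots> \<le> integral {s..t} (\<lambda>r. (c r)\<^sup>2 / 2 + B / 2)"
  proof (rule set_lebesgue_integral_le_bound)
    have "(\<lambda>r. 1 / 2 * (c r)\<^sup>2) absolutely_integrable_on {s..t}"
      using abs_integrable_subinterval(1)[OF cI st(1,3)] by (rule set_integrable_mult_right)
    moreover have "(\<lambda>r. B / 2) absolutely_integrable_on {s..t}"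
      by (intro absolutely_integrable_continuous_real continuous_intros)
    ultimately show "(\<lambda>r. (c r)\<^sup>2 / 2 + B / 2) absolutely_integrable_on {s..t}"
      using set_integral_add(1)[of lebesgue "{s..t}" "\<lambda>r. 1 / 2 * (c r)\<^sup>2" "\<lambda>r. B / 2"] by simp
    fix r assume r: "r \<in> {s..t}"
    let ?E = "\<integral>x. (?G x)\<^sup>2 * \<rho> r x \<partial>m"
    show "0 \<le> (c r)\<^sup>2 / 2 + B / 2" using E[OF r] by simp
    have "2 * c r * sqrt ?E \<le> (c r)\<^sup>2 + (sqrt ?E)\<^sup>2" by (rule sum_squares_bound)
    also have "(sqrt ?E)\<^sup>2 = ?E" using E(2)[OF r] by simp
    finally show "c r * sqrt ?E \<le> (c r)\<^sup>2 / 2 + B / 2" using E(1)[OF r] by simp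
  qed
  also have "\<dots> = integral {s..t} (\<lambda>r. (c r)\<^sup>2) / 2 + B / 2 * (t - s)"
  proof -
    have "(\<lambda>r. (c r)\<^sup>2 / 2) integrable_on {s..t}"
      using integrable_on_divide[OF abs_integrable_subinterval(2)[OF cI st(1,3)], of 2] by simp
    then show ?thesis using st by (subst Henstock_Kurzweil_Integration.integral_add) (auto simp: integrable_const_ivl)
  qed
  finally show ?thesis .
qed

end

section \<open>Dependence of Hopf-Lax functions on the parameter, and their slope\<close>

lemma ctrans_mono_s:
  assumes \<delta>: "\<delta> \<in> admissible d" and g: "\<And>x. \<bar>g x\<bar> \<le> B" and M: "\<And>x y. \<delta> x y \<le> M" and s: "0 \<le> s" "s \<le> s'"
  shows "ctrans \<delta> s g y \<le> ctrans \<delta> s' g y"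
    and "ctrans \<delta> s' g y \<le> ctrans \<delta> s g y + (s' - s) * M\<^sup>2"
proof -
  note D = admissibleD[OF \<delta>]
  have s': "0 \<le> s'" using s by simp
  note t = ctrans[where g = g, OF \<delta> s(1) g] and t' = ctrans[where g = g, OF \<delta> s' g]
  show "ctrans \<delta> s g y \<le> ctrans \<delta> s' g y"
  proof (rule t'(2))
    fix x
    have "s * (\<delta> x y)\<^sup>2 \<le> s' * (\<delta> x y)\<^sup>2" using s by (intro mult_right_mono) auto
    then show "g x + ctrans \<delta> s g y \<le> s' * (\<delta> x y)\<^sup>2" using t(1)[of x y] by simp
  qed
  have "ctrans \<delta> s' g y - (s' - s) * M\<^sup>2 \<le> ctrans \<delta> s g y"
  proof (rule t(2))
    fix x
    have "(\<delta> x y)\<^sup>2 \<le> M\<^sup>2" using D(1) M by (intro power_mono)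
    then have "(s' - s) * (\<delta> x y)\<^sup>2 \<le> (s' - s) * M\<^sup>2" using s by (intro mult_left_mono) auto
    then show "g x + (ctrans \<delta> s' g y - (s' - s) * M\<^sup>2) \<le> s * (\<delta> x y)\<^sup>2"
      using t'(1)[of x y] by (simp add: algebra_simps)
  qed
  then show "ctrans \<delta> s' g y \<le> ctrans \<delta> s g y + (s' - s) * M\<^sup>2" by simp
qed

text \<open>
  \<open>s \<mapsto> ctrans \<delta> s g y\<close> is an infimum of affine functions, hence concave. Its backward difference
  quotients therefore decrease with the step; they control the slope of \<open>ctrans \<delta> s g\<close>.
\<close>

lemma ctrans_quotient_mono:
  assumes \<delta>: "\<delta> \<in> admissible d" and g: "\<And>x. \<bar>g x\<bar> \<le> B" and k: "0 < k" "k \<le> k'" "k' \<le> s"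
  shows "(ctrans \<delta> s g y - ctrans \<delta> (s - k) g y) / k \<le> (ctrans \<delta> s g y - ctrans \<delta> (s - k') g y) / k'"
proof -
  have p: "0 \<le> s" "0 \<le> s - k" "0 \<le> s - k'" "0 < k'" using k by auto
  note t = ctrans[where g = g, OF \<delta> p(1) g] and t' = ctrans[where g = g, OF \<delta> p(3) g]
    and t1 = ctrans[where g = g, OF \<delta> p(2) g]
  define c where "c = k / k'"
  have c: "0 \<le> c" "c \<le> 1" "c * k' = k" using k p by (auto simp: c_def)
  have "(1 - c) * ctrans \<delta> s g y + c * ctrans \<delta> (s - k') g y \<le> ctrans \<delta> (s - k) g y"
  proof (rule t1(2))
    fix x
    have "(1 - c) * ctrans \<delta> s g y + c * ctrans \<delta> (s - k') g y
        \<le> (1 - c) * (s * (\<delta> x y)\<^sup>2 - g x) + c * ((s - k') * (\<delta> x y)\<^sup>2 - g x)"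
      using t(1)[of x y] t'(1)[of x y] c by (intro add_mono mult_left_mono) auto
    also have "\<dots> = (s - c * k') * (\<delta> x y)\<^sup>2 - g x" by (simp add: algebra_simps)
    finally show "g x + ((1 - c) * ctrans \<delta> s g y + c * ctrans \<delta> (s - k') g y) \<le> (s - k) * (\<delta> x y)\<^sup>2"
      using c by simp
  qed
  then have "ctrans \<delta> s g y - ctrans \<delta> (s - k) g y \<le> c * (ctrans \<delta> s g y - ctrans \<delta> (s - k') g y)"
    by (simp add: algebra_simps)
  then show ?thesis using k p by (simp add: c_def field_simps)
qed

text \<open>Let A be the backward quotient in s at z. Comparing the transforms at s and s - k shows
  that a near-minimiser w for z satisfies \<open>\<delta> w z \<le> sqrt A + u\<close>, where
  \<open>k * u\<^sup>2\<close> is the slack of the infimum. Testing the transform at y with the same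
  w gives the increment, and then u tends to 0.\<close>

lemma ctrans_increment_le:
  assumes \<delta>: "\<delta> \<in> admissible d" and g: "\<And>x. \<bar>g x\<bar> \<le> B" and k: "0 < k" "k \<le> s"
  shows "ctrans \<delta> s g y - ctrans \<delta> s g z
    \<le> s * \<delta> y z * (2 * sqrt ((ctrans \<delta> s g z - ctrans \<delta> (s - k) g z) / k) + \<delta> y z)"
proof -
  note D = admissibleD[OF \<delta>]
  have p: "0 \<le> s" "0 \<le> s - k" using k by auto
  note t = ctrans[where g = g, OF \<delta> p(1) g] and t' = ctrans[where g = g, OF \<delta> p(2) g]
  define A where "A = (ctrans \<delta> s g z - ctrans \<delta> (s - k) g z) / k"
  obtain M where "\<And>x y. \<delta> x y \<le> M" using admissible_bound[OF \<delta>] by metis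
  then have A0: "0 \<le> A" using ctrans_mono_s(1)[OF \<delta> g _ p(2), where M = M and s' = s and y = z] k by (simp add: A_def)
  have *: "ctrans \<delta> s g y - ctrans \<delta> s g z \<le> s * \<delta> y z * (2 * sqrt A + 2 * u + \<delta> y z) + k * u\<^sup>2" if u: "0 < u" for u
  proof -
    have "\<exists>w. s * (\<delta> w z)\<^sup>2 - g w < ctrans \<delta> s g z + k * u\<^sup>2"
    proof (rule ccontr)
      assume "\<not> ?thesis"
      then have "ctrans \<delta> s g z + k * u\<^sup>2 \<le> ctrans \<delta> s g z"
        by (intro t(2)) (simp add: not_less algebra_simps)
      moreover have "0 < k * u\<^sup>2" using k u by simp
      ultimately show False by simp
    qed
    then obtain w where w: "s * (\<delta> w z)\<^sup>2 - g w < ctrans \<delta> s g z + k * u\<^sup>2" by blast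
    have "k * A = ctrans \<delta> s g z - ctrans \<delta> (s - k) g z" using k by (simp add: A_def)
    moreover have "(s - k) * (\<delta> w z)\<^sup>2 = s * (\<delta> w z)\<^sup>2 - k * (\<delta> w z)\<^sup>2" by (simp add: algebra_simps)
    ultimately have "k * (\<delta> w z)\<^sup>2 \<le> k * A + k * u\<^sup>2" using t'(1)[of w z] w by linarith
    then have "k * (\<delta> w z)\<^sup>2 \<le> k * (A + u\<^sup>2)" by (simp add: algebra_simps)
    then have "(\<delta> w z)\<^sup>2 \<le> A + u\<^sup>2" using k by simp
    also have "\<dots> \<le> (sqrt A + u)\<^sup>2" using A0 u by (simp add: power2_sum)
    finally have "(\<delta> w z)\<^sup>2 \<le> (sqrt A + u)\<^sup>2" .
    moreover have "0 \<le> sqrt A + u" using A0 u by simp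
    ultimately have dw: "\<delta> w z \<le> sqrt A + u" by (rule power2_le_imp_le)
    have "ctrans \<delta> s g y - ctrans \<delta> s g z \<le> s * ((\<delta> w y)\<^sup>2 - (\<delta> w z)\<^sup>2) + k * u\<^sup>2"
      using t(1)[of w y] w by (simp add: algebra_simps)
    also have "(\<delta> w y)\<^sup>2 - (\<delta> w z)\<^sup>2 \<le> \<delta> y z * (2 * sqrt A + 2 * u + \<delta> y z)"
    proof -
      have "\<delta> w y \<le> \<delta> w z + \<delta> y z" using D(4)[of w y z] D(3)[of z y] by simp
      then have "(\<delta> w y)\<^sup>2 \<le> (\<delta> w z + \<delta> y z)\<^sup>2" using D(1) by (intro power_mono)
      then have "(\<delta> w y)\<^sup>2 - (\<delta> w z)\<^sup>2 \<le> \<delta> y z * (2 * \<delta> w z + \<delta> y z)" by (simp add: power2_eq_square algebra_simps)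
      also have "\<dots> \<le> \<delta> y z * (2 * sqrt A + 2 * u + \<delta> y z)" using dw D(1) by (intro mult_left_mono) auto
      finally show ?thesis .
    qed
    finally show ?thesis using p(1) by (simp add: mult_left_mono mult.assoc)
  qed
  have lim: "(\<lambda>n. s * \<delta> y z * (2 * sqrt A + 2 * (1 / real (Suc n)) + \<delta> y z) + k * (1 / real (Suc n))\<^sup>2)
      \<longlonglongrightarrow> s * \<delta> y z * (2 * sqrt A + 2 * 0 + \<delta> y z) + k * 0\<^sup>2"
    using LIMSEQ_inverse_real_of_nat by (intro tendsto_intros) (simp_all add: inverse_eq_divide)
  have "ctrans \<delta> s g y - ctrans \<delta> s g z \<le> s * \<delta> y z * (2 * sqrt A + 2 * 0 + \<delta> y z) + k * 0\<^sup>2"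
    by (rule LIMSEQ_le_const[OF lim]) (intro exI[of _ 0] allI impI *, simp)
  then show ?thesis by (simp add: A_def)
qed

text \<open>With s = 1/(2t) and k tending to 0 this is the Hamilton-Jacobi bound between slope and
  time derivative; a positive k keeps the right-hand side continuous in x. The quotient A is
  Lipschitz for \<delta>, so its values near x may be replaced by A x, as an asymptotic slope
  requires.\<close>

lemma lipa_ctrans_le:
  fixes d :: "'a::t2_space \<Rightarrow> 'a \<Rightarrow> ennreal"
  assumes ext: "extended_metric d" and \<delta>: "\<delta> \<in> admissible d" and g: "\<And>x. \<bar>g x\<bar> \<le> B" and k: "0 < k" "k \<le> s"
  shows "lipa d (ctrans \<delta> s g) x \<le> 2 * s * sqrt ((ctrans \<delta> s g x - ctrans \<delta> (s - k) g x) / k)"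
proof -
  note D = admissibleD[OF \<delta>]
  have p: "0 \<le> s" "0 \<le> s - k" using k by auto
  note t = ctrans[where g = g, OF \<delta> p(1) g] and t' = ctrans[where g = g, OF \<delta> p(2) g]
  define A where "A z = (ctrans \<delta> s g z - ctrans \<delta> (s - k) g z) / k" for z
  obtain M where M: "\<And>x y. \<delta> x y \<le> M" using admissible_bound[OF \<delta>] by metis
  have A0: "0 \<le> A z" for z using ctrans_mono_s(1)[OF \<delta> g M p(2), where s' = s and y = z] k by (simp add: A_def)
  obtain L1 where L1: "L1 \<ge> 0" "\<And>x y. \<bar>ctrans \<delta> s g x - ctrans \<delta> s g y\<bar> \<le> L1 * \<delta> x y"
    using t(3) by (auto simp: blip_def)
  obtain L2 where L2: "L2 \<ge> 0" "\<And>x y. \<bar>ctrans \<delta> (s - k) g x - ctrans \<delta> (s - k) g y\<bar> \<le> L2 * \<delta> x y"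
    using t'(3) by (auto simp: blip_def)
  define L where "L = (L1 + L2) / k"
  have L: "0 \<le> L" using L1 L2 k by (simp add: L_def)
  have AL: "A z \<le> A x + L * \<delta> z x" for z
  proof -
    have "A z - A x = ((ctrans \<delta> s g z - ctrans \<delta> s g x) - (ctrans \<delta> (s - k) g z - ctrans \<delta> (s - k) g x)) / k"
      by (simp add: A_def diff_divide_distrib)
    also have "\<dots> \<le> (L1 * \<delta> z x + L2 * \<delta> z x) / k"
      using L1(2)[of z x] L2(2)[of z x] k by (intro divide_right_mono) (auto simp: abs_le_iff)
    also have "\<dots> = L * \<delta> z x" by (simp add: L_def field_simps)
    finally show ?thesis by simp
  qed
  show ?thesis
    unfolding A_def[symmetric]
  proof (rule lipa_leI[OF blip_Lip_b[OF \<delta> t(3)] ext])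
    show "0 \<le> 2 * s * sqrt (A x)" using p A0 by simp
    fix e :: real assume e: "0 < e"
    have "((\<lambda>r. s * (2 * sqrt (L * r) + 2 * r)) \<longlongrightarrow> s * (2 * sqrt (L * 0) + 2 * 0)) (at_right 0)"
      by (intro tendsto_intros)
    then have "\<forall>\<^sub>F r in at_right 0. s * (2 * sqrt (L * r) + 2 * r) < e" using e by (intro order_tendstoD(2)) auto
    then obtain b where b: "0 < b" "\<And>r. 0 < r \<Longrightarrow> r < b \<Longrightarrow> s * (2 * sqrt (L * r) + 2 * r) < e"
      unfolding eventually_at_right_field by auto
    define r where "r = b / 2"
    have r0: "0 < r" "r < b" using b(1) by (auto simp: r_def)
    note r = r0(1) b(2)[OF r0]
    have half: "ctrans \<delta> s g y - ctrans \<delta> s g z \<le> (2 * s * sqrt (A x) + e) * DD"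
      if yz: "d y x < ennreal r" "d z x < ennreal r" "d y z = ennreal DD" "0 \<le> DD" for y z DD
    proof -
      have yr: "\<delta> y x < r" "\<delta> z x < r"
        using le_less_trans[OF D(5) yz(1)] le_less_trans[OF D(5) yz(2)] r(1) by (simp_all add: ennreal_less_iff D(1))
      have yzD: "\<delta> y z \<le> DD" using D(5)[of y z] yz(3,4) by simp
      have yz2: "\<delta> y z \<le> 2 * r" using D(4)[of y z x] D(3)[of x z] yr by simp
      have "sqrt (A z) \<le> sqrt (A x + L * r)"
        using AL[of z] yr(2) L mult_left_mono[of "\<delta> z x" r L] by (intro real_sqrt_le_mono) auto
      also have "\<dots> \<le> sqrt (A x) + sqrt (L * r)" using A0 L r by (intro sqrt_add_le_add_sqrt) auto
      finally have sA: "sqrt (A z) \<le> sqrt (A x) + sqrt (L * r)" .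
      have "ctrans \<delta> s g y - ctrans \<delta> s g z \<le> s * \<delta> y z * (2 * sqrt (A z) + \<delta> y z)"
        unfolding A_def by (rule ctrans_increment_le[OF \<delta> g k])
      also have "\<dots> \<le> s * \<delta> y z * (2 * (sqrt (A x) + sqrt (L * r)) + 2 * r)"
        using sA yz2 p(1) D(1) by (intro mult_left_mono) auto
      also have "\<dots> = (2 * s * sqrt (A x) + s * (2 * sqrt (L * r) + 2 * r)) * \<delta> y z" by (simp add: algebra_simps)
      also have "\<dots> \<le> (2 * s * sqrt (A x) + e) * \<delta> y z" using r(2) D(1) by (intro mult_right_mono) auto
      also have "\<dots> \<le> (2 * s * sqrt (A x) + e) * DD" using yzD p(1) A0 e by (intro mult_left_mono) auto
      finally show ?thesis .
    qed
    have "\<bar>ctrans \<delta> s g y - ctrans \<delta> s g z\<bar> \<le> (2 * s * sqrt (A x) + e) * DD"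
      if yz: "d y x < ennreal r" "d z x < ennreal r" "d y z = ennreal DD" "0 \<le> DD" for y z DD
    proof -
      have zy: "d z y = ennreal DD" using ext yz(3) by (simp add: extended_metric_def)
      show ?thesis using half[OF yz] half[OF yz(2,1) zy yz(4)] by (simp add: abs_le_iff)
    qed
    with r(1) show "\<exists>r>0. \<forall>y z D. d y x < ennreal r \<and> d z x < ennreal r \<and> d y z = ennreal D \<and> 0 \<le> D \<longrightarrow>
      \<bar>ctrans \<delta> s g y - ctrans \<delta> s g z\<bar> \<le> (2 * s * sqrt (A x) + e) * D" by blast
  qed
qed

section \<open>Kuwada's estimate\<close>

context emms
begin

lemma Lip_b_abs_bound: "f \<in> Lip_b d \<Longrightarrow> \<exists>B. AE x in m. \<bar>f x\<bar> \<le> B"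
proof -
  assume f: "f \<in> Lip_b d"
  obtain B where "\<And>x. \<bar>f x\<bar> \<le> B" by (rule Lip_bE[OF f]) (rule that)
  then show ?thesis by auto
qed

lemma CE2_bound_integral_continuous:
  assumes c: "CE2_bound m d T \<rho> c" and \<rho>: "\<And>t. t \<in> {0..T} \<Longrightarrow> prob_density m (\<rho> t)" and f: "f \<in> Lip_b d"
  shows "continuous_on {0..T} (\<lambda>t. \<integral>x. f x * \<rho> t x \<partial>m)"
proof -
  obtain L where L: "0 \<le> L" "AE x in m. lp f x \<le> L" by (rule lp_bounded[OF f]) (rule that)
  have cI: "(\<lambda>r. (c r)\<^sup>2) absolutely_integrable_on {0..T}"
    using c by (intro lebesgue_on_integrable_absolutely) (simp add: CE2_bound_def L2_def)
  define G where "G t = integral {0..t} (\<lambda>r. (c r)\<^sup>2) / 2 + L\<^sup>2 / 2 * t" for t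
  let ?\<Phi> = "\<lambda>t. \<integral>x. f x * \<rho> t x \<partial>m"
  have Gc: "continuous_on {0..T} G"
    unfolding G_def using abs_integrable_subinterval(2)[OF cI, of 0 T]
    by (intro continuous_intros indefinite_integral_continuous_1) auto
  have le: "\<bar>?\<Phi> t - ?\<Phi> s\<bar> \<le> \<bar>G t - G s\<bar>" if st: "0 \<le> s" "s \<le> t" "t \<le> T" for s t
  proof -
    have "AE x in m. (lp f x)\<^sup>2 \<le> L\<^sup>2" using L(2) by eventually_elim (simp add: power_mono lips_nonneg)
    then have "\<bar>?\<Phi> t - ?\<Phi> s\<bar> \<le> integral {s..t} (\<lambda>r. (c r)\<^sup>2) / 2 + L\<^sup>2 / 2 * (t - s)"
    proof (intro CE2_bound_Lip_b[OF c \<rho> f, where a = "\<lambda>_. L\<^sup>2" and A = "L\<^sup>2"])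
      show "(\<integral>x. L\<^sup>2 * \<rho> r x \<partial>m) \<le> L\<^sup>2" if "r \<in> {s..t}" for r
        using that st by (intro prob_density_integral_le_const[of _ _ "L\<^sup>2"] \<rho>) auto
    qed (use st in auto)
    also have "\<dots> = G t - G s"
      using integral_combine_abs[OF cI, of 0 s t] st by (simp add: G_def field_simps)
    finally show ?thesis by simp
  qed
  show ?thesis
    unfolding continuous_on_iff
  proof (intro ballI allI impI)
    fix s e assume s: "s \<in> {0..T}" and e: "(0 :: real) < e"
    then obtain \<eta> where \<eta>: "\<eta> > 0" "\<And>t. t \<in> {0..T} \<Longrightarrow> dist t s < \<eta> \<Longrightarrow> dist (G t) (G s) < e"
      using Gc unfolding continuous_on_iff by meson
    have "dist (?\<Phi> t) (?\<Phi> s) < e" if t: "t \<in> {0..T}" "dist t s < \<eta>" for t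
    proof (cases "s \<le> t")
      case True
      then show ?thesis using le[of s t] \<eta>(2)[OF t] s t by (auto simp: dist_real_def)
    next
      case False
      then show ?thesis using le[of t s] \<eta>(2)[OF t] s t by (auto simp: dist_real_def abs_minus_commute)
    qed
    with \<eta>(1) show "\<exists>\<eta>>0. \<forall>t\<in>{0..T}. dist t s < \<eta> \<longrightarrow> dist (?\<Phi> t) (?\<Phi> s) < e" by blast
  qed
qed

text \<open>The function U - G is shown to have upper right derivative at most 0 on (0, 1). A Dini
  estimate of this kind needs only finite increments, so nothing is differentiated under the
  integral.\<close>

lemma Kuwada:
  assumes c: "CE2_bound m d 1 \<rho> c" and \<rho>: "\<And>t. t \<in> {0..1} \<Longrightarrow> prob_density m (\<rho> t)"
    and \<delta>: "\<delta> \<in> admissible d" and \<phi>: "\<phi> \<in> blip \<delta>" and \<psi>: "\<psi> \<in> blip \<delta>" and le: "\<And>x y. \<phi> x + \<psi> y \<le> (\<delta> x y)\<^sup>2"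
  shows "(\<integral>x. \<phi> x * \<rho> 0 x \<partial>m) + (\<integral>x. \<psi> x * \<rho> 1 x \<partial>m) \<le> integral {0..1} (\<lambda>r. (c r)\<^sup>2)"
proof -
  note D = admissibleD[OF \<delta>]
  \<comment> \<open>The dual pair has cost \<open>\<delta>\<^sup>2\<close>, whereas Hopf-Lax at time
    1 has half of it; both potentials are halved and the factor is restored at the end.\<close>
  define g where "g x = 1 / 2 * \<phi> x" for x
  have gb: "g \<in> blip \<delta>" unfolding g_def by (rule blip_scale[OF \<phi>])
  obtain B where B: "\<And>x. \<bar>g x\<bar> \<le> B" using gb by (auto simp: blip_def)
  obtain M where M: "0 < M" "\<And>x y. \<delta> x y \<le> M" using admissible_bound[OF \<delta>] by metis
  define q where "q s = ctrans \<delta> s g" for s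
  note T = ctrans[where g = g, OF \<delta> _ B, folded q_def]
  note qm = ctrans_mono_s[where g = g, OF \<delta> B M(2), folded q_def]
  have qL: "q s \<in> Lip_b d" if "0 \<le> s" for s by (rule blip_Lip_b[OF \<delta> T(3)[OF that]])
  have qme: "q s \<in> borel_measurable m" if "0 \<le> s" for s by (rule Lip_b_integrable(1)[OF qL[OF that] m])
  have qB: "\<exists>B. AE x in m. \<bar>q s x\<bar> \<le> B" if "0 \<le> s" for s by (rule Lip_b_abs_bound[OF qL[OF that]])
  have qint: "integrable m (\<lambda>x. q s x * \<rho> r x)" if "0 \<le> s" "r \<in> {0..1}" for s r
    using qB[OF that(1)] prob_density_mult_integrable[OF \<rho>[OF that(2)] qme[OF that(1)]] by blast
  define u where "u s r = (\<integral>x. q s x * \<rho> r x \<partial>m)" for s r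
  have u_mono: "u s r \<le> u s' r" "u s' r \<le> u s r + (s' - s) * M\<^sup>2" if s: "0 \<le> s" "s \<le> s'" and r: "r \<in> {0..1}" for s s' r
  proof -
    have s': "0 \<le> s'" using s by simp
    have r0: "AE x in m. 0 \<le> \<rho> r x" and r1: "(\<integral>x. \<rho> r x \<partial>m) = 1" and ri: "integrable m (\<rho> r)"
      using prob_density_integrable[OF \<rho>[OF r]] by auto
    show "u s r \<le> u s' r"
      unfolding u_def using r0 qm(1)[OF s] by (intro integral_mono_AE qint s(1) s' r) (auto elim!: eventually_mono intro: mult_right_mono)
    have "u s' r \<le> (\<integral>x. q s x * \<rho> r x + (s' - s) * M\<^sup>2 * \<rho> r x \<partial>m)"
      unfolding u_def
    proof (rule integral_mono_AE[OF qint[OF s' r]])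
      show "integrable m (\<lambda>x. q s x * \<rho> r x + (s' - s) * M\<^sup>2 * \<rho> r x)" using qint[OF s(1) r] ri by simp
      show "AE x in m. q s' x * \<rho> r x \<le> q s x * \<rho> r x + (s' - s) * M\<^sup>2 * \<rho> r x"
        using r0
      proof eventually_elim
        case (elim x)
        have "q s' x * \<rho> r x \<le> (q s x + (s' - s) * M\<^sup>2) * \<rho> r x" by (rule mult_right_mono[OF qm(2)[OF s] elim])
        then show ?case by (simp add: distrib_right)
      qed
    qed
    also have "\<dots> = u s r + (s' - s) * M\<^sup>2"
      unfolding u_def using qint[OF s(1) r] ri r1 by simp
    finally show "u s' r \<le> u s r + (s' - s) * M\<^sup>2" .
  qed
  have cI: "(\<lambda>r. (c r)\<^sup>2) absolutely_integrable_on {0..1}"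
    using c by (intro lebesgue_on_integrable_absolutely) (simp add: CE2_bound_def L2_def)
  define G where "G t = integral {0..t} (\<lambda>r. (c r)\<^sup>2) / 2" for t
  have Gc: "continuous_on {0..1} G"
    unfolding G_def using abs_integrable_subinterval(2)[OF cI, of 0 1]
    by (intro continuous_intros indefinite_integral_continuous_1) auto
  have Gd: "integral {s..t} (\<lambda>r. (c r)\<^sup>2) / 2 = G t - G s" if "0 \<le> s" "s \<le> t" "t \<le> 1" for s t
    using integral_combine_abs[OF cI, of 0 s t] that by (simp add: G_def field_simps)
  \<comment> \<open>Time t corresponds to the parameter 1/(2t), infinite at t = 0; hence U is
    treated on {a..1} with a > 0 only.\<close>
  define \<sigma> where "\<sigma> t = 1 / (2 * t)" for t :: real
  define U where "U t = u (\<sigma> t) t" for t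
  have uc: "continuous_on {0..1} (u s)" if "0 \<le> s" for s
    unfolding u_def by (rule CE2_bound_integral_continuous[OF c \<rho> qL[OF that]])
  have Uc: "continuous_on {a..1} U" if a: "0 < a" for a
    unfolding continuous_on_iff
  proof (intro ballI allI impI)
    fix t e :: real assume t: "t \<in> {a..1}" and e: "0 < e"
    have s0: "0 \<le> \<sigma> r" if "r \<in> {a..1}" for r using that a by (simp add: \<sigma>_def)
    have "continuous_on {a..1} \<sigma>" unfolding \<sigma>_def using a by (intro continuous_intros) auto
    then obtain \<eta>1 where \<eta>1: "\<eta>1 > 0" "\<And>r. r \<in> {a..1} \<Longrightarrow> dist r t < \<eta>1 \<Longrightarrow> dist (\<sigma> r) (\<sigma> t) < e / (2 * M\<^sup>2)"
      using t e M(1) unfolding continuous_on_iff by (metis divide_pos_pos mult_pos_pos zero_less_numeral zero_less_power)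
    have "continuous_on {a..1} (u (\<sigma> t))" using uc[OF s0[OF t]] by (rule continuous_on_subset) (use a in auto)
    then obtain \<eta>2 where \<eta>2: "\<eta>2 > 0" "\<And>r. r \<in> {a..1} \<Longrightarrow> dist r t < \<eta>2 \<Longrightarrow> dist (u (\<sigma> t) r) (u (\<sigma> t) t) < e / 2"
      using t e unfolding continuous_on_iff by (metis half_gt_zero)
    have "dist (U r) (U t) < e" if r: "r \<in> {a..1}" "dist r t < min \<eta>1 \<eta>2" for r
    proof -
      have r01: "r \<in> {0..1}" using r a by auto
      have "\<bar>u (\<sigma> r) r - u (\<sigma> t) r\<bar> \<le> \<bar>\<sigma> r - \<sigma> t\<bar> * M\<^sup>2"
        using u_mono[OF s0[OF r(1)] _ r01, of "\<sigma> t"] u_mono[OF s0[OF t] _ r01, of "\<sigma> r"]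
        by (cases "\<sigma> r \<le> \<sigma> t") auto
      also have "\<dots> < e / 2"
        using \<eta>1(2)[OF r(1)] r(2) M(1) by (simp add: dist_real_def field_simps)
      finally have "\<bar>u (\<sigma> r) r - u (\<sigma> t) r\<bar> < e / 2" .
      moreover have "\<bar>u (\<sigma> t) r - u (\<sigma> t) t\<bar> < e / 2"
        using \<eta>2(2)[OF r(1)] r(2) by (simp add: dist_real_def)
      ultimately show ?thesis unfolding U_def dist_real_def by linarith
    qed
    then show "\<exists>\<eta>>0. \<forall>r\<in>{a..1}. dist r t < \<eta> \<longrightarrow> dist (U r) (U t) < e"
      using \<eta>1(1) \<eta>2(1) by (intro exI[of _ "min \<eta>1 \<eta>2"]) auto
  qed
  have key: "\<exists>\<eta>>0. \<forall>h. 0 < h \<and> h < \<eta> \<and> t + h \<le> 1 \<longrightarrow> (U (t + h) - G (t + h)) - (U t - G t) \<le> e * h"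
    if t: "0 < t" "t < 1" and e: "0 < e" for t e
  proof -
    define s where "s = \<sigma> t"
    have s: "0 < s" using t by (simp add: s_def \<sigma>_def)
    have t01: "t \<in> {0..1}" using t by simp
    define \<alpha> where "\<alpha> k = (u s t - u (s - k) t) / k" for k
    have \<alpha>_mono: "\<alpha> k \<le> \<alpha> k'" if k: "0 < k" "k \<le> k'" "k' \<le> s" for k k'
    proof -
      have *: "\<alpha> k = (\<integral>x. ((q s x - q (s - k) x) / k) * \<rho> t x \<partial>m)" if "0 < k" "k \<le> s" for k
        using qint[of s t] qint[of "s - k" t] that s t01 by (simp add: \<alpha>_def u_def left_diff_distrib diff_divide_distrib)
      have i: "integrable m (\<lambda>x. ((q s x - q (s - k) x) / k) * \<rho> t x)" if "0 < k" "k \<le> s" for k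
        using qint[of s t] qint[of "s - k" t] that s t01 by (simp add: left_diff_distrib diff_divide_distrib)
      have ks: "k \<le> s" "0 < k'" using k by auto
      have "(\<integral>x. ((q s x - q (s - k) x) / k) * \<rho> t x \<partial>m) \<le> (\<integral>x. ((q s x - q (s - k') x) / k') * \<rho> t x \<partial>m)"
      proof (rule integral_mono_AE[OF i[OF k(1) ks(1)] i[OF ks(2) k(3)]])
        show "AE x in m. ((q s x - q (s - k) x) / k) * \<rho> t x \<le> ((q s x - q (s - k') x) / k') * \<rho> t x"
          using prob_density_integrable(4)[OF \<rho>[OF t01]]
          by eventually_elim (rule mult_right_mono[OF ctrans_quotient_mono[where g = g, OF \<delta> B k, folded q_def]])
      qed
      then show ?thesis by (simp only: *[OF k(1) ks(1)] *[OF ks(2) k(3)])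
    qed
    have \<alpha>0: "0 \<le> \<alpha> k" "\<alpha> k \<le> M\<^sup>2" if k: "0 < k" "k \<le> s" for k
      using u_mono[of "s - k" s t] k t01 s by (auto simp: \<alpha>_def field_simps)
    \<comment> \<open>The left derivative at s of the concave function u (.) t, since its backward
      quotients \<alpha> k decrease with k.\<close>
    define \<alpha>\<^sub>0 where "\<alpha>\<^sub>0 = (INF k\<in>{0<..s}. \<alpha> k)"
    have bdd: "bdd_below (\<alpha> ` {0<..s})" using \<alpha>0 by (intro bdd_belowI[of _ 0]) auto
    have \<alpha>\<^sub>0_le: "\<alpha>\<^sub>0 \<le> \<alpha> k" if "0 < k" "k \<le> s" for k
      unfolding \<alpha>\<^sub>0_def using that by (intro cINF_lower[OF bdd]) auto
    have \<alpha>\<^sub>0_M: "\<alpha>\<^sub>0 \<le> M\<^sup>2" using \<alpha>\<^sub>0_le[OF s order_refl] \<alpha>0(2)[OF s order_refl] by simp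
    have \<alpha>\<^sub>0_0: "0 \<le> \<alpha>\<^sub>0" unfolding \<alpha>\<^sub>0_def using \<alpha>0 s by (intro cINF_greatest) auto
    \<comment> \<open>Three errors of size e1 enter Bd, and 3 e1 / (2 t^2) is then e/2.\<close>
    define e1 where "e1 = t\<^sup>2 * e / 3"
    have e1: "0 < e1" using t e by (simp add: e1_def)
    obtain k0 where k0: "0 < k0" "k0 \<le> s" "\<alpha> k0 < \<alpha>\<^sub>0 + e1"
    proof -
      have "\<exists>k\<in>{0<..s}. \<alpha> k < \<alpha>\<^sub>0 + e1"
        using e1 s by (subst cINF_less_iff[OF _ bdd, symmetric]) (auto simp: \<alpha>\<^sub>0_def)
      with that show thesis by auto
    qed
    \<comment> \<open>k at most s/2 keeps s' - k nonnegative, because s' is at least s/2 once h <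
      t.\<close>
    define k where "k = min k0 (s / 2)"
    have k: "0 < k" "k \<le> s / 2" "\<alpha> k < \<alpha>\<^sub>0 + e1"
      using k0 s \<alpha>_mono[of k k0] by (auto simp: k_def min_def split: if_splits)
    have sk: "0 \<le> s - k" using k s by simp
    let ?v = "\<lambda>r. (u s r - u (s - k) r) / k"
    have "continuous_on {0..1} ?v" using k(1) by (intro continuous_intros uc) (use s sk in auto)
    then obtain \<eta>1 where \<eta>1: "\<eta>1 > 0" "\<And>r. r \<in> {0..1} \<Longrightarrow> dist r t < \<eta>1 \<Longrightarrow> dist (?v r) (?v t) < e1"
      using t01 e1 unfolding continuous_on_iff by meson
    \<comment> \<open>In this order: the quotient with step k at time r is close to its value at t;
      h < t; the second-order remainder 1/t^2 - 1/(t(t+h)) is absorbed by e; replacing s' by s in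
      the quotient costs at most e1.\<close>
    define \<eta> where "\<eta> = min (min \<eta>1 t) (min (t ^ 3 * e / M\<^sup>2) (e1 * k * t\<^sup>2 / M\<^sup>2))"
    have \<eta>0: "0 < \<eta>" using \<eta>1 t e e1 M k(1) by (simp add: \<eta>_def)
    have "(U (t + h) - G (t + h)) - (U t - G t) \<le> e * h" if h: "0 < h" "h < \<eta>" "t + h \<le> 1" for h
    proof -
      define s' where "s' = \<sigma> (t + h)"
      have hs: "h < \<eta>1" "h < t" "h * M\<^sup>2 < t ^ 3 * e" "h * M\<^sup>2 < e1 * k * t\<^sup>2"
        using h(2) M(1) by (auto simp: \<eta>_def field_simps)
      have ss: "s - s' = h / (2 * t * (t + h))" using t h by (simp add: s_def s'_def \<sigma>_def field_simps)
      have ss0: "0 < s - s'" using ss t h by simp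
      have s'2: "s / 2 \<le> s'" using t h hs(2) by (simp add: s_def s'_def \<sigma>_def field_simps)
      have s'0: "0 < s'" "0 \<le> s' - k" using s'2 s k by auto
      have ss2: "s - s' \<le> h / (2 * t\<^sup>2)"
        unfolding ss using t h by (intro divide_left_mono) (auto simp: power2_eq_square)
      have 1: "u s' t - u s t \<le> - (h / (2 * t * (t + h))) * \<alpha>\<^sub>0"
      proof -
        have "\<alpha>\<^sub>0 \<le> \<alpha> (s - s')" using ss0 s'0 by (intro \<alpha>\<^sub>0_le) auto
        then have "\<alpha>\<^sub>0 * (s - s') \<le> u s t - u s' t" using ss0 by (simp add: \<alpha>_def field_simps)
        then show ?thesis using ss by (simp add: mult.commute)
      qed
      \<comment> \<open>The square of the slope bound for q s', a measurable majorant of the squared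
        slope.\<close>
      define a where "a x = (2 * s')\<^sup>2 * ((q s' x - q (s' - k) x) / k)" for x
      define Bd where "Bd = (\<alpha>\<^sub>0 + 3 * e1) / t\<^sup>2"
      have am: "a \<in> borel_measurable m" unfolding a_def
        by (intro borel_measurable_times borel_measurable_divide borel_measurable_diff borel_measurable_const qme) (use s'0 in auto)
      have aA: "\<bar>a x\<bar> \<le> (2 * s')\<^sup>2 * M\<^sup>2" and an: "0 \<le> (q s' x - q (s' - k) x) / k" for x
      proof -
        have "0 \<le> (q s' x - q (s' - k) x) / k" "(q s' x - q (s' - k) x) / k \<le> M\<^sup>2"
          using qm[OF s'0(2), of s' x] k(1) by (auto simp: field_simps)
        then have "\<bar>(q s' x - q (s' - k) x) / k\<bar> \<le> M\<^sup>2" by simp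
        then have "(2 * s')\<^sup>2 * \<bar>(q s' x - q (s' - k) x) / k\<bar> \<le> (2 * s')\<^sup>2 * M\<^sup>2" by (rule mult_left_mono) simp
        then show "\<bar>a x\<bar> \<le> (2 * s')\<^sup>2 * M\<^sup>2" unfolding a_def abs_mult by simp
        show "0 \<le> (q s' x - q (s' - k) x) / k" by fact
      qed
      have "AE x in m. lp (q s') x \<le> 2 * s' * sqrt ((q s' x - q (s' - k) x) / k)"
        using lipa_ctrans_le[where g = g and s = s', OF ext \<delta> B k(1), folded q_def] s'0 qme[of s'] qme[of "s' - k"]
        by (intro lips_least[OF m qL]) (auto intro!: borel_measurable_times borel_measurable_sqrt borel_measurable_divide)
      then have la: "AE x in m. (lp (q s') x)\<^sup>2 \<le> a x"
      proof eventually_elim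
        case (elim x)
        have "(lp (q s') x)\<^sup>2 \<le> (2 * s' * sqrt ((q s' x - q (s' - k) x) / k))\<^sup>2" using elim lips_nonneg by (rule power_mono)
        also have "\<dots> = a x" using an[of x] unfolding power_mult_distrib a_def by simp
        finally show ?case .
      qed
      have ab: "(\<integral>x. a x * \<rho> r x \<partial>m) \<le> Bd" if r: "r \<in> {t..t + h}" for r
      proof -
        have r01: "r \<in> {0..1}" using r t h by auto
        have "(\<integral>x. a x * \<rho> r x \<partial>m) = (2 * s')\<^sup>2 * ((u s' r - u (s' - k) r) / k)"
        proof -
          have "(\<integral>x. a x * \<rho> r x \<partial>m) = (\<integral>x. (2 * s')\<^sup>2 / k * (q s' x * \<rho> r x - q (s' - k) x * \<rho> r x) \<partial>m)"
            by (intro Bochner_Integration.integral_cong) (auto simp: a_def algebra_simps diff_divide_distrib)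
          also have "\<dots> = (2 * s')\<^sup>2 / k * (u s' r - u (s' - k) r)"
            unfolding u_def using qint[of s' r] qint[of "s' - k" r] s'0 r01 by simp
          finally show ?thesis by simp
        qed
        also have "(u s' r - u (s' - k) r) / k \<le> \<alpha>\<^sub>0 + 3 * e1"
        proof -
          have "u s' r \<le> u s r" using s'0 ss0 r01 by (intro u_mono) auto
          moreover have "u (s - k) r \<le> u (s' - k) r + (s - s') * M\<^sup>2" using u_mono(2)[of "s' - k" "s - k" r] s'0 ss0 r01 by auto
          ultimately have "u s' r - u (s' - k) r \<le> u s r - u (s - k) r + (s - s') * M\<^sup>2" by simp
          then have "(u s' r - u (s' - k) r) / k \<le> (u s r - u (s - k) r + (s - s') * M\<^sup>2) / k"
            using k(1) by (intro divide_right_mono) auto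
          also have "\<dots> = ?v r + (s - s') * M\<^sup>2 / k" by (simp add: add_divide_distrib)
          also have "?v r \<le> \<alpha>\<^sub>0 + 2 * e1"
          proof -
            have "dist (?v r) (?v t) < e1" using r hs by (intro \<eta>1 r01) (auto simp: dist_real_def)
            moreover have "?v t = \<alpha> k" by (simp add: \<alpha>_def)
            ultimately show ?thesis using k(3) by (auto simp: dist_real_def)
          qed
          also have "(s - s') * M\<^sup>2 / k \<le> e1"
          proof -
            have "(s - s') * M\<^sup>2 \<le> h / (2 * t\<^sup>2) * M\<^sup>2" by (intro mult_right_mono ss2) auto
            also have "\<dots> \<le> e1 * k"
            proof -
              have "0 < e1 * k * t\<^sup>2" using e1 k(1) t by simp
              with hs(4) have "h * M\<^sup>2 \<le> e1 * k * (2 * t\<^sup>2)" by simp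
              then show ?thesis using t by (simp add: field_simps)
            qed
            finally show ?thesis using k(1) by (simp add: field_simps)
          qed
          finally show ?thesis by simp
        qed
        also have "(2 * s')\<^sup>2 * (\<alpha>\<^sub>0 + 3 * e1) \<le> 1 / t\<^sup>2 * (\<alpha>\<^sub>0 + 3 * e1)"
        proof (rule mult_right_mono)
          have "2 * s' \<le> 1 / t" using t h by (simp add: s'_def \<sigma>_def field_simps)
          then have "(2 * s')\<^sup>2 \<le> (1 / t)\<^sup>2" using s'0 by (intro power_mono) auto
          then show "(2 * s')\<^sup>2 \<le> 1 / t\<^sup>2" by (simp add: power_divide)
        qed (use \<alpha>\<^sub>0_0 e1 in auto)
        finally show ?thesis by (simp add: Bd_def mult_left_mono)
      qed
      have "\<bar>u s' (t + h) - u s' t\<bar> \<le> integral {t..t + h} (\<lambda>r. (c r)\<^sup>2) / 2 + Bd / 2 * (t + h - t)"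
        unfolding u_def
        by (rule CE2_bound_Lip_b[OF c \<rho> qL am _ la _ _ _ ab]) (use aA s'0 t h in auto)
      then have 2: "u s' (t + h) - u s' t \<le> G (t + h) - G t + Bd / 2 * h"
        using Gd[of t "t + h"] t h by simp
      have "(U (t + h) - G (t + h)) - (U t - G t) \<le> Bd / 2 * h - (h / (2 * t * (t + h))) * \<alpha>\<^sub>0"
        using 1 2 by (simp add: U_def s_def[symmetric] s'_def[symmetric])
      also have "\<dots> = h * (3 * e1 / (2 * t\<^sup>2)) + \<alpha>\<^sub>0 * (h / 2 * (1 / t\<^sup>2 - 1 / (t * (t + h))))"
      proof -
        have "(\<alpha>\<^sub>0 + 3 * e1) * A / 2 * h - h / 2 * B * \<alpha>\<^sub>0 = h * (3 * e1 * A / 2) + \<alpha>\<^sub>0 * (h / 2 * (A - B))" for A B :: real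
          by (simp add: algebra_simps diff_divide_distrib add_divide_distrib)
        from this[of "1 / t\<^sup>2" "1 / (t * (t + h))"] show ?thesis by (simp add: Bd_def mult.assoc mult.commute[of 2])
      qed
      also have "1 / t\<^sup>2 - 1 / (t * (t + h)) = h / (t\<^sup>2 * (t + h))"
      proof -
        have "t \<noteq> 0" "t + h \<noteq> 0" using t h by auto
        then show ?thesis by (simp add: divide_simps power2_eq_square)
      qed
      also have "\<alpha>\<^sub>0 * (h / 2 * (h / (t\<^sup>2 * (t + h)))) \<le> h * (e / 2)"
      proof -
        have "h / (t\<^sup>2 * (t + h)) \<le> h / (t\<^sup>2 * t)" using t h by (intro divide_left_mono mult_left_mono mult_pos_pos) auto
        then have "\<alpha>\<^sub>0 * (h / 2 * (h / (t\<^sup>2 * (t + h)))) \<le> M\<^sup>2 * (h / 2 * (h / (t\<^sup>2 * t)))"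
          using \<alpha>\<^sub>0_0 \<alpha>\<^sub>0_M h t by (intro mult_mono mult_left_mono) auto
        also have "\<dots> = h / 2 * (h * M\<^sup>2 / t ^ 3)" by (simp add: power3_eq_cube power2_eq_square)
        also have "\<dots> \<le> h / 2 * e" using hs(3) t h by (intro mult_left_mono) (auto simp: field_simps)
        finally show ?thesis by simp
      qed
      also have "3 * e1 / (2 * t\<^sup>2) = e / 2" using t by (simp add: e1_def)
      finally show ?thesis by (simp add: field_simps)
    qed
    with \<eta>0 show ?thesis by blast
  qed
  have up: "U 1 - G 1 \<le> (U a - G a)" if a: "0 < a" "a < 1" for a
  proof (rule field_le_epsilon)
    fix e :: real assume e: "0 < e"
    have "(U 1 - G 1) - (U a - G a) \<le> e * (1 - a)"
    proof (rule Dini_upper_bound)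
      show "continuous_on {a..1} (\<lambda>t. U t - G t)"
        using Uc[OF a(1)] continuous_on_subset[OF Gc, of "{a..1}"] a by (intro continuous_intros) auto
    qed (use a key e in auto)
    also have "\<dots> \<le> e * 1" using a e by (intro mult_left_mono) auto
    finally show "U 1 - G 1 \<le> U a - G a + e" by simp
  qed
  \<comment> \<open>At small times the Hopf-Lax function lies below its initial value -g. Since V is
    continuous up to 0, the unbounded parameter there is avoided.\<close>
  define V where "V t = (\<integral>x. (- g x) * \<rho> t x \<partial>m)" for t
  have gL: "(\<lambda>x. - g x) \<in> Lip_b d" using Lip_b_scale[OF blip_Lip_b[OF \<delta> gb], of "-1"] by simp
  have Vc: "continuous_on {0..1} V" unfolding V_def by (rule CE2_bound_integral_continuous[OF c \<rho> gL])
  have UV: "U a - G a \<le> V a - G a" if a: "0 < a" "a < 1" for a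
  proof -
    have s: "0 \<le> \<sigma> a" using a by (simp add: \<sigma>_def)
    have "U a \<le> V a"
      unfolding U_def u_def V_def
    proof (rule integral_mono_AE[OF qint[OF s]])
      show "integrable m (\<lambda>x. - g x * \<rho> a x)"
        using prob_density_mult_integrable[OF \<rho>, of a "\<lambda>x. - g x" B] Lip_b_integrable(1)[OF gL m] B a by auto
      have "q (\<sigma> a) x \<le> - g x" for x using T(1)[OF s, of x x] D(2)[of x] by simp
      then show "AE x in m. q (\<sigma> a) x * \<rho> a x \<le> - g x * \<rho> a x"
      proof -
        have "AE x in m. 0 \<le> \<rho> a x" using prob_density_integrable(4)[OF \<rho>, of a] a by simp
        then show ?thesis
        proof eventually_elim
          case (elim x)
          with \<open>q (\<sigma> a) x \<le> - g x\<close> show ?case by (rule mult_right_mono)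
        qed
      qed
    qed (use a in auto)
    then show ?thesis by simp
  qed
  have "U 1 - G 1 \<le> V 0 - G 0"
  proof (rule LIMSEQ_le_const)
    define a where "a n = 1 / real (Suc (Suc n))" for n
    have a: "0 < a n" "a n < 1" for n by (auto simp: a_def)
    have "a \<longlonglongrightarrow> 0" unfolding a_def using LIMSEQ_Suc[OF LIMSEQ_inverse_real_of_nat] by (simp add: inverse_eq_divide)
    moreover have "continuous_on {0..1} (\<lambda>t. V t - G t)" using Vc Gc by (intro continuous_intros)
    ultimately show "(\<lambda>n. V (a n) - G (a n)) \<longlonglongrightarrow> V 0 - G 0"
      using a by (intro continuous_on_tendsto_compose[of "{0..1}" "\<lambda>t. V t - G t"]) (auto intro!: always_eventually less_imp_le)
    show "\<exists>N. \<forall>n\<ge>N. U 1 - G 1 \<le> V (a n) - G (a n)"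
      using order_trans[OF up UV] a by blast
  qed
  then have fin: "U 1 - V 0 \<le> G 1" by (simp add: G_def)
  have "(\<integral>x. 1 / 2 * \<psi> x * \<rho> 1 x \<partial>m) \<le> U 1"
    unfolding U_def u_def
  proof (rule integral_mono_AE[OF _ qint])
    have \<psi>L: "\<psi> \<in> Lip_b d" by (rule blip_Lip_b[OF \<delta> \<psi>])
    obtain B' where "\<And>x. \<bar>\<psi> x\<bar> \<le> B'" using \<psi> by (auto simp: blip_def)
    then show "integrable m (\<lambda>x. 1 / 2 * \<psi> x * \<rho> 1 x)"
      using prob_density_mult_integrable[OF \<rho>, of 1 \<psi> B'] Lip_b_integrable(1)[OF \<psi>L m] by (simp add: mult.assoc)
    have "1 / 2 * \<psi> y \<le> q (\<sigma> 1) y" for y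
    proof (rule T(2))
      show "g x + 1 / 2 * \<psi> y \<le> \<sigma> 1 * (\<delta> x y)\<^sup>2" for x using le[of x y] by (simp add: g_def \<sigma>_def)
    qed (simp add: \<sigma>_def)
    then have *: "1 / 2 * \<psi> x * \<rho> 1 x \<le> q (\<sigma> 1) x * \<rho> 1 x" if "0 \<le> \<rho> 1 x" for x
      using that by (rule mult_right_mono)
    have "AE x in m. 0 \<le> \<rho> 1 x" using prob_density_integrable(4)[OF \<rho>, of 1] by simp
    then show "AE x in m. 1 / 2 * \<psi> x * \<rho> 1 x \<le> q (\<sigma> 1) x * \<rho> 1 x" by eventually_elim (rule *)
  qed (auto simp: \<sigma>_def)
  moreover have "V 0 = - (1 / 2 * (\<integral>x. \<phi> x * \<rho> 0 x \<partial>m))" by (simp add: V_def g_def)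
  moreover have "(\<integral>x. 1 / 2 * \<psi> x * \<rho> 1 x \<partial>m) = 1 / 2 * (\<integral>x. \<psi> x * \<rho> 1 x \<partial>m)" by (simp add: mult.assoc)
  ultimately show ?thesis using fin by (simp add: G_def)
qed

end

section \<open>The least speed and the comparison of the two distances\<close>

lemma esqrt_mono: "a \<le> b \<Longrightarrow> esqrt a \<le> esqrt b"
proof (cases "b = \<top>")
  case False
  assume "a \<le> b"
  then have "enn2real a \<le> enn2real b" using False by (intro enn2real_mono) (auto simp: less_top)
  then show ?thesis using False \<open>a \<le> b\<close> by (auto simp: esqrt_def top_unique intro!: ennreal_leI)
qed (simp add: esqrt_def)

lemma set_integral_lebesgue_eq:
  fixes f :: "real \<Rightarrow> real"
  assumes "f absolutely_integrable_on {0..T}" "0 \<le> s" "t \<le> T"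
  shows "(LINT r:{s..t}|lebesgue. f r) = integral {s..t} f"
  by (rule set_lebesgue_integral_eq_integral(2)[OF abs_integrable_subinterval(1)[OF assms]])

lemma L2_lebesgue_absolutely_integrable:
  fixes T :: real
  assumes c: "c \<in> L2 (lebesgue_on {0<..<T})"
  shows "c absolutely_integrable_on {0..T}"
proof -
  have "integrable (lebesgue_on {0<..<T}) c"
  proof (rule Bochner_Integration.integrable_bound[of _ "\<lambda>r. 1 + (c r)\<^sup>2"])
    show "integrable (lebesgue_on {0<..<T}) (\<lambda>r. 1 + (c r)\<^sup>2)"
      using c finite_measure.integrable_const[OF finite_measure_lebesgue_on[OF lmeasurable_interval(2)]]
      by (intro Bochner_Integration.integrable_add) (auto simp: L2_def)
    have "\<bar>c r\<bar> \<le> 1 + (c r)\<^sup>2" for r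
      using sum_squares_bound[of 1 "\<bar>c r\<bar>"] by simp
    then show "AE r in lebesgue_on {0<..<T}. norm (c r) \<le> norm (1 + (c r)\<^sup>2)" by simp
  qed (use c in \<open>simp add: L2_def\<close>)
  then show ?thesis by (rule lebesgue_on_integrable_absolutely)
qed

context emms
begin

text \<open>
  The measurability of the energies \<open>\<integral>h \<rho>\<^sub>r dm\<close> in time comes from the continuity for \<open>h\<close> in \<open>Lip_b\<close> and
  the \<open>m\<close>-a.e. approximation of bounded Borel functions by functions in \<open>Lip_b\<close>.
\<close>

lemma CE2_bound_energy_measurable:
  assumes c: "CE2_bound m d T \<rho> c" and \<rho>: "\<And>t. t \<in> {0..T} \<Longrightarrow> prob_density m (\<rho> t)"
    and h: "h \<in> borel_measurable m" "AE x in m. \<bar>h x\<bar> \<le> B"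
  shows "(\<lambda>r. \<integral>x. h x * \<rho> r x \<partial>m) \<in> borel_measurable (lebesgue_on {0..T})"
proof -
  \<comment> \<open>h is bounded only a.e.; truncation gives bounds everywhere without changing the
    integrals.\<close>
  define h' where "h' x = max (- \<bar>B\<bar>) (min \<bar>B\<bar> (h x))" for x
  have h'm: "h' \<in> borel_measurable m" unfolding h'_def using h(1) by measurable
  have hh': "AE x in m. h' x = h x" using h(2) by eventually_elim (auto simp: h'_def)
  obtain F where F: "\<And>n::nat. F n \<in> Lip_b d" "\<And>n x. - \<bar>B\<bar> \<le> F n x \<and> F n x \<le> \<bar>B\<bar>" "AE x in m. (\<lambda>n. F n x) \<longlonglongrightarrow> h' x"
    by (rule Lip_b_AE_dense[OF d m h'm, of "- \<bar>B\<bar>" "\<bar>B\<bar>"]) (auto simp: h'_def intro: that)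
  have Fm: "F n \<in> borel_measurable m" for n by (rule Lip_b_integrable(1)[OF F(1) m])
  show ?thesis
  proof (rule borel_measurable_LIMSEQ_real)
    fix r assume "r \<in> space (lebesgue_on {0..T})"
    then have r: "prob_density m (\<rho> r)" by (intro \<rho>) simp
    show "(\<lambda>n. \<integral>x. F n x * \<rho> r x \<partial>m) \<longlonglongrightarrow> (\<integral>x. h x * \<rho> r x \<partial>m)"
    proof (rule integral_dominated_convergence[where w = "\<lambda>x. \<bar>B\<bar> * \<rho> r x"])
      show "AE x in m. (\<lambda>n. F n x * \<rho> r x) \<longlonglongrightarrow> h x * \<rho> r x"
        using F(3) hh' by eventually_elim (auto intro: tendsto_intros)
      show "AE x in m. norm (F n x * \<rho> r x) \<le> \<bar>B\<bar> * \<rho> r x" for n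
        using prob_density_integrable(4)[OF r]
      proof eventually_elim
        case (elim x)
        have "\<bar>F n x\<bar> \<le> \<bar>B\<bar>" using F(2)[of n x] by (simp add: abs_le_iff)
        then show ?case using elim by (simp add: abs_mult mult_right_mono)
      qed
    qed (use Fm h prob_density_integrable[OF r] in \<open>auto\<close>)
  next
    show "(\<lambda>r. \<integral>x. F n x * \<rho> r x \<partial>m) \<in> borel_measurable (lebesgue_on {0..T})" for n
      by (rule continuous_imp_measurable_on_sets_lebesgue[OF CE2_bound_integral_continuous[OF c \<rho> F(1)]]) auto
  qed
qed

text \<open>A speed is nonnegative only a.e.; its positive part makes the integrand nonnegative at
  every time, and the a.e. bounded minimal slope makes it integrable.\<close>

lemma CE2_bound_integrand:
  assumes c: "CE2_bound m d T \<rho> c" and \<rho>: "\<And>t. t \<in> {0..T} \<Longrightarrow> prob_density m (\<rho> t)" and f: "f \<in> Ch_algebra m d"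
  shows "(\<lambda>r. max 0 (c r) * sqrt (\<integral>x. (min_relaxed_slope m d f x)\<^sup>2 * \<rho> r x \<partial>m)) absolutely_integrable_on {0..T}"
    and "0 \<le> s \<Longrightarrow> t \<le> T \<Longrightarrow> (LINT r:{s..t}|lebesgue. c r * sqrt (\<integral>x. (min_relaxed_slope m d f x)\<^sup>2 * \<rho> r x \<partial>m))
      = (LINT r:{s..t}|lebesgue. max 0 (c r) * sqrt (\<integral>x. (min_relaxed_slope m d f x)\<^sup>2 * \<rho> r x \<partial>m))"
proof -
  let ?G = "min_relaxed_slope m d f"
  let ?E = "\<lambda>r. sqrt (\<integral>x. (?G x)\<^sup>2 * \<rho> r x \<partial>m)"
  have fD: "f \<in> Ch_domain m d" and GLi: "?G \<in> Linf m" using f by (auto simp: Ch_algebra_def)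
  have Gm: "?G \<in> borel_measurable m" using GLi by (simp add: Linf_def)
  obtain B where B: "0 \<le> B" "AE x in m. \<bar>?G x\<bar> \<le> B" by (rule Linf_bound[OF GLi]) (rule that)
  have G2: "AE x in m. \<bar>(?G x)\<^sup>2\<bar> \<le> B\<^sup>2"
    using B(2) by eventually_elim (simp add: abs_le_square_iff[symmetric])
  have Em: "?E \<in> borel_measurable (lebesgue_on {0..T})"
    by (rule measurable_compose[OF CE2_bound_energy_measurable[OF c \<rho> _ G2] borel_measurable_sqrt]) (use Gm in auto)
  have EB: "0 \<le> ?E r" "?E r \<le> B" if "r \<in> {0..T}" for r
  proof -
    have "(\<integral>x. (?G x)\<^sup>2 * \<rho> r x \<partial>m) \<le> B\<^sup>2"
      using Gm G2 by (intro prob_density_integral_le_const[OF \<rho>[OF that] _ G2]) (auto elim!: eventually_mono)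
    then show "?E r \<le> B" using B(1) by (intro real_le_lsqrt) auto
    have "0 \<le> (\<integral>x. (?G x)\<^sup>2 * \<rho> r x \<partial>m)"
      by (rule prob_density_integral_ge_const[OF \<rho>[OF that] _ G2]) (use Gm in auto)
    then show "0 \<le> ?E r" by simp
  qed
  have cL2: "c \<in> L2 (lebesgue_on {0<..<T})" and c0: "AE r in lebesgue_on {0<..<T}. 0 \<le> c r"
    using c by (auto simp: CE2_bound_def)
  have cI: "c absolutely_integrable_on {0..T}" by (rule L2_lebesgue_absolutely_integrable[OF cL2])
  then have cmI: "(\<lambda>r. max 0 (c r)) absolutely_integrable_on {0..T}"
    using absolutely_integrable_max_1[OF _ cI, of "\<lambda>_. 0"] by (simp add: max.commute)
  have cmm: "(\<lambda>r. max 0 (c r)) \<in> borel_measurable (lebesgue_on {0..T})"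
    using cmI absolutely_integrable_measurable[of "{0..T}" "\<lambda>r. max 0 (c r)"] by auto
  show I: "(\<lambda>r. max 0 (c r) * ?E r) absolutely_integrable_on {0..T}"
  proof (rule measurable_bounded_by_integrable_imp_absolutely_integrable)
    show "(\<lambda>r. max 0 (c r) * ?E r) \<in> borel_measurable (lebesgue_on {0..T})" using cmm Em by (rule borel_measurable_times)
    show "(\<lambda>r. B * max 0 (c r)) integrable_on {0..T}"
      by (rule set_lebesgue_integral_eq_integral(1)[OF set_integrable_mult_right[OF cmI]])
    show "norm (max 0 (c r) * ?E r) \<le> B * max 0 (c r)" if "r \<in> {0..T}" for r
      using mult_left_mono[OF EB(2)[OF that], of "max 0 (c r)"] EB(1)[OF that] by (simp add: abs_mult mult.commute)
  qed auto
  assume st: "0 \<le> s" "t \<le> T"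
  have "AE r in lebesgue. r \<in> {0<..<T} \<longrightarrow> 0 \<le> c r"
    using c0 by (subst (asm) AE_restrict_space_iff) auto
  \<comment> \<open>The speed is constrained on the open interval, while {s..t} may contain its two
    end points.\<close>
  moreover have "AE r in lebesgue. r \<noteq> 0" "AE r in lebesgue. r \<noteq> T"
    by (auto intro!: AE_I[of _ _ "{0}"] AE_I[of _ _ "{T}"])
  ultimately have ae: "AE r in lebesgue. r \<in> {s..t} \<longrightarrow> 0 \<le> c r"
    by eventually_elim (use st in auto)
  show "(LINT r:{s..t}|lebesgue. c r * ?E r) = (LINT r:{s..t}|lebesgue. max 0 (c r) * ?E r)"
    unfolding set_lebesgue_integral_def
  proof (rule Bochner_Integration.integral_cong_AE)
    show "AE r in lebesgue. indicator {s..t} r *\<^sub>R (c r * ?E r) = indicator {s..t} r *\<^sub>R (max 0 (c r) * ?E r)"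
      using ae by eventually_elim (auto simp: indicator_def)
    have 1: "(\<lambda>r. c r * ?E r) \<in> borel_measurable (lebesgue_on {0..T})"
      using cI absolutely_integrable_measurable[of "{0..T}" c] Em by (intro borel_measurable_times) auto
    have "(\<lambda>r. c r * ?E r) \<in> borel_measurable (lebesgue_on {s..t})"
      by (rule measurable_restrict_mono[OF 1]) (use st in auto)
    then show "(\<lambda>r. indicator {s..t} r *\<^sub>R (c r * ?E r)) \<in> borel_measurable lebesgue"
      by (subst (asm) borel_measurable_restrict_space_iff) auto
    have "(\<lambda>r. max 0 (c r) * ?E r) \<in> borel_measurable (lebesgue_on {s..t})"
      by (rule measurable_restrict_mono[OF borel_measurable_times[OF cmm Em]]) (use st in auto)
    then show "(\<lambda>r. indicator {s..t} r *\<^sub>R (max 0 (c r) * ?E r)) \<in> borel_measurable lebesgue"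
      by (subst (asm) borel_measurable_restrict_space_iff) auto
  qed
qed

text \<open>Admissibility passes to countable infima: for each f the increments are below the
  integral of every integrand and thus of their infimum, and multiplication by the nonnegative root
  of the energy commutes with the infimum.\<close>

lemma CE2_bound_INF:
  fixes c :: "nat \<Rightarrow> real \<Rightarrow> real"
  assumes c: "\<And>k. CE2_bound m d T \<rho> (c k)" and \<rho>: "\<And>t. t \<in> {0..T} \<Longrightarrow> prob_density m (\<rho> t)"
  shows "CE2_bound m d T \<rho> (\<lambda>r. INF k. max 0 (c k r))"
proof -
  let ?h = "\<lambda>r. INF k. max 0 (c k r)"
  have bdd: "bdd_below (range (\<lambda>k. max 0 (c k r)))" for r by (intro bdd_belowI[of _ 0]) auto
  have h0: "0 \<le> ?h r" for r by (intro cINF_greatest) auto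
  have hle: "?h r \<le> max 0 (c k r)" for k r by (rule cINF_lower[OF bdd]) auto
  have cL2: "c k \<in> L2 (lebesgue_on {0<..<T})" for k using c by (auto simp: CE2_bound_def)
  have cm: "(\<lambda>r. max 0 (c k r)) \<in> borel_measurable (lebesgue_on {0<..<T})" for k
    by (intro borel_measurable_max borel_measurable_const) (use cL2[of k] in \<open>simp add: L2_def\<close>)
  have hm: "?h \<in> borel_measurable (lebesgue_on {0<..<T})" using cm bdd by (intro borel_measurable_cINF) auto
  have hL2: "?h \<in> L2 (lebesgue_on {0<..<T})"
  proof -
    have "integrable (lebesgue_on {0<..<T}) (\<lambda>r. (?h r)\<^sup>2)"
    proof (rule Bochner_Integration.integrable_bound[of _ "\<lambda>r. (c 0 r)\<^sup>2"])
      show "integrable (lebesgue_on {0<..<T}) (\<lambda>r. (c 0 r)\<^sup>2)" using cL2[of 0] by (simp add: L2_def)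
      have "(?h r)\<^sup>2 \<le> (c 0 r)\<^sup>2" for r
      proof -
        have "?h r \<le> \<bar>c 0 r\<bar>" using hle[of r 0] by (auto simp: max_def split: if_splits)
        then have "(?h r)\<^sup>2 \<le> \<bar>c 0 r\<bar>\<^sup>2" by (rule power_mono[OF _ h0])
        then show ?thesis by simp
      qed
      then show "AE r in lebesgue_on {0<..<T}. norm ((?h r)\<^sup>2) \<le> norm ((c 0 r)\<^sup>2)" by simp
    qed (use hm in measurable)
    then show ?thesis using hm by (simp add: L2_def)
  qed
  moreover have "\<bar>(\<integral>x. f x * \<rho> t x \<partial>m) - (\<integral>x. f x * \<rho> s x \<partial>m)\<bar>
      \<le> (LINT r:{s..t}|lebesgue. ?h r * sqrt (\<integral>x. (min_relaxed_slope m d f x)\<^sup>2 * \<rho> r x \<partial>m))"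
    if f: "f \<in> Ch_algebra m d" and st: "0 \<le> s" "s \<le> t" "t \<le> T" for f s t
  proof -
    let ?E = "\<lambda>r. sqrt (\<integral>x. (min_relaxed_slope m d f x)\<^sup>2 * \<rho> r x \<partial>m)"
    define a where "a k r = max 0 (c k r) * ?E r" for k r
    have aI: "a k absolutely_integrable_on {0..T}" for k
      unfolding a_def by (rule CE2_bound_integrand(1)[OF c \<rho> f])
    have E0: "0 \<le> ?E r" if "r \<in> {0..T}" for r
      using prob_density_integrable(4)[OF \<rho>[OF that]]
      by (intro real_sqrt_ge_zero integral_nonneg_AE) (auto elim!: eventually_mono)
    define \<Phi> where "\<Phi> u = (\<integral>x. f x * \<rho> u x \<partial>m)" for u
    have bd: "\<bar>\<Phi> v - \<Phi> u\<bar> \<le> integral {u..v} (a k)" if "0 \<le> u" "u \<le> v" "v \<le> T" for k u v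
    proof -
      have "\<bar>\<Phi> v - \<Phi> u\<bar> \<le> (LINT r:{u..v}|lebesgue. c k r * ?E r)"
        using c[of k] f that by (simp add: CE2_bound_def \<Phi>_def)
      also have "\<dots> = (LINT r:{u..v}|lebesgue. a k r)"
        unfolding a_def by (rule CE2_bound_integrand(2)[OF c \<rho> f that(1,3)])
      also have "\<dots> = integral {u..v} (a k)" by (rule set_integral_lebesgue_eq[OF aI that(1,3)])
      finally show ?thesis .
    qed
    have an: "0 \<le> a k r" if "r \<in> {0..T}" for k r using E0[OF that] by (simp add: a_def)
    note L = increment_le_integral_INF[where a = a and \<phi> = \<Phi> and T = T]
    have L1: "(\<lambda>r. INF k. a k r) absolutely_integrable_on {0..T}" by (rule L(1)) (use aI an bd in auto)
    have L2: "\<bar>\<Phi> t - \<Phi> s\<bar> \<le> integral {s..t} (\<lambda>r. INF k. a k r)" by (rule L(2)) (use aI an bd st in auto)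
    have eq: "(INF k. a k r) = ?h r * ?E r" if r: "r \<in> {0..T}" for r
    proof -
      have "(INF k. a k r) = (INF k. ?E r * max 0 (c k r))" by (simp add: a_def mult.commute)
      also have "\<dots> = ?E r * ?h r"
        using E0[OF r] bdd[of r]
        by (intro continuous_at_Inf_mono[of "\<lambda>x. ?E r * x" "range (\<lambda>k. max 0 (c k r))", symmetric, unfolded image_image])
           (auto intro!: monoI mult_left_mono continuous_intros)
      finally show ?thesis by (simp add: mult.commute)
    qed
    note L2
    also have "integral {s..t} (\<lambda>r. INF k. a k r) = (LINT r:{s..t}|lebesgue. INF k. a k r)"
      by (rule set_integral_lebesgue_eq[symmetric, OF L1 st(1,3)])
    also have "\<dots> = (LINT r:{s..t}|lebesgue. ?h r * ?E r)"
      using eq st by (intro set_lebesgue_integral_cong) auto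
    finally show ?thesis by (simp add: \<Phi>_def)
  qed
  ultimately show ?thesis using h0 by (simp add: CE2_bound_def)
qed

text \<open>The infimum h of a sequence minimising the L2 energy of the speed is admissible. For any
  other speed c' the minimum of h and c' is admissible and cannot have less energy, so it equals h
  a.e. This makes the choice in \<open>CE2_speed\<close> meaningful.\<close>

lemma CE2_speed:
  assumes c: "CE2_bound m d T \<rho> c0" and \<rho>: "\<And>t. t \<in> {0..T} \<Longrightarrow> prob_density m (\<rho> t)"
  shows "CE2_bound m d T \<rho> (CE2_speed m d T \<rho>)"
    and "\<And>c'. CE2_bound m d T \<rho> c' \<Longrightarrow> AE r in lebesgue_on {0<..<T}. CE2_speed m d T \<rho> r \<le> c' r"
proof -
  let ?M = "lebesgue_on {0<..<T}"
  define J where "J c = (\<integral>r. (c r)\<^sup>2 \<partial>?M)" for c :: "real \<Rightarrow> real"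
  define \<C> where "\<C> = {c. CE2_bound m d T \<rho> c}"
  define I where "I = (INF c\<in>\<C>. J c)"
  have J0: "0 \<le> J c" for c by (simp add: J_def)
  have bdd: "bdd_below (J ` \<C>)" using J0 by (intro bdd_belowI[of _ 0]) auto
  have ne: "\<C> \<noteq> {}" using c by (auto simp: \<C>_def)
  have "\<exists>c\<in>\<C>. J c < I + 1 / real (Suc n)" for n
    by (subst cINF_less_iff[OF ne bdd, symmetric]) (simp add: I_def)
  then obtain C where C: "\<And>n. CE2_bound m d T \<rho> (C n)" "\<And>n. J (C n) < I + 1 / real (Suc n)"
    unfolding \<C>_def by (metis mem_Collect_eq)
  define h where "h r = (INF k. max 0 (C k r))" for r
  have hb: "CE2_bound m d T \<rho> h" unfolding h_def by (rule CE2_bound_INF[OF C(1) \<rho>])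
  have bddh: "bdd_below (range (\<lambda>k. max 0 (C k r)))" for r by (intro bdd_belowI[of _ 0]) auto
  have h0: "0 \<le> h r" for r unfolding h_def by (intro cINF_greatest) auto
  have int: "integrable ?M (\<lambda>r. (c r)\<^sup>2)" if "CE2_bound m d T \<rho> c" for c using that by (simp add: CE2_bound_def L2_def)
  have Jmono: "J u \<le> J v" if "CE2_bound m d T \<rho> u" "CE2_bound m d T \<rho> v" "\<And>r. 0 \<le> u r \<and> u r \<le> \<bar>v r\<bar>" for u v
    unfolding J_def
  proof (rule integral_mono[OF int[OF that(1)] int[OF that(2)]])
    show "(u r)\<^sup>2 \<le> (v r)\<^sup>2" for r
      using power_mono[of "u r" "\<bar>v r\<bar>" 2] that(3)[of r] by simp
  qed
  have "J h \<le> J (C n)" for n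
  proof (rule Jmono[OF hb C(1)])
    have "h r \<le> max 0 (C n r)" for r unfolding h_def by (rule cINF_lower[OF bddh]) auto
    then show "0 \<le> h r \<and> h r \<le> \<bar>C n r\<bar>" for r using h0[of r] by (smt (verit))
  qed
  then have "J h \<le> I + 1 / real (Suc n)" for n using C(2)[of n] by (meson less_imp_le order_trans)
  then have "J h \<le> I + 0"
    by (intro LIMSEQ_le_const[OF tendsto_add[OF tendsto_const LIMSEQ_inverse_real_of_nat]]) (auto simp: inverse_eq_divide)
  then have JI: "J h \<le> I" by simp
  have least: "AE r in ?M. h r \<le> c' r" if c': "CE2_bound m d T \<rho> c'" for c'
  proof -
    \<comment> \<open>The minimum of two speeds, written as a countable infimum so that the closure
      lemma applies.\<close>
    define u where "u r = (INF k::nat. max 0 ((if k = 0 then h else c') r))" for r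
    have ub: "CE2_bound m d T \<rho> u" unfolding u_def by (rule CE2_bound_INF[OF _ \<rho>]) (use hb c' in auto)
    have bddu: "bdd_below (range (\<lambda>k::nat. max 0 ((if k = 0 then h else c') r)))" for r by (intro bdd_belowI[of _ 0]) auto
    have u0: "0 \<le> u r" for r unfolding u_def by (intro cINF_greatest) auto
    have uh: "u r \<le> h r" for r using cINF_lower[OF bddu, of 0 r] h0[of r] by (simp add: u_def)
    have uc: "u r \<le> max 0 (c' r)" for r using cINF_lower[OF bddu, of 1 r] by (simp add: u_def)
    have "I \<le> J u" unfolding I_def using ub by (intro cINF_lower[OF bdd]) (simp add: \<C>_def)
    then have le: "(\<integral>r. (h r)\<^sup>2 - (u r)\<^sup>2 \<partial>?M) \<le> 0" using JI int[OF hb] int[OF ub] by (simp add: J_def)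
    have nn: "AE r in ?M. 0 \<le> (h r)\<^sup>2 - (u r)\<^sup>2" using uh u0 by (simp add: power_mono)
    have i: "integrable ?M (\<lambda>r. (h r)\<^sup>2 - (u r)\<^sup>2)" using int[OF hb] int[OF ub] by simp
    have "(\<integral>r. (h r)\<^sup>2 - (u r)\<^sup>2 \<partial>?M) = 0" using le integral_nonneg_AE[OF nn] by linarith
    then have "AE r in ?M. (h r)\<^sup>2 - (u r)\<^sup>2 = 0" using integral_nonneg_eq_0_iff_AE[OF i nn] by simp
    moreover have "AE r in ?M. 0 \<le> c' r" using c' by (simp add: CE2_bound_def)
    ultimately show ?thesis
    proof eventually_elim
      case (elim r)
      then have "h r = u r" using h0[of r] u0[of r] by (simp add: power2_eq_iff_nonneg)
      with uc[of r] elim show ?case by simp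
    qed
  qed
  have "CE2_bound m d T \<rho> (CE2_speed m d T \<rho>) \<and>
     (\<forall>c'. CE2_bound m d T \<rho> c' \<longrightarrow> (AE r in lebesgue_on {0<..<T}. CE2_speed m d T \<rho> r \<le> c' r))"
    unfolding CE2_speed_def by (rule someI[of _ h]) (use hb least in blast)
  then show "CE2_bound m d T \<rho> (CE2_speed m d T \<rho>)"
    "\<And>c'. CE2_bound m d T \<rho> c' \<Longrightarrow> AE r in lebesgue_on {0<..<T}. CE2_speed m d T \<rho> r \<le> c' r" by blast+
qed

text \<open>A joining curve has densities at both ends, which makes \<mu> and \<nu> Radon; without
  one \<open>W_Ch\<close> is infinite. Since the inequality holds for all pairs, it passes directly
  to metric derivatives.\<close>

theorem Wasserstein_le_W_Ch: "Wasserstein d \<mu> \<nu> \<le> W_Ch m d \<mu> \<nu>"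
  unfolding W_Ch_def Wasserstein_def
proof (rule esqrt_mono, rule INF_greatest)
  fix \<rho> assume "\<rho> \<in> {\<rho> \<in> CE2 m d 1. mu (\<rho> 0) = \<mu> \<and> mu (\<rho> 1) = \<nu>}"
  then have *: "\<rho> \<in> CE2 m d 1" "mu (\<rho> 0) = \<mu>" "mu (\<rho> 1) = \<nu>" by auto
  then obtain c0 where c0: "CE2_bound m d 1 \<rho> c0" and \<rho>: "\<And>t. t \<in> {0..1} \<Longrightarrow> prob_density m (\<rho> t)"
    unfolding CE2_def by blast
  define c where "c = CE2_speed m d 1 \<rho>"
  have cb: "CE2_bound m d 1 \<rho> c" unfolding c_def by (rule CE2_speed(1)[OF c0 \<rho>])
  have \<rho>01: "prob_density m (\<rho> 0)" "prob_density m (\<rho> 1)" by (auto intro: \<rho>)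
  have R: "\<mu> \<in> Radon_prob" "\<nu> \<in> Radon_prob" using mu_Radon \<rho>01 * by auto
  define C where "C = integral {0..1} (\<lambda>r. (c r)\<^sup>2)"
  have i2: "integrable (lebesgue_on {0<..<1}) (\<lambda>r. (c r)\<^sup>2)" using cb by (simp add: CE2_bound_def L2_def)
  obtain \<pi> where \<pi>: "\<pi> \<in> Radon_prob" "distr \<pi> borel fst = \<mu>" "distr \<pi> borel snd = \<nu>"
    "(\<integral>\<^sup>+(x, y). (d x y)\<^sup>2 \<partial>\<pi>) \<le> ennreal C"
  proof (rule coupling_of_dual_bound[OF d R])
    fix \<delta> \<phi> \<psi>
    assume a: "\<delta> \<in> admissible d" "\<phi> \<in> blip \<delta>" "\<psi> \<in> blip \<delta>" "\<And>x y. \<phi> x + \<psi> y \<le> (\<delta> x y)\<^sup>2"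
    have "(\<integral>x. \<phi> x \<partial>\<mu>) = (\<integral>x. \<phi> x * \<rho> 0 x \<partial>m)" "(\<integral>x. \<psi> x \<partial>\<nu>) = (\<integral>x. \<psi> x * \<rho> 1 x \<partial>m)"
      using integral_mu[OF \<rho>01(1)] integral_mu[OF \<rho>01(2)] *(2,3) Lip_b_integrable(1)[OF blip_Lip_b m] a by auto
    then show "(\<integral>x. \<phi> x \<partial>\<mu>) + (\<integral>x. \<psi> x \<partial>\<nu>) \<le> C"
      using Kuwada[OF cb \<rho> a] by (simp add: C_def)
  qed
  have "C = (\<integral>r. (c r)\<^sup>2 \<partial>lebesgue_on {0<..<1})"
  proof -
    have "(\<lambda>r. (c r)\<^sup>2) absolutely_integrable_on {0<..<1}"
      using i2 by (simp add: integrable_restrict_space set_integrable_def)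
    then have "(LINT r:{0<..<1}|lebesgue. (c r)\<^sup>2) = integral {0<..<1} (\<lambda>r. (c r)\<^sup>2)"
      by (rule set_lebesgue_integral_eq_integral(2))
    also have "\<dots> = C" unfolding C_def using integral_open_interval_real[of 0 1 "\<lambda>r. (c r)\<^sup>2"] by simp
    finally show ?thesis by (simp add: integral_restrict_space set_lebesgue_integral_def)
  qed
  then have "ennreal C = (\<integral>\<^sup>+t. ennreal ((c t)\<^sup>2) \<partial>lebesgue_on {0<..<1})"
    using i2 by (simp add: nn_integral_eq_integral)
  with \<pi> show "(INF \<pi>\<in>{\<pi> \<in> Radon_prob. distr \<pi> borel fst = \<mu> \<and> distr \<pi> borel snd = \<nu>}. \<integral>\<^sup>+(x, y). (d x y)\<^sup>2 \<partial>\<pi>)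
      \<le> (\<integral>\<^sup>+t. ennreal ((CE2_speed m d 1 \<rho> t)\<^sup>2) \<partial>lebesgue_on {0<..<1})"
    unfolding c_def[symmetric] by (intro INF_lower2[of \<pi>]) auto
qed

end

subsection \<open>Wasserstein-Lipschitz curves of bounded densities\<close>

context emms
begin

text \<open>Lower semicontinuity of \<open>d\<close> in the product topology, as a supremum of
  continuous functions. The maximum with 0 in the proof reflects that \<open>ennreal\<close> sends
  negative numbers to 0.\<close>

lemma closed_dist_le: "closed {(x, y). d x y \<le> ennreal q}"
proof -
  have "{(x, y). d x y \<le> ennreal q} = (\<Inter>\<delta>\<in>admissible d. {z. (\<lambda>(x, y). \<delta> x y) z \<le> max 0 q})"
    using ennreal_le_iff[of "max 0 q"] by (auto simp: SUP_admissible[OF d] SUP_le_iff)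
  also have "closed \<dots>"
    by (intro closed_INT ballI closed_Collect_le continuous_on_const admissibleD(6))
  finally show ?thesis .
qed

lemma borel_dist: "(\<lambda>z. d (fst z) (snd z)) \<in> borel_measurable borel"
proof (rule borel_measurableI_greater)
  fix a :: ennreal
  have "{z. a < d (fst z) (snd z)} = (\<Union>\<delta>\<in>admissible d. {z. a < ennreal ((\<lambda>(x, y). \<delta> x y) z)})"
    by (auto simp: SUP_admissible[OF d] less_SUP_iff)
  moreover have "open \<dots>"
    by (intro open_UN ballI open_Collect_less continuous_on_const continuous_on_ennreal admissibleD(6))
  ultimately show "{z \<in> space borel. a < d (fst z) (snd z)} \<in> sets borel" by simp
qed

text \<open>
  A one-sided difference quotient over all \<open>y\<close> is an uncountable supremum. Restricting \<open>x\<close> and \<open>y\<close> to a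
  \<open>\<sigma>\<close>-compact set makes it Borel, since its superlevel sets are then countable unions of projections of
  compact sets.
\<close>

lemma local_slope_functions:
  assumes f: "f \<in> Lip_b d" and L: "0 \<le> L" "\<And>x y. ennreal \<bar>f x - f y\<bar> \<le> ennreal L * d x y"
    and K: "\<And>n::nat. compact (K n)"
  obtains u :: "nat \<Rightarrow> 'a \<Rightarrow> real" where "\<And>k. u k \<in> borel_measurable borel" "\<And>k x. 0 \<le> u k x \<and> u k x \<le> L"
    "\<And>k x y D. x \<in> (\<Union>n. K n) \<Longrightarrow> y \<in> (\<Union>n. K n) \<Longrightarrow> d x y = ennreal D \<Longrightarrow> 0 \<le> D \<Longrightarrow> D < 1 / real (Suc k) \<Longrightarrow>
      \<bar>f x - f y\<bar> \<le> u k x * D"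
    "\<And>k x B. 0 \<le> B \<Longrightarrow> \<forall>y D. d x y = ennreal D \<and> 0 \<le> D \<and> D < 1 / real (Suc k) \<longrightarrow> \<bar>f x - f y\<bar> \<le> B * D \<Longrightarrow> u k x \<le> B"
proof -
  \<comment> \<open>q bounds a distance and c a slope: x lies in A if some y in K j has distance at
    most q from x and \<open>\<bar>f x - f y\<bar> \<ge> c * q\<close>. Rational parameters leave
    countably many sets.\<close>
  define A :: "nat \<times> nat \<times> rat \<times> rat \<Rightarrow> 'a set" where "A = (\<lambda>(n, j, q, c). fst ` ((K n \<times> K j) \<inter>
    ({(x, y). d x y \<le> ennreal (of_rat q)} \<inter> {z. of_rat c * of_rat q \<le> \<bar>f (fst z) - f (snd z)\<bar>})))"
  define h :: "nat \<Rightarrow> nat \<times> nat \<times> rat \<times> rat \<Rightarrow> 'a \<Rightarrow> real" where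
    "h k i x = (case i of (n, j, q, c) \<Rightarrow> if 0 < q \<and> of_rat q < 1 / real (Suc k) \<and> 0 < c \<and> x \<in> A i then of_rat c else 0)" for k i x
  have fc: "continuous_on UNIV f" by (rule Lip_b_continuous[OF f])
  have "compact (A i)" for i
  proof -
    obtain n j q c where i: "i = (n, j, q, c)" by (cases i) auto
    have "closed {z. of_rat c * of_rat q \<le> \<bar>f (fst z) - f (snd z)\<bar>}"
      by (intro closed_Collect_le continuous_intros continuous_on_compose2[OF fc]) auto
    then have "compact ((K n \<times> K j) \<inter> ({(x, y). d x y \<le> ennreal (of_rat q)} \<inter> {z. of_rat c * of_rat q \<le> \<bar>f (fst z) - f (snd z)\<bar>}))"
      by (intro compact_Int_closed compact_Times K closed_Int closed_dist_le)
    then show ?thesis unfolding A_def i prod.case by (intro compact_continuous_image continuous_intros)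
  qed
  then have As: "A i \<in> sets borel" for i by (rule borel_compact)
  have hm: "h k i \<in> borel_measurable borel" for k i
  proof -
    obtain n j q c where i: "i = (n, j, q, c)" by (cases i) auto
    have "h k i = (\<lambda>x. if 0 < q \<and> of_rat q < 1 / real (Suc k) \<and> 0 < c then indicator (A i) x * of_rat c else 0)"
      by (auto simp: h_def i)
    also have "\<dots> \<in> borel_measurable borel" using As by auto
    finally show ?thesis .
  qed
  have hB: "h k i x \<le> B"
    if B: "0 \<le> B" "\<And>y D. d x y = ennreal D \<Longrightarrow> 0 \<le> D \<Longrightarrow> D < 1 / real (Suc k) \<Longrightarrow> \<bar>f x - f y\<bar> \<le> B * D" for k i x B
  proof (cases i)
    case (fields n j q c)
    show ?thesis
    proof (cases "0 < q \<and> of_rat q < 1 / real (Suc k) \<and> 0 < c \<and> x \<in> A i")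
      case True
      then obtain y where y: "d x y \<le> ennreal (of_rat q)" "of_rat c * of_rat q \<le> \<bar>f x - f y\<bar>"
        by (auto simp: A_def fields)
      have q0: "(0::real) < of_rat q" using True by simp
      obtain D where D: "d x y = ennreal D" "0 \<le> D" using y(1) by (cases "d x y") (auto simp: top_unique)
      have Dq: "D \<le> of_rat q" using y(1) D q0 by (simp add: ennreal_le_iff)
      then have "\<bar>f x - f y\<bar> \<le> B * D" using True D by (intro B(2)) auto
      also have "\<dots> \<le> B * of_rat q" using Dq B(1) by (rule mult_left_mono)
      finally have "of_rat c * of_rat q \<le> B * (of_rat q :: real)" using y(2) by simp
      then have "of_rat c \<le> B" using q0 by (simp add: mult_le_cancel_right)
      with True show ?thesis by (simp add: h_def fields)
    qed (use B(1) in \<open>auto simp: h_def fields\<close>)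
  qed
  have hL: "h k i x \<le> L" for k i x
  proof (rule hB[OF L(1)])
    show "\<bar>f x - f y\<bar> \<le> L * D" if "d x y = ennreal D" "0 \<le> D" for y D by (rule ennreal_Lipschitz_real[OF L that])
  qed
  have bdd: "bdd_above (range (\<lambda>i. h k i x))" for k x using hL by (intro bdd_aboveI[of _ L]) auto
  have h0: "0 \<le> h k i x" for k i x by (cases i) (auto simp: h_def)
  show thesis
  proof (rule that[of "\<lambda>k x. SUP i. h k i x"])
    show "(\<lambda>x. SUP i. h k i x) \<in> borel_measurable borel" for k
      using hm bdd by (intro borel_measurable_cSUP) auto
    show u0: "0 \<le> (SUP i. h k i x) \<and> (SUP i. h k i x) \<le> L" for k x
      using order_trans[OF h0 cSUP_upper[OF UNIV_I bdd]] hL by (auto intro: cSUP_least)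
    show "(SUP i. h k i x) \<le> B"
      if "0 \<le> B" "\<forall>y D. d x y = ennreal D \<and> 0 \<le> D \<and> D < 1 / real (Suc k) \<longrightarrow> \<bar>f x - f y\<bar> \<le> B * D" for k x B
      using hB[OF that(1)] that(2) by (intro cSUP_least) auto
    fix k x y D
    assume xy: "x \<in> (\<Union>n. K n)" "y \<in> (\<Union>n. K n)" "d x y = ennreal D" "0 \<le> D" "D < 1 / real (Suc k)"
    let ?u = "SUP i. h k i x"
    show "\<bar>f x - f y\<bar> \<le> ?u * D"
    proof (rule ccontr)
      assume n: "\<not> \<bar>f x - f y\<bar> \<le> ?u * D"
      have D: "0 < D"
      proof (rule ccontr)
        assume "\<not> 0 < D"
        then have "d x y = 0" using xy by simp
        then have "x = y" using ext by (simp add: extended_metric_def)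
        with n \<open>\<not> 0 < D\<close> xy(4) show False by simp
      qed
      with n have "?u < \<bar>f x - f y\<bar> / D" by (simp add: field_simps)
      then obtain c where c: "?u < of_rat c" "of_rat c < \<bar>f x - f y\<bar> / D" using of_rat_dense by blast
      have c0: "(0::real) < of_rat c" using c(1) u0[of k x] by linarith
      \<comment> \<open>A rational q slightly above D is still below 1/(k+1) and keeps
        \<open>c * q \<le> \<bar>f x - f y\<bar>\<close>.\<close>
      have "D < min (1 / real (Suc k)) (\<bar>f x - f y\<bar> / of_rat c)" using xy(5) c(2) c0 D by (simp add: field_simps)
      then obtain q where q: "D < of_rat q" "of_rat q < min (1 / real (Suc k)) (\<bar>f x - f y\<bar> / of_rat c)" using of_rat_dense by blast
      obtain n j where nj: "x \<in> K n" "y \<in> K j" using xy(1,2) by blast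
      have "of_rat c * of_rat q \<le> \<bar>f x - f y\<bar>" using q(2) c0 by (simp add: field_simps)
      moreover have "d x y \<le> ennreal (of_rat q)" using q(1) xy by (simp add: ennreal_leI)
      ultimately have "(x, y) \<in> (K n \<times> K j) \<inter> ({(x, y). d x y \<le> ennreal (of_rat q)} \<inter> {z. of_rat c * of_rat q \<le> \<bar>f (fst z) - f (snd z)\<bar>})"
        using nj by simp
      then have "x \<in> A (n, j, q, c)" unfolding A_def prod.case by (metis (no_types, lifting) fst_conv image_eqI)
      moreover have "0 < q" using q(1) D by (metis less_trans zero_less_of_rat_iff)
      moreover have "0 < c" using c0 by simp
      ultimately have "h k (n, j, q, c) x = of_rat c" using q(2) by (simp add: h_def)
      moreover have "h k (n, j, q, c) x \<le> ?u" by (rule cSUP_upper[OF UNIV_I bdd])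
      ultimately show False using c(1) by simp
    qed
  qed
qed

text \<open>For almost every x the slopes u k at scale 1/(k+1) are asymptotically at most the slope
  of f, and everything is bounded by L. A single k thus makes the m-integral of the excess less than
  e/M, and this controls all densities below M at once.\<close>

lemma local_slope_bound:
  assumes f: "f \<in> Lip_b d" and e: "0 < e" and M: "0 < M"
  obtains v X \<kappa> V where "AE x in m. x \<in> X" "v \<in> borel_measurable m" "\<And>x. 0 \<le> v x \<and> v x \<le> V" "0 < \<kappa>"
    "\<And>x y D. x \<in> X \<Longrightarrow> y \<in> X \<Longrightarrow> d x y = ennreal D \<Longrightarrow> 0 \<le> D \<Longrightarrow> D < \<kappa> \<Longrightarrow> \<bar>f x - f y\<bar> \<le> v x * D"
    "\<And>\<rho>. prob_density m \<rho> \<Longrightarrow> AE x in m. \<rho> x \<le> M \<Longrightarrow> (\<integral>x. (v x)\<^sup>2 * \<rho> x \<partial>m) \<le> (\<integral>x. (lp f x)\<^sup>2 * \<rho> x \<partial>m) + e"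
proof -
  obtain L where L: "0 \<le> L" "\<And>x y. ennreal \<bar>f x - f y\<bar> \<le> ennreal L * d x y" by (rule Lip_bE[OF f]) (rule that)
  obtain K where K: "\<And>n::nat. compact (K n)" and "AE x in m. x \<in> UNIV \<longrightarrow> x \<in> (\<Union>n. K n)"
    by (rule Radon_sigma_compact[OF m, of UNIV]) auto
  then have K2: "AE x in m. x \<in> (\<Union>n. K n)" by simp
  obtain u :: "nat \<Rightarrow> 'a \<Rightarrow> real" where u: "\<And>k. u k \<in> borel_measurable borel" "\<And>k x. 0 \<le> u k x \<and> u k x \<le> L"
    "\<And>k x y D. x \<in> (\<Union>n. K n) \<Longrightarrow> y \<in> (\<Union>n. K n) \<Longrightarrow> d x y = ennreal D \<Longrightarrow> 0 \<le> D \<Longrightarrow> D < 1 / real (Suc k) \<Longrightarrow>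
      \<bar>f x - f y\<bar> \<le> u k x * D"
    "\<And>k x B. 0 \<le> B \<Longrightarrow> \<forall>y D. d x y = ennreal D \<and> 0 \<le> D \<and> D < 1 / real (Suc k) \<longrightarrow> \<bar>f x - f y\<bar> \<le> B * D \<Longrightarrow> u k x \<le> B"
    by (rule local_slope_functions[OF f L K]) (rule that)
  define w where "w x = min L (lp f x)" for x
  \<comment> \<open>The maximum with w makes \<open>v\<^sup>2 - w\<^sup>2\<close> nonnegative, so
    the density may be replaced by its upper bound M. The cut-off at L in w turns an a.e. bound into
    one everywhere.\<close>
  define v where "v k x = max (u k x) (w x)" for k x
  have wm: "w \<in> borel_measurable m" unfolding w_def using lips_measurable[OF m f] by measurable
  have um: "u k \<in> borel_measurable m" for k using u(1) sets_m by (simp cong: measurable_cong_sets)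
  have vm: "v k \<in> borel_measurable m" for k unfolding v_def using wm um by measurable
  have w: "0 \<le> w x" "w x \<le> L" for x using L(1) lips_nonneg[of m d f x] by (auto simp: w_def)
  have v: "0 \<le> v k x \<and> v k x \<le> L" "w x \<le> v k x" for k x using w[of x] u(2)[of k x] by (auto simp: v_def)
  have wlp: "AE x in m. w x = lp f x" using lips_le_Lipschitz[OF m f L] by eventually_elim (simp add: w_def)
  have lim: "AE x in m. (\<lambda>k. (v k x)\<^sup>2 - (w x)\<^sup>2) \<longlonglongrightarrow> 0"
    using lips_ge[OF m f] wlp
  proof eventually_elim
    case (elim x)
    have "(\<lambda>k. v k x) \<longlonglongrightarrow> w x"
    proof (rule LIMSEQ_I)
      fix e :: real assume e: "0 < e"
      obtain r where r: "0 < r" "\<And>y z D. d y x < ennreal r \<Longrightarrow> d z x < ennreal r \<Longrightarrow> d y z = ennreal D \<Longrightarrow> 0 \<le> D \<Longrightarrow>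
          \<bar>f y - f z\<bar> \<le> (lipa d f x + e / 2) * D"
        by (rule lipaD[OF ext f half_gt_zero[OF e], where x = x]) (rule that)
      obtain N where N: "1 / real (Suc N) < r" using r(1) nat_approx_posE by blast
      have "norm (v k x - w x) < e" if k: "N \<le> k" for k
      proof -
        have "u k x \<le> lipa d f x + e / 2"
        proof (rule u(4), goal_cases)
          case 1 show "0 \<le> lipa d f x + e / 2" using e lipa_nonneg[of d f x] by simp
        next
          case 2
          have "\<bar>f x - f y\<bar> \<le> (lipa d f x + e / 2) * D" if y: "d x y = ennreal D" "0 \<le> D" "D < 1 / real (Suc k)" for y D
          proof -
          have "1 / real (Suc k) \<le> 1 / real (Suc N)" using k by (simp add: field_simps)
          then have "D < r" using y N by linarith
          moreover have "d x x = 0" "d y x = d x y" using ext by (auto simp: extended_metric_def)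
          ultimately show ?thesis
            using y r(1) by (intro r(2)) (auto simp: ennreal_less_iff)
          qed
          then show ?case by blast
        qed
        then show ?thesis using elim v(2)[of x k] e by (auto simp: v_def)
      qed
      then show "\<exists>N. \<forall>k\<ge>N. norm (v k x - w x) < e" by blast
    qed
    then have "(\<lambda>k. (v k x)\<^sup>2 - (w x)\<^sup>2) \<longlonglongrightarrow> (w x)\<^sup>2 - (w x)\<^sup>2" by (intro tendsto_intros)
    then show ?case by simp
  qed
  have sq: "0 \<le> (v k x)\<^sup>2 - (w x)\<^sup>2" "(v k x)\<^sup>2 - (w x)\<^sup>2 \<le> L\<^sup>2" for k x
  proof -
    show "0 \<le> (v k x)\<^sup>2 - (w x)\<^sup>2" using v(2)[of x k] w(1)[of x] by (simp add: power_mono)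
    have "(v k x)\<^sup>2 \<le> L\<^sup>2" using v(1)[of k x] by (intro power_mono) auto
    then show "(v k x)\<^sup>2 - (w x)\<^sup>2 \<le> L\<^sup>2" using zero_le_power2[of "w x"] by linarith
  qed
  have "(\<lambda>k. \<integral>x. (v k x)\<^sup>2 - (w x)\<^sup>2 \<partial>m) \<longlonglongrightarrow> (\<integral>x. 0 \<partial>m)"
  proof (rule integral_dominated_convergence[where w = "\<lambda>_. L\<^sup>2"])
    show "AE x in m. norm ((v k x)\<^sup>2 - (w x)\<^sup>2) \<le> L\<^sup>2" for k using sq by simp
  qed (use vm wm lim in auto)
  then have "\<forall>\<^sub>F k in sequentially. (\<integral>x. (v k x)\<^sup>2 - (w x)\<^sup>2 \<partial>m) < e / M" using e M by (intro order_tendstoD(2)) auto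
  then obtain k where k: "(\<integral>x. (v k x)\<^sup>2 - (w x)\<^sup>2 \<partial>m) < e / M" by (auto simp: eventually_sequentially)
  show thesis
  proof (rule that[OF K2 vm v(1), of "1 / real (Suc k)" k])
    show "\<bar>f x - f y\<bar> \<le> v k x * D" if xy: "x \<in> (\<Union>n. K n)" "y \<in> (\<Union>n. K n)" "d x y = ennreal D" "0 \<le> D" "D < 1 / real (Suc k)" for x y D
    proof -
      have "u k x * D \<le> v k x * D" using xy(4) by (intro mult_right_mono) (simp add: v_def)
      with u(3)[OF xy] show ?thesis by simp
    qed
    fix \<rho> assume \<rho>: "prob_density m \<rho>" and \<rho>M: "AE x in m. \<rho> x \<le> M"
    have i: "integrable m (\<lambda>x. (v k x)\<^sup>2 * \<rho> x)" "integrable m (\<lambda>x. (w x)\<^sup>2 * \<rho> x)"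
    proof -
      have "(v k x)\<^sup>2 \<le> L\<^sup>2" "(w x)\<^sup>2 \<le> L\<^sup>2" for x using v(1)[of k x] w[of x] by (auto intro!: power_mono)
      then show "integrable m (\<lambda>x. (v k x)\<^sup>2 * \<rho> x)" "integrable m (\<lambda>x. (w x)\<^sup>2 * \<rho> x)"
        using vm wm by (auto intro!: prob_density_mult_integrable[OF \<rho>, of _ "L\<^sup>2"])
    qed
    have "(\<integral>x. (v k x)\<^sup>2 * \<rho> x \<partial>m) - (\<integral>x. (w x)\<^sup>2 * \<rho> x \<partial>m) = (\<integral>x. ((v k x)\<^sup>2 - (w x)\<^sup>2) * \<rho> x \<partial>m)"
      using i by (simp add: left_diff_distrib)
    also have "\<dots> \<le> (\<integral>x. M * ((v k x)\<^sup>2 - (w x)\<^sup>2) \<partial>m)"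
    proof (rule integral_mono_AE)
      show "integrable m (\<lambda>x. ((v k x)\<^sup>2 - (w x)\<^sup>2) * \<rho> x)" using i by (simp add: left_diff_distrib)
      show "integrable m (\<lambda>x. M * ((v k x)\<^sup>2 - (w x)\<^sup>2))"
        using vm wm sq by (intro integrable_mult_right integrable_const_bound[of _ "L\<^sup>2"]) auto
      show "AE x in m. ((v k x)\<^sup>2 - (w x)\<^sup>2) * \<rho> x \<le> M * ((v k x)\<^sup>2 - (w x)\<^sup>2)"
        using \<rho>M by eventually_elim (metis mult.commute mult_right_mono sq(1))
    qed
    also have "\<dots> \<le> M * (e / M)" using k M by (simp del: times_divide_eq_right)
    also have "\<dots> = e" using M by simp
    also have "(\<integral>x. (w x)\<^sup>2 * \<rho> x \<partial>m) = (\<integral>x. (lp f x)\<^sup>2 * \<rho> x \<partial>m)"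
      using wlp wm lips_measurable[OF m f] prob_density_integrable(3)[OF \<rho>]
      by (intro Bochner_Integration.integral_cong_AE) (auto elim!: eventually_mono)
    finally show "(\<integral>x. (v k x)\<^sup>2 * \<rho> x \<partial>m) \<le> (\<integral>x. (lp f x)\<^sup>2 * \<rho> x \<partial>m) + e" by simp
  qed simp
qed

text \<open>In a coupling of cost below \<open>C\<^sup>2\<close>, pairs closer than \<kappa>
  contribute at most \<open>v * D\<close>, to which Cauchy-Schwarz applies, and for the other pairs
  \<open>L * D \<le> L / \<kappa> * D\<^sup>2\<close>. Long transport is therefore of second order
  in C.\<close>

lemma coupling_increment_le:
  assumes \<rho>: "prob_density m \<rho>a" "prob_density m \<rho>b" and W: "Wasserstein d (mu \<rho>a) (mu \<rho>b) < ennreal C" and C: "0 \<le> C"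
    and f: "f \<in> Lip_b d" and L: "0 \<le> L" "\<And>x y. ennreal \<bar>f x - f y\<bar> \<le> ennreal L * d x y"
    and X: "AE x in m. x \<in> X" and v: "v \<in> borel_measurable m" "\<And>x. 0 \<le> v x \<and> v x \<le> V" and k: "0 < \<kappa>"
    and loc: "\<And>x y D. x \<in> X \<Longrightarrow> y \<in> X \<Longrightarrow> d x y = ennreal D \<Longrightarrow> 0 \<le> D \<Longrightarrow> D < \<kappa> \<Longrightarrow> \<bar>f x - f y\<bar> \<le> v x * D"
  shows "\<bar>(\<integral>x. f x * \<rho>b x \<partial>m) - (\<integral>x. f x * \<rho>a x \<partial>m)\<bar> \<le> sqrt (\<integral>x. (v x)\<^sup>2 * \<rho>a x \<partial>m) * C + L / \<kappa> * C\<^sup>2"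
proof -
  have "\<not> ennreal (C\<^sup>2) \<le> (INF \<pi>\<in>{\<pi> \<in> Radon_prob. distr \<pi> borel fst = mu \<rho>a \<and> distr \<pi> borel snd = mu \<rho>b}. \<integral>\<^sup>+(x, y). (d x y)\<^sup>2 \<partial>\<pi>)"
  proof
    assume "ennreal (C\<^sup>2) \<le> (INF \<pi>\<in>{\<pi> \<in> Radon_prob. distr \<pi> borel fst = mu \<rho>a \<and> distr \<pi> borel snd = mu \<rho>b}. \<integral>\<^sup>+(x, y). (d x y)\<^sup>2 \<partial>\<pi>)"
    from esqrt_mono[OF this] W have "esqrt (ennreal (C\<^sup>2)) < ennreal C" by (simp add: Wasserstein_def)
    with C show False by (simp add: esqrt_def)
  qed
  then obtain \<pi> where \<pi>: "\<pi> \<in> Radon_prob" "distr \<pi> borel fst = mu \<rho>a" "distr \<pi> borel snd = mu \<rho>b"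
    "(\<integral>\<^sup>+(x, y). (d x y)\<^sup>2 \<partial>\<pi>) < ennreal (C\<^sup>2)"
    unfolding not_le INF_less_iff by auto
  have pp: "prob_space \<pi>" and sp: "sets \<pi> = sets borel" using \<pi>(1) by (auto simp: Radon_prob_def)
  interpret \<pi>: prob_space \<pi> by fact
  define D where "D z = enn2real (d (fst z) (snd z))" for z
  have dm: "(\<lambda>z. d (fst z) (snd z)) \<in> borel_measurable \<pi>" using borel_dist sp by (simp cong: measurable_cong_sets)
  have Dm: "D \<in> borel_measurable \<pi>" unfolding D_def using dm by measurable
  have fs: "fst \<in> measurable \<pi> borel" "snd \<in> measurable \<pi> borel" using borel_fst_snd sp by (simp_all cong: measurable_cong_sets)
  have cost: "(\<integral>\<^sup>+z. (d (fst z) (snd z))\<^sup>2 \<partial>\<pi>) < ennreal (C\<^sup>2)" using \<pi>(4) by (simp add: case_prod_beta')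
  have fin: "AE z in \<pi>. d (fst z) (snd z) = ennreal (D z)"
  proof -
    have "AE z in \<pi>. (d (fst z) (snd z))\<^sup>2 \<noteq> \<infinity>" using cost dm by (intro nn_integral_noteq_infinite) auto
    then show ?thesis by eventually_elim (auto simp: D_def less_top power2_eq_square ennreal_mult_eq_top_iff)
  qed
  have nn: "(\<integral>\<^sup>+z. ennreal ((D z)\<^sup>2) \<partial>\<pi>) < ennreal (C\<^sup>2)"
  proof -
    have "(\<integral>\<^sup>+z. ennreal ((D z)\<^sup>2) \<partial>\<pi>) = (\<integral>\<^sup>+z. (d (fst z) (snd z))\<^sup>2 \<partial>\<pi>)"
    proof (rule nn_integral_cong_AE)
      show "AE z in \<pi>. ennreal ((D z)\<^sup>2) = (d (fst z) (snd z))\<^sup>2"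
        using fin
      proof eventually_elim
        case (elim z)
        show ?case unfolding elim by (simp add: D_def ennreal_power)
      qed
    qed
    with cost show ?thesis by simp
  qed
  have D2i: "integrable \<pi> (\<lambda>z. (D z)\<^sup>2)"
    using Dm nn by (intro integrableI_bounded) (auto intro: less_trans)
  have DL2: "D \<in> L2 \<pi>" using D2i Dm by (simp add: L2_def)
  have D2: "(\<integral>z. (D z)\<^sup>2 \<partial>\<pi>) \<le> C\<^sup>2"
    using nn nn_integral_eq_integral[OF D2i] by (simp add: ennreal_less_iff)
  have vb: "v \<in> borel_measurable borel" using v(1) sets_m by (simp cong: measurable_cong_sets)
  have V2: "\<bar>(v x)\<^sup>2\<bar> \<le> V\<^sup>2" for x using v(2)[of x] by (auto intro!: power_mono)
  have muP: "prob_space (mu \<rho>a)" "prob_space (mu \<rho>b)" using mu_Radon[OF \<rho>(1)] mu_Radon[OF \<rho>(2)] by (auto simp: Radon_prob_def)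
  have v2i: "integrable (mu \<rho>a) (\<lambda>x. (v x)\<^sup>2)"
    using V2 v(1) by (intro finite_measure.integrable_const_bound[OF prob_space.finite_measure[OF muP(1)], of _ "V\<^sup>2"]) auto
  have fi: "integrable (mu \<rho>a) f" "integrable (mu \<rho>b) f" using Lip_b_integrable(2)[OF f] mu_Radon \<rho> by auto
  have fb: "f \<in> borel_measurable borel" by (rule continuous_real_borel[OF Lip_b_continuous[OF f]])
  note I = Radon_integral_distr_fst_snd[OF \<pi>(1-3) fb fi(1) fb fi(2)]
  have vI: "integrable \<pi> (\<lambda>z. (v (fst z))\<^sup>2)" "(\<integral>z. (v (fst z))\<^sup>2 \<partial>\<pi>) = (\<integral>x. (v x)\<^sup>2 \<partial>mu \<rho>a)"
    using Radon_integral_distr_fst_snd(1,2)[OF \<pi>(1-3) _ v2i fb fi(2)] vb by auto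
  have vL2: "(\<lambda>z. v (fst z)) \<in> L2 \<pi>" using vI(1) measurable_compose[OF fs(1) vb] by (simp add: L2_def)
  have XX: "AE z in \<pi>. fst z \<in> X \<and> snd z \<in> X"
  proof -
    have *: "AE x in mu \<rho>. x \<in> X" if "prob_density m \<rho>" for \<rho>
      using X prob_density_integrable(3)[OF that] by (subst AE_density) (auto elim!: eventually_mono)
    have "AE x in distr \<pi> borel fst. x \<in> X" "AE x in distr \<pi> borel snd. x \<in> X" unfolding \<pi>(2,3) by (auto intro: * \<rho>)
    from AE_distrD[OF fs(1) this(1)] AE_distrD[OF fs(2) this(2)] show ?thesis by eventually_elim simp
  qed
  have le: "AE z in \<pi>. \<bar>f (snd z) - f (fst z)\<bar> \<le> v (fst z) * D z + L / \<kappa> * (D z)\<^sup>2"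
    using XX fin
  proof eventually_elim
    case (elim z)
    have D0: "0 \<le> D z" by (simp add: D_def)
    have v0: "0 \<le> v (fst z)" using v(2) by blast
    show ?case
    proof (cases "D z < \<kappa>")
      case True
      have "0 \<le> L / \<kappa> * (D z)\<^sup>2" using L(1) k by simp
      then show ?thesis using loc[of "fst z" "snd z" "D z"] elim D0 True by (simp add: abs_minus_commute)
    next
      case False
      have "\<bar>f (fst z) - f (snd z)\<bar> \<le> L * D z" by (rule ennreal_Lipschitz_real[OF L(1) L(2) elim(2) D0])
      also have "\<dots> \<le> L * (D z * (D z / \<kappa>))"
        using False k D0 L(1) by (intro mult_left_mono mult_right_mono[of 1, simplified] mult_le_cancel_left1[THEN iffD2]) auto
      finally show ?thesis using v0 D0 by (simp add: abs_minus_commute power2_eq_square add_increasing)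
    qed
  qed
  have vDi: "integrable \<pi> (\<lambda>z. v (fst z) * D z)" by (rule \<pi>.L2_integrable_mult[OF vL2 DL2])
  have "(\<integral>x. f x * \<rho>b x \<partial>m) - (\<integral>x. f x * \<rho>a x \<partial>m) = (\<integral>z. f (snd z) - f (fst z) \<partial>\<pi>)"
    using I integral_mu[OF \<rho>(1) Lip_b_integrable(1)[OF f m]] integral_mu[OF \<rho>(2) Lip_b_integrable(1)[OF f m]] by simp
  also have "\<bar>\<dots>\<bar> \<le> (\<integral>z. \<bar>f (snd z) - f (fst z)\<bar> \<partial>\<pi>)" by (rule integral_abs_bound)
  also have "\<dots> \<le> (\<integral>z. v (fst z) * D z + L / \<kappa> * (D z)\<^sup>2 \<partial>\<pi>)"
    using I(1,3) vDi D2i le by (intro integral_mono_AE) auto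
  also have "\<dots> = (\<integral>z. v (fst z) * D z \<partial>\<pi>) + L / \<kappa> * (\<integral>z. (D z)\<^sup>2 \<partial>\<pi>)"
    using vDi D2i by simp
  also have "\<dots> \<le> sqrt (\<integral>x. (v x)\<^sup>2 * \<rho>a x \<partial>m) * C + L / \<kappa> * C\<^sup>2"
  proof (rule add_mono)
    have "(\<integral>z. v (fst z) * D z \<partial>\<pi>) \<le> L2_norm \<pi> (\<lambda>z. v (fst z)) * L2_norm \<pi> D"
      using \<pi>.L2_Cauchy_Schwarz[OF vL2 DL2] by simp
    also have "L2_norm \<pi> (\<lambda>z. v (fst z)) = sqrt (\<integral>x. (v x)\<^sup>2 * \<rho>a x \<partial>m)"
      unfolding L2_norm_def vI(2) using integral_mu[OF \<rho>(1), of "\<lambda>x. (v x)\<^sup>2"] v(1) by simp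
    also have "sqrt (\<integral>x. (v x)\<^sup>2 * \<rho>a x \<partial>m) * L2_norm \<pi> D \<le> sqrt (\<integral>x. (v x)\<^sup>2 * \<rho>a x \<partial>m) * C"
    proof (rule mult_left_mono)
      show "L2_norm \<pi> D \<le> C" unfolding L2_norm_def using D2 C by (intro real_le_lsqrt) auto
      have "AE x in m. 0 \<le> (v x)\<^sup>2 * \<rho>a x" using prob_density_integrable(4)[OF \<rho>(1)] by eventually_elim simp
      then show "0 \<le> sqrt (\<integral>x. (v x)\<^sup>2 * \<rho>a x \<partial>m)" by (simp add: integral_nonneg_AE)
    qed
    finally show "(\<integral>z. v (fst z) * D z \<partial>\<pi>) \<le> sqrt (\<integral>x. (v x)\<^sup>2 * \<rho>a x \<partial>m) * C" .
    show "L / \<kappa> * (\<integral>z. (D z)\<^sup>2 \<partial>\<pi>) \<le> L / \<kappa> * C\<^sup>2" using D2 L(1) k by (intro mult_left_mono) auto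
  qed
  finally show ?thesis .
qed

end

section \<open>From a Wasserstein-Lipschitz curve to the continuity inequality\<close>

context emms
begin

lemma density_integral_diff_le:
  assumes \<rho>: "prob_density m \<rho>" "AE x in m. \<rho> x \<le> M" and f: "integrable m f" "integrable m (\<lambda>x. f x * \<rho> x)"
    and h: "integrable m h" "integrable m (\<lambda>x. h x * \<rho> x)"
  shows "\<bar>(\<integral>x. f x * \<rho> x \<partial>m) - (\<integral>x. h x * \<rho> x \<partial>m)\<bar> \<le> M * (\<integral>x. \<bar>f x - h x\<bar> \<partial>m)"
proof -
  have "(\<integral>x. f x * \<rho> x \<partial>m) - (\<integral>x. h x * \<rho> x \<partial>m) = (\<integral>x. f x * \<rho> x - h x * \<rho> x \<partial>m)" using f h by simp
  also have "\<bar>\<dots>\<bar> \<le> (\<integral>x. \<bar>f x * \<rho> x - h x * \<rho> x\<bar> \<partial>m)" by (rule integral_abs_bound)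
  also have "\<dots> \<le> (\<integral>x. M * \<bar>f x - h x\<bar> \<partial>m)"
  proof (rule integral_mono_AE)
    show "AE x in m. \<bar>f x * \<rho> x - h x * \<rho> x\<bar> \<le> M * \<bar>f x - h x\<bar>"
      using \<rho>(2) prob_density_integrable(4)[OF \<rho>(1)]
    proof eventually_elim
      case (elim x)
      have "f x * \<rho> x - h x * \<rho> x = \<rho> x * (f x - h x)" by (simp add: algebra_simps)
      then have "\<bar>f x * \<rho> x - h x * \<rho> x\<bar> = \<rho> x * \<bar>f x - h x\<bar>" using elim(2) by (simp add: abs_mult)
      also have "\<dots> \<le> M * \<bar>f x - h x\<bar>" using elim(1) by (intro mult_right_mono) auto
      finally show ?case .
    qed
  qed (use f h in auto)
  finally show ?thesis by simp
qed

context
  fixes \<rho> :: "real \<Rightarrow> 'a \<Rightarrow> real" and M G :: real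
  assumes \<rho>: "\<And>t. t \<in> {0..1} \<Longrightarrow> prob_density m (\<rho> t)" and M: "0 < M" "\<And>t. t \<in> {0..1} \<Longrightarrow> AE x in m. \<rho> t x \<le> M"
    and G: "0 \<le> G" "\<And>a b. a \<in> {0..1} \<Longrightarrow> b \<in> {0..1} \<Longrightarrow> Wasserstein d (mu (\<rho> a)) (mu (\<rho> b)) \<le> ennreal (G * \<bar>b - a\<bar>)"
begin

text \<open>For f in \<open>Lip_b\<close> the coupling estimate with v constantly L gives a
  Lipschitz function of time. Bounded Borel h are reached by L1 approximation, uniform in time
  because the densities stay below M.\<close>

lemma integral_continuous_of_Wasserstein_Lipschitz:
  assumes h: "h \<in> borel_measurable m" "AE x in m. \<bar>h x\<bar> \<le> B"
  shows "continuous_on {0..1::real} (\<lambda>r. \<integral>x. h x * \<rho> r x \<partial>m)"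
proof -
  have Lip: "continuous_on {0..1} (\<lambda>r. \<integral>x. f x * \<rho> r x \<partial>m)" if f: "f \<in> Lip_b d" for f
  proof -
    obtain L where L: "0 \<le> L" "\<And>x y. ennreal \<bar>f x - f y\<bar> \<le> ennreal L * d x y" by (rule Lip_bE[OF f]) (rule that)
    let ?K = "L * (G + 1) + L * (G + 1)\<^sup>2"
    have "?K-lipschitz_on {0..1} (\<lambda>r. \<integral>x. f x * \<rho> r x \<partial>m)"
    proof (rule lipschitz_onI)
      show "0 \<le> ?K" using L(1) G(1) by simp
      fix b a :: real assume ab: "b \<in> {0..1}" "a \<in> {0..1}"
      show "dist (\<integral>x. f x * \<rho> b x \<partial>m) (\<integral>x. f x * \<rho> a x \<partial>m) \<le> ?K * dist b a"
      proof (cases "a = b")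
        case False
        \<comment> \<open>G + 1 instead of G gives the strict inequality from which a coupling can
          be picked.\<close>
        define C where "C = (G + 1) * \<bar>b - a\<bar>"
        have C: "0 < C" "C \<le> G + 1" using False G(1) ab by (auto simp: C_def intro!: mult_left_le)
        have "Wasserstein d (mu (\<rho> a)) (mu (\<rho> b)) < ennreal C"
          using G(2)[OF ab(2,1)] False G(1) by (rule_tac order.strict_trans1) (auto simp: C_def ennreal_less_iff)
        then have "\<bar>(\<integral>x. f x * \<rho> b x \<partial>m) - (\<integral>x. f x * \<rho> a x \<partial>m)\<bar> \<le> sqrt (\<integral>x. L\<^sup>2 * \<rho> a x \<partial>m) * C + L / 1 * C\<^sup>2"
          by (rule coupling_increment_le[OF \<rho>[OF ab(2)] \<rho>[OF ab(1)] _ _ f L, where X = UNIV and V = L])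
             (use C L in \<open>auto intro: ennreal_Lipschitz_real[OF L(1) L(2)]\<close>)
        also have "sqrt (\<integral>x. L\<^sup>2 * \<rho> a x \<partial>m) = L" using prob_density_integrable(2)[OF \<rho>[OF ab(2)]] L(1) by simp
        also have "L * C + L / 1 * C\<^sup>2 \<le> L * C + L * ((G + 1) * C)"
          using C L(1) by (auto simp: power2_eq_square intro!: mult_left_mono mult_right_mono)
        also have "\<dots> = ?K * \<bar>b - a\<bar>" by (simp add: C_def power2_eq_square algebra_simps)
        finally show ?thesis by (simp add: dist_real_def)
      qed simp
    qed
    then show ?thesis by (rule lipschitz_on_continuous_on)
  qed
  have hL: "integrable m h" by (rule integrable_const_bound[OF _ h(1), of B]) (use h(2) in simp)
  show ?thesis
    unfolding continuous_on_iff
  proof (intro ballI allI impI)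
    fix a e :: real assume a: "a \<in> {0..1}" and e: "0 < e"
    have e3: "0 < e / (3 * M)" using e M(1) by simp
    obtain f where f: "f \<in> Lip_b d" "(\<integral>x. \<bar>f x - h x\<bar> \<partial>m) \<le> e / (3 * M)" by (rule Lip_b_L1_dense[OF d m hL e3]) (rule that)
    have fi: "integrable m f" "f \<in> borel_measurable m" using Lip_b_integrable[OF f(1) m] by auto
    obtain B' where B': "\<And>x. \<bar>f x\<bar> \<le> B'" by (rule Lip_bE[OF f(1)]) (rule that)
    have close: "\<bar>(\<integral>x. f x * \<rho> r x \<partial>m) - (\<integral>x. h x * \<rho> r x \<partial>m)\<bar> \<le> e / 3" if r: "r \<in> {0..1}" for r
    proof -
      have i: "integrable m (\<lambda>x. f x * \<rho> r x)" "integrable m (\<lambda>x. h x * \<rho> r x)"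
        using prob_density_mult_integrable[OF \<rho>[OF r] fi(2), of B'] B' prob_density_mult_integrable[OF \<rho>[OF r] h] by auto
      have "\<bar>(\<integral>x. f x * \<rho> r x \<partial>m) - (\<integral>x. h x * \<rho> r x \<partial>m)\<bar> \<le> M * (\<integral>x. \<bar>f x - h x\<bar> \<partial>m)"
        by (rule density_integral_diff_le[OF \<rho>[OF r] M(2)[OF r] fi(1) i(1) hL i(2)])
      also have "\<dots> \<le> M * (e / (3 * M))" using f(2) M(1) by (simp del: times_divide_eq_right)
      also have "\<dots> = e / 3" using M(1) by simp
      finally show ?thesis .
    qed
    obtain \<delta> where \<delta>: "\<delta> > 0" "\<And>r. r \<in> {0..1} \<Longrightarrow> dist r a < \<delta> \<Longrightarrow> dist (\<integral>x. f x * \<rho> r x \<partial>m) (\<integral>x. f x * \<rho> a x \<partial>m) < e / 3"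
      using Lip[OF f(1)] a e unfolding continuous_on_iff by (metis zero_less_divide_iff zero_less_numeral)
    have "dist (\<integral>x. h x * \<rho> r x \<partial>m) (\<integral>x. h x * \<rho> a x \<partial>m) < e" if "r \<in> {0..1}" "dist r a < \<delta>" for r
      using \<delta>(2)[OF that] close[OF that(1)] close[OF a] unfolding dist_real_def by linarith
    with \<delta>(1) show "\<exists>\<delta>>0. \<forall>r\<in>{0..1}. dist r a < \<delta> \<longrightarrow> dist (\<integral>x. h x * \<rho> r x \<partial>m) (\<integral>x. h x * \<rho> a x \<partial>m) < e" by blast
  qed
qed

text \<open>A Dini estimate at each time a: the coupling estimate is used with the local slope at a,
  and continuity of the energy in time replaces its value at a by values on the short interval that
  follows.\<close>

lemma Lip_b_increment_le:
  assumes f: "f \<in> Lip_b d" and st: "0 \<le> s" "s \<le> t" "t \<le> (1::real)"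
  shows "continuous_on {0..1} (\<lambda>r. sqrt (\<integral>x. (lp f x)\<^sup>2 * \<rho> r x \<partial>m))"
    and "\<bar>(\<integral>x. f x * \<rho> t x \<partial>m) - (\<integral>x. f x * \<rho> s x \<partial>m)\<bar> \<le> integral {s..t} (\<lambda>r. G * sqrt (\<integral>x. (lp f x)\<^sup>2 * \<rho> r x \<partial>m))"
proof -
  let ?E = "\<lambda>r. sqrt (\<integral>x. (lp f x)\<^sup>2 * \<rho> r x \<partial>m)"
  define \<Phi> where "\<Phi> r = (\<integral>x. f x * \<rho> r x \<partial>m)" for r
  obtain L where L: "0 \<le> L" "\<And>x y. ennreal \<bar>f x - f y\<bar> \<le> ennreal L * d x y" by (rule Lip_bE[OF f]) (rule that)
  obtain B where B: "\<And>x. \<bar>f x\<bar> \<le> B" by (rule Lip_bE[OF f]) (rule that)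
  have lm: "(\<lambda>x. (lp f x)\<^sup>2) \<in> borel_measurable m" using lips_measurable[OF m f] by measurable
  have lL: "AE x in m. \<bar>(lp f x)\<^sup>2\<bar> \<le> L\<^sup>2"
    using lips_le_Lipschitz[OF m f L] by eventually_elim (auto intro!: power_mono lips_nonneg)
  have cont: "continuous_on {0..1} (\<lambda>r. \<integral>x. h x * \<rho> r x \<partial>m)" if "h \<in> borel_measurable m" "AE x in m. \<bar>h x\<bar> \<le> B" for h B
    by (rule integral_continuous_of_Wasserstein_Lipschitz[OF that])
  have Ec2: "continuous_on {0..1} (\<lambda>r. \<integral>x. (lp f x)\<^sup>2 * \<rho> r x \<partial>m)" by (rule cont[OF lm lL])
  then show Ec: "continuous_on {0..1} ?E" by (intro continuous_intros)
  have \<Phi>c: "continuous_on {0..1} \<Phi>"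
    unfolding \<Phi>_def by (rule cont[OF Lip_b_integrable(1)[OF f m], of B]) (use B in auto)
  have E0: "0 \<le> (\<integral>x. (lp f x)\<^sup>2 * \<rho> r x \<partial>m)" if "r \<in> {0..1}" for r
    by (rule prob_density_integral_ge_const[OF \<rho>[OF that] lm lL]) auto
  have Gi: "(\<lambda>r. G * ?E r) integrable_on {a..b}" if "0 \<le> a" "b \<le> 1" for a b
    by (intro integrable_continuous_interval continuous_intros continuous_on_subset[OF Ec]) (use that in auto)
  have up: "\<sigma> * \<Phi> t - \<sigma> * \<Phi> s \<le> integral {s..t} (\<lambda>r. G * ?E r)" if \<sigma>: "\<bar>\<sigma>\<bar> = 1" for \<sigma>
  proof (rule field_le_epsilon)
    fix e :: real assume e: "0 < e"
    define Z where "Z r = \<sigma> * \<Phi> r - integral {0..r} (\<lambda>r. G * ?E r)" for r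
    have split: "integral {0..b} (\<lambda>r. G * ?E r) - integral {0..a} (\<lambda>r. G * ?E r) = integral {a..b} (\<lambda>r. G * ?E r)"
      if "0 \<le> a" "a \<le> b" "b \<le> 1" for a b
      using Henstock_Kurzweil_Integration.integral_combine[OF that(1,2) Gi[of 0 b]] that by simp
    have Zc: "continuous_on {s..t} Z"
      unfolding Z_def using st
      by (intro continuous_intros continuous_on_subset[OF \<Phi>c] continuous_on_subset[OF indefinite_integral_continuous_1[OF Gi[of 0 1]]]) auto
    have loc: "\<exists>\<eta>>0. \<forall>h. 0 < h \<and> h < \<eta> \<and> a + h \<le> t \<longrightarrow> Z (a + h) - Z a \<le> e * h" if a: "s \<le> a" "a < t" for a
    proof -
      have a01: "a \<in> {0..1}" using a st by auto
      \<comment> \<open>The first-order error (E + \<epsilon>)(G + \<epsilon>) - G (E - \<epsilon>),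
        with E the root of the energy at a, equals \<epsilon> (E + 2G + \<epsilon>), which is at
        most \<epsilon> k.\<close>
      define k where "k = ?E a + 2 * G + 3"
      have Ea: "0 \<le> ?E a" using E0[OF a01] by simp
      have k: "0 < k" using Ea G(1) unfolding k_def by linarith
      define \<epsilon> where "\<epsilon> = min 1 (e / (2 * k))"
      have \<epsilon>: "0 < \<epsilon>" "\<epsilon> \<le> 1" "\<epsilon> * k \<le> e / 2" using e k by (auto simp: \<epsilon>_def min_def field_simps)
      have \<epsilon>2: "0 < \<epsilon>\<^sup>2" using \<epsilon> by simp
      obtain v X \<kappa> V where X: "AE x in m. x \<in> X" and v: "v \<in> borel_measurable m" "\<And>x. 0 \<le> v x \<and> v x \<le> V" and \<kappa>: "0 < \<kappa>"
        and vX: "\<And>x y D. x \<in> X \<Longrightarrow> y \<in> X \<Longrightarrow> d x y = ennreal D \<Longrightarrow> 0 \<le> D \<Longrightarrow> D < \<kappa> \<Longrightarrow> \<bar>f x - f y\<bar> \<le> v x * D"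
        and vE: "\<And>\<rho>. prob_density m \<rho> \<Longrightarrow> AE x in m. \<rho> x \<le> M \<Longrightarrow> (\<integral>x. (v x)\<^sup>2 * \<rho> x \<partial>m) \<le> (\<integral>x. (lp f x)\<^sup>2 * \<rho> x \<partial>m) + \<epsilon>\<^sup>2"
        by (rule local_slope_bound[OF f \<epsilon>2 M(1)]) (rule that)
      have v\<epsilon>: "sqrt (\<integral>x. (v x)\<^sup>2 * \<rho> a x \<partial>m) \<le> ?E a + \<epsilon>"
      proof (rule real_le_lsqrt)
        have "(?E a + \<epsilon>)\<^sup>2 = (\<integral>x. (lp f x)\<^sup>2 * \<rho> a x \<partial>m) + \<epsilon>\<^sup>2 + 2 * ?E a * \<epsilon>"
          using E0[OF a01] by (simp add: power2_sum)
        moreover have "0 \<le> 2 * ?E a * \<epsilon>" using Ea \<epsilon>(1) by simp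
        ultimately show "(\<integral>x. (v x)\<^sup>2 * \<rho> a x \<partial>m) \<le> (?E a + \<epsilon>)\<^sup>2" using vE[OF \<rho>[OF a01] M(2)[OF a01]] by linarith
      qed (use Ea \<epsilon> in simp)
      \<comment> \<open>Coefficient of h^2 caused by long transport; the bound on h makes A h at
        most e/2.\<close>
      define A where "A = L / \<kappa> * (G + \<epsilon>)\<^sup>2"
      have A: "0 \<le> A" using L(1) \<kappa> by (simp add: A_def)
      obtain \<eta>1 where \<eta>1: "\<eta>1 > 0" "\<And>r. r \<in> {0..1} \<Longrightarrow> dist r a < \<eta>1 \<Longrightarrow> dist (?E r) (?E a) < \<epsilon>"
        using Ec a01 \<epsilon>(1) unfolding continuous_on_iff by blast
      define \<eta> where "\<eta> = min \<eta>1 (e / (2 * (A + 1)))"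
      have \<eta>0: "0 < \<eta>" using \<eta>1 e A by (simp add: \<eta>_def)
      have "Z (a + h) - Z a \<le> e * h" if h: "0 < h" "h < \<eta>" "a + h \<le> t" for h
      proof -
        have ah: "a + h \<in> {0..1}" using a h st by auto
        have "Wasserstein d (mu (\<rho> a)) (mu (\<rho> (a + h))) < ennreal ((G + \<epsilon>) * h)"
          using G(2)[OF a01 ah] h(1) \<epsilon>(1) G(1) by (rule_tac order.strict_trans1) (auto simp: ennreal_less_iff)
        then have "\<bar>\<Phi> (a + h) - \<Phi> a\<bar> \<le> sqrt (\<integral>x. (v x)\<^sup>2 * \<rho> a x \<partial>m) * ((G + \<epsilon>) * h) + L / \<kappa> * ((G + \<epsilon>) * h)\<^sup>2"
          unfolding \<Phi>_def
          by (rule coupling_increment_le[OF \<rho>[OF a01] \<rho>[OF ah] _ _ f L X v \<kappa> vX]) (use G(1) \<epsilon>(1) h(1) in auto)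
        also have "\<dots> \<le> (?E a + \<epsilon>) * ((G + \<epsilon>) * h) + A * h * h"
        proof (rule add_mono)
          show "sqrt (\<integral>x. (v x)\<^sup>2 * \<rho> a x \<partial>m) * ((G + \<epsilon>) * h) \<le> (?E a + \<epsilon>) * ((G + \<epsilon>) * h)"
            using G(1) \<epsilon>(1) h(1) by (intro mult_right_mono v\<epsilon>) auto
          have "L / \<kappa> * ((G + \<epsilon>) * h)\<^sup>2 = A * h * h" unfolding A_def power_mult_distrib power2_eq_square by (simp only: mult_ac)
          then show "L / \<kappa> * ((G + \<epsilon>) * h)\<^sup>2 \<le> A * h * h" by simp
        qed
        finally have 1: "\<bar>\<Phi> (a + h) - \<Phi> a\<bar> \<le> (?E a + \<epsilon>) * ((G + \<epsilon>) * h) + A * h * h" .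
        have "\<sigma> * (\<Phi> (a + h) - \<Phi> a) \<le> \<bar>\<sigma>\<bar> * \<bar>\<Phi> (a + h) - \<Phi> a\<bar>" by (simp add: abs_mult[symmetric])
        with 1 \<sigma> have 2: "\<sigma> * \<Phi> (a + h) - \<sigma> * \<Phi> a \<le> (?E a + \<epsilon>) * ((G + \<epsilon>) * h) + A * h * h" by (simp add: algebra_simps)
        have "integral {a..a + h} (\<lambda>r. G * (?E a - \<epsilon>)) \<le> integral {a..a + h} (\<lambda>r. G * ?E r)"
        proof (rule integral_le)
          show "(\<lambda>r. G * ?E r) integrable_on {a..a + h}" using a01 ah by (intro Gi) auto
          fix r assume r: "r \<in> {a..a + h}"
          then have "dist (?E r) (?E a) < \<epsilon>" using a01 ah h(2) by (intro \<eta>1(2)) (auto simp: dist_real_def \<eta>_def)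
          then show "G * (?E a - \<epsilon>) \<le> G * ?E r" using G(1) by (intro mult_left_mono) (auto simp: dist_real_def)
        qed (auto intro: integrable_const_ivl)
        then have 3: "h * (G * (?E a - \<epsilon>)) \<le> integral {a..a + h} (\<lambda>r. G * ?E r)" using h(1) by (simp add: mult_ac)
        have "Z (a + h) - Z a = \<sigma> * \<Phi> (a + h) - \<sigma> * \<Phi> a - integral {a..a + h} (\<lambda>r. G * ?E r)"
          using split[of a "a + h"] a01 ah h(1) by (simp add: Z_def)
        also have "\<dots> \<le> (?E a + \<epsilon>) * ((G + \<epsilon>) * h) + A * h * h - h * (G * (?E a - \<epsilon>))" using 2 3 by linarith
        also have "\<dots> = h * (\<epsilon> * (?E a + 2 * G + \<epsilon>)) + h * (A * h)" by (simp add: algebra_simps)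
        also have "\<dots> \<le> h * (e / 2) + h * (e / 2)"
        proof (intro add_mono mult_left_mono)
          have "\<epsilon> * (?E a + 2 * G + \<epsilon>) \<le> \<epsilon> * k" using \<epsilon> by (intro mult_left_mono) (auto simp: k_def)
          then show "\<epsilon> * (?E a + 2 * G + \<epsilon>) \<le> e / 2" using \<epsilon>(3) by simp
          have "A * h \<le> (A + 1) * (e / (2 * (A + 1)))" using h A by (intro mult_mono) (auto simp: \<eta>_def)
          also have "\<dots> = e / 2" using A by (simp add: field_simps)
          finally show "A * h \<le> e / 2" .
        qed (use h in auto)
        also have "\<dots> = e * h" by simp
        finally show ?thesis .
      qed
      with \<eta>0 show ?thesis by blast
    qed
    have "Z t - Z s \<le> e * (t - s)" by (rule Dini_upper_bound[OF st(2) Zc loc])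
    also have "\<dots> \<le> e * 1" using st e by (intro mult_left_mono) auto
    finally show "\<sigma> * \<Phi> t - \<sigma> * \<Phi> s \<le> integral {s..t} (\<lambda>r. G * ?E r) + e"
      using split[OF st] by (simp add: Z_def)
  qed
  show "\<bar>(\<integral>x. f x * \<rho> t x \<partial>m) - (\<integral>x. f x * \<rho> s x \<partial>m)\<bar> \<le> integral {s..t} (\<lambda>r. G * ?E r)"
    using up[of 1] up[of "-1"] by (simp add: \<Phi>_def abs_le_iff)
qed

text \<open>Apply the estimate for \<open>Lip_b\<close> to the functions F n whose slope majorants H
  n converge strongly to the minimal slope of f, and pass to the limit. Both errors, in the function
  and in the slope, are uniform in time thanks to the bound M.\<close>

lemma Wasserstein_Lipschitz_CE2_bound:
  shows "CE2_bound m d 1 \<rho> (\<lambda>_. G)"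
  unfolding CE2_bound_def
proof (intro conjI ballI allI impI)
  have "integrable (lebesgue_on {0<..<1::real}) (\<lambda>_. G\<^sup>2)"
    by (rule finite_measure.integrable_const[OF finite_measure_lebesgue_on[OF lmeasurable_interval(2)]])
  then show "(\<lambda>_. G) \<in> L2 (lebesgue_on {0<..<1::real})" by (simp add: L2_def)
  show "AE r in lebesgue_on {0<..<1::real}. 0 \<le> G" using G(1) by simp
  fix f s t assume f: "f \<in> Ch_algebra m d" and "0 \<le> s \<and> s \<le> t \<and> t \<le> (1::real)"
  then have st: "0 \<le> s" "s \<le> t" "t \<le> 1" by auto
  define g where "g = min_relaxed_slope m d f"
  let ?E = "\<lambda>r. sqrt (\<integral>x. (g x)\<^sup>2 * \<rho> r x \<partial>m)"
  have fD: "f \<in> Ch_domain m d" and fL: "f \<in> Linf m" and gLi: "g \<in> Linf m" using f by (auto simp: Ch_algebra_def g_def)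
  have fm: "f \<in> borel_measurable m" using fL by (simp add: Linf_def)
  have fL2: "f \<in> L2 m" using fD by (simp add: Ch_domain_def)
  obtain Bf where Bf: "0 \<le> Bf" "AE x in m. \<bar>f x\<bar> \<le> Bf" by (rule Linf_bound[OF fL]) (rule that)
  have gm: "g \<in> borel_measurable m" using gLi by (simp add: Linf_def)
  obtain B where B: "0 \<le> B" "AE x in m. \<bar>g x\<bar> \<le> B" by (rule Linf_bound[OF gLi]) (rule that)
  have g2: "AE x in m. \<bar>(g x)\<^sup>2\<bar> \<le> B\<^sup>2"
    using B(2) by eventually_elim (simp add: abs_le_square_iff[symmetric])
  have gm2: "(\<lambda>x. (g x)\<^sup>2) \<in> borel_measurable m" using gm by measurable
  have "continuous_on {0..1} (\<lambda>r. \<integral>x. (g x)\<^sup>2 * \<rho> r x \<partial>m)"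
    by (rule integral_continuous_of_Wasserstein_Lipschitz[OF gm2 g2])
  then have Ec: "continuous_on {0..1} ?E" by (intro continuous_intros)
  obtain F H where FH: "\<And>n::nat. F n \<in> Lip_b d" "\<And>n. H n \<in> L2 m" "\<And>n. AE x in m. lp (F n) x \<le> H n x"
     "(\<lambda>n. nrm (\<lambda>x. F n x - f x)) \<longlonglongrightarrow> 0" "(\<lambda>n. nrm (\<lambda>x. H n x - g x)) \<longlonglongrightarrow> 0" and gL: "g \<in> L2 m"
    using min_relaxed_slope(1)[OF fD] unfolding upper_slope_def g_def by blast
  define \<Phi> where "\<Phi> n r = (\<integral>x. F n x * \<rho> r x \<partial>m)" for n r
  have \<Phi>: "(\<lambda>n. \<Phi> n r) \<longlonglongrightarrow> (\<integral>x. f x * \<rho> r x \<partial>m)" if r: "r \<in> {0..1}" for r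
  proof (rule Lim_null_comparison[where g = "\<lambda>n. M * nrm (\<lambda>x. F n x - f x)", THEN LIM_zero_cancel])
    show "(\<lambda>n. M * nrm (\<lambda>x. F n x - f x)) \<longlonglongrightarrow> 0" using tendsto_mult_right_zero[OF FH(4), of M] by simp
    have "norm (\<Phi> n r - (\<integral>x. f x * \<rho> r x \<partial>m)) \<le> M * nrm (\<lambda>x. F n x - f x)" for n
    proof -
      obtain B' where B': "\<And>x. \<bar>F n x\<bar> \<le> B'" by (rule Lip_bE[OF FH(1)[of n]]) (rule that)
      have i: "integrable m (\<lambda>x. F n x * \<rho> r x)" "integrable m (\<lambda>x. f x * \<rho> r x)"
        using prob_density_mult_integrable[OF \<rho>[OF r] Lip_b_integrable(1)[OF FH(1)[of n] m], of B'] B'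
          prob_density_mult_integrable[OF \<rho>[OF r] fm Bf(2)] by auto
      have dL: "(\<lambda>x. F n x - f x) \<in> L2 m" by (rule L2_diff[OF Lip_b_L2[OF FH(1)] fL2])
      have "norm (\<Phi> n r - (\<integral>x. f x * \<rho> r x \<partial>m)) \<le> M * (\<integral>x. \<bar>F n x - f x\<bar> \<partial>m)"
        unfolding \<Phi>_def real_norm_def
        by (rule density_integral_diff_le[OF \<rho>[OF r] M(2)[OF r] Lip_b_integrable(2)[OF FH(1) m] i(1) L2_integrable[OF fL2] i(2)])
      also have "\<dots> \<le> M * nrm (\<lambda>x. F n x - f x)" using L1_le_L2_norm[OF dL] M(1) by (intro mult_left_mono) auto
      finally show ?thesis .
    qed
    then show "\<forall>\<^sub>F n in sequentially. norm (\<Phi> n r - (\<integral>x. f x * \<rho> r x \<partial>m)) \<le> M * nrm (\<lambda>x. F n x - f x)" by simp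
  qed
  \<comment> \<open>The root of the energy is the L2(m) norm of the slope times
    \<open>sqrt (\<rho> r)\<close>, so the triangle inequality compares the energies of F n and
    f.\<close>
  have EE: "sqrt (\<integral>x. (lp (F n) x)\<^sup>2 * \<rho> r x \<partial>m) \<le> ?E r + sqrt M * nrm (\<lambda>x. H n x - g x)" if r: "r \<in> {0..1}" for r n
  proof -
    note P = prob_density_integrable[OF \<rho>[OF r]]
    have wL2: "(\<lambda>x. h x * sqrt (\<rho> r x)) \<in> L2 m" "nrm (\<lambda>x. h x * sqrt (\<rho> r x)) = sqrt (\<integral>x. (h x)\<^sup>2 * \<rho> r x \<partial>m)"
      "nrm (\<lambda>x. h x * sqrt (\<rho> r x)) \<le> sqrt M * nrm h" if h: "h \<in> L2 m" for h
    proof -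
      note hm = L2_measurable[OF h]
      have meas: "(\<lambda>x. h x * sqrt (\<rho> r x)) \<in> borel_measurable m" using hm P(3) by measurable
      have le: "AE x in m. \<bar>h x * sqrt (\<rho> r x)\<bar> \<le> \<bar>sqrt M * h x\<bar>"
        using M(2)[OF r] P(4)
      proof eventually_elim
        case (elim x)
        then have "\<bar>h x\<bar> * sqrt (\<rho> r x) \<le> \<bar>h x\<bar> * sqrt M" by (intro mult_left_mono real_sqrt_le_mono) auto
        with elim M(1) show ?case by (simp add: abs_mult mult.commute)
      qed
      have sL: "(\<lambda>x. sqrt M * h x) \<in> L2 m" by (rule L2_scale[OF h])
      show "(\<lambda>x. h x * sqrt (\<rho> r x)) \<in> L2 m" by (rule L2_dominated[OF meas sL le])
      have "nrm (\<lambda>x. h x * sqrt (\<rho> r x)) \<le> nrm (\<lambda>x. sqrt M * h x)" by (rule L2_norm_mono[OF meas sL le])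
      also have "\<dots> = sqrt M * nrm h" using L2_norm_scale[of "sqrt M" h] M(1) by simp
      finally show "nrm (\<lambda>x. h x * sqrt (\<rho> r x)) \<le> sqrt M * nrm h" .
      show "nrm (\<lambda>x. h x * sqrt (\<rho> r x)) = sqrt (\<integral>x. (h x)\<^sup>2 * \<rho> r x \<partial>m)"
        unfolding L2_norm_def using P(3,4) hm
        by (intro arg_cong[where f = sqrt] Bochner_Integration.integral_cong_AE) (auto elim!: eventually_mono simp: power_mult_distrib)
    qed
    have lL: "lp (F n) \<in> L2 m" by (rule lp_L2[OF FH(1)])
    have HgL: "(\<lambda>x. H n x - g x) \<in> L2 m" by (rule L2_diff[OF FH(2) gL])
    have "sqrt (\<integral>x. (lp (F n) x)\<^sup>2 * \<rho> r x \<partial>m) = nrm (\<lambda>x. lp (F n) x * sqrt (\<rho> r x))" by (rule wL2(2)[OF lL, symmetric])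
    also have "\<dots> \<le> nrm (\<lambda>x. H n x * sqrt (\<rho> r x))"
    proof (rule L2_norm_mono[OF L2_measurable[OF wL2(1)[OF lL]] wL2(1)[OF FH(2)]])
      show "AE x in m. \<bar>lp (F n) x * sqrt (\<rho> r x)\<bar> \<le> \<bar>H n x * sqrt (\<rho> r x)\<bar>"
        using FH(3)[of n] P(4)
      proof eventually_elim
        case (elim x)
        have "0 \<le> lp (F n) x" by (rule lips_nonneg)
        with elim show ?case by (simp add: abs_mult mult_right_mono)
      qed
    qed
    also have "\<dots> \<le> nrm (\<lambda>x. g x * sqrt (\<rho> r x)) + nrm (\<lambda>x. H n x * sqrt (\<rho> r x) - g x * sqrt (\<rho> r x))"
      by (rule L2_norm_le_add_diff[OF wL2(1)[OF FH(2)] wL2(1)[OF gL]])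
    also have "(\<lambda>x. H n x * sqrt (\<rho> r x) - g x * sqrt (\<rho> r x)) = (\<lambda>x. (H n x - g x) * sqrt (\<rho> r x))"
      by (simp add: left_diff_distrib)
    also have "nrm (\<lambda>x. g x * sqrt (\<rho> r x)) + nrm \<dots> \<le> ?E r + sqrt M * nrm (\<lambda>x. H n x - g x)"
      using wL2(2)[OF gL] wL2(3)[OF HgL] by simp
    finally show ?thesis .
  qed
  have Gi: "(\<lambda>r. G * ?E r) absolutely_integrable_on {0..1}"
    by (intro absolutely_integrable_continuous_real continuous_intros Ec)
  have bound: "\<bar>\<Phi> n t - \<Phi> n s\<bar> \<le> integral {s..t} (\<lambda>r. G * ?E r) + G * (sqrt M * nrm (\<lambda>x. H n x - g x))" for n
  proof -
    note LI = Lip_b_increment_le[OF FH(1)[of n] st]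
    let ?c = "G * (sqrt M * nrm (\<lambda>x. H n x - g x))"
    have i: "(\<lambda>r. G * ?E r) integrable_on {s..t}" using st
      by (intro integrable_continuous_interval continuous_intros continuous_on_subset[OF Ec]) auto
    have "\<bar>\<Phi> n t - \<Phi> n s\<bar> \<le> integral {s..t} (\<lambda>r. G * sqrt (\<integral>x. (lp (F n) x)\<^sup>2 * \<rho> r x \<partial>m))"
      unfolding \<Phi>_def by (rule LI(2))
    also have "\<dots> \<le> integral {s..t} (\<lambda>r. G * ?E r + ?c)"
    proof (rule integral_le)
      show "(\<lambda>r. G * sqrt (\<integral>x. (lp (F n) x)\<^sup>2 * \<rho> r x \<partial>m)) integrable_on {s..t}" using st
        by (intro integrable_continuous_interval continuous_intros continuous_on_subset[OF LI(1)]) auto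
      show "(\<lambda>r. G * ?E r + ?c) integrable_on {s..t}" using i by (intro integrable_add) (auto intro: integrable_const_ivl)
      show "G * sqrt (\<integral>x. (lp (F n) x)\<^sup>2 * \<rho> r x \<partial>m) \<le> G * ?E r + ?c" if "r \<in> {s..t}" for r
        using mult_left_mono[OF EE[of r n] G(1)] that st by (simp add: distrib_left)
    qed
    also have "\<dots> = integral {s..t} (\<lambda>r. G * ?E r) + ?c * (t - s)"
      using i st by (subst Henstock_Kurzweil_Integration.integral_add) (auto simp: integrable_const_ivl)
    also have "?c * (t - s) \<le> ?c * 1" using G(1) M(1) st L2_norm_nonneg by (intro mult_left_mono) auto
    finally show ?thesis by simp
  qed
  have "\<bar>(\<integral>x. f x * \<rho> t x \<partial>m) - (\<integral>x. f x * \<rho> s x \<partial>m)\<bar> \<le> integral {s..t} (\<lambda>r. G * ?E r) + G * (sqrt M * 0)"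
  proof (rule LIMSEQ_le)
    show "(\<lambda>n. \<bar>\<Phi> n t - \<Phi> n s\<bar>) \<longlonglongrightarrow> \<bar>(\<integral>x. f x * \<rho> t x \<partial>m) - (\<integral>x. f x * \<rho> s x \<partial>m)\<bar>"
      using st by (intro tendsto_intros \<Phi>) auto
    show "(\<lambda>n. integral {s..t} (\<lambda>r. G * ?E r) + G * (sqrt M * nrm (\<lambda>x. H n x - g x))) \<longlonglongrightarrow> integral {s..t} (\<lambda>r. G * ?E r) + G * (sqrt M * 0)"
      by (intro tendsto_intros FH(5))
  qed (use bound in blast)
  also have "\<dots> = (LINT r:{s..t}|lebesgue. G * ?E r)"
    unfolding mult_zero_right add_0_right by (rule set_integral_lebesgue_eq[OF Gi st(1,3), symmetric])
  finally show "\<bar>(\<integral>x. f x * \<rho> t x \<partial>m) - (\<integral>x. f x * \<rho> s x \<partial>m)\<bar>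
      \<le> (LINT r:{s..t}|lebesgue. G * sqrt (\<integral>x. (min_relaxed_slope m d f x)\<^sup>2 * \<rho> r x \<partial>m))"
    by (simp add: g_def)
qed

lemma W_Ch_le_of_Wasserstein_Lipschitz:
  shows "W_Ch m d (mu (\<rho> 0)) (mu (\<rho> 1)) \<le> ennreal G"
  unfolding W_Ch_def esqrt_le_iff[OF G(1)]
proof (rule INF_lower2)
  note b = Wasserstein_Lipschitz_CE2_bound
  show "\<rho> \<in> {\<rho>' \<in> CE2 m d 1. mu (\<rho>' 0) = mu (\<rho> 0) \<and> mu (\<rho>' 1) = mu (\<rho> 1)}"
    using b \<rho> by (auto simp: CE2_def)
  have "CE2_bound m d 1 \<rho> (CE2_speed m d 1 \<rho>)" by (rule CE2_speed(1)[OF b \<rho>])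
  then have "AE r in lebesgue_on {0<..<1}. 0 \<le> CE2_speed m d 1 \<rho> r" by (simp add: CE2_bound_def)
  moreover have "AE r in lebesgue_on {0<..<1}. CE2_speed m d 1 \<rho> r \<le> G" by (rule CE2_speed(2)[OF b \<rho> b])
  ultimately have "AE r in lebesgue_on {0<..<1}. ennreal ((CE2_speed m d 1 \<rho> r)\<^sup>2) \<le> ennreal (G\<^sup>2)"
    by eventually_elim (intro ennreal_leI power_mono)
  then have "(\<integral>\<^sup>+t. ennreal ((CE2_speed m d 1 \<rho> t)\<^sup>2) \<partial>lebesgue_on {0<..<1}) \<le> (\<integral>\<^sup>+t. ennreal (G\<^sup>2) \<partial>lebesgue_on {0<..<1::real})"
    by (rule nn_integral_mono_AE)
  also have "\<dots> = ennreal (G\<^sup>2)" by (simp add: emeasure_restrict_space)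
  finally show "(\<integral>\<^sup>+t. ennreal ((CE2_speed m d 1 \<rho> t)\<^sup>2) \<partial>lebesgue_on {0<..<1}) \<le> ennreal (G\<^sup>2)" .
qed

end

end

subsection \<open>The equivalence\<close>

text \<open>The integrand in \<open>AC2\<close> may take negative values; its absolute value serves
  equally well and is what an arc length needs.\<close>

lemma AC2D:
  assumes "AC2 Y \<delta> T y"
  obtains g where "g \<in> L2 (lebesgue_on {0<..<T})" "\<And>r. 0 \<le> g r" "g absolutely_integrable_on {0..T}"
    "\<And>s t. 0 \<le> s \<Longrightarrow> s \<le> t \<Longrightarrow> t \<le> T \<Longrightarrow> \<delta> (y s) (y t) \<le> ennreal (integral {s..t} g)"
proof -
  obtain g where g: "g \<in> L2 (lebesgue_on {0<..<T})"
    "\<And>s t. 0 \<le> s \<Longrightarrow> s \<le> t \<Longrightarrow> t \<le> T \<Longrightarrow> \<delta> (y s) (y t) \<le> ennreal (LINT r:{s..t}|lebesgue. g r)"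
    using assms unfolding AC2_def by blast
  note gI = L2_lebesgue_absolutely_integrable[OF g(1)]
  have aI: "(\<lambda>r. \<bar>g r\<bar>) absolutely_integrable_on {0..T}" using absolutely_integrable_abs[OF gI] by simp
  show thesis
  proof (rule that[of "\<lambda>r. \<bar>g r\<bar>"])
    show "(\<lambda>r. \<bar>g r\<bar>) \<in> L2 (lebesgue_on {0<..<T})" using g(1) by (auto simp: L2_def)
    fix s t assume st: "0 \<le> s" "s \<le> t" "t \<le> T"
    have "(LINT r:{s..t}|lebesgue. g r) = integral {s..t} g" by (rule set_integral_lebesgue_eq[OF gI st(1,3)])
    also have "\<dots> \<le> integral {s..t} (\<lambda>r. \<bar>g r\<bar>)"
      by (rule integral_le) (use abs_integrable_subinterval(2)[OF gI st(1,3)] abs_integrable_subinterval(2)[OF aI st(1,3)] in auto)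
    finally show "\<delta> (y s) (y t) \<le> ennreal (integral {s..t} (\<lambda>r. \<bar>g r\<bar>))"
      using g(2)[OF st] ennreal_leI order_trans by blast
  qed (use aI in auto)
qed

lemma AC2I:
  assumes "\<And>t. t \<in> {0..T} \<Longrightarrow> y t \<in> Y" "g \<in> L2 (lebesgue_on {0<..<T})"
    "\<And>s t. 0 \<le> s \<Longrightarrow> s \<le> t \<Longrightarrow> t \<le> T \<Longrightarrow> \<delta> (y s) (y t) \<le> ennreal (integral {s..t} g)"
  shows "AC2 Y \<delta> T y"
  unfolding AC2_def
proof (intro conjI ballI bexI[OF _ assms(2)] allI impI)
  fix s t assume st: "0 \<le> s \<and> s \<le> t \<and> t \<le> T"
  then have "(LINT r:{s..t}|lebesgue. g r) = integral {s..t} g"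
    by (intro set_integral_lebesgue_eq[OF L2_lebesgue_absolutely_integrable[OF assms(2)]]) auto
  with assms(3)[of s t] st show "\<delta> (y s) (y t) \<le> ennreal (LINT r:{s..t}|lebesgue. g r)" by simp
qed (rule assms(1))

lemma metric_derivative_mono:
  assumes "\<And>a b. \<delta> a b \<le> \<delta>' a b"
  shows "metric_derivative \<delta> y t \<le> metric_derivative \<delta>' y t"
  unfolding metric_derivative_def by (intro Limsup_mono always_eventually allI divide_right_mono_ennreal assms)

text \<open>Bounds in both orders of the arguments take the place of symmetry, since s approaches t
  from either side; for \<open>W_Ch\<close> the reversed order comes from the reversed
  curve.\<close>

lemma metric_derivative_le_integrand:
  fixes \<delta> :: "'b \<Rightarrow> 'b \<Rightarrow> ennreal"
  assumes t: "t \<in> {0<..<T}" and h0: "0 \<le> h t"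
    and N: "\<And>e. 0 < e \<Longrightarrow> \<exists>d>0. \<forall>a b. 0 \<le> a \<and> a \<le> t \<and> t \<le> b \<and> b \<le> T \<and> b - a < d \<longrightarrow>
         \<bar>integral {a..b} h - h t * (b - a)\<bar> \<le> e * (b - a)"
    and bd: "\<And>a b. 0 \<le> a \<Longrightarrow> a \<le> b \<Longrightarrow> b \<le> T \<Longrightarrow> \<delta> (y a) (y b) \<le> ennreal (integral {a..b} h)"
      "\<And>a b. 0 \<le> a \<Longrightarrow> a \<le> b \<Longrightarrow> b \<le> T \<Longrightarrow> \<delta> (y b) (y a) \<le> ennreal (integral {a..b} h)"
  shows "metric_derivative \<delta> y t \<le> ennreal (h t)"
proof (rule ennreal_le_epsilon)
  fix e :: real assume e: "0 < e"
  obtain \<eta> where \<eta>: "\<eta> > 0" "\<And>a b. 0 \<le> a \<Longrightarrow> a \<le> t \<Longrightarrow> t \<le> b \<Longrightarrow> b \<le> T \<Longrightarrow> b - a < \<eta> \<Longrightarrow>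
      \<bar>integral {a..b} h - h t * (b - a)\<bar> \<le> e * (b - a)"
    using N[OF e] by blast
  have "metric_derivative \<delta> y t \<le> ennreal (h t + e)"
    unfolding metric_derivative_def
  proof (rule Limsup_bounded)
    have "\<delta> (y s) (y t) / ennreal \<bar>s - t\<bar> \<le> ennreal (h t + e)" if s: "s \<noteq> t" "dist s t < min \<eta> (min t (T - t))" for s
    proof -
      define a b where "a = min s t" and "b = max s t"
      have ab: "0 \<le> a" "a \<le> t" "t \<le> b" "b \<le> T" "b - a < \<eta>" "b - a = \<bar>s - t\<bar>"
        using s(2) t by (auto simp: a_def b_def dist_real_def min_def max_def abs_if split: if_splits)
      have "\<delta> (y s) (y t) \<le> ennreal (integral {a..b} h)"
        using bd[of a b] ab by (cases "s \<le> t") (auto simp: a_def b_def)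
      also have "\<dots> \<le> ennreal ((h t + e) * \<bar>s - t\<bar>)"
        using \<eta>(2)[OF ab(1-5)] ab(6) by (intro ennreal_leI) (simp add: abs_le_iff algebra_simps)
      finally have "\<delta> (y s) (y t) / ennreal \<bar>s - t\<bar> \<le> ennreal ((h t + e) * \<bar>s - t\<bar>) / ennreal \<bar>s - t\<bar>"
        by (rule divide_right_mono_ennreal)
      also have "\<dots> = ennreal (h t + e)" using s(1) h0 e by (subst divide_ennreal) auto
      finally show ?thesis .
    qed
    then show "\<forall>\<^sub>F s in at t. \<delta> (y s) (y t) / ennreal \<bar>s - t\<bar> \<le> ennreal (h t + e)"
      unfolding eventually_at using \<eta>(1) t by (intro exI[of _ "min \<eta> (min t (T - t))"]) auto
  qed
  then show "metric_derivative \<delta> y t \<le> ennreal (h t) + ennreal e" using h0 e by simp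
qed

section \<open>Reparametrisation by arc length\<close>

context emms
begin

text \<open>Run through {s..t} with parameter proportional to the arc length \<theta>. The curve on
  [0, 1] is then \<open>Wasserstein\<close>-Lipschitz with constant l, the total length, so l is an
  admissible constant speed.\<close>

lemma W_Ch_le_integral:
  assumes \<rho>: "\<And>t. t \<in> {0..T} \<Longrightarrow> prob_density m (\<rho> t)" and M: "0 < M" "\<And>t. t \<in> {0..T} \<Longrightarrow> AE x in m. \<rho> t x \<le> M"
    and g: "g absolutely_integrable_on {0..T}" and g0: "\<And>r. r \<in> {0..T} \<Longrightarrow> 0 \<le> g r"
    and bd: "\<And>a b. 0 \<le> a \<Longrightarrow> a \<le> b \<Longrightarrow> b \<le> T \<Longrightarrow> Wasserstein d (mu (\<rho> a)) (mu (\<rho> b)) \<le> ennreal (integral {a..b} g)"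
    and st: "0 \<le> s" "s \<le> t" "t \<le> (T::real)"
  shows "W_Ch m d (mu (\<rho> s)) (mu (\<rho> t)) \<le> ennreal (integral {s..t} g)"
    and "W_Ch m d (mu (\<rho> t)) (mu (\<rho> s)) \<le> ennreal (integral {s..t} g)"
proof -
  have "W_Ch m d (mu (\<rho> s)) (mu (\<rho> t)) \<le> ennreal (integral {s..t} g) + ennreal e \<and>
      W_Ch m d (mu (\<rho> t)) (mu (\<rho> s)) \<le> ennreal (integral {s..t} g) + ennreal e" if e: "0 < e" for e
  proof (cases "s = t")
    case True
    have "W_Ch m d (mu (\<rho> s)) (mu (\<rho> s)) \<le> ennreal 0"
      by (rule W_Ch_le_of_Wasserstein_Lipschitz[where \<rho> = "\<lambda>_. \<rho> s", OF \<rho> M]) (use bd[of s s] st in auto)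
    with True show ?thesis by simp
  next
    case False
    then have s_t: "s < t" using st by simp
    \<comment> \<open>The term with \<eta> makes \<theta> strictly increasing even where g vanishes,
      and adds exactly e to the total length.\<close>
    define \<eta> where "\<eta> = e / (t - s)"
    have \<eta>: "0 < \<eta>" using e s_t by (simp add: \<eta>_def)
    define \<theta> where "\<theta> r = integral {s..r} g + \<eta> * (r - s)" for r
    define l where "l = \<theta> t"
    have gi: "g integrable_on {a..b}" if "0 \<le> a" "b \<le> T" for a b by (rule abs_integrable_subinterval(2)[OF g that])
    have \<theta>d: "\<theta> b - \<theta> a = integral {a..b} g + \<eta> * (b - a)" if "s \<le> a" "a \<le> b" "b \<le> t" for a b
      using Henstock_Kurzweil_Integration.integral_combine[OF that(1,2) gi[of s b]] that st by (simp add: \<theta>_def algebra_simps)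
    have gn: "0 \<le> integral {a..b} g" if "0 \<le> a" "b \<le> T" for a b
      using that g0 by (intro integral_nonneg gi) auto
    have \<theta>c: "continuous_on {s..t} \<theta>"
      unfolding \<theta>_def using st by (intro continuous_intros indefinite_integral_continuous_1 gi) auto
    have \<theta>s: "\<theta> a < \<theta> b" if "s \<le> a" "a < b" "b \<le> t" for a b
    proof -
      have "0 < \<eta> * (b - a)" using \<eta> that by simp
      then show ?thesis using \<theta>d[of a b] gn[of a b] that st by simp
    qed
    have \<theta>0: "\<theta> s = 0" by (simp add: \<theta>_def)
    have l0: "0 < l" using \<theta>s[of s t] s_t \<theta>0 by (simp add: l_def)
    \<comment> \<open>\<sigma> inverts \<theta>/l: existence by intermediate values, uniqueness by
      strict monotonicity.\<close>
    have "\<exists>r. s \<le> r \<and> r \<le> t \<and> \<theta> r = l * x" if "x \<in> {0..1}" for x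
    proof (rule IVT')
      show "\<theta> s \<le> l * x" using that l0 \<theta>0 by simp
      show "l * x \<le> \<theta> t" using that l0 by (simp add: l_def mult_left_le)
    qed (use st \<theta>c in auto)
    then obtain \<sigma> where \<sigma>: "\<And>x. x \<in> {0..1} \<Longrightarrow> s \<le> \<sigma> x \<and> \<sigma> x \<le> t \<and> \<theta> (\<sigma> x) = l * x" by metis
    have inj: "a = b" if "s \<le> a" "a \<le> t" "s \<le> b" "b \<le> t" "\<theta> a = \<theta> b" for a b
      using \<theta>s[of a b] \<theta>s[of b a] that by (cases a b rule: linorder_cases) auto
    have \<sigma>01: "\<sigma> 0 = s" "\<sigma> 1 = t"
    proof -
      show "\<sigma> 0 = s" by (rule inj) (use \<sigma>[of 0] \<theta>0 s_t in auto)
      show "\<sigma> 1 = t" by (rule inj) (use \<sigma>[of 1] s_t in \<open>auto simp: l_def\<close>)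
    qed
    have \<sigma>T: "\<sigma> x \<in> {0..T}" if "x \<in> {0..1}" for x using \<sigma>[OF that] st by auto
    have W1: "Wasserstein d (mu (\<rho> (\<sigma> a))) (mu (\<rho> (\<sigma> b))) \<le> ennreal (l * \<bar>b - a\<bar>)"
      if ab: "a \<in> {0..1}" "b \<in> {0..1}" "a \<le> b" for a b
    proof -
      have le: "\<sigma> a \<le> \<sigma> b"
      proof (rule ccontr)
        assume "\<not> \<sigma> a \<le> \<sigma> b"
        then have "l * b < l * a" using \<theta>s[of "\<sigma> b" "\<sigma> a"] \<sigma>[OF ab(1)] \<sigma>[OF ab(2)] by simp
        with l0 ab(3) show False by simp
      qed
      have "Wasserstein d (mu (\<rho> (\<sigma> a))) (mu (\<rho> (\<sigma> b))) \<le> ennreal (integral {\<sigma> a..\<sigma> b} g)"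
        using \<sigma>T[OF ab(1)] \<sigma>T[OF ab(2)] le by (intro bd) auto
      also have "integral {\<sigma> a..\<sigma> b} g \<le> l * \<bar>b - a\<bar>"
      proof -
        have "0 \<le> \<eta> * (\<sigma> b - \<sigma> a)" using \<eta> le by simp
        then show ?thesis using \<theta>d[OF _ le] \<sigma>[OF ab(1)] \<sigma>[OF ab(2)] ab(3) by (simp add: algebra_simps)
      qed
      finally show ?thesis by (simp add: ennreal_leI)
    qed
    have W: "Wasserstein d (mu (\<rho> (\<sigma> a))) (mu (\<rho> (\<sigma> b))) \<le> ennreal (l * \<bar>b - a\<bar>)"
      if ab: "a \<in> {0..1}" "b \<in> {0..1}" for a b
    proof (cases "a \<le> b")
      case False
      have "Wasserstein d (mu (\<rho> (\<sigma> a))) (mu (\<rho> (\<sigma> b))) = Wasserstein d (mu (\<rho> (\<sigma> b))) (mu (\<rho> (\<sigma> a)))"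
        by (intro Wasserstein_sym[OF d] mu_Radon \<rho> \<sigma>T ab)
      then show ?thesis using W1[OF ab(2,1)] False by (simp add: abs_minus_commute)
    qed (use W1 ab in auto)
    have ll: "l = integral {s..t} g + e" using s_t by (simp add: l_def \<theta>_def \<eta>_def)
    have "W_Ch m d (mu (\<rho> (\<sigma> 0))) (mu (\<rho> (\<sigma> 1))) \<le> ennreal l"
      by (rule W_Ch_le_of_Wasserstein_Lipschitz[where \<rho> = "\<lambda>x. \<rho> (\<sigma> x)", OF \<rho>[OF \<sigma>T] M(1) M(2)[OF \<sigma>T] less_imp_le[OF l0] W])
    \<comment> \<open>The reversed curve yields the other order of the arguments.\<close>
    moreover have "W_Ch m d (mu (\<rho> (\<sigma> (1 - 0)))) (mu (\<rho> (\<sigma> (1 - 1)))) \<le> ennreal l"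
    proof (rule W_Ch_le_of_Wasserstein_Lipschitz[where \<rho> = "\<lambda>x. \<rho> (\<sigma> (1 - x))"])
      show "Wasserstein d (mu (\<rho> (\<sigma> (1 - a)))) (mu (\<rho> (\<sigma> (1 - b)))) \<le> ennreal (l * \<bar>b - a\<bar>)"
        if "a \<in> {0..1}" "b \<in> {0..1}" for a b
        using W[of "1 - a" "1 - b"] that by (simp add: abs_minus_commute)
    qed (use \<rho>[OF \<sigma>T] M(1) M(2)[OF \<sigma>T] l0 in auto)
    moreover have "ennreal l = ennreal (integral {s..t} g) + ennreal e" using gn[OF st(1,3)] e unfolding ll by simp
    ultimately show ?thesis using \<sigma>01 by simp
  qed
  then show "W_Ch m d (mu (\<rho> s)) (mu (\<rho> t)) \<le> ennreal (integral {s..t} g)"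
    "W_Ch m d (mu (\<rho> t)) (mu (\<rho> s)) \<le> ennreal (integral {s..t} g)"
    by (auto intro: ennreal_le_epsilon)
qed

end

theorem corollary7p5:
  fixes d :: "'a::t2_space \<Rightarrow> 'a \<Rightarrow> ennreal"
    and m :: "'a measure"
    and \<rho> :: "real \<Rightarrow> 'a \<Rightarrow> real"
    and T :: real
  assumes "extended_metric_measure_space d m"
    and "complete_extended_metric d"
    and "0 < T"
    and "\<forall>t\<in>{0..T}. prob_density m (\<rho> t)"
    and "(SUP t\<in>{0..T}. Linf_norm m (\<rho> t)) < \<top>"
  shows "let \<mu> = (\<lambda>t. density m (\<lambda>x. ennreal (\<rho> t x))) in
    (AC2 Radon_prob (Wasserstein d) T \<mu> \<longleftrightarrow> AC2 Radon_prob (W_Ch m d) T \<mu>) \<and>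
    (AC2 Radon_prob (Wasserstein d) T \<mu> \<longrightarrow>
      (AE t in lebesgue_on {0<..<T}.
        metric_derivative (Wasserstein d) \<mu> t = metric_derivative (W_Ch m d) \<mu> t))"
proof -
  interpret emms d m using assms(1) by (simp add: emms_def extended_metric_measure_space_def)
  define \<mu> where "\<mu> t = mu (\<rho> t)" for t
  have \<rho>: "prob_density m (\<rho> t)" if "t \<in> {0..T}" for t using assms(4) that by blast
  have \<mu>R: "\<mu> t \<in> Radon_prob" if "t \<in> {0..T}" for t unfolding \<mu>_def by (rule mu_Radon[OF \<rho>[OF that]])
  obtain B where B: "(SUP t\<in>{0..T}. Linf_norm m (\<rho> t)) = ennreal B" "0 \<le> B"
    using assms(5) by (cases "SUP t\<in>{0..T}. Linf_norm m (\<rho> t)") auto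
  have M: "AE x in m. \<rho> t x \<le> B + 1" if t: "t \<in> {0..T}" for t
  proof -
    have le: "esssup m (\<lambda>x. ennreal \<bar>\<rho> t x\<bar>) \<le> ennreal B" unfolding B(1)[symmetric] Linf_norm_def[symmetric] by (rule SUP_upper[OF t])
    have "AE x in m. ennreal \<bar>\<rho> t x\<bar> \<le> esssup m (\<lambda>x. ennreal \<bar>\<rho> t x\<bar>)"
      by (rule esssup_AE)
    then show ?thesis
    proof eventually_elim
      case (elim x)
      then have "ennreal \<bar>\<rho> t x\<bar> \<le> ennreal B" using le by (rule order_trans)
      then show ?case using B(2) by (simp add: ennreal_le_iff)
    qed
  qed
  \<comment> \<open>B + 1 is certainly positive, and the estimates divide by the density
    bound.\<close>
  have B1: "0 < B + 1" using B(2) by simp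
  have ac: "AC2 Radon_prob (W_Ch m d) T \<mu>" if AC: "AC2 Radon_prob (Wasserstein d) T \<mu>"
  proof -
    obtain g where g: "g \<in> L2 (lebesgue_on {0<..<T})" "\<And>r. 0 \<le> g r" "g absolutely_integrable_on {0..T}"
      "\<And>s t. 0 \<le> s \<Longrightarrow> s \<le> t \<Longrightarrow> t \<le> T \<Longrightarrow> Wasserstein d (\<mu> s) (\<mu> t) \<le> ennreal (integral {s..t} g)"
      by (rule AC2D[OF AC]) (rule that)
    show ?thesis
    proof (rule AC2I[OF \<mu>R g(1)])
      show "W_Ch m d (\<mu> s) (\<mu> t) \<le> ennreal (integral {s..t} g)" if st: "0 \<le> s" "s \<le> t" "t \<le> T" for s t
        unfolding \<mu>_def by (rule W_Ch_le_integral(1)[OF \<rho> B1 M g(3) g(2) g(4)[unfolded \<mu>_def] st])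
    qed
  qed
  have ac': "AC2 Radon_prob (Wasserstein d) T \<mu>" if AC: "AC2 Radon_prob (W_Ch m d) T \<mu>"
  proof -
    obtain g where g: "g \<in> L2 (lebesgue_on {0<..<T})"
      "\<And>s t. 0 \<le> s \<Longrightarrow> s \<le> t \<Longrightarrow> t \<le> T \<Longrightarrow> W_Ch m d (\<mu> s) (\<mu> t) \<le> ennreal (integral {s..t} g)"
      by (rule AC2D[OF AC]) (rule that)
    show ?thesis
      by (rule AC2I[OF \<mu>R g(1) order_trans[OF Wasserstein_le_W_Ch g(2)]])
  qed
  have md: "AE t in lebesgue_on {0<..<T}. metric_derivative (Wasserstein d) \<mu> t = metric_derivative (W_Ch m d) \<mu> t"
    if AC: "AC2 Radon_prob (Wasserstein d) T \<mu>"
  proof -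
    obtain g where g: "\<And>r. 0 \<le> g r" "g absolutely_integrable_on {0..T}"
      "\<And>s t. 0 \<le> s \<Longrightarrow> s \<le> t \<Longrightarrow> t \<le> T \<Longrightarrow> Wasserstein d (\<mu> s) (\<mu> t) \<le> ennreal (integral {s..t} g)"
      by (rule AC2D[OF AC]) (rule that)
    obtain h where h: "h absolutely_integrable_on {0..T}" "\<And>r. 0 \<le> h r"
      "\<And>r. r \<in> {0<..<T} \<Longrightarrow> ennreal (h r) \<le> metric_derivative (Wasserstein d) \<mu> r"
      "\<And>s t. 0 \<le> s \<Longrightarrow> s \<le> t \<Longrightarrow> t \<le> T \<Longrightarrow> Wasserstein d (\<mu> s) (\<mu> t) \<le> ennreal (integral {s..t} h)"
      by (rule metric_derivative_integrand[where \<delta> = "Wasserstein d" and y = \<mu>,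
            OF Wasserstein_sym[OF d \<mu>R \<mu>R] Wasserstein_triangle[OF d \<mu>R \<mu>R \<mu>R] g(2,1,3)]) (assumption | rule that)+
    obtain N where N: "negligible N" "\<And>x e. x \<in> {0..T} - N \<Longrightarrow> 0 < e \<Longrightarrow>
       \<exists>d>0. \<forall>a b. 0 \<le> a \<and> a \<le> x \<and> x \<le> b \<and> b \<le> T \<and> b - a < d \<longrightarrow> \<bar>integral {a..b} h - h x * (b - a)\<bar> \<le> e * (b - a)"
      by (rule lebesgue_differentiation_on[OF h(1)]) (rule that)
    have Wh: "W_Ch m d (\<mu> s) (\<mu> t) \<le> ennreal (integral {s..t} h)" "W_Ch m d (\<mu> t) (\<mu> s) \<le> ennreal (integral {s..t} h)"
      if st: "0 \<le> s" "s \<le> t" "t \<le> T" for s t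
    proof -
      show "W_Ch m d (\<mu> s) (\<mu> t) \<le> ennreal (integral {s..t} h)"
        unfolding \<mu>_def by (rule W_Ch_le_integral(1)[OF \<rho> B1 M h(1,2) h(4)[unfolded \<mu>_def] st])
      show "W_Ch m d (\<mu> t) (\<mu> s) \<le> ennreal (integral {s..t} h)"
        unfolding \<mu>_def by (rule W_Ch_le_integral(2)[OF \<rho> B1 M h(1,2) h(4)[unfolded \<mu>_def] st])
    qed
    \<comment> \<open>A closed chain: the \<open>Wasserstein\<close> derivative is at most the
      \<open>W_Ch\<close> derivative, which at Lebesgue points is at most h t, and h is at most the
      \<open>Wasserstein\<close> derivative by its construction.\<close>
    have eq: "metric_derivative (Wasserstein d) \<mu> t = metric_derivative (W_Ch m d) \<mu> t" if t: "t \<in> {0<..<T}" "t \<notin> N" for t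
    proof (rule antisym)
      show "metric_derivative (Wasserstein d) \<mu> t \<le> metric_derivative (W_Ch m d) \<mu> t"
        by (rule metric_derivative_mono[OF Wasserstein_le_W_Ch])
      have tN: "t \<in> {0..T} - N" using t by auto
      have "metric_derivative (W_Ch m d) \<mu> t \<le> ennreal (h t)"
        by (rule metric_derivative_le_integrand[where h = h and \<delta> = "W_Ch m d" and y = \<mu>, OF t(1) h(2) N(2)[OF tN] Wh])
      also have "\<dots> \<le> metric_derivative (Wasserstein d) \<mu> t" by (rule h(3)[OF t(1)])
      finally show "metric_derivative (W_Ch m d) \<mu> t \<le> metric_derivative (Wasserstein d) \<mu> t" .
    qed
    have "AE t in lebesgue. t \<notin> N" using N(1) by (intro AE_not_in) (simp add: negligible_iff_null_sets)
    then have "AE t in lebesgue. t \<in> {0<..<T} \<longrightarrow> metric_derivative (Wasserstein d) \<mu> t = metric_derivative (W_Ch m d) \<mu> t"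
      by eventually_elim (use eq in blast)
    then show ?thesis by (subst AE_restrict_space_iff) auto
  qed
  have "\<mu> = (\<lambda>t. density m (\<lambda>x. ennreal (\<rho> t x)))" by (simp add: \<mu>_def fun_eq_iff)
  then show ?thesis unfolding Let_def using ac ac' md by blast
qed

end
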